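(* Let $G$ be an amenable just infinite group. Then the algebra $\mathcal{A}_{sn}(G)$ is nilpotent if and only if $G$ is not a branch group. Moreover: (i) if $G$ is finitely generated and virtually abelian, then the index of nilpotence of $\mathcal{A}_{sn}(G)$ is $\operatorname{rank} G + 1$; (ii) otherwise, the index of nilpotence of $\mathcal{A}_{sn}(G)$ is $\log_2 |\mathcal{L}(G)| + 1$, where $\mathcal{L}(G)$ is the structure lattice of $G$ (this quantity is infinite, meaning that $\mathcal{A}_{sn}(G)$ is not nilpotent, when $G$ is a branch group).
   Context: All groups are discrete. For a group $G$, $\ell^1(G)$ is the Banach algebra of absolutely summable functions $G\to\mathbb{C}$ under convolution; $\delta_t$ is the point mass at $t$; $\ell^1(G)^*=\ell^\infty(G)$, and $1$ is the constant function. The bidual $\ell^1(G)^{**}$ carries the first Arens product $\Box$: for a Banach algebra $A$, $\langle \Psi\Box\Phi,\lambda\rangle=\langle\Psi,\Phi\cdot\lambda\rangle$, $\langle a,\Phi\cdot\lambda\rangle=\langle\Phi,\lambda\cdot a\rangle$, $\langle b,\lambda\cdot a\rangle=\langle ab,\lambda\rangle$ ($\Phi,\Psi\in A^{**}$, $\lambda\in A^*$, $a,b\in A$). For $H\le G$, $\ell^1(H)^{**}$ is identified with its image in $\ell^1(G)^{**}$ under the second adjoint of the inclusion $\ell^1(H)\hookrightarrow\ell^1(G)$. An invariant difference on a group $H$ is an element $\Gamma\in\ell^1(H)^{**}$ with $\delta_s\Box\Gamma=\Gamma$ for all $s\in H$ and $\langle\Gamma,1\rangle=0$. $\mathcal{D}(H)$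 is the set of invariant differences on $H$. A subgroup $H\le G$ is subnormal if there is a finite chain $H=H_n\lhd H_{n-1}\lhd\cdots\lhd H_1\lhd G$. Define $$\mathcal{A}_{sn}(G)=\operatorname{span}\{\Gamma_1\Box\cdots\Box\Gamma_n : n\in\mathbb{N},\ \Gamma_i\in\mathcal{D}(H_i)\text{ for some subnormal subgroups } H_i \text{ of } G\},$$ a subalgebra of $\ell^1(G)^{**}$. An algebra $A$ is nilpotent if $A^n=\{0\}$ for some $n\in\mathbb{N}=\{1,2,\dots\}$ (all $n$-fold products vanish); the least such $n$ is the index of nilpotence. An infinite group is just infinite if every non-trivial normal subgroup has finite index. The rank of a finitely generated virtually abelian group is the (torsion-free) rank of any finite-index abelian subgroup. A group $G$ is a branch group if there exist descending chains of subgroups $H_1\supset H_2\supset\cdots$ and $L_1\supset L_2\supset\cdots$ and natural numbers $(k_i)_{i\in\mathbb{N}}$ such that: (1) $\bigcap_i H_i=1$; (2) each $H_i$ is a finite-index normal subgroup of $G$; (3) each $H_i$ is an (internal) direct product $L_i^{(1)}\times\cdots\times L_i^{(k_i)}$ with each factor isomorphic to $L_i$; (4) for each $i$, $m_i:=k_{i+1}/k_i$ is an integer at least $2$, and the decomposition of $H_{i+1}$ properly refines that of $H_i$ in the sense that each $L_i^{(j)}$ contains the subgroups $L_{i+1}^{(l)}$ for $l=(j-1)m_i+1,\dots,jm_i$; (5) conjugation by $G$ transitively permutes the subgroups $L_i^{(1)},\dots,L_i^{(k_i)}$. The Baer radical of $G$ is the subgroup generated by the subnormal cyclic subgroups of $G$.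 Every just infinite group which is not finitely generated virtually abelian has trivial Baer radical. For a just infinite group $G$ with trivial Baer radical, the structure lattice $\mathcal{L}(G)$ is the set of subnormal subgroups of $G$ modulo commensurability, where subnormal $H,K$ are equivalent if $[H:H\cap K]<\infty$ and $[K:H\cap K]<\infty$. *)

theory Defs
  imports
    "HOL-Analysis.Analysis"
    "HOL-Algebra.Algebra"
    "HOL-Library.Function_Algebras"
    "HOL-Library.Extended_Real"
begin

section \<open>Duals of complex normed spaces of functions\<close>

text \<open>All complex normed spaces below are sets \<open>V\<close> of complex-valued functions with the
  pointwise operations, together with a norm \<open>N\<close>. A bounded linear functional on \<open>V\<close> is again
  a complex-valued function; it is required to vanish off \<open>V\<close>, so that equality of functionals
  on \<open>V\<close> is equality in HOL and the dual construction can be iterated.\<close>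

definition cscale :: "complex \<Rightarrow> ('x \<Rightarrow> complex) \<Rightarrow> ('x \<Rightarrow> complex)" where
  "cscale c f = (\<lambda>x. c * f x)"

definition dual ::
    "('x \<Rightarrow> complex) set \<Rightarrow> (('x \<Rightarrow> complex) \<Rightarrow> real) \<Rightarrow> (('x \<Rightarrow> complex) \<Rightarrow> complex) set" where
  "dual V N = {\<phi>.
     (\<forall>f\<in>V. \<forall>g\<in>V. \<phi> (f + g) = \<phi> f + \<phi> g) \<and>
     (\<forall>c. \<forall>f\<in>V. \<phi> (cscale c f) = c * \<phi> f) \<and>
     (\<exists>C. \<forall>f\<in>V. cmod (\<phi> f) \<le> C * N f) \<and>
     (\<forall>f. f \<notin> V \<longrightarrow> \<phi> f = 0)}"

definition dual_norm ::
    "('x \<Rightarrow> complex) set \<Rightarrow> (('x \<Rightarrow> complex) \<Rightarrow> real) \<Rightarrow> (('x \<Rightarrow> complex) \<Rightarrow> complex) \<Rightarrow> real" where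
  "dual_norm V N \<phi> = Sup {cmod (\<phi> f) | f. f \<in> V \<and> N f \<le> 1}"


section \<open>The group algebra and its bidual\<close>

definition l1 :: "('a, 'b) monoid_scheme \<Rightarrow> ('a \<Rightarrow> complex) set" where
  "l1 G = {f. (\<lambda>t. cmod (f t)) summable_on carrier G \<and> (\<forall>t. t \<notin> carrier G \<longrightarrow> f t = 0)}"

definition l1_norm :: "('a, 'b) monoid_scheme \<Rightarrow> ('a \<Rightarrow> complex) \<Rightarrow> real" where
  "l1_norm G f = (\<Sum>\<^sub>\<infinity>t\<in>carrier G. cmod (f t))"

definition convolution ::
    "('a, 'b) monoid_scheme \<Rightarrow> ('a \<Rightarrow> complex) \<Rightarrow> ('a \<Rightarrow> complex) \<Rightarrow> ('a \<Rightarrow> complex)" where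
  "convolution G f g =
     (\<lambda>t. if t \<in> carrier G
          then (\<Sum>\<^sub>\<infinity>s\<in>carrier G. f s * g (inv\<^bsub>G\<^esub> s \<otimes>\<^bsub>G\<^esub> t)) else 0)"

definition point_mass :: "'a \<Rightarrow> ('a \<Rightarrow> complex)" where
  "point_mass t = (\<lambda>s. if s = t then 1 else 0)"

definition l1_dual :: "('a, 'b) monoid_scheme \<Rightarrow> (('a \<Rightarrow> complex) \<Rightarrow> complex) set" where
  "l1_dual G = dual (l1 G) (l1_norm G)"

definition l1_dual_norm :: "('a, 'b) monoid_scheme \<Rightarrow> (('a \<Rightarrow> complex) \<Rightarrow> complex) \<Rightarrow> real" where
  "l1_dual_norm G = dual_norm (l1 G) (l1_norm G)"

type_synonym 'a bidual_elt = "(('a \<Rightarrow> complex) \<Rightarrow> complex) \<Rightarrow> complex"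

definition l1_bidual :: "('a, 'b) monoid_scheme \<Rightarrow> 'a bidual_elt set" where
  "l1_bidual G = dual (l1_dual G) (l1_dual_norm G)"

definition l1_bidual_norm :: "('a, 'b) monoid_scheme \<Rightarrow> 'a bidual_elt \<Rightarrow> real" where
  "l1_bidual_norm G = dual_norm (l1_dual G) (l1_dual_norm G)"

text \<open>The functional on \<open>l1 G\<close> given by a bounded function on \<open>G\<close>, that is, the identification
  of the dual of \<open>l1 G\<close> with the bounded functions.\<close>

definition functional_of ::
    "('a, 'b) monoid_scheme \<Rightarrow> ('a \<Rightarrow> complex) \<Rightarrow> (('a \<Rightarrow> complex) \<Rightarrow> complex)" where
  "functional_of G u = (\<lambda>a. if a \<in> l1 G then (\<Sum>\<^sub>\<infinity>t\<in>carrier G. a t * u t) else 0)"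

definition one_functional :: "('a, 'b) monoid_scheme \<Rightarrow> (('a \<Rightarrow> complex) \<Rightarrow> complex)" where
  "one_functional G = functional_of G (\<lambda>t. 1)"

definition to_bidual :: "('a, 'b) monoid_scheme \<Rightarrow> ('a \<Rightarrow> complex) \<Rightarrow> 'a bidual_elt" where
  "to_bidual G a = (\<lambda>lam. if lam \<in> l1_dual G then lam a else 0)"

text \<open>The first Arens product: \<open>dual_act G lam a\<close> is \<open>lam \<cdot> a\<close> and \<open>bidual_act G \<Phi> lam\<close> is
  \<open>\<Phi> \<cdot> lam\<close>, both in the dual of \<open>l1 G\<close>.\<close>

definition dual_act ::
    "('a, 'b) monoid_scheme \<Rightarrow> (('a \<Rightarrow> complex) \<Rightarrow> complex) \<Rightarrow> ('a \<Rightarrow> complex)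
      \<Rightarrow> (('a \<Rightarrow> complex) \<Rightarrow> complex)" where
  "dual_act G lam a = (\<lambda>b. if b \<in> l1 G then lam (convolution G a b) else 0)"

definition bidual_act ::
    "('a, 'b) monoid_scheme \<Rightarrow> 'a bidual_elt \<Rightarrow> (('a \<Rightarrow> complex) \<Rightarrow> complex)
      \<Rightarrow> (('a \<Rightarrow> complex) \<Rightarrow> complex)" where
  "bidual_act G \<Phi> lam = (\<lambda>a. if a \<in> l1 G then \<Phi> (dual_act G lam a) else 0)"

definition arens ::
    "('a, 'b) monoid_scheme \<Rightarrow> 'a bidual_elt \<Rightarrow> 'a bidual_elt \<Rightarrow> 'a bidual_elt" where
  "arens G \<Psi> \<Phi> = (\<lambda>lam. if lam \<in> l1_dual G then \<Psi> (bidual_act G \<Phi> lam) else 0)"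

text \<open>For a subgroup \<open>H\<close>, elements of \<open>l1 (G\<lparr>carrier := H\<rparr>)\<close> vanish off \<open>H\<close> and hence already
  lie in \<open>l1 G\<close>: the inclusion map is the identity on functions, its adjoint restricts
  functionals, and the second adjoint is \<open>bidual_embed\<close>.\<close>

definition dual_restrict ::
    "('a, 'b) monoid_scheme \<Rightarrow> 'a set \<Rightarrow> (('a \<Rightarrow> complex) \<Rightarrow> complex)
      \<Rightarrow> (('a \<Rightarrow> complex) \<Rightarrow> complex)" where
  "dual_restrict G H lam = (\<lambda>a. if a \<in> l1 (G\<lparr>carrier := H\<rparr>) then lam a else 0)"

definition bidual_embed ::
    "('a, 'b) monoid_scheme \<Rightarrow> 'a set \<Rightarrow> 'a bidual_elt \<Rightarrow> 'a bidual_elt" where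
  "bidual_embed G H \<Gamma> = (\<lambda>lam. if lam \<in> l1_dual G then \<Gamma> (dual_restrict G H lam) else 0)"


section \<open>Amenability, invariant differences and the algebra\<close>

definition amenable :: "('a, 'b) monoid_scheme \<Rightarrow> bool" where
  "amenable G \<longleftrightarrow> (\<exists>M\<in>l1_bidual G.
     l1_bidual_norm G M = 1 \<and> M (one_functional G) = 1 \<and>
     (\<forall>s\<in>carrier G. arens G (to_bidual G (point_mass s)) M = M))"

definition invariant_differences :: "('a, 'b) monoid_scheme \<Rightarrow> 'a bidual_elt set" where
  "invariant_differences H = {\<Gamma>\<in>l1_bidual H.
     (\<forall>s\<in>carrier H. arens H (to_bidual H (point_mass s)) \<Gamma> = \<Gamma>) \<and>
     \<Gamma> (one_functional H) = 0}"

definition subnormal :: "'a set \<Rightarrow> ('a, 'b) monoid_scheme \<Rightarrow> bool" where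
  "subnormal H G \<longleftrightarrow> (\<exists>(n::nat) (K :: nat \<Rightarrow> 'a set).
     K 0 = carrier G \<and> K n = H \<and> (\<forall>i<n. K (Suc i) \<lhd> G\<lparr>carrier := K i\<rparr>))"

text \<open>Products of nonempty lists; the bracketing is irrelevant since the Arens product is
  associative. The value on the empty list is unspecified and never used.\<close>

fun list_product :: "('v \<Rightarrow> 'v \<Rightarrow> 'v) \<Rightarrow> 'v list \<Rightarrow> 'v" where
  "list_product mul [x] = x"
| "list_product mul (x # y # zs) = mul x (list_product mul (y # zs))"

definition A_sn :: "('a, 'b) monoid_scheme \<Rightarrow> 'a bidual_elt set" where
  "A_sn G = module.span cscale
     {list_product (arens G) \<Gamma>s | \<Gamma>s. \<Gamma>s \<noteq> [] \<and>
        (\<forall>\<Gamma>\<in>set \<Gamma>s. \<exists>H. subnormal H G \<and>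
           \<Gamma> \<in> bidual_embed G H ` invariant_differences (G\<lparr>carrier := H\<rparr>))}"

definition products_vanish :: "('v::zero \<Rightarrow> 'v \<Rightarrow> 'v) \<Rightarrow> 'v set \<Rightarrow> nat \<Rightarrow> bool" where
  "products_vanish mul A n \<longleftrightarrow>
     (\<forall>xs. length xs = n \<and> set xs \<subseteq> A \<longrightarrow> list_product mul xs = 0)"

definition nilpotent_algebra :: "('v::zero \<Rightarrow> 'v \<Rightarrow> 'v) \<Rightarrow> 'v set \<Rightarrow> bool" where
  "nilpotent_algebra mul A \<longleftrightarrow> (\<exists>n\<ge>1. products_vanish mul A n)"

text \<open>Since \<open>Inf {} = \<infinity>\<close> for \<^typ>\<open>enat\<close>, the index is infinite for algebras that are not
  nilpotent.\<close>

definition nilpotence_index :: "('v::zero \<Rightarrow> 'v \<Rightarrow> 'v) \<Rightarrow> 'v set \<Rightarrow> enat" where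
  "nilpotence_index mul A = Inf {enat n | n. n \<ge> 1 \<and> products_vanish mul A n}"


section \<open>Group-theoretic notions\<close>

definition finite_index :: "('a, 'b) monoid_scheme \<Rightarrow> 'a set \<Rightarrow> bool" where
  "finite_index G H \<longleftrightarrow> finite (rcosets\<^bsub>G\<^esub> H)"

definition just_infinite :: "('a, 'b) monoid_scheme \<Rightarrow> bool" where
  "just_infinite G \<longleftrightarrow> infinite (carrier G) \<and>
     (\<forall>N. N \<lhd> G \<and> N \<noteq> {\<one>\<^bsub>G\<^esub>} \<longrightarrow> finite_index G N)"

definition finitely_generated :: "('a, 'b) monoid_scheme \<Rightarrow> bool" where
  "finitely_generated G \<longleftrightarrow> (\<exists>S\<subseteq>carrier G. finite S \<and> generate G S = carrier G)"

definition finite_index_abelian :: "('a, 'b) monoid_scheme \<Rightarrow> 'a set \<Rightarrow> bool" where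
  "finite_index_abelian G A \<longleftrightarrow>
     subgroup A G \<and> finite_index G A \<and> comm_group (G\<lparr>carrier := A\<rparr>)"

definition virtually_abelian :: "('a, 'b) monoid_scheme \<Rightarrow> bool" where
  "virtually_abelian G \<longleftrightarrow> (\<exists>A. finite_index_abelian G A)"

text \<open>The torsion-free rank of an abelian group is the supremum of the sizes of its finite
  subsets that are linearly independent over the integers.\<close>

definition int_independent :: "('a, 'b) monoid_scheme \<Rightarrow> 'a set \<Rightarrow> bool" where
  "int_independent A B \<longleftrightarrow> finite B \<and> B \<subseteq> carrier A \<and>
     (\<forall>k :: 'a \<Rightarrow> int. finprod A (\<lambda>b. b [^]\<^bsub>A\<^esub> k b) B = \<one>\<^bsub>A\<^esub> \<longrightarrow> (\<forall>b\<in>B. k b = 0))"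

definition torsion_free_rank :: "('a, 'b) monoid_scheme \<Rightarrow> enat" where
  "torsion_free_rank A = (SUP B\<in>{B. int_independent A B}. enat (card B))"

definition virtual_rank :: "('a, 'b) monoid_scheme \<Rightarrow> enat" where
  "virtual_rank G =
     (THE r. \<exists>A. finite_index_abelian G A \<and> torsion_free_rank (G\<lparr>carrier := A\<rparr>) = r)"

definition internal_direct_product ::
    "('a, 'b) monoid_scheme \<Rightarrow> 'a set \<Rightarrow> 'i set \<Rightarrow> ('i \<Rightarrow> 'a set) \<Rightarrow> bool" where
  "internal_direct_product G H I K \<longleftrightarrow>
     (\<forall>i\<in>I. K i \<lhd> G\<lparr>carrier := H\<rparr>) \<and>
     generate G (\<Union>i\<in>I. K i) = H \<and>
     (\<forall>i\<in>I. K i \<inter> generate G (\<Union>j\<in>I - {i}. K j) = {\<one>\<^bsub>G\<^esub>})"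

definition conjugate_set :: "('a, 'b) monoid_scheme \<Rightarrow> 'a \<Rightarrow> 'a set \<Rightarrow> 'a set" where
  "conjugate_set G g K = (g <#\<^bsub>G\<^esub> K) #>\<^bsub>G\<^esub> (inv\<^bsub>G\<^esub> g)"

text \<open>All sequences are indexed by the positive integers (values at \<open>0\<close> play no role), and
  \<open>F i j\<close> is the \<open>j\<close>-th direct factor of \<open>H i\<close>.\<close>

definition branch_group :: "('a, 'b) monoid_scheme \<Rightarrow> bool" where
  "branch_group G \<longleftrightarrow>
    (\<exists>(H :: nat \<Rightarrow> 'a set) (L :: nat \<Rightarrow> 'a set) (k :: nat \<Rightarrow> nat) (F :: nat \<Rightarrow> nat \<Rightarrow> 'a set).
      (\<forall>i\<ge>1. subgroup (H i) G \<and> H (i + 1) \<subset> H i) \<and>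
      (\<forall>i\<ge>1. subgroup (L i) G \<and> L (i + 1) \<subset> L i) \<and>
      (\<forall>i\<ge>1. k i \<ge> 1) \<and>
      (\<Inter>i\<in>{1..}. H i) = {\<one>\<^bsub>G\<^esub>} \<and>
      (\<forall>i\<ge>1. H i \<lhd> G \<and> finite_index G (H i)) \<and>
      (\<forall>i\<ge>1. internal_direct_product G (H i) {1..k i} (F i) \<and>
         (\<forall>j\<in>{1..k i}. G\<lparr>carrier := F i j\<rparr> \<cong> G\<lparr>carrier := L i\<rparr>)) \<and>
      (\<forall>i\<ge>1. \<exists>m\<ge>2. k (i + 1) = m * k i \<and>
         (\<forall>j\<in>{1..k i}. \<forall>l\<in>{(j - 1) * m + 1..j * m}. F (i + 1) l \<subseteq> F i j)) \<and>
      (\<forall>i\<ge>1.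
         (\<forall>g\<in>carrier G. \<forall>j\<in>{1..k i}. \<exists>l\<in>{1..k i}. conjugate_set G g (F i j) = F i l) \<and>
         (\<forall>j\<in>{1..k i}. \<forall>l\<in>{1..k i}. \<exists>g\<in>carrier G. conjugate_set G g (F i j) = F i l)))"

definition commensurability :: "('a, 'b) monoid_scheme \<Rightarrow> ('a set \<times> 'a set) set" where
  "commensurability G = {(H, K). subnormal H G \<and> subnormal K G \<and>
     finite_index (G\<lparr>carrier := H\<rparr>) (H \<inter> K) \<and> finite_index (G\<lparr>carrier := K\<rparr>) (H \<inter> K)}"

text \<open>Only the underlying set of the structure lattice is needed.\<close>

definition structure_lattice :: "('a, 'b) monoid_scheme \<Rightarrow> 'a set set set" where
  "structure_lattice G = {H. subnormal H G} // commensurability G"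

definition log2_card :: "'x set \<Rightarrow> ereal" where
  "log2_card S = (if finite S then ereal (log 2 (real (card S))) else \<infinity>)"

end

theory Submission
  imports Defs
begin

text \<open>If \<open>\<Gamma>\<close> is an invariant difference on \<open>H\<close> and \<open>H\<close> is virtually contained in the left
  stabilizer of \<open>\<Phi>\<close>, then \<open>\<Gamma> \<box> \<Phi> = 0\<close>; so every factor of a nonzero product enlarges the stabilizer
  by infinite index. Conversely, if \<open>H\<^sub>1, \<dots>, H\<^sub>n\<close> are infinite and generate their direct product, a
  product of nonzero \<open>\<Gamma>\<^sub>i \<in> \<D>(H\<^sub>i)\<close> acts as a tensor product and is nonzero. Hence the index of
  nilpotence is one more than the largest number of independent infinite subnormal subgroups: the
  rank in the virtually abelian case. Otherwise each subnormal subgroup together with its centralizer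
  generates a subgroup of finite index, so a maximal family of \<open>d\<close> commuting nontrivial subnormal
  subgroups consists of atoms and \<open>\<L>(G)\<close> has \<open>2\<^sup>d\<close> elements. If there is no maximal family, then subgroups
  that commute with all their other conjugates can be refined indefinitely, and their conjugates
  form a branch structure.\<close>

section \<open>Bounded functions and the bidual\<close>

text \<open>Vanishing has a simple source: on finitely many cosets of H, an invariant difference
  gives every coset indicator the same value, and <\<Gamma>,1> = 0 makes this value 0. The obstacle
  is to iterate. Multiplication by \<Gamma> in D(M) adds M to the left stabilizer, but is only known
  to keep the part of the old one that commutes with M. So the growing quantity is not the
  stabilizer but the set of atoms lying virtually in it, or an integrally independent set inside it.
  For these to commute with M or lie in it up to finite index, all subgroups must lie in one normal
  subgroup of finite index. This is arranged by cutting each \<Gamma> into translates of a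
  difference on a smaller subgroup and moving the translations to the left by conjugation. Nonzero
  differences come from two limits of point evaluations that a thick set with thick complement tells
  apart, averaged by the mean of G. That H C(H) has finite index rests on an intersection argument:
  having trivial centralizer passes to finite intersections of conjugates, so the normal core is
  nontrivial and just infinity applies to it.\<close>

definition bdd_fun :: "('a, 'b) monoid_scheme \<Rightarrow> ('a \<Rightarrow> complex) \<Rightarrow> bool" where
  "bdd_fun G u \<longleftrightarrow> (\<exists>C. \<forall>t\<in>carrier G. cmod (u t) \<le> C)"

text \<open>With the dual of \<open>l1 G\<close> identified with the bounded functions, this is the
  value <\<Phi>, u>. Later arguments handle bidual elements through these values, which determine
  them by \<open>l1_bidual_ext\<close>.\<close>

definition ev :: "('a, 'b) monoid_scheme \<Rightarrow> 'a bidual_elt \<Rightarrow> ('a \<Rightarrow> complex) \<Rightarrow> complex" where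
  "ev G \<Phi> u = \<Phi> (functional_of G u)"

lemma bdd_funI: "(\<And>t. t \<in> carrier G \<Longrightarrow> cmod (u t) \<le> C) \<Longrightarrow> bdd_fun G u"
  unfolding bdd_fun_def by blast

lemma bdd_fun_const [simp, intro]: "bdd_fun G (\<lambda>t. c)"
  by (rule bdd_funI[where C = "cmod c"]) simp

lemma bdd_fun_indicator [simp, intro]: "bdd_fun G (\<lambda>t. if P t then c else d)"
  by (rule bdd_funI[where C = "cmod c + cmod d"]) simp

lemma bdd_fun_bound:
  assumes "bdd_fun G u"
  obtains C where "C \<ge> 0" "\<And>t. t \<in> carrier G \<Longrightarrow> cmod (u t) \<le> C"
proof -
  from assms obtain C where "\<forall>t\<in>carrier G. cmod (u t) \<le> C" unfolding bdd_fun_def by blast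
  then have "\<And>t. t \<in> carrier G \<Longrightarrow> cmod (u t) \<le> max C 0" by fastforce
  then show ?thesis using that[of "max C 0"] by simp
qed

lemma bdd_fun_add [intro]: "bdd_fun G u \<Longrightarrow> bdd_fun G v \<Longrightarrow> bdd_fun G (\<lambda>t. u t + v t)"
  by (metis (no_types, lifting) bdd_fun_def norm_triangle_le add_mono)

lemma bdd_fun_mult [intro]: "bdd_fun G u \<Longrightarrow> bdd_fun G v \<Longrightarrow> bdd_fun G (\<lambda>t. u t * v t)"
proof -
  assume "bdd_fun G u" "bdd_fun G v"
  then obtain C D where "C \<ge> 0" "\<And>t. t \<in> carrier G \<Longrightarrow> cmod (u t) \<le> C"
    "D \<ge> 0" "\<And>t. t \<in> carrier G \<Longrightarrow> cmod (v t) \<le> D" by (metis bdd_fun_bound)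
  then show ?thesis by (intro bdd_funI[where C = "C * D"]) (simp add: norm_mult mult_mono)
qed

lemma bdd_fun_sum [intro]: "(\<And>i. i \<in> I \<Longrightarrow> bdd_fun G (u i)) \<Longrightarrow> bdd_fun G (\<lambda>t. \<Sum>i\<in>I. u i t)"
  by (induction I rule: infinite_finite_induct) (auto intro: bdd_fun_add)

lemma l1_abs_summable: "a \<in> l1 G \<Longrightarrow> (\<lambda>t. cmod (a t)) summable_on carrier G"
  by (simp add: l1_def)

lemma l1_mult_summable:
  assumes "a \<in> l1 G" "bdd_fun G u"
  shows "(\<lambda>t. cmod (a t * u t)) summable_on carrier G"
proof -
  obtain C where C: "\<And>t. t \<in> carrier G \<Longrightarrow> cmod (u t) \<le> C" using assms(2) by (metis bdd_fun_bound)
  have "(\<lambda>t. cmod (a t) * C) summable_on carrier G"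
    by (rule summable_on_cmult_left[OF l1_abs_summable[OF assms(1)]])
  then show ?thesis
    by (rule summable_on_comparison_test) (auto simp: norm_mult mult_left_mono C)
qed

lemma l1_add: "a \<in> l1 G \<Longrightarrow> b \<in> l1 G \<Longrightarrow> a + b \<in> l1 G"
  unfolding l1_def
  by (auto intro!: summable_on_comparison_test[OF summable_on_add norm_triangle_ineq])

lemma l1_scale: "a \<in> l1 G \<Longrightarrow> cscale c a \<in> l1 G"
  unfolding l1_def cscale_def by (auto simp: norm_mult intro: summable_on_cmult_right)

lemma l1_norm_nonneg: "0 \<le> l1_norm G a"
  unfolding l1_norm_def by (simp add: infsum_nonneg)

lemma functional_of_bound:
  assumes "a \<in> l1 G" "\<And>t. t \<in> carrier G \<Longrightarrow> cmod (u t) \<le> C"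
  shows "cmod (functional_of G u a) \<le> C * l1_norm G a"
proof -
  have b: "bdd_fun G u" using assms(2) by (rule bdd_funI)
  have "cmod (functional_of G u a) \<le> (\<Sum>\<^sub>\<infinity>t\<in>carrier G. cmod (a t * u t))"
    using assms(1) unfolding functional_of_def
    by (simp add: norm_infsum_bound l1_mult_summable[OF assms(1) b])
  also have "\<dots> \<le> (\<Sum>\<^sub>\<infinity>t\<in>carrier G. cmod (a t) * C)"
    by (intro infsum_mono l1_mult_summable assms b summable_on_cmult_left l1_abs_summable)
      (simp add: norm_mult assms(2) mult_left_mono)
  also have "\<dots> = C * l1_norm G a"
    unfolding l1_norm_def by (subst infsum_cmult_left') (rule mult.commute)
  finally show ?thesis .
qed

lemma functional_of_in_l1_dual:
  assumes "bdd_fun G u" shows "functional_of G u \<in> l1_dual G"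
proof -
  obtain C where C: "\<And>t. t \<in> carrier G \<Longrightarrow> cmod (u t) \<le> C" using assms by (metis bdd_fun_bound)
  have s: "(\<lambda>t. a t * u t) summable_on carrier G" if "a \<in> l1 G" for a
    using l1_mult_summable[OF that assms] by (rule abs_summable_summable)
  have "functional_of G u (f + g) = functional_of G u f + functional_of G u g"
    if "f \<in> l1 G" "g \<in> l1 G" for f g
    using that by (simp add: functional_of_def l1_add distrib_right infsum_add s)
  moreover have "functional_of G u (cscale c f) = c * functional_of G u f" if "f \<in> l1 G" for c f
    using that l1_scale[OF that, of c]
    by (simp add: functional_of_def cscale_def mult.assoc infsum_cmult_right')
  moreover have "\<exists>C. \<forall>f\<in>l1 G. cmod (functional_of G u f) \<le> C * l1_norm G f"
    using functional_of_bound[of _ G u C, OF _ C] by blast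
  ultimately show ?thesis unfolding l1_dual_def dual_def by (auto simp: functional_of_def)
qed

lemma finite_support_l1:
  assumes "finite F" "F \<subseteq> carrier G" shows "(\<lambda>t. if t \<in> F then a t else 0) \<in> l1 G"
proof -
  have "(\<lambda>t. cmod (if t \<in> F then a t else 0)) summable_on carrier G"
    by (rule finite_nonzero_values_imp_summable_on) (use assms in \<open>auto intro: finite_subset[of _ F] split: if_splits\<close>)
  then show ?thesis unfolding l1_def using assms by auto
qed

lemma point_mass_l1: "t \<in> carrier G \<Longrightarrow> point_mass t \<in> l1 G"
  using finite_support_l1[of "{t}" G "\<lambda>_. 1"] by (simp add: point_mass_def)

lemma l1_norm_point_mass: "t \<in> carrier G \<Longrightarrow> l1_norm G (point_mass t) = 1"
  unfolding l1_norm_def point_mass_def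
  by (subst infsum_cong_neutral[where T = "{t}" and g = "\<lambda>_. 1"]) auto

lemma functional_of_point_mass: "t \<in> carrier G \<Longrightarrow> functional_of G u (point_mass t) = u t"
  unfolding functional_of_def
  by (simp add: point_mass_l1)
     (subst infsum_cong_neutral[where T = "{t}" and g = u], auto simp: point_mass_def)

lemma l1_dual_add: "lam \<in> l1_dual G \<Longrightarrow> a \<in> l1 G \<Longrightarrow> b \<in> l1 G \<Longrightarrow> lam (a + b) = lam a + lam b"
  and l1_dual_scale: "lam \<in> l1_dual G \<Longrightarrow> a \<in> l1 G \<Longrightarrow> lam (cscale c a) = c * lam a"
  and l1_dual_off: "lam \<in> l1_dual G \<Longrightarrow> a \<notin> l1 G \<Longrightarrow> lam a = 0"
  unfolding l1_dual_def dual_def by auto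

lemma l1_dual_bound:
  assumes "lam \<in> l1_dual G"
  obtains C where "C \<ge> 0" "\<And>a. a \<in> l1 G \<Longrightarrow> cmod (lam a) \<le> C * l1_norm G a"
proof -
  from assms obtain C where C: "\<forall>a\<in>l1 G. cmod (lam a) \<le> C * l1_norm G a"
    unfolding l1_dual_def dual_def by blast
  have "cmod (lam a) \<le> max C 0 * l1_norm G a" if "a \<in> l1 G" for a
    using C that mult_right_mono[of C "max C 0" "l1_norm G a"] l1_norm_nonneg[of G a] by fastforce
  then show ?thesis using that[of "max C 0"] by simp
qed

lemma l1_tail:
  assumes "a \<in> l1 G" "e > 0"
  obtains F where "finite F" "F \<subseteq> carrier G" "l1_norm G (\<lambda>t. if t \<in> F then 0 else a t) < e"
proof -
  have hs: "((\<lambda>t. cmod (a t)) has_sum l1_norm G a) (carrier G)"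
    unfolding l1_norm_def using l1_abs_summable[OF assms(1)] by simp
  then have "eventually (\<lambda>F. dist (sum (\<lambda>t. cmod (a t)) F) (l1_norm G a) < e) (finite_subsets_at_top (carrier G))"
    unfolding has_sum_def using assms(2) tendstoD by blast
  then obtain F where F: "finite F" "F \<subseteq> carrier G" "dist (sum (\<lambda>t. cmod (a t)) F) (l1_norm G a) < e"
    unfolding eventually_finite_subsets_at_top by blast
  have "l1_norm G a = infsum (\<lambda>t. cmod (a t)) (F \<union> (carrier G - F))"
    unfolding l1_norm_def using F by (simp add: Un_absorb1)
  also have "\<dots> = sum (\<lambda>t. cmod (a t)) F + infsum (\<lambda>t. cmod (a t)) (carrier G - F)"
    using F l1_abs_summable[OF assms(1)]
    by (subst infsum_Un_disjoint) (auto intro: summable_on_subset_banach)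
  also have "infsum (\<lambda>t. cmod (a t)) (carrier G - F) = l1_norm G (\<lambda>t. if t \<in> F then 0 else a t)"
    unfolding l1_norm_def by (rule infsum_cong_neutral) auto
  finally have "l1_norm G (\<lambda>t. if t \<in> F then 0 else a t) < e"
    using F(3) by (simp add: dist_real_def)
  then show ?thesis using that F by blast
qed

lemma l1_cut: "a \<in> l1 G \<Longrightarrow> (\<lambda>t. if P t then 0 else a t) \<in> l1 G"
  unfolding l1_def by (auto elim!: summable_on_comparison_test)

text \<open>Finitely supported functions are dense.\<close>

lemma l1_dual_ext:
  assumes "lam \<in> l1_dual G" "mu \<in> l1_dual G"
    and eq: "\<And>t. t \<in> carrier G \<Longrightarrow> lam (point_mass t) = mu (point_mass t)"
  shows "lam = mu"
proof
  fix a
  show "lam a = mu a"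
  proof (cases "a \<in> l1 G")
    case True
    obtain C where C: "C \<ge> 0" "\<And>a. a \<in> l1 G \<Longrightarrow> cmod (lam a) \<le> C * l1_norm G a"
      using assms(1) by (metis l1_dual_bound)
    obtain D where D: "D \<ge> 0" "\<And>a. a \<in> l1 G \<Longrightarrow> cmod (mu a) \<le> D * l1_norm G a"
      using assms(2) by (metis l1_dual_bound)
    have fin: "lam (\<lambda>t. if t \<in> F then a t else 0) = mu (\<lambda>t. if t \<in> F then a t else 0)"
      if "finite F" "F \<subseteq> carrier G" for F
      using that
    proof (induction F)
      case empty
      have "(\<lambda>t. if t \<in> {} then a t else 0) = cscale 0 a" by (simp add: cscale_def)
      then show ?case using True l1_dual_scale assms by (metis mult_zero_left)
    next
      case (insert x F)
      have "(\<lambda>t. if t \<in> insert x F then a t else 0) =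
            cscale (a x) (point_mass x) + (\<lambda>t. if t \<in> F then a t else 0)"
        using insert by (auto simp: cscale_def point_mass_def fun_eq_iff)
      moreover have "cscale (a x) (point_mass x) \<in> l1 G" "point_mass x \<in> l1 G"
          "(\<lambda>t. if t \<in> F then a t else 0) \<in> l1 G"
        using insert by (auto intro!: l1_scale point_mass_l1 finite_support_l1)
      ultimately show ?case
        using insert assms by (simp add: l1_dual_add[OF assms(1)] l1_dual_add[OF assms(2)]
            l1_dual_scale[OF assms(1)] l1_dual_scale[OF assms(2)])
    qed
    have "cmod (lam a - mu a) \<le> e" if "e > 0" for e
    proof -
      \<comment> \<open>The summand 1 keeps the divisor positive when both bounds are 0.\<close>
      have "e / (C + D + 1) > 0" using that C D by simp
      then obtain F where F: "finite F" "F \<subseteq> carrier G"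
        "l1_norm G (\<lambda>t. if t \<in> F then 0 else a t) < e / (C + D + 1)" using l1_tail[OF True] by metis
      let ?f = "\<lambda>t. if t \<in> F then a t else 0" and ?g = "\<lambda>t. if t \<in> F then 0 else a t"
      have a: "a = ?f + ?g" by auto
      have f: "?f \<in> l1 G" and g: "?g \<in> l1 G" using F True by (auto intro: finite_support_l1 l1_cut)
      have "lam a = lam ?f + lam ?g" "mu a = mu ?f + mu ?g"
        using l1_dual_add[OF assms(1) f g] l1_dual_add[OF assms(2) f g] a by simp_all
      then have "lam a - mu a = lam ?g - mu ?g" using fin[OF F(1,2)] by simp
      then have "cmod (lam a - mu a) \<le> (C + D) * l1_norm G ?g"
        using C(2)[OF g] D(2)[OF g] norm_triangle_ineq4[of "lam ?g" "mu ?g"] by (simp add: distrib_right)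
      also have "\<dots> \<le> (C + D + 1) * l1_norm G ?g" by (intro mult_right_mono) (auto simp: l1_norm_nonneg)
      also have "\<dots> \<le> e" using F(3) C D by (simp add: field_simps)
      finally show ?thesis .
    qed
    then have "cmod (lam a - mu a) \<le> 0" by (rule field_le_epsilon[of _ 0, simplified]) auto
    then show ?thesis by simp
  next
    case False
    then show ?thesis using assms by (simp add: l1_dual_off)
  qed
qed

lemma l1_dual_bdd_fun: "lam \<in> l1_dual G \<Longrightarrow> bdd_fun G (\<lambda>t. lam (point_mass t))"
proof -
  assume "lam \<in> l1_dual G"
  then obtain C where C: "C \<ge> 0" "\<And>a. a \<in> l1 G \<Longrightarrow> cmod (lam a) \<le> C * l1_norm G a"
    by (metis l1_dual_bound)
  show ?thesis using C(2)[OF point_mass_l1]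
    by (intro bdd_funI[of _ _ C]) (auto simp: l1_norm_point_mass)
qed

text \<open>The dual of \<open>l1 G\<close> is the space of bounded functions: a functional is
  recovered from its values at point masses, which are bounded because point masses have norm
  1.\<close>

lemma l1_dual_eq_functional_of:
  "lam \<in> l1_dual G \<Longrightarrow> lam = functional_of G (\<lambda>t. lam (point_mass t))"
  by (rule l1_dual_ext) (auto simp: functional_of_point_mass functional_of_in_l1_dual l1_dual_bdd_fun)

lemma functional_of_eq_iff:
  "functional_of G u = functional_of G v" if "\<And>t. t \<in> carrier G \<Longrightarrow> u t = v t"
  unfolding functional_of_def using that by (auto cong: infsum_cong)

lemma functional_of_add: "bdd_fun G u \<Longrightarrow> bdd_fun G v \<Longrightarrow>
   functional_of G (\<lambda>t. u t + v t) = functional_of G u + functional_of G v"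
  by (auto simp: functional_of_def fun_eq_iff distrib_left
      intro!: infsum_add abs_summable_summable[OF l1_mult_summable])

lemma functional_of_scale: "functional_of G (\<lambda>t. c * u t) = cscale c (functional_of G u)"
  unfolding functional_of_def cscale_def
  by (auto simp: fun_eq_iff infsum_cmult_right' mult.left_commute)

lemma zero_in_l1: "(\<lambda>t. 0) \<in> l1 G" by (simp add: l1_def)

text \<open>With \<open>l1_dual_norm_point_mass\<close> this identifies the dual norm with the
  supremum norm of the representing function.\<close>

lemma l1_dual_norm_bound:
  assumes "lam \<in> l1_dual G" "\<And>t. t \<in> carrier G \<Longrightarrow> cmod (lam (point_mass t)) \<le> C" "C \<ge> 0"
  shows "l1_dual_norm G lam \<le> C"
proof -
  have "cmod (lam f) \<le> C" if "f \<in> l1 G" "l1_norm G f \<le> 1" for f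
    using functional_of_bound[of f G "\<lambda>t. lam (point_mass t)" C, OF that(1) assms(2)] l1_dual_eq_functional_of[OF assms(1)] that(2)
      mult_left_mono[OF that(2) assms(3)] by simp
  then show ?thesis unfolding l1_dual_norm_def dual_norm_def
    by (intro cSup_least) (use zero_in_l1[of G] in \<open>auto intro!: exI[of _ "\<lambda>t. 0"] simp: l1_norm_def\<close>)
qed

lemma l1_dual_norm_point_mass:
  assumes "lam \<in> l1_dual G" "t \<in> carrier G"
  shows "cmod (lam (point_mass t)) \<le> l1_dual_norm G lam"
proof -
  obtain C where C: "C \<ge> 0" "\<And>a. a \<in> l1 G \<Longrightarrow> cmod (lam a) \<le> C * l1_norm G a"
    using assms(1) by (metis l1_dual_bound)
  have "cmod (lam a) \<le> C" if "a \<in> l1 G" "l1_norm G a \<le> 1" for a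
    using C(2)[OF that(1)] mult_left_mono[OF that(2) C(1)] by simp
  then have "bdd_above {cmod (lam f) |f. f \<in> l1 G \<and> l1_norm G f \<le> 1}"
    by (intro bdd_aboveI[of _ C]) auto
  then show ?thesis unfolding l1_dual_norm_def dual_norm_def
    by (rule cSup_upper[rotated])
      (use assms point_mass_l1[of t G] l1_norm_point_mass[of t G] in \<open>auto intro!: exI[of _ "point_mass t"]\<close>)
qed

section \<open>Values of bidual elements on bounded functions\<close>

lemma ev_cong: "(\<And>t. t \<in> carrier G \<Longrightarrow> u t = v t) \<Longrightarrow> ev G \<Phi> u = ev G \<Phi> v"
  unfolding ev_def by (simp add: functional_of_eq_iff[of G u v])

lemma ev_add:
  assumes "\<Phi> \<in> l1_bidual G" "bdd_fun G u" "bdd_fun G v"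
  shows "ev G \<Phi> (\<lambda>t. u t + v t) = ev G \<Phi> u + ev G \<Phi> v"
  using assms functional_of_in_l1_dual[of G]
  unfolding ev_def functional_of_add[OF assms(2,3)] l1_bidual_def dual_def by auto

lemma ev_scale:
  assumes "\<Phi> \<in> l1_bidual G" "bdd_fun G u"
  shows "ev G \<Phi> (\<lambda>t. c * u t) = c * ev G \<Phi> u"
  using assms functional_of_in_l1_dual[of G]
  unfolding ev_def functional_of_scale l1_bidual_def dual_def by auto

lemma ev_zero: "\<Phi> \<in> l1_bidual G \<Longrightarrow> ev G \<Phi> (\<lambda>t. 0) = 0"
  using ev_scale[of \<Phi> G "\<lambda>t. 0" 0] by auto

lemma ev_sum:
  assumes "\<Phi> \<in> l1_bidual G" "\<And>i. i \<in> I \<Longrightarrow> bdd_fun G (u i)" "finite I"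
  shows "ev G \<Phi> (\<lambda>t. \<Sum>i\<in>I. u i t) = (\<Sum>i\<in>I. ev G \<Phi> (u i))"
  using assms(3,2)
proof (induction I rule: finite_induct)
  case empty
  then show ?case by (simp add: ev_zero assms(1))
next
  case (insert x F)
  then show ?case by (simp add: ev_add[OF assms(1)] bdd_fun_sum)
qed

lemma ev_bound:
  assumes "\<Phi> \<in> l1_bidual G"
  obtains K where "K \<ge> 0" "\<And>u C. (\<And>t. t \<in> carrier G \<Longrightarrow> cmod (u t) \<le> C) \<Longrightarrow> C \<ge> 0 \<Longrightarrow> cmod (ev G \<Phi> u) \<le> K * C"
proof -
  from assms obtain K where K: "\<And>lam. lam \<in> l1_dual G \<Longrightarrow> cmod (\<Phi> lam) \<le> K * l1_dual_norm G lam"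
    unfolding l1_bidual_def dual_def by blast
  show ?thesis
  proof (rule that[of "\<bar>K\<bar>"])
    fix u C assume u: "\<And>t. t \<in> carrier G \<Longrightarrow> cmod (u t) \<le> C" and C0: "(C::real) \<ge> 0"
    let ?l = "functional_of G u"
    have l: "?l \<in> l1_dual G" using u by (intro functional_of_in_l1_dual bdd_funI)
    have le: "l1_dual_norm G ?l \<le> C" using u C0
      by (intro l1_dual_norm_bound l) (auto simp: functional_of_point_mass)
    \<comment> \<open>The zero function lies in the unit ball, so the dual norm is nonnegative; this
      allows \<open>K\<close> to be replaced by its absolute value.\<close>
    have nn: "0 \<le> l1_dual_norm G ?l"
    proof -
      have "cmod (?l (\<lambda>t. 0)) \<le> l1_dual_norm G ?l" unfolding l1_dual_norm_def dual_norm_def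
      proof (rule cSup_upper)
        show "bdd_above {cmod (?l f) |f. f \<in> l1 G \<and> l1_norm G f \<le> 1}"
        proof (rule bdd_aboveI[of _ C])
          fix x assume "x \<in> {cmod (?l f) |f. f \<in> l1 G \<and> l1_norm G f \<le> 1}"
          then obtain f where f: "x = cmod (?l f)" "f \<in> l1 G" "l1_norm G f \<le> 1" by blast
          have "x \<le> C * l1_norm G f" using functional_of_bound[OF f(2) u] f(1) by simp
          also have "\<dots> \<le> C" using mult_left_mono[OF f(3) C0] by simp
          finally show "x \<le> C" .
        qed
      qed (use zero_in_l1[of G] in \<open>auto intro!: exI[of _ "\<lambda>t. 0"] simp: l1_norm_def\<close>)
      then show ?thesis by (meson norm_ge_zero order_trans)
    qed
    have "cmod (ev G \<Phi> u) \<le> K * l1_dual_norm G ?l" unfolding ev_def by (rule K[OF l])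
    also have "\<dots> \<le> \<bar>K\<bar> * l1_dual_norm G ?l" using nn by (intro mult_right_mono) auto
    also have "\<dots> \<le> \<bar>K\<bar> * C" using le by (intro mult_left_mono) auto
    finally show "cmod (ev G \<Phi> u) \<le> \<bar>K\<bar> * C" .
  qed simp
qed

text \<open>Functionals in \<open>dual\<close> vanish off their space, so agreement on all
  representing functions already gives equality as HOL functions.\<close>

lemma l1_bidual_ext:
  assumes "\<Phi> \<in> l1_bidual G" "\<Psi> \<in> l1_bidual G" "\<And>u. bdd_fun G u \<Longrightarrow> ev G \<Phi> u = ev G \<Psi> u"
  shows "\<Phi> = \<Psi>"
proof
  fix lam
  show "\<Phi> lam = \<Psi> lam"
  proof (cases "lam \<in> l1_dual G")
    case True
    then show ?thesis using assms(3)[OF l1_dual_bdd_fun[OF True]] l1_dual_eq_functional_of[OF True]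
      by (simp add: ev_def)
  next
    case False
    then show ?thesis using assms by (simp add: l1_bidual_def dual_def)
  qed
qed

text \<open>Converse of \<open>ev\<close>: a bounded linear functional on bounded functions becomes
  a bidual element. Setting the function to 0 off the carrier gives \<phi> a representative that
  depends only on the functional.\<close>

definition bidual_of :: "('a, 'b) monoid_scheme \<Rightarrow> (('a \<Rightarrow> complex) \<Rightarrow> complex) \<Rightarrow> 'a bidual_elt" where
  "bidual_of G \<phi> = (\<lambda>lam. if lam \<in> l1_dual G then \<phi> (\<lambda>t. if t \<in> carrier G then lam (point_mass t) else 0) else 0)"

lemma l1_dual_plus: "lam \<in> l1_dual G \<Longrightarrow> mu \<in> l1_dual G \<Longrightarrow> lam + mu \<in> l1_dual G"
  and l1_dual_cscale: "lam \<in> l1_dual G \<Longrightarrow> cscale c lam \<in> l1_dual G"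
proof -
  assume l: "lam \<in> l1_dual G"
  then have "cscale c lam = functional_of G (\<lambda>t. c * lam (point_mass t))"
    by (simp add: functional_of_scale l1_dual_eq_functional_of[symmetric])
  then show "cscale c lam \<in> l1_dual G"
    using functional_of_in_l1_dual[OF bdd_fun_mult[OF bdd_fun_const l1_dual_bdd_fun[OF l]]] by simp
  assume m: "mu \<in> l1_dual G"
  then have "lam + mu = functional_of G (\<lambda>t. lam (point_mass t) + mu (point_mass t))"
    using l by (simp add: functional_of_add l1_dual_bdd_fun l1_dual_eq_functional_of[symmetric])
  then show "lam + mu \<in> l1_dual G"
    using functional_of_in_l1_dual[OF bdd_fun_add[OF l1_dual_bdd_fun[OF l] l1_dual_bdd_fun[OF m]]] by simp
qed

lemma bidual_of:
  assumes nonempty: "carrier G \<noteq> {}"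
    and add: "\<And>u v. bdd_fun G u \<Longrightarrow> bdd_fun G v \<Longrightarrow> \<phi> (\<lambda>t. u t + v t) = \<phi> u + \<phi> v"
    and scale: "\<And>c u. bdd_fun G u \<Longrightarrow> \<phi> (\<lambda>t. c * u t) = c * \<phi> u"
    and bound: "\<And>u C. (\<And>t. t \<in> carrier G \<Longrightarrow> cmod (u t) \<le> C) \<Longrightarrow> C \<ge> 0 \<Longrightarrow> cmod (\<phi> u) \<le> K * C"
  shows "bidual_of G \<phi> \<in> l1_bidual G"
    and "bdd_fun G u \<Longrightarrow> ev G (bidual_of G \<phi>) u = \<phi> u"
proof -
  let ?r = "\<lambda>lam t. if t \<in> carrier G then lam (point_mass t) else (0::complex)"
  have b: "bdd_fun G (?r lam)" if "lam \<in> l1_dual G" for lam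
    using l1_dual_bdd_fun[OF that] by (auto simp: bdd_fun_def)
  have "bidual_of G \<phi> (lam + mu) = bidual_of G \<phi> lam + bidual_of G \<phi> mu"
    if "lam \<in> l1_dual G" "mu \<in> l1_dual G" for lam mu
  proof -
    have "?r (lam + mu) = (\<lambda>t. ?r lam t + ?r mu t)" by auto
    then show ?thesis using that by (simp add: bidual_of_def l1_dual_plus add b)
  qed
  moreover have "bidual_of G \<phi> (cscale c lam) = c * bidual_of G \<phi> lam" if "lam \<in> l1_dual G" for c lam
  proof -
    have "?r (cscale c lam) = (\<lambda>t. c * ?r lam t)" by (auto simp: cscale_def)
    then show ?thesis using that by (simp add: bidual_of_def l1_dual_cscale scale b)
  qed
  moreover have "cmod (bidual_of G \<phi> lam) \<le> K * l1_dual_norm G lam" if "lam \<in> l1_dual G" for lam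
  proof -
    \<comment> \<open>A point of the carrier shows that the dual norm is nonnegative, so that it may
      serve as the constant \<open>C\<close> of the assumed bound.\<close>
    from nonempty obtain t0 where t0: "t0 \<in> carrier G" by blast
    have n0: "0 \<le> l1_dual_norm G lam"
      using l1_dual_norm_point_mass[OF that t0] by (meson norm_ge_zero order_trans)
    then show ?thesis
      using that l1_dual_norm_point_mass[OF that] by (auto simp: bidual_of_def intro!: bound)
  qed
  ultimately show "bidual_of G \<phi> \<in> l1_bidual G"
    unfolding l1_bidual_def dual_def[of "l1_dual G"] mem_Collect_eq
    by (intro conjI allI ballI impI exI[of _ K]) (auto simp: bidual_of_def)
  assume u: "bdd_fun G u"
  have ub: "bdd_fun G (\<lambda>t. if t \<in> carrier G then u t else 0)" using u by (auto simp: bdd_fun_def)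
  have m: "bdd_fun G (\<lambda>t. (-1) * (if t \<in> carrier G then u t else 0))"
    by (rule bdd_fun_mult[OF bdd_fun_const ub])
  \<comment> \<open>The bound with \<open>C = 0\<close> shows that \<phi> ignores values off the
    carrier, so the cut-off made by \<open>bidual_of\<close> changes nothing.\<close>
  have "cmod (\<phi> (\<lambda>t. u t + (-1) * (if t \<in> carrier G then u t else 0))) \<le> K * 0"
    by (rule bound) auto
  moreover have "\<phi> (\<lambda>t. u t + (-1) * (if t \<in> carrier G then u t else 0)) =
      \<phi> u - \<phi> (\<lambda>t. if t \<in> carrier G then u t else 0)"
    by (subst add[OF u m], subst scale[OF ub]) simp
  ultimately have "\<phi> u = \<phi> (\<lambda>t. if t \<in> carrier G then u t else 0)" by simp
  moreover have "?r (functional_of G u) = (\<lambda>t. if t \<in> carrier G then u t else 0)"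
    by (auto simp: functional_of_point_mass)
  ultimately show "ev G (bidual_of G \<phi>) u = \<phi> u"
    by (simp add: ev_def bidual_of_def functional_of_in_l1_dual u)
qed

section \<open>The Arens product\<close>

context group begin

lemma convolution_product_summable:
  assumes "a \<in> l1 G" "b \<in> l1 G" "bdd_fun G w"
  shows "Infinite_Sum.abs_summable_on (\<lambda>(s,x). a s * b x * w (s \<otimes> x)) (carrier G \<times> carrier G)"
proof -
  obtain C where C: "\<And>t. t \<in> carrier G \<Longrightarrow> cmod (w t) \<le> C" using assms(3) by (metis bdd_fun_bound)
  have "Infinite_Sum.abs_summable_on (\<lambda>(s,x). a s * b x) (carrier G \<times> carrier G)"
    unfolding Infinite_Sum.abs_summable_on_Sigma_iff
    using l1_abs_summable[OF assms(1)] l1_abs_summable[OF assms(2)]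
    by (auto simp: norm_mult infsum_cmult_right' abs_mult infsum_nonneg intro: summable_on_cmult_right summable_on_cmult_left)
  then have "(\<lambda>p. cmod (case p of (s,x) \<Rightarrow> a s * b x) * C) summable_on carrier G \<times> carrier G"
    by (rule summable_on_cmult_left)
  then show ?thesis
    by (rule summable_on_comparison_test) (auto simp: norm_mult intro!: mult_left_mono C)
qed

text \<open>The substitution t = s x turns the double sum over s and t behind a convolution into an
  absolutely convergent product sum over s and x.\<close>

lemma bij_betw_shear: "bij_betw (\<lambda>(s,x). (s \<otimes> x, s)) (carrier G \<times> carrier G) (carrier G \<times> carrier G)"
  by (rule bij_betw_byWitness[where f' = "\<lambda>(t,s). (s, inv s \<otimes> t)"])
    (auto simp: m_assoc[symmetric])

lemma convolution_shear_summable: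
  assumes "a \<in> l1 G" "b \<in> l1 G" "bdd_fun G w"
  shows "Infinite_Sum.abs_summable_on (\<lambda>(t,s). a s * b (inv s \<otimes> t) * w t) (carrier G \<times> carrier G)"
    and "infsum (\<lambda>(t,s). a s * b (inv s \<otimes> t) * w t) (carrier G \<times> carrier G) =
         infsum (\<lambda>(s,x). a s * b x * w (s \<otimes> x)) (carrier G \<times> carrier G)"
proof -
  have "(\<lambda>p. cmod (case p of (t,s) \<Rightarrow> a s * b (inv s \<otimes> t) * w t)) summable_on carrier G \<times> carrier G
    \<longleftrightarrow> (\<lambda>q. cmod (case (case q of (s,x) \<Rightarrow> (s \<otimes> x, s)) of (t,s) \<Rightarrow> a s * b (inv s \<otimes> t) * w t)) summable_on carrier G \<times> carrier G"
    by (rule summable_on_reindex_bij_betw[OF bij_betw_shear, symmetric])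
  also have "\<dots> \<longleftrightarrow> (\<lambda>p. cmod (case p of (s,x) \<Rightarrow> a s * b x * w (s \<otimes> x))) summable_on carrier G \<times> carrier G"
    by (rule summable_on_cong) (auto simp: m_assoc[symmetric])
  finally show "Infinite_Sum.abs_summable_on (\<lambda>(t,s). a s * b (inv s \<otimes> t) * w t) (carrier G \<times> carrier G)"
    using convolution_product_summable[OF assms] by blast
  have "infsum (\<lambda>(t,s). a s * b (inv s \<otimes> t) * w t) (carrier G \<times> carrier G) =
     infsum (\<lambda>q. case (case q of (s,x) \<Rightarrow> (s \<otimes> x, s)) of (t,s) \<Rightarrow> a s * b (inv s \<otimes> t) * w t) (carrier G \<times> carrier G)"
    by (rule infsum_reindex_bij_betw[OF bij_betw_shear, symmetric])
  also have "\<dots> = infsum (\<lambda>(s,x). a s * b x * w (s \<otimes> x)) (carrier G \<times> carrier G)"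
    by (rule infsum_cong) (auto simp: m_assoc[symmetric])
  finally show "infsum (\<lambda>(t,s). a s * b (inv s \<otimes> t) * w t) (carrier G \<times> carrier G) =
         infsum (\<lambda>(s,x). a s * b x * w (s \<otimes> x)) (carrier G \<times> carrier G)" .
qed

lemma convolution_l1:
  assumes "a \<in> l1 G" "b \<in> l1 G" shows "convolution G a b \<in> l1 G"
proof -
  have "Infinite_Sum.abs_summable_on (\<lambda>(t,s). a s * b (inv s \<otimes> t)) (carrier G \<times> carrier G)"
    using convolution_shear_summable(1)[OF assms bdd_fun_const[of G 1]] by simp
  then have A: "\<forall>t\<in>carrier G. (\<lambda>s. cmod (a s * b (inv s \<otimes> t))) summable_on carrier G"
    and B: "(\<lambda>t. cmod (infsum (\<lambda>s. cmod (a s * b (inv s \<otimes> t))) (carrier G))) summable_on carrier G"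
    unfolding Infinite_Sum.abs_summable_on_Sigma_iff by auto
  have "(\<lambda>t. cmod (convolution G a b t)) summable_on carrier G"
  proof (rule summable_on_comparison_test)
    show "(\<lambda>t. cmod (infsum (\<lambda>s. cmod (a s * b (inv s \<otimes> t))) (carrier G))) summable_on carrier G"
      using B by simp
    fix t assume t: "t \<in> carrier G"
    have "cmod (convolution G a b t) \<le> infsum (\<lambda>s. cmod (a s * b (inv s \<otimes> t))) (carrier G)"
      using A t by (simp add: convolution_def norm_infsum_bound)
    also have "\<dots> \<le> cmod (infsum (\<lambda>s. cmod (a s * b (inv s \<otimes> t))) (carrier G))"
      by simp
    finally show "cmod (convolution G a b t) \<le> cmod (infsum (\<lambda>s. cmod (a s * b (inv s \<otimes> t))) (carrier G))" .
  qed simp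
  then show ?thesis by (simp add: l1_def convolution_def)
qed

text \<open>Fubini for the sheared double sum. It exhibits the functional \<lambda> \<cdot> a as the
  function x \<mapsto> \<Sum> a(s) w(s x).\<close>

lemma functional_of_convolution:
  assumes "a \<in> l1 G" "b \<in> l1 G" "bdd_fun G w"
  shows "functional_of G w (convolution G a b) =
    functional_of G (\<lambda>x. functional_of G (\<lambda>s. w (s \<otimes> x)) a) b"
proof -
  let ?C = "carrier G"
  note sh = convolution_shear_summable[OF assms]
  have "functional_of G w (convolution G a b) =
      infsum (\<lambda>t. infsum (\<lambda>s. a s * b (inv s \<otimes> t) * w t) ?C) ?C"
    using convolution_l1[OF assms(1,2)]
    by (auto simp: functional_of_def convolution_def infsum_cmult_left' intro!: infsum_cong)
  also have "\<dots> = infsum (\<lambda>(t,s). a s * b (inv s \<otimes> t) * w t) (?C \<times> ?C)"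
    using infsum_Sigma'_banach[of "\<lambda>t s. a s * b (inv s \<otimes> t) * w t" ?C "\<lambda>_. ?C"]
      abs_summable_summable[OF sh(1)] by simp
  also have "\<dots> = infsum (\<lambda>(s,x). a s * b x * w (s \<otimes> x)) (?C \<times> ?C)" by (rule sh(2))
  also have "\<dots> = infsum (\<lambda>s. infsum (\<lambda>x. a s * b x * w (s \<otimes> x)) ?C) ?C"
    using infsum_Sigma'_banach[of "\<lambda>s x. a s * b x * w (s \<otimes> x)" ?C "\<lambda>_. ?C"]
      abs_summable_summable[OF convolution_product_summable[OF assms]] by simp
  also have "\<dots> = infsum (\<lambda>x. infsum (\<lambda>s. a s * b x * w (s \<otimes> x)) ?C) ?C"
    by (rule infsum_swap_banach)
      (use abs_summable_summable[OF convolution_product_summable[OF assms]] in \<open>simp\<close>)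
  also have "\<dots> = functional_of G (\<lambda>x. functional_of G (\<lambda>s. w (s \<otimes> x)) a) b"
    unfolding functional_of_def using assms(1,2)
    by (auto intro!: infsum_cong simp: infsum_cmult_right'[symmetric] mult.assoc mult.left_commute)
  finally show ?thesis .
qed

lemma bdd_fun_left: "bdd_fun G w \<Longrightarrow> s \<in> carrier G \<Longrightarrow> bdd_fun G (\<lambda>x. w (s \<otimes> x))"
  and bdd_fun_right: "bdd_fun G w \<Longrightarrow> s \<in> carrier G \<Longrightarrow> bdd_fun G (\<lambda>x. w (x \<otimes> s))"
  unfolding bdd_fun_def by auto

lemma dual_act_functional_of:
  assumes "a \<in> l1 G" "bdd_fun G w"
  shows "dual_act G (functional_of G w) a = functional_of G (\<lambda>x. functional_of G (\<lambda>s. w (s \<otimes> x)) a)"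
  unfolding dual_act_def using functional_of_convolution[OF assms(1) _ assms(2)]
  by (auto simp: fun_eq_iff functional_of_def)

lemma bdd_functional_of_right:
  assumes "a \<in> l1 G" "\<And>t. t \<in> carrier G \<Longrightarrow> cmod (w t) \<le> C" "x \<in> carrier G"
  shows "cmod (functional_of G (\<lambda>s. w (s \<otimes> x)) a) \<le> C * l1_norm G a"
  using assms by (intro functional_of_bound) auto

text \<open>Once \<Phi> \<cdot> \<lambda> is known to lie in the dual, it is determined by its
  values at point masses, where \<lambda> \<cdot> \<delta>_s is a left translate of w. In this way
  \<Phi> is never interchanged with an infinite sum.\<close>

lemma bidual_act_functional_of:
  assumes "\<Phi> \<in> l1_bidual G" "bdd_fun G w"
  shows "bidual_act G \<Phi> (functional_of G w) = functional_of G (\<lambda>s. ev G \<Phi> (\<lambda>x. w (s \<otimes> x)))" (is ?eq)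
    and "bdd_fun G (\<lambda>s. ev G \<Phi> (\<lambda>x. w (s \<otimes> x)))" (is ?bdd)
proof -
  obtain C where C: "C \<ge> 0" "\<And>t. t \<in> carrier G \<Longrightarrow> cmod (w t) \<le> C" using assms(2) by (metis bdd_fun_bound)
  obtain K where K: "K \<ge> 0" "\<And>u C. (\<And>t. t \<in> carrier G \<Longrightarrow> cmod (u t) \<le> C) \<Longrightarrow> C \<ge> 0 \<Longrightarrow> cmod (ev G \<Phi> u) \<le> K * C"
    using ev_bound[OF assms(1)] by metis
  show bdd: ?bdd using C by (intro bdd_funI[of _ _ "K * C"] K(2)) auto
  let ?h = "\<lambda>a x. functional_of G (\<lambda>s. w (s \<otimes> x)) a"
  have act: "bidual_act G \<Phi> (functional_of G w) a = ev G \<Phi> (?h a)" if "a \<in> l1 G" for a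
    using that by (simp add: bidual_act_def dual_act_functional_of assms ev_def)
  have hb: "bdd_fun G (?h a)" if "a \<in> l1 G" for a
    using bdd_functional_of_right[where w = w and C = C, OF that C(2)] by (auto intro: bdd_funI)
  have fr: "functional_of G (\<lambda>s. w (s \<otimes> x)) \<in> l1_dual G" if "x \<in> carrier G" for x
    using that assms(2) by (intro functional_of_in_l1_dual bdd_fun_right)
  have "bidual_act G \<Phi> (functional_of G w) \<in> l1_dual G"
    unfolding l1_dual_def dual_def mem_Collect_eq
  proof (intro conjI ballI allI impI)
    fix f g assume fg: "f \<in> l1 G" "g \<in> l1 G"
    have "ev G \<Phi> (?h (f + g)) = ev G \<Phi> (\<lambda>x. ?h f x + ?h g x)"
      by (rule ev_cong) (simp add: l1_dual_add[OF fr] fg)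
    then show "bidual_act G \<Phi> (functional_of G w) (f + g) =
       bidual_act G \<Phi> (functional_of G w) f + bidual_act G \<Phi> (functional_of G w) g"
      using fg by (simp add: act l1_add ev_add[OF assms(1)] hb)
  next
    fix c f assume f: "f \<in> l1 G"
    have "ev G \<Phi> (?h (cscale c f)) = ev G \<Phi> (\<lambda>x. c * ?h f x)"
      by (rule ev_cong) (simp add: l1_dual_scale[OF fr] f)
    then show "bidual_act G \<Phi> (functional_of G w) (cscale c f) = c * bidual_act G \<Phi> (functional_of G w) f"
      using f by (simp add: act l1_scale ev_scale[OF assms(1)] hb)
  next
    have "cmod (bidual_act G \<Phi> (functional_of G w) f) \<le> (K * C) * l1_norm G f" if "f \<in> l1 G" for f
      using K(2)[of "?h f" "C * l1_norm G f"] bdd_functional_of_right[of f w C, OF that C(2)] C(1)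
      by (simp add: act that mult.assoc l1_norm_nonneg)
    then show "\<exists>C. \<forall>f\<in>l1 G. cmod (bidual_act G \<Phi> (functional_of G w) f) \<le> C * l1_norm G f" by blast
  next
    fix f assume "f \<notin> l1 G"
    then show "bidual_act G \<Phi> (functional_of G w) f = 0" by (simp add: bidual_act_def)
  qed
  then show ?eq
  proof (rule l1_dual_ext)
    show "functional_of G (\<lambda>s. ev G \<Phi> (\<lambda>x. w (s \<otimes> x))) \<in> l1_dual G"
      by (rule functional_of_in_l1_dual[OF bdd])
    fix t assume t: "t \<in> carrier G"
    show "bidual_act G \<Phi> (functional_of G w) (point_mass t) = functional_of G (\<lambda>s. ev G \<Phi> (\<lambda>x. w (s \<otimes> x))) (point_mass t)"
      using t by (simp add: act point_mass_l1 functional_of_point_mass)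
  qed
qed

text \<open>The right factor is applied first, to left translates of the function; the left factor
  is applied to the result. Later calculations with Arens products start from this formula.\<close>

lemma ev_arens:
  assumes "\<Phi> \<in> l1_bidual G" "bdd_fun G u"
  shows "ev G (arens G \<Psi> \<Phi>) u = ev G \<Psi> (\<lambda>s. ev G \<Phi> (\<lambda>x. u (s \<otimes> x)))"
  using assms by (simp add: ev_def arens_def functional_of_in_l1_dual bidual_act_functional_of)

lemma bdd_fun_ev: "\<Phi> \<in> l1_bidual G \<Longrightarrow> bdd_fun G w \<Longrightarrow> bdd_fun G (\<lambda>s. ev G \<Phi> (\<lambda>x. w (s \<otimes> x)))"
  by (rule bidual_act_functional_of)

lemma carrier_nonempty: "carrier G \<noteq> {}" using one_closed by blast

text \<open>The iterated evaluation is linear in u and bounded by the product of the two constants,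
  so \<open>bidual_of\<close> produces a bidual element from it, and this element is the
  product.\<close>

lemma arens_closed:
  assumes "\<Psi> \<in> l1_bidual G" "\<Phi> \<in> l1_bidual G" shows "arens G \<Psi> \<Phi> \<in> l1_bidual G"
proof -
  obtain K where K: "K \<ge> 0" "\<And>u C. (\<And>t. t \<in> carrier G \<Longrightarrow> cmod (u t) \<le> C) \<Longrightarrow> C \<ge> 0 \<Longrightarrow> cmod (ev G \<Phi> u) \<le> K * C"
    using ev_bound[OF assms(2)] by metis
  obtain L where L: "L \<ge> 0" "\<And>u C. (\<And>t. t \<in> carrier G \<Longrightarrow> cmod (u t) \<le> C) \<Longrightarrow> C \<ge> 0 \<Longrightarrow> cmod (ev G \<Psi> u) \<le> L * C"
    using ev_bound[OF assms(1)] by metis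
  let ?f = "\<lambda>u. ev G \<Psi> (\<lambda>s. ev G \<Phi> (\<lambda>x. u (s \<otimes> x)))"
  have 1: "?f (\<lambda>t. u t + v t) = ?f u + ?f v" if "bdd_fun G u" "bdd_fun G v" for u v
  proof -
    have "?f (\<lambda>t. u t + v t) = ev G \<Psi> (\<lambda>s. ev G \<Phi> (\<lambda>x. u (s \<otimes> x)) + ev G \<Phi> (\<lambda>x. v (s \<otimes> x)))"
      by (rule ev_cong) (use that assms in \<open>simp add: ev_add bdd_fun_left\<close>)
    then show ?thesis using that assms by (simp add: ev_add bdd_fun_ev)
  qed
  have 2: "?f (\<lambda>t. c * u t) = c * ?f u" if "bdd_fun G u" for u c
  proof -
    have "?f (\<lambda>t. c * u t) = ev G \<Psi> (\<lambda>s. c * ev G \<Phi> (\<lambda>x. u (s \<otimes> x)))"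
      by (rule ev_cong) (use that assms in \<open>simp add: ev_scale bdd_fun_left\<close>)
    then show ?thesis using that assms by (simp add: ev_scale bdd_fun_ev)
  qed
  have 3: "cmod (?f u) \<le> (L * K) * C" if "\<And>t. t \<in> carrier G \<Longrightarrow> cmod (u t) \<le> C" "C \<ge> 0" for u C
    using that K(1) by (auto simp: mult.assoc intro!: L(2) K(2) mult_nonneg_nonneg)
  have b1: "bidual_of G ?f \<in> l1_bidual G" by (rule bidual_of(1)[OF carrier_nonempty 1 2 3])
  have b2: "ev G (bidual_of G ?f) u = ?f u" if "bdd_fun G u" for u
    by (rule bidual_of(2)[OF carrier_nonempty 1 2 3 that])
  have "arens G \<Psi> \<Phi> = bidual_of G ?f"
  proof
    fix lam show "arens G \<Psi> \<Phi> lam = bidual_of G ?f lam"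
    proof (cases "lam \<in> l1_dual G")
      case True
      let ?u = "\<lambda>t. lam (point_mass t)"
      have "arens G \<Psi> \<Phi> lam = ev G (arens G \<Psi> \<Phi>) ?u"
        using l1_dual_eq_functional_of[OF True] by (simp add: ev_def)
      also have "\<dots> = ?f ?u" by (rule ev_arens[OF assms(2) l1_dual_bdd_fun[OF True]])
      also have "\<dots> = ev G (bidual_of G ?f) ?u" by (rule b2[OF l1_dual_bdd_fun[OF True], symmetric])
      also have "\<dots> = bidual_of G ?f lam"
        using l1_dual_eq_functional_of[OF True] by (simp add: ev_def)
      finally show ?thesis .
    qed (simp add: arens_def bidual_of_def)
  qed
  then show ?thesis using b1 by simp
qed

section \<open>Point masses, associativity and bilinearity\<close>

lemma to_bidual_point_mass:
  assumes "t \<in> carrier G"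
  shows "to_bidual G (point_mass t) \<in> l1_bidual G"
    and "bdd_fun G u \<Longrightarrow> ev G (to_bidual G (point_mass t)) u = u t"
proof -
  have "cmod (lam (point_mass t)) \<le> 1 * l1_dual_norm G lam" if "lam \<in> l1_dual G" for lam
    using l1_dual_norm_point_mass[OF that assms] by simp
  moreover have cs: "cscale c lam (point_mass t) = c * lam (point_mass t)" for c and lam :: "('a \<Rightarrow> complex) \<Rightarrow> complex"
    by (simp add: cscale_def)
  ultimately have "\<exists>C. \<forall>lam\<in>l1_dual G. cmod (lam (point_mass t)) \<le> C * l1_dual_norm G lam" by blast
  then show "to_bidual G (point_mass t) \<in> l1_bidual G"
    unfolding l1_bidual_def dual_def[of "l1_dual G"]
    by (auto simp: to_bidual_def l1_dual_plus l1_dual_cscale cs)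
  show "bdd_fun G u \<Longrightarrow> ev G (to_bidual G (point_mass t)) u = u t"
    using assms by (simp add: ev_def to_bidual_def functional_of_in_l1_dual functional_of_point_mass)
qed

lemma ev_translate:
  assumes "t \<in> carrier G" "\<Phi> \<in> l1_bidual G" "bdd_fun G u"
  shows "ev G (arens G (to_bidual G (point_mass t)) \<Phi>) u = ev G \<Phi> (\<lambda>x. u (t \<otimes> x))"
  using assms by (simp add: ev_arens to_bidual_point_mass bdd_fun_ev)

lemma arens_assoc:
  assumes "\<Psi> \<in> l1_bidual G" "\<Phi> \<in> l1_bidual G" "\<Theta> \<in> l1_bidual G"
  shows "arens G (arens G \<Psi> \<Phi>) \<Theta> = arens G \<Psi> (arens G \<Phi> \<Theta>)"
proof (rule l1_bidual_ext)
  fix u assume u: "bdd_fun G u"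
  have "ev G (arens G (arens G \<Psi> \<Phi>) \<Theta>) u = ev G \<Psi> (\<lambda>s. ev G \<Phi> (\<lambda>x. ev G \<Theta> (\<lambda>y. u (s \<otimes> x \<otimes> y))))"
    using assms u by (simp add: ev_arens bdd_fun_ev)
  also have "\<dots> = ev G (arens G \<Psi> (arens G \<Phi> \<Theta>)) u"
    unfolding ev_arens[OF arens_closed[OF assms(2,3)] u]
    by (rule ev_cong) (use assms u in \<open>auto simp: ev_arens bdd_fun_left m_assoc intro!: ev_cong\<close>)
  finally show "ev G (arens G (arens G \<Psi> \<Phi>) \<Theta>) u = ev G (arens G \<Psi> (arens G \<Phi> \<Theta>)) u" .
qed (use assms in \<open>auto intro: arens_closed\<close>)

lemma l1_bidual_add:
  assumes "\<Phi> \<in> l1_bidual G" "\<Psi> \<in> l1_bidual G" shows "\<Phi> + \<Psi> \<in> l1_bidual G"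
proof -
  obtain K L where "\<forall>l\<in>l1_dual G. cmod (\<Phi> l) \<le> K * l1_dual_norm G l"
     "\<forall>l\<in>l1_dual G. cmod (\<Psi> l) \<le> L * l1_dual_norm G l"
    using assms unfolding l1_bidual_def dual_def by blast
  then have "\<forall>l\<in>l1_dual G. cmod (\<Phi> l + \<Psi> l) \<le> (K + L) * l1_dual_norm G l"
    by (metis add_mono distrib_right norm_triangle_le)
  then have "\<exists>C. \<forall>l\<in>l1_dual G. cmod (\<Phi> l + \<Psi> l) \<le> C * l1_dual_norm G l" by blast
  then show ?thesis using assms unfolding l1_bidual_def dual_def by (auto simp: algebra_simps)
qed

lemma l1_bidual_cscale:
  assumes "\<Phi> \<in> l1_bidual G" shows "cscale c \<Phi> \<in> l1_bidual G"
proof -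
  obtain K where "\<forall>l\<in>l1_dual G. cmod (\<Phi> l) \<le> K * l1_dual_norm G l"
    using assms unfolding l1_bidual_def dual_def by blast
  then have "\<forall>l\<in>l1_dual G. cmod (c * \<Phi> l) \<le> (cmod c * K) * l1_dual_norm G l"
    by (simp add: norm_mult mult.assoc mult_left_mono)
  then have "\<exists>C. \<forall>l\<in>l1_dual G. cmod (c * \<Phi> l) \<le> C * l1_dual_norm G l" by blast
  then show ?thesis using assms unfolding l1_bidual_def dual_def cscale_def
    by (auto simp: algebra_simps)
qed

lemma l1_bidual_zero: "0 \<in> l1_bidual G"
  unfolding l1_bidual_def dual_def by (auto intro!: exI[of _ 0])

lemma arens_add_left: "arens G (\<Psi> + \<Psi>') \<Phi> = arens G \<Psi> \<Phi> + arens G \<Psi>' \<Phi>"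
  by (auto simp: arens_def)

lemma arens_cscale_left: "arens G (cscale c \<Psi>) \<Phi> = cscale c (arens G \<Psi> \<Phi>)"
  by (auto simp: arens_def cscale_def)

lemma arens_zero_left: "arens G 0 \<Phi> = 0"
  by (auto simp: arens_def)

text \<open>Additivity on the left is pointwise; here the sum is first moved through the inner
  evaluation, and then \<open>\<Psi>\<close> is linear on bounded functions.\<close>

lemma arens_add_right:
  assumes "\<Psi> \<in> l1_bidual G" "\<Phi> \<in> l1_bidual G" "\<Phi>' \<in> l1_bidual G"
  shows "arens G \<Psi> (\<Phi> + \<Phi>') = arens G \<Psi> \<Phi> + arens G \<Psi> \<Phi>'"
proof (rule l1_bidual_ext)
  fix u assume u: "bdd_fun G u"
  have "ev G (arens G \<Psi> (\<Phi> + \<Phi>')) u = ev G \<Psi> (\<lambda>s. ev G \<Phi> (\<lambda>x. u (s \<otimes> x)) + ev G \<Phi>' (\<lambda>x. u (s \<otimes> x)))"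
    by (subst ev_arens[OF l1_bidual_add[OF assms(2,3)] u]) (simp add: ev_def)
  also have "\<dots> = ev G (arens G \<Psi> \<Phi>) u + ev G (arens G \<Psi> \<Phi>') u"
    using assms u by (simp add: ev_add bdd_fun_ev ev_arens)
  finally show "ev G (arens G \<Psi> (\<Phi> + \<Phi>')) u = ev G (arens G \<Psi> \<Phi> + arens G \<Psi> \<Phi>') u" by (simp add: ev_def)
qed (use assms in \<open>auto intro: arens_closed l1_bidual_add\<close>)

lemma arens_cscale_right:
  assumes "\<Psi> \<in> l1_bidual G" "\<Phi> \<in> l1_bidual G"
  shows "arens G \<Psi> (cscale c \<Phi>) = cscale c (arens G \<Psi> \<Phi>)"
proof (rule l1_bidual_ext)
  fix u assume u: "bdd_fun G u"
  have "ev G (arens G \<Psi> (cscale c \<Phi>)) u = ev G \<Psi> (\<lambda>s. c * ev G \<Phi> (\<lambda>x. u (s \<otimes> x)))"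
    by (subst ev_arens[OF l1_bidual_cscale[OF assms(2)] u]) (simp add: ev_def cscale_def)
  also have "\<dots> = c * ev G (arens G \<Psi> \<Phi>) u"
    using assms u by (simp add: ev_scale bdd_fun_ev ev_arens)
  finally show "ev G (arens G \<Psi> (cscale c \<Phi>)) u = ev G (cscale c (arens G \<Psi> \<Phi>)) u" by (simp add: ev_def cscale_def)
qed (use assms in \<open>auto intro: arens_closed l1_bidual_cscale\<close>)

lemma arens_zero_right: "\<Psi> \<in> l1_bidual G \<Longrightarrow> arens G \<Psi> 0 = 0"
  using arens_cscale_right[of \<Psi> 0 0] l1_bidual_zero by (simp add: cscale_def fun_eq_iff zero_fun_def)

end

section \<open>Subgroups up to finite index and subnormal subgroups\<close>

text \<open>For subgroups this says that \<open>A \<inter> B\<close> has finite index in \<open>A\<close>.\<close>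

definition virtually_le :: "('a, 'b) monoid_scheme \<Rightarrow> 'a set \<Rightarrow> 'a set \<Rightarrow> bool" where
  "virtually_le G A B \<longleftrightarrow> (\<exists>T. finite T \<and> T \<subseteq> carrier G \<and> (\<forall>a\<in>A. \<exists>t\<in>T. inv\<^bsub>G\<^esub> t \<otimes>\<^bsub>G\<^esub> a \<in> B))"

context group begin

abbreviation vle :: "'a set \<Rightarrow> 'a set \<Rightarrow> bool" (infix "\<lessapprox>" 50) where
  "A \<lessapprox> B \<equiv> virtually_le G A B"

lemma vle_subset: "A \<subseteq> B \<Longrightarrow> B \<subseteq> carrier G \<Longrightarrow> A \<lessapprox> B"
proof -
  assume "A \<subseteq> B" "B \<subseteq> carrier G"
  then have "inv \<one> \<otimes> a \<in> B" if "a \<in> A" for a using that by (simp add: subset_iff)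
  then show ?thesis unfolding virtually_le_def by (intro exI[of _ "{\<one>}"]) simp
qed

lemma vle_mono: "A \<lessapprox> B \<Longrightarrow> A' \<subseteq> A \<Longrightarrow> B \<subseteq> B' \<Longrightarrow> A' \<lessapprox> B'"
  unfolding virtually_le_def by (elim exE conjE) (intro exI conjI ballI, assumption+, meson subsetD)

lemma vle_trans:
  assumes "A \<lessapprox> B" "B \<lessapprox> C" "A \<subseteq> carrier G"
  shows "A \<lessapprox> C"
proof -
  obtain T where T: "finite T" "T \<subseteq> carrier G" "\<And>a. a \<in> A \<Longrightarrow> \<exists>t\<in>T. inv t \<otimes> a \<in> B"
    using assms unfolding virtually_le_def by metis
  obtain S where S: "finite S" "S \<subseteq> carrier G" "\<And>a. a \<in> B \<Longrightarrow> \<exists>t\<in>S. inv t \<otimes> a \<in> C"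
    using assms unfolding virtually_le_def by metis
  have "\<exists>p\<in>(\<lambda>(t,s). t \<otimes> s) ` (T \<times> S). inv p \<otimes> a \<in> C" if aA: "a \<in> A" for a
  proof -
    obtain t where t: "t \<in> T" "inv t \<otimes> a \<in> B" using T aA by blast
    then obtain s where s: "s \<in> S" "inv s \<otimes> (inv t \<otimes> a) \<in> C" using S by blast
    moreover have "inv s \<otimes> (inv t \<otimes> a) = inv (t \<otimes> s) \<otimes> a"
      using t s T S aA assms by (simp add: inv_mult_group m_assoc subset_iff)
    ultimately show ?thesis using t by force
  qed
  then show ?thesis unfolding virtually_le_def
    by (intro exI[of _ "(\<lambda>(t,s). t \<otimes> s) ` (T \<times> S)"]) (use T S in auto)
qed

text \<open>In each of the finitely many translates of \<open>B\<close> that meets \<open>A\<close>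
  a representative is taken from \<open>A\<close>; quotients of elements of one translate lie in
  \<open>B\<close>.\<close>

lemma vle_reps:
  assumes "A \<lessapprox> B" "subgroup A G" "subgroup B G"
  obtains T where "finite T" "T \<subseteq> A" "\<And>a. a \<in> A \<Longrightarrow> \<exists>t\<in>T. inv t \<otimes> a \<in> A \<inter> B"
proof -
  obtain T where T: "finite T" "T \<subseteq> carrier G" "\<And>a. a \<in> A \<Longrightarrow> \<exists>t\<in>T. inv t \<otimes> a \<in> B"
    using assms unfolding virtually_le_def by metis
  define T' where "T' = {t \<in> T. \<exists>a\<in>A. inv t \<otimes> a \<in> B}"
  define r where "r t = (SOME a. a \<in> A \<and> inv t \<otimes> a \<in> B)" for t
  have r: "r t \<in> A" "inv t \<otimes> r t \<in> B" if "t \<in> T'" for t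
    using someI_ex[of "\<lambda>a. a \<in> A \<and> inv t \<otimes> a \<in> B"] that unfolding T'_def r_def by auto
  have "\<exists>t\<in>r ` T'. inv t \<otimes> a \<in> A \<inter> B" if a: "a \<in> A" for a
  proof -
    obtain t where t: "t \<in> T" "inv t \<otimes> a \<in> B" using T a by blast
    then have t': "t \<in> T'" using a by (auto simp: T'_def)
    have c: "t \<in> carrier G" "a \<in> carrier G" "r t \<in> carrier G"
      using t T a r[OF t'] subgroup.subset[OF assms(2)] by auto
    have "inv (inv t \<otimes> r t) \<otimes> (inv t \<otimes> a) \<in> B"
      using r[OF t'] t assms(3) by (meson subgroup.m_closed subgroup.m_inv_closed)
    moreover have "inv (inv t \<otimes> r t) \<otimes> (inv t \<otimes> a) = inv (r t) \<otimes> a"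
      using c by (simp add: inv_mult_group m_assoc) (simp add: m_assoc[symmetric])
    moreover have "inv (r t) \<otimes> a \<in> A"
      using r[OF t'] a assms(2) by (meson subgroup.m_closed subgroup.m_inv_closed)
    ultimately show ?thesis using t' by auto
  qed
  moreover have "finite (r ` T')" "r ` T' \<subseteq> A" using T r by (auto simp: T'_def)
  ultimately show ?thesis using that by blast
qed

text \<open>Translates of A \<inter> B cover \<open>A\<close>, and translates of A \<inter> B
  \<inter> C cover A \<inter> B. Representatives taken inside the group keep the translated elements
  in it.\<close>

lemma vle_Int:
  assumes "A \<lessapprox> B" "A \<lessapprox> C" "subgroup A G" "subgroup B G" "subgroup C G"
  shows "A \<lessapprox> B \<inter> C"
proof -
  obtain T where T: "finite T" "T \<subseteq> A" "\<And>a. a \<in> A \<Longrightarrow> \<exists>t\<in>T. inv t \<otimes> a \<in> A \<inter> B"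
    using vle_reps[of A B] assms by metis
  have "A \<lessapprox> A \<inter> B" unfolding virtually_le_def using T subgroup.subset[OF assms(3)] by blast
  moreover
  obtain S where S: "finite S" "S \<subseteq> A \<inter> B" "\<And>a. a \<in> A \<inter> B \<Longrightarrow> \<exists>t\<in>S. inv t \<otimes> a \<in> A \<inter> B \<inter> C"
    using vle_reps[OF vle_mono[OF assms(2), of "A \<inter> B" C] subgroups_Inter_pair[OF assms(3,4)] assms(5)]
    by blast
  have "A \<inter> B \<lessapprox> B \<inter> C" unfolding virtually_le_def
    by (intro exI[of _ S] conjI ballI) (use S subgroup.subset[OF assms(3)] in \<open>blast+\<close>)
  ultimately show ?thesis using vle_trans subgroup.subset[OF assms(3)] by blast
qed

lemma vle_Inter_finite:
  assumes "finite I" "subgroup A G" "\<And>i. i \<in> I \<Longrightarrow> A \<lessapprox> B i" "\<And>i. i \<in> I \<Longrightarrow> subgroup (B i) G"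
  shows "A \<lessapprox> carrier G \<inter> (\<Inter>i\<in>I. B i) \<and> subgroup (carrier G \<inter> (\<Inter>i\<in>I. B i)) G"
  using assms(1,3,4)
proof (induction I rule: finite_induct)
  case empty
  then show ?case using subgroup.subset[OF assms(2)] by (auto intro: vle_subset subgroup_self)
next
  case (insert x F)
  have "carrier G \<inter> \<Inter> (B ` insert x F) = B x \<inter> (carrier G \<inter> (\<Inter>i\<in>F. B i))" by auto
  then show ?case using insert assms(2) by (auto intro!: vle_Int subgroups_Inter_pair)
qed

lemma vle_trivial_finite:
  assumes "A \<lessapprox> B" "finite B" "A \<subseteq> carrier G" shows "finite A"
proof -
  obtain T where T: "finite T" "T \<subseteq> carrier G" "\<And>a. a \<in> A \<Longrightarrow> \<exists>t\<in>T. inv t \<otimes> a \<in> B"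
    using assms unfolding virtually_le_def by metis
  have "A \<subseteq> (\<lambda>(t,b). t \<otimes> b) ` (T \<times> B)"
  proof
    fix a assume a: "a \<in> A"
    then obtain t where t: "t \<in> T" "inv t \<otimes> a \<in> B" using T by blast
    then have "a = t \<otimes> (inv t \<otimes> a)" using T assms a by (simp add: m_assoc[symmetric] subset_iff)
    then show "a \<in> (\<lambda>(t,b). t \<otimes> b) ` (T \<times> B)" using t by force
  qed
  then show ?thesis using T assms finite_subset by blast
qed

text \<open>\<open>rcosets\<close> consists of right cosets S a, while \<open>virtually_le\<close>
  covers by left translates t S; inversion exchanges the two.\<close>

lemma finite_index_iff_vle:
  assumes "subgroup H G" "subgroup S G" "S \<subseteq> H"
  shows "finite_index (G\<lparr>carrier := H\<rparr>) S \<longleftrightarrow> H \<lessapprox> S"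
proof
  have HG: "H \<subseteq> carrier G" using assms(1) by (rule subgroup.subset)
  have rc: "rcosets\<^bsub>G\<lparr>carrier := H\<rparr>\<^esub> S = (\<lambda>a. S #> a) ` H"
    by (auto simp: RCOSETS_def r_coset_def)
  {
    assume "finite_index (G\<lparr>carrier := H\<rparr>) S"
    then obtain T where T: "finite T" "T \<subseteq> H" "(\<lambda>a. S #> a) ` H = (\<lambda>a. S #> a) ` T"
      unfolding finite_index_def rc by (metis finite_subset_image order_refl)
    have "\<exists>t\<in>(\<lambda>t. inv t) ` T. inv t \<otimes> a \<in> S" if a: "a \<in> H" for a
    proof -
      have ia: "inv a \<in> H" using a assms(1) by (meson subgroup.m_inv_closed)
      then obtain t where t: "t \<in> T" "S #> inv a = S #> t" using T(3) by (metis image_iff)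
      have "inv a \<in> S #> t" using t(2) ia HG assms(2) by (metis rcos_self subsetD)
      then obtain s where s: "s \<in> S" "inv a = s \<otimes> t" by (auto simp: r_coset_def)
      have c: "s \<in> carrier G" "t \<in> carrier G" "a \<in> carrier G" using s t T a HG assms(2) subgroup.mem_carrier by auto
      then have "a = inv (s \<otimes> t)" using s by (metis inv_inv)
      then have "inv (inv t) \<otimes> a = inv s" using c by (simp add: inv_mult_group m_assoc[symmetric])
      then show ?thesis using t s assms(2) by (auto intro!: bexI[of _ t] subgroup.m_inv_closed)
    qed
    then show "H \<lessapprox> S" unfolding virtually_le_def
      by (intro exI[of _ "(\<lambda>t. inv t) ` T"]) (use T HG in auto)
  }
  assume "H \<lessapprox> S"
  then obtain T where T: "finite T" "T \<subseteq> carrier G" "\<And>a. a \<in> H \<Longrightarrow> \<exists>t\<in>T. inv t \<otimes> a \<in> S"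
    unfolding virtually_le_def by metis
  have "(\<lambda>a. S #> a) ` H \<subseteq> (\<lambda>t. S #> inv t) ` T"
  proof safe
    fix a assume a: "a \<in> H"
    then have ia: "inv a \<in> H" using assms(1) by (meson subgroup.m_inv_closed)
    then obtain t where t: "t \<in> T" "inv t \<otimes> inv a \<in> S" using T by blast
    have c: "t \<in> carrier G" "a \<in> carrier G" using t T a HG by auto
    have "inv (inv t \<otimes> inv a) \<in> S" using t assms(2) by (meson subgroup.m_inv_closed)
    then have at: "a \<otimes> t \<in> S" using c by (simp add: inv_mult_group)
    have "inv t = inv (a \<otimes> t) \<otimes> a" using c by (simp add: inv_mult_group m_assoc)
    moreover have "inv (a \<otimes> t) \<in> S" using at assms(2) by (meson subgroup.m_inv_closed)
    ultimately have "inv t \<in> S #> a" by (auto simp: r_coset_def)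
    then have "S #> a = S #> inv t"
      using c by (intro repr_independence[OF _ _ assms(2)]) auto
    then show "S #> a \<in> (\<lambda>t. S #> inv t) ` T" using t by auto
  qed
  then show "finite_index (G\<lparr>carrier := H\<rparr>) S"
    unfolding finite_index_def rc using T finite_subset by blast
qed

lemma finite_index_iff_vle': "subgroup S G \<Longrightarrow> finite_index G S \<longleftrightarrow> carrier G \<lessapprox> S"
  using finite_index_iff_vle[OF subgroup_self, of S] subgroup.subset[of S G] by simp

section \<open>Conjugates, normality inside a subgroup, normal cores\<close>

abbreviation cj :: "'a \<Rightarrow> 'a set \<Rightarrow> 'a set" where "cj \<equiv> conjugate_set G"

lemma conjugate_set_image:
  "A \<subseteq> carrier G \<Longrightarrow> g \<in> carrier G \<Longrightarrow> cj g A = (\<lambda>x. g \<otimes> x \<otimes> inv g) ` A"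
  unfolding conjugate_set_def l_coset_def r_coset_def by auto

lemma conjugate_mem_iff:
  assumes "A \<subseteq> carrier G" "g \<in> carrier G" "x \<in> carrier G"
  shows "x \<in> cj g A \<longleftrightarrow> inv g \<otimes> x \<otimes> g \<in> A"
proof
  assume "x \<in> cj g A"
  then obtain a where a: "a \<in> A" "x = g \<otimes> a \<otimes> inv g" using conjugate_set_image assms by auto
  then have "inv g \<otimes> x \<otimes> g = a" using assms by (auto simp: m_assoc subset_iff) (simp add: m_assoc[symmetric] subset_iff)
  then show "inv g \<otimes> x \<otimes> g \<in> A" using a by simp
next
  assume i: "inv g \<otimes> x \<otimes> g \<in> A"
  have "x = g \<otimes> (inv g \<otimes> x \<otimes> g) \<otimes> inv g"
    using assms by (simp add: m_assoc) (simp add: m_assoc[symmetric])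
  then show "x \<in> cj g A" using i conjugate_set_image assms by blast
qed

lemma conjugate_subset_carrier: "A \<subseteq> carrier G \<Longrightarrow> g \<in> carrier G \<Longrightarrow> cj g A \<subseteq> carrier G"
  by (auto simp: conjugate_set_image)

lemma conjugate_carrier: "g \<in> carrier G \<Longrightarrow> cj g (carrier G) = carrier G"
  using conjugate_mem_iff[of "carrier G" g] conjugate_subset_carrier[of "carrier G" g] by auto

lemma conjugate_one: "A \<subseteq> carrier G \<Longrightarrow> cj \<one> A = A"
  by (auto simp: conjugate_set_image subset_iff image_iff)

lemma conjugate_conjugate:
  "A \<subseteq> carrier G \<Longrightarrow> g \<in> carrier G \<Longrightarrow> h \<in> carrier G \<Longrightarrow> cj g (cj h A) = cj (g \<otimes> h) A"
proof -
  assume a: "A \<subseteq> carrier G" "g \<in> carrier G" "h \<in> carrier G"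
  have "(\<lambda>x. g \<otimes> x \<otimes> inv g) ` (\<lambda>x. h \<otimes> x \<otimes> inv h) ` A = (\<lambda>x. g \<otimes> h \<otimes> x \<otimes> inv (g \<otimes> h)) ` A"
    unfolding image_image using a by (intro image_cong) (auto simp: inv_mult_group m_assoc subset_iff)
  then show ?thesis using a conjugate_subset_carrier[of A h]
    by (simp add: conjugate_set_image[OF conjugate_subset_carrier] conjugate_set_image)
qed

lemma conjugate_inv_conjugate:
  "A \<subseteq> carrier G \<Longrightarrow> g \<in> carrier G \<Longrightarrow> cj (inv g) (cj g A) = A"
  "A \<subseteq> carrier G \<Longrightarrow> g \<in> carrier G \<Longrightarrow> cj g (cj (inv g) A) = A"
  by (simp_all add: conjugate_conjugate conjugate_one)

lemma conjugate_mono: "A \<subseteq> B \<Longrightarrow> cj g A \<subseteq> cj g B"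
  unfolding conjugate_set_def l_coset_def r_coset_def by auto

lemma conjugate_Int:
  assumes "A \<subseteq> carrier G" "B \<subseteq> carrier G" "g \<in> carrier G" shows "cj g (A \<inter> B) = cj g A \<inter> cj g B"
proof -
  have c: "A \<inter> B \<subseteq> carrier G" using assms by blast
  have "x \<in> cj g (A \<inter> B) \<longleftrightarrow> x \<in> cj g A \<inter> cj g B" if "x \<in> carrier G" for x
    using conjugate_mem_iff[OF c assms(3) that] conjugate_mem_iff[OF assms(1,3) that]
      conjugate_mem_iff[OF assms(2,3) that] by simp
  moreover have "cj g (A \<inter> B) \<subseteq> carrier G" "cj g A \<subseteq> carrier G"
    using c assms conjugate_subset_carrier by blast+
  ultimately show ?thesis by blast
qed

lemma conjugate_subgroup:
  assumes "subgroup A G" "g \<in> carrier G" shows "subgroup (cj g A) G"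
proof -
  have A: "A \<subseteq> carrier G" using assms(1) by (rule subgroup.subset)
  show ?thesis
  proof (rule subgroupI)
    show "cj g A \<noteq> {}" using subgroup.one_closed[OF assms(1)] A assms(2) by (auto simp: conjugate_set_image)
    fix a assume "a \<in> cj g A"
    then obtain x where x: "x \<in> A" "a = g \<otimes> x \<otimes> inv g" using A assms by (auto simp: conjugate_set_image)
    have "inv a = g \<otimes> inv x \<otimes> inv g" using x A assms by (auto simp: inv_mult_group m_assoc subset_iff)
    then show "inv a \<in> cj g A" using A assms x subgroup.m_inv_closed[OF assms(1)] by (auto simp: conjugate_set_image)
    fix b assume "b \<in> cj g A"
    then obtain y where y: "y \<in> A" "b = g \<otimes> y \<otimes> inv g" using A assms by (auto simp: conjugate_set_image)
    have "a \<otimes> b = g \<otimes> (x \<otimes> y) \<otimes> inv g" using x y A assms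
      by (auto simp: m_assoc subset_iff) (simp add: m_assoc[symmetric])
    then show "a \<otimes> b \<in> cj g A" using A assms x y subgroup.m_closed[OF assms(1)] by (auto simp: conjugate_set_image)
  qed (use conjugate_subset_carrier[OF A assms(2)] in blast)
qed

lemma vle_conjugate:
  assumes "A \<lessapprox> B" "A \<subseteq> carrier G" "B \<subseteq> carrier G" "g \<in> carrier G"
  shows "cj g A \<lessapprox> cj g B"
proof -
  obtain T where T: "finite T" "T \<subseteq> carrier G" "\<And>a. a \<in> A \<Longrightarrow> \<exists>t\<in>T. inv t \<otimes> a \<in> B"
    using assms unfolding virtually_le_def by metis
  have "\<exists>t\<in>(\<lambda>t. g \<otimes> t \<otimes> inv g) ` T. inv t \<otimes> a \<in> cj g B" if a: "a \<in> cj g A" for a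
  proof -
    obtain x where x: "x \<in> A" "a = g \<otimes> x \<otimes> inv g" using a assms by (auto simp: conjugate_set_image)
    then obtain t where t: "t \<in> T" "inv t \<otimes> x \<in> B" using T by blast
    have "inv (g \<otimes> t \<otimes> inv g) \<otimes> a = g \<otimes> (inv t \<otimes> x) \<otimes> inv g"
      using x t T assms by (auto simp: m_assoc inv_mult_group subset_iff) (simp add: m_assoc[symmetric])
    then show ?thesis using t assms by (auto simp: conjugate_set_image intro!: bexI[of _ t])
  qed
  then show ?thesis unfolding virtually_le_def
    by (intro exI[of _ "(\<lambda>t. g \<otimes> t \<otimes> inv g) ` T"]) (use T assms in auto)
qed

lemma normal_conjugate: "N \<lhd> G \<Longrightarrow> g \<in> carrier G \<Longrightarrow> cj g N = N"
proof -
  assume N: "N \<lhd> G" and g: "g \<in> carrier G"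
  have c: "N \<subseteq> carrier G" using N by (simp add: normal_imp_subgroup subgroup.subset)
  have "x \<in> cj g N \<longleftrightarrow> x \<in> N" if "x \<in> carrier G" for x
  proof -
    have "x \<in> N" if "inv g \<otimes> x \<otimes> g \<in> N"
    proof -
      have "g \<otimes> (inv g \<otimes> x \<otimes> g) \<otimes> inv g \<in> N" using N that g by (simp add: normal.inv_op_closed2)
      moreover have "g \<otimes> (inv g \<otimes> x \<otimes> g) \<otimes> inv g = x"
        using g \<open>x \<in> carrier G\<close> by (simp add: m_assoc) (simp add: m_assoc[symmetric])
      ultimately show ?thesis by simp
    qed
    then show ?thesis using conjugate_mem_iff[OF c g that] N g by (auto simp: normal.inv_op_closed1)
  qed
  then show "cj g N = N" using c conjugate_subset_carrier[OF c g] by blast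
qed

lemma normal_conjugateI:
  assumes "subgroup N G" "\<And>g. g \<in> carrier G \<Longrightarrow> cj g N \<subseteq> N" shows "N \<lhd> G"
  unfolding normal_inv_iff using assms conjugate_set_image subgroup.subset by blast

text \<open>Translates normality inside \<open>K\<close> into conditions in \<open>G\<close>, so
  that the inverse of the restricted structure disappears from later arguments.\<close>

lemma normal_restrict_iff:
  assumes "subgroup K G"
  shows "H \<lhd> G\<lparr>carrier := K\<rparr> \<longleftrightarrow> subgroup H G \<and> H \<subseteq> K \<and> (\<forall>k\<in>K. \<forall>h\<in>H. k \<otimes> h \<otimes> inv k \<in> H)"
proof -
  interpret K: group "G\<lparr>carrier := K\<rparr>" by (rule subgroup.subgroup_is_group[OF assms group_axioms])
  have "subgroup H (G\<lparr>carrier := K\<rparr>) \<longleftrightarrow> subgroup H G \<and> H \<subseteq> K"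
    using incl_subgroup[OF assms, of H] subgroup_incl[OF _ assms, of H] subgroup.subset[of H "G\<lparr>carrier := K\<rparr>"] by auto
  moreover have "\<forall>k\<in>K. inv\<^bsub>G\<lparr>carrier := K\<rparr>\<^esub> k = inv k" using assms m_inv_consistent by blast
  ultimately show ?thesis unfolding K.normal_inv_iff by auto
qed

lemma normal_restrict_conjugate:
  assumes "subgroup K G" "H \<lhd> G\<lparr>carrier := K\<rparr>" "k \<in> K" shows "cj k H = H"
proof -
  have H: "subgroup H G" "H \<subseteq> K" "\<forall>k\<in>K. \<forall>h\<in>H. k \<otimes> h \<otimes> inv k \<in> H"
    using assms normal_restrict_iff by auto
  have Hc: "H \<subseteq> carrier G" "K \<subseteq> carrier G" using H assms by (auto simp: subgroup.subset)
  have sub: "cj k H \<subseteq> H" if "k \<in> K" for k using that Hc H by (auto simp: conjugate_set_image subset_iff)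
  have "H = cj k (cj (inv k) H)" using conjugate_inv_conjugate Hc assms by (metis subsetD)
  also have "\<dots> \<subseteq> cj k H" using sub[of "inv k"] assms conjugate_mono by (meson subgroup.m_inv_closed)
  finally show ?thesis using sub[OF assms(3)] by blast
qed

text \<open>\<open>B\<close> normalizes itself, so the conjugate of \<open>B\<close> by g depends
  only on the coset g B. Hence finitely many conjugates give the normal core, and their intersection
  still has finite index.\<close>

lemma finite_index_core:
  assumes "subgroup B G" "carrier G \<lessapprox> B"
  obtains N where "N \<lhd> G" "N \<subseteq> B" "carrier G \<lessapprox> N"
    "\<And>g. g \<in> carrier G \<Longrightarrow> N \<subseteq> cj g B" "\<exists>T. finite T \<and> T \<subseteq> carrier G \<and> N = carrier G \<inter> (\<Inter>t\<in>T. cj t B)"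
proof -
  have Bc: "B \<subseteq> carrier G" using assms(1) by (rule subgroup.subset)
  obtain T where T: "finite T" "T \<subseteq> carrier G" "\<And>a. a \<in> carrier G \<Longrightarrow> \<exists>t\<in>T. inv t \<otimes> a \<in> B"
    using assms unfolding virtually_le_def by metis
  define N where "N = carrier G \<inter> (\<Inter>t\<in>T. cj t B)"
  have "carrier G \<lessapprox> cj t B" if "t \<in> T" for t
  proof -
    have "t \<in> carrier G" using that T by blast
    moreover have "cj t (carrier G) = carrier G"
      by (rule conjugate_carrier[OF \<open>t \<in> carrier G\<close>])
    ultimately show ?thesis using vle_conjugate[OF assms(2) _ Bc, of t] by simp
  qed
  then have N: "carrier G \<lessapprox> N" "subgroup N G"
    unfolding N_def using vle_Inter_finite[OF T(1) subgroup_self, of "\<lambda>t. cj t B"]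
      conjugate_subgroup[OF assms(1)] T by blast+
  have conj: "\<exists>t\<in>T. cj g B = cj t B" if g: "g \<in> carrier G" for g
  proof -
    obtain t where t: "t \<in> T" "inv t \<otimes> g \<in> B" using T g by blast
    have tc: "t \<in> carrier G" using t T by blast
    have "B \<lhd> G\<lparr>carrier := B\<rparr>" using assms(1) by (auto simp: normal_restrict_iff subgroup.m_closed subgroup.m_inv_closed)
    then have "cj (inv t \<otimes> g) B = B" using normal_restrict_conjugate[OF assms(1)] t by blast
    then have "cj t (cj (inv t \<otimes> g) B) = cj t B" by simp
    moreover have "t \<otimes> (inv t \<otimes> g) = g" using tc g by (simp add: m_assoc[symmetric])
    ultimately show ?thesis using t Bc tc g conjugate_conjugate[of B t "inv t \<otimes> g"] by auto
  qed
  have sub: "N \<subseteq> cj g B" if "g \<in> carrier G" for g using conj[OF that] by (auto simp: N_def)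
  have "cj g N \<subseteq> N" if g: "g \<in> carrier G" for g
  proof -
    have "cj g N \<subseteq> cj t B" if "t \<in> T" for t
    proof -
      have tc: "t \<in> carrier G" using that T by blast
      have "cj g N \<subseteq> cj g (cj (inv g \<otimes> t) B)" using g tc by (intro conjugate_mono sub) auto
      also have "\<dots> = cj t B" using g tc Bc by (simp add: conjugate_conjugate m_assoc[symmetric])
      finally show ?thesis .
    qed
    moreover have "cj g N \<subseteq> carrier G" using g by (intro conjugate_subset_carrier) (auto simp: N_def)
    ultimately show ?thesis by (auto simp: N_def)
  qed
  then have "N \<lhd> G" using N by (intro normal_conjugateI)
  moreover have "N \<subseteq> B" using sub[OF one_closed] conjugate_one[OF Bc] by simp
  ultimately show ?thesis using that N sub T N_def by blast
qed

section \<open>Subnormal subgroups\<close>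

lemma subnormal_carrier: "subnormal (carrier G) G"
  unfolding subnormal_def by (intro exI[of _ 0] exI[of _ "\<lambda>_. carrier G"]) auto

lemma subnormal_step:
  assumes "subnormal K G" "H \<lhd> G\<lparr>carrier := K\<rparr>" shows "subnormal H G"
proof -
  obtain n and L :: "nat \<Rightarrow> 'a set" where L: "L 0 = carrier G" "L n = K" "\<forall>i<n. L (Suc i) \<lhd> G\<lparr>carrier := L i\<rparr>"
    using assms unfolding subnormal_def by blast
  show ?thesis unfolding subnormal_def
    by (intro exI[of _ "Suc n"] exI[of _ "\<lambda>i. if i \<le> n then L i else H"])
       (use L assms in \<open>auto simp: less_Suc_eq Suc_le_eq\<close>)
qed

text \<open>Replaces the existentially quantified chain in \<open>subnormal\<close> by induction on
  the depth, starting at \<open>G\<close>.\<close>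

lemma subnormal_induct [consumes 1, case_names carrier step]:
  assumes "subnormal H G" "P (carrier G)"
    "\<And>K H. subnormal K G \<Longrightarrow> subgroup K G \<Longrightarrow> P K \<Longrightarrow> H \<lhd> G\<lparr>carrier := K\<rparr> \<Longrightarrow> P H"
  shows "P H"
proof -
  obtain n and L :: "nat \<Rightarrow> 'a set" where L: "L 0 = carrier G" "L n = H" "\<forall>i<n. L (Suc i) \<lhd> G\<lparr>carrier := L i\<rparr>"
    using assms unfolding subnormal_def by blast
  have "i \<le> n \<Longrightarrow> subnormal (L i) G \<and> subgroup (L i) G \<and> P (L i)" for i
  proof (induction i)
    case 0
    show ?case unfolding L(1) using assms(2) subnormal_carrier subgroup_self by blast
  next
    case (Suc i)
    then have i: "subnormal (L i) G" "subgroup (L i) G" "P (L i)" "L (Suc i) \<lhd> G\<lparr>carrier := L i\<rparr>" using L by auto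
    then show ?case using subnormal_step assms(3) normal_restrict_iff by blast
  qed
  then show ?thesis using L by blast
qed

lemma subnormal_subgroup: "subnormal H G \<Longrightarrow> subgroup H G"
  by (induction rule: subnormal_induct) (auto simp: subgroup_self normal_restrict_iff)

lemma normal_subnormal: "N \<lhd> G \<Longrightarrow> subnormal N G"
  using subnormal_step[OF subnormal_carrier, of N] by simp

text \<open>Intersecting each term of a chain for \<open>H\<close> with \<open>K\<close> gives a
  chain from \<open>K\<close> down to H \<inter> K, which prolongs a chain for
  \<open>K\<close>.\<close>

lemma subnormal_Int: "subnormal H G \<Longrightarrow> subnormal K G \<Longrightarrow> subnormal (H \<inter> K) G"
proof (induction rule: subnormal_induct)
  case carrier
  then show ?case by (simp add: Int_absorb1 subnormal_subgroup subgroup.subset)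
next
  case (step L H)
  then have "subnormal (L \<inter> K) G" "subgroup (L \<inter> K) G" "subgroup K G" using subnormal_subgroup by auto
  moreover have "H \<inter> K \<lhd> G\<lparr>carrier := L \<inter> K\<rparr>"
    using \<open>H \<lhd> G\<lparr>carrier := L\<rparr>\<close> calculation(3) unfolding normal_restrict_iff[OF \<open>subgroup L G\<close>] normal_restrict_iff[OF calculation(2)]
    by (auto simp: subgroups_Inter_pair subgroup.m_closed subgroup.m_inv_closed)
  ultimately show ?case using subnormal_step by blast
qed

lemma subnormal_conjugate:
  assumes g: "g \<in> carrier G" shows "subnormal H G \<Longrightarrow> subnormal (cj g H) G"
proof (induction rule: subnormal_induct)
  case carrier
  show ?case by (simp add: conjugate_carrier[OF g] subnormal_carrier)
next
  case (step L H)
  then have s: "subgroup H G" "H \<subseteq> L" "\<forall>k\<in>L. \<forall>h\<in>H. k \<otimes> h \<otimes> inv k \<in> H" by (auto simp: normal_restrict_iff)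
  then have c: "H \<subseteq> carrier G" "L \<subseteq> carrier G" using step by (auto simp: subgroup.subset)
  have "k \<otimes> h \<otimes> inv k \<in> cj g H" if kh: "k \<in> cj g L" "h \<in> cj g H" for k h
  proof -
    obtain k' h' where k': "k' \<in> L" "k = g \<otimes> k' \<otimes> inv g" "h' \<in> H" "h = g \<otimes> h' \<otimes> inv g"
      using kh c g by (auto simp: conjugate_set_image)
    have "k \<otimes> h \<otimes> inv k = g \<otimes> (k' \<otimes> h' \<otimes> inv k') \<otimes> inv g"
      using k' c g by (auto simp: m_assoc inv_mult_group subset_iff) (simp add: m_assoc[symmetric])
    then show ?thesis using k' s c g by (auto simp: conjugate_set_image)
  qed
  then have "cj g H \<lhd> G\<lparr>carrier := cj g L\<rparr>"
    using s step g by (auto simp: normal_restrict_iff conjugate_subgroup dest: subsetD[OF conjugate_mono])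
  then show ?case using step subnormal_step by blast
qed

end

section \<open>Invariant differences inside the bidual of the whole group\<close>

text \<open>For a subgroup this describes, without mention of \<open>bidual_embed\<close>, the
  functionals that come from its bidual: they see a function only through its restriction.\<close>

definition supported_on :: "('a, 'b) monoid_scheme \<Rightarrow> 'a set \<Rightarrow> 'a bidual_elt \<Rightarrow> bool" where
  "supported_on G S \<Gamma> \<longleftrightarrow>
     (\<forall>u v. bdd_fun G u \<longrightarrow> bdd_fun G v \<longrightarrow> (\<forall>t\<in>S. u t = v t) \<longrightarrow> ev G \<Gamma> u = ev G \<Gamma> v)"

definition invariant_under :: "('a, 'b) monoid_scheme \<Rightarrow> 'a set \<Rightarrow> 'a bidual_elt \<Rightarrow> bool" where
  "invariant_under G S \<Gamma> \<longleftrightarrow>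
     (\<forall>s\<in>S. \<forall>u. bdd_fun G u \<longrightarrow> ev G \<Gamma> (\<lambda>x. u (s \<otimes>\<^bsub>G\<^esub> x)) = ev G \<Gamma> u)"

text \<open>The image of \<open>invariant_differences H\<close> in the bidual of \<open>G\<close>.\<close>

definition differences_on :: "('a, 'b) monoid_scheme \<Rightarrow> 'a set \<Rightarrow> 'a bidual_elt set" where
  "differences_on G H =
     {\<Gamma> \<in> l1_bidual G. supported_on G H \<Gamma> \<and> invariant_under G H \<Gamma> \<and> ev G \<Gamma> (\<lambda>t. 1) = 0}"

context group begin

lemma differences_onD:
  assumes "\<Gamma> \<in> differences_on G H"
  shows "\<Gamma> \<in> l1_bidual G"
    and "\<And>u v. bdd_fun G u \<Longrightarrow> bdd_fun G v \<Longrightarrow> (\<And>t. t \<in> H \<Longrightarrow> u t = v t) \<Longrightarrow> ev G \<Gamma> u = ev G \<Gamma> v"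
    and "\<And>s u. s \<in> H \<Longrightarrow> bdd_fun G u \<Longrightarrow> ev G \<Gamma> (\<lambda>x. u (s \<otimes> x)) = ev G \<Gamma> u"
    and "ev G \<Gamma> (\<lambda>t. 1) = 0"
  using assms unfolding differences_on_def supported_on_def invariant_under_def by blast+

lemma l1_bidual_ext':
  assumes "\<Phi> \<in> l1_bidual G" "\<And>lam. lam \<notin> l1_dual G \<Longrightarrow> \<Psi> lam = 0" "\<And>u. bdd_fun G u \<Longrightarrow> ev G \<Psi> u = ev G \<Phi> u"
  shows "\<Psi> = \<Phi>"
proof
  fix lam
  show "\<Psi> lam = \<Phi> lam"
  proof (cases "lam \<in> l1_dual G")
    case True
    then show ?thesis using assms(3)[OF l1_dual_bdd_fun[OF True]] l1_dual_eq_functional_of[OF True]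
      by (simp add: ev_def)
  next
    case False
    then show ?thesis using assms by (simp add: l1_bidual_def dual_def)
  qed
qed

lemma l1_restrict_subset: "H \<subseteq> carrier G \<Longrightarrow> a \<in> l1 (G\<lparr>carrier := H\<rparr>) \<Longrightarrow> a \<in> l1 G"
proof -
  assume H: "H \<subseteq> carrier G" and a: "a \<in> l1 (G\<lparr>carrier := H\<rparr>)"
  have "(\<lambda>t. cmod (a t)) summable_on carrier G \<longleftrightarrow> (\<lambda>t. cmod (a t)) summable_on H"
    by (rule summable_on_cong_neutral) (use H a in \<open>auto simp: l1_def\<close>)
  then show "a \<in> l1 G" using a H by (auto simp: l1_def)
qed

lemma bdd_fun_restrict: "H \<subseteq> carrier G \<Longrightarrow> bdd_fun G u \<Longrightarrow> bdd_fun (G\<lparr>carrier := H\<rparr>) u"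
  unfolding bdd_fun_def by auto

lemma bdd_fun_extend: "bdd_fun (G\<lparr>carrier := H\<rparr>) u \<Longrightarrow> bdd_fun G (\<lambda>t. if t \<in> H then u t else 0)"
proof -
  assume "bdd_fun (G\<lparr>carrier := H\<rparr>) u"
  then obtain C where "C \<ge> 0" "\<And>t. t \<in> H \<Longrightarrow> cmod (u t) \<le> C" by (auto elim!: bdd_fun_bound)
  then show ?thesis by (intro bdd_funI[of _ _ C]) auto
qed

lemma dual_restrict_functional_of:
  assumes "H \<subseteq> carrier G"
  shows "dual_restrict G H (functional_of G u) = functional_of (G\<lparr>carrier := H\<rparr>) u"
proof
  fix a
  show "dual_restrict G H (functional_of G u) a = functional_of (G\<lparr>carrier := H\<rparr>) u a"
  proof (cases "a \<in> l1 (G\<lparr>carrier := H\<rparr>)")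
    case True
    then have "infsum (\<lambda>t. a t * u t) (carrier G) = infsum (\<lambda>t. a t * u t) H"
      by (intro infsum_cong_neutral) (use assms in \<open>auto simp: l1_def\<close>)
    then show ?thesis using True l1_restrict_subset[OF assms True] by (simp add: dual_restrict_def functional_of_def)
  qed (simp add: dual_restrict_def functional_of_def)
qed

lemma ev_bidual_embed:
  assumes "H \<subseteq> carrier G" "bdd_fun G u"
  shows "ev G (bidual_embed G H \<Gamma>) u = ev (G\<lparr>carrier := H\<rparr>) \<Gamma> u"
  using assms by (simp add: ev_def bidual_embed_def functional_of_in_l1_dual dual_restrict_functional_of)

lemma bidual_embed_closed:
  assumes "H \<subseteq> carrier G" "\<Gamma> \<in> l1_bidual (G\<lparr>carrier := H\<rparr>)"
  shows "bidual_embed G H \<Gamma> \<in> l1_bidual G"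
proof -
  let ?K = "G\<lparr>carrier := H\<rparr>"
  obtain K where K: "K \<ge> 0" "\<And>u C. (\<And>t. t \<in> carrier ?K \<Longrightarrow> cmod (u t) \<le> C) \<Longrightarrow> C \<ge> 0 \<Longrightarrow> cmod (ev ?K \<Gamma> u) \<le> K * C"
    using ev_bound[OF assms(2)] by metis
  have 3: "cmod (ev ?K \<Gamma> u) \<le> K * C" if "\<And>t. t \<in> carrier G \<Longrightarrow> cmod (u t) \<le> C" "C \<ge> 0" for u C
    using that assms(1) by (intro K(2)) auto
  note r = bdd_fun_restrict[OF assms(1)]
  have b: "bidual_of G (ev ?K \<Gamma>) \<in> l1_bidual G"
    using ev_add[OF assms(2) r r] ev_scale[OF assms(2) r] 3 by (rule bidual_of(1)[OF carrier_nonempty]) auto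
  have e: "ev G (bidual_of G (ev ?K \<Gamma>)) u = ev ?K \<Gamma> u" if "bdd_fun G u" for u
    using ev_add[OF assms(2) r r] ev_scale[OF assms(2) r] 3 that by (rule bidual_of(2)[OF carrier_nonempty]) auto
  have "bidual_embed G H \<Gamma> = bidual_of G (ev ?K \<Gamma>)"
    by (rule l1_bidual_ext'[OF b]) (auto simp: bidual_embed_def e ev_bidual_embed[OF assms(1), unfolded bidual_embed_def])
  then show ?thesis using b by simp
qed

text \<open>A functional supported on \<open>H\<close> is pulled back by extending functions on
  \<open>H\<close> by 0; the support condition makes the choice of extension irrelevant. From here
  on all differences are elements of the bidual of \<open>G\<close>.\<close>

lemma bidual_embed_invariant_differences:
  assumes "subgroup H G"
  shows "bidual_embed G H ` invariant_differences (G\<lparr>carrier := H\<rparr>) = differences_on G H"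
proof -
  let ?K = "G\<lparr>carrier := H\<rparr>"
  interpret K: group ?K by (rule subgroup.subgroup_is_group[OF assms group_axioms])
  have Hc: "H \<subseteq> carrier G" by (rule subgroup.subset[OF assms])
  note emb = ev_bidual_embed[OF Hc] and r = bdd_fun_restrict[OF Hc]
  show ?thesis
  proof (intro equalityI subsetI)
    fix \<Gamma>' assume "\<Gamma>' \<in> bidual_embed G H ` invariant_differences ?K"
    then obtain \<Gamma> where \<Gamma>: "\<Gamma>' = bidual_embed G H \<Gamma>" "\<Gamma> \<in> l1_bidual ?K"
      "\<And>s. s \<in> H \<Longrightarrow> arens ?K (to_bidual ?K (point_mass s)) \<Gamma> = \<Gamma>" "\<Gamma> (one_functional ?K) = 0"
      unfolding invariant_differences_def by auto
    have "ev G \<Gamma>' u = ev G \<Gamma>' v" if "bdd_fun G u" "bdd_fun G v" "\<forall>t\<in>H. u t = v t" for u v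
      using ev_cong[of ?K u v \<Gamma>] that by (simp add: \<Gamma>(1) emb)
    moreover have "ev G \<Gamma>' (\<lambda>x. u (s \<otimes> x)) = ev G \<Gamma>' u" if "s \<in> H" "bdd_fun G u" for s u
      using K.ev_translate[of s \<Gamma> u] \<Gamma>(3)[OF that(1)] \<Gamma>(2) that Hc bdd_fun_left[of u s]
      by (auto simp: \<Gamma>(1) emb r)
    moreover have "ev G \<Gamma>' (\<lambda>t. 1) = 0"
      using \<Gamma>(4) by (simp add: \<Gamma>(1) emb) (simp add: ev_def one_functional_def)
    moreover have "\<Gamma>' \<in> l1_bidual G" using \<Gamma>(1) bidual_embed_closed[OF Hc \<Gamma>(2)] by simp
    ultimately show "\<Gamma>' \<in> differences_on G H"
      unfolding differences_on_def supported_on_def invariant_under_def by blast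
  next
    fix \<Gamma>' assume g: "\<Gamma>' \<in> differences_on G H"
    let ?x = "\<lambda>u t. if t \<in> H then u t else 0"
    let ?f = "\<lambda>u. ev G \<Gamma>' (?x u)"
    note D = differences_onD[OF g]
    obtain K where K: "K \<ge> 0" "\<And>u C. (\<And>t. t \<in> carrier G \<Longrightarrow> cmod (u t) \<le> C) \<Longrightarrow> C \<ge> 0 \<Longrightarrow> cmod (ev G \<Gamma>' u) \<le> K * C"
      using ev_bound[OF D(1)] by metis
    have 1: "?f (\<lambda>t. u t + v t) = ?f u + ?f v" if "bdd_fun ?K u" "bdd_fun ?K v" for u v
      unfolding ev_add[OF D(1) bdd_fun_extend[OF that(1)] bdd_fun_extend[OF that(2)], symmetric]
      by (rule ev_cong) auto
    have 2: "?f (\<lambda>t. c * u t) = c * ?f u" if "bdd_fun ?K u" for c u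
      unfolding ev_scale[OF D(1) bdd_fun_extend[OF that], symmetric]
      by (rule ev_cong) auto
    have 3: "cmod (?f u) \<le> K * C" if "\<And>t. t \<in> carrier ?K \<Longrightarrow> cmod (u t) \<le> C" "C \<ge> 0" for u C
      using that by (intro K(2)) auto
    let ?\<Gamma> = "bidual_of ?K ?f"
    have b: "?\<Gamma> \<in> l1_bidual ?K" by (rule bidual_of(1)[OF K.carrier_nonempty 1 2 3])
    have e: "ev ?K ?\<Gamma> u = ?f u" if "bdd_fun ?K u" for u by (rule bidual_of(2)[OF K.carrier_nonempty 1 2 3 that])
    have xx: "?f u = ev G \<Gamma>' u" if "bdd_fun G u" for u
      by (rule D(2)) (use that bdd_fun_extend[OF r] in auto)
    have "\<Gamma>' = bidual_embed G H ?\<Gamma>"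
      by (rule l1_bidual_ext[OF D(1) bidual_embed_closed[OF Hc b]]) (simp add: emb e r xx)
    moreover have "arens ?K (to_bidual ?K (point_mass s)) ?\<Gamma> = ?\<Gamma>" if s: "s \<in> H" for s
    proof (rule l1_bidual_ext)
      show "arens ?K (to_bidual ?K (point_mass s)) ?\<Gamma> \<in> l1_bidual ?K"
        using s b K.to_bidual_point_mass(1) by (intro K.arens_closed) auto
      fix u assume u: "bdd_fun ?K u"
      have bl: "bdd_fun G (\<lambda>t. if t \<in> H then u (s \<otimes> t) else 0)"
        using bdd_fun_extend[OF K.bdd_fun_left[OF u, of s]] s by (simp cong: if_cong)
      have "ev ?K (arens ?K (to_bidual ?K (point_mass s)) ?\<Gamma>) u = ?f (\<lambda>x. u (s \<otimes> x))"
        using s b u K.ev_translate[of s ?\<Gamma> u] K.bdd_fun_left[OF u, of s] by (simp add: e)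
      also have "\<dots> = ev G \<Gamma>' (\<lambda>x. ?x u (s \<otimes> x))"
        using bl bdd_fun_left[OF bdd_fun_extend[OF u], of s] s Hc
        by (intro D(2)) (auto intro: subgroup.m_closed[OF assms])
      also have "\<dots> = ?f u" using D(3)[OF s bdd_fun_extend[OF u]] by simp
      finally show "ev ?K (arens ?K (to_bidual ?K (point_mass s)) ?\<Gamma>) u = ev ?K ?\<Gamma> u" by (simp add: e u)
    qed (rule b)
    moreover have "?\<Gamma> (one_functional ?K) = 0"
      using e[of "\<lambda>t. 1"] xx[of "\<lambda>t. 1"] D(4) by (simp add: ev_def[of ?K] one_functional_def)
    ultimately show "\<Gamma>' \<in> bidual_embed G H ` invariant_differences ?K"
      using b unfolding invariant_differences_def by auto
  qed
qed

section \<open>From products of differences to products in their span\<close>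

definition sn_differences :: "'a bidual_elt set" where
  "sn_differences = (\<Union>H\<in>{H. subnormal H G}. differences_on G H)"

lemma sn_differences_closed: "\<Gamma> \<in> sn_differences \<Longrightarrow> \<Gamma> \<in> l1_bidual G"
  unfolding sn_differences_def using differences_onD(1) by auto

lemma A_sn_eq: "A_sn G = module.span cscale {list_product (arens G) xs |xs. xs \<noteq> [] \<and> set xs \<subseteq> sn_differences}"
proof -
  have "(\<forall>\<Gamma>\<in>set xs. \<exists>H. subnormal H G \<and> \<Gamma> \<in> bidual_embed G H ` invariant_differences (G\<lparr>carrier := H\<rparr>)) \<longleftrightarrow>
        set xs \<subseteq> sn_differences" for xs
    unfolding sn_differences_def using bidual_embed_invariant_differences[OF subnormal_subgroup]
    by (simp add: subset_iff Ball_def cong: conj_cong)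
  then show ?thesis unfolding A_sn_def by simp
qed

lemma cscale_module: "Modules.module (cscale :: complex \<Rightarrow> ('x \<Rightarrow> complex) \<Rightarrow> _)"
  by unfold_locales (auto simp: cscale_def algebra_simps)

lemma list_product_Cons: "xs \<noteq> [] \<Longrightarrow> list_product mul (x # xs) = mul x (list_product mul xs)"
  by (cases xs) auto

lemma list_product_closed:
  "xs \<noteq> [] \<Longrightarrow> set xs \<subseteq> l1_bidual G \<Longrightarrow> list_product (arens G) xs \<in> l1_bidual G"
  by (induction xs rule: list_nonempty_induct) (auto simp: list_product_Cons arens_closed)

lemma list_product_append:
  assumes "xs \<noteq> []" "ys \<noteq> []" "set xs \<subseteq> l1_bidual G" "set ys \<subseteq> l1_bidual G"
  shows "list_product (arens G) (xs @ ys) = arens G (list_product (arens G) xs) (list_product (arens G) ys)"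
  using assms(1,3)
  by (induction xs rule: list_nonempty_induct)
    (use assms in \<open>auto simp: list_product_Cons arens_assoc list_product_closed\<close>)

lemma list_product_vanish_longer:
  assumes "\<And>xs. length xs = n \<Longrightarrow> set xs \<subseteq> S \<Longrightarrow> list_product (arens G) xs = 0" "n \<ge> 1" "S \<subseteq> l1_bidual G"
  shows "length xs \<ge> n \<Longrightarrow> set xs \<subseteq> S \<Longrightarrow> list_product (arens G) xs = 0"
proof (induction xs)
  case (Cons x xs)
  show ?case
  proof (cases "length (x # xs) = n")
    case False
    then have "list_product (arens G) xs = 0" "xs \<noteq> []" using Cons assms(2) by auto
    then show ?thesis using Cons.prems arens_zero_right[of x] assms(3) by (simp add: list_product_Cons subset_iff)
  qed (use assms Cons in auto)
qed (use assms in auto)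

text \<open>Bilinearity is used one factor at a time: first the admissible right factors, then the
  admissible left factors, form a subspace. The right ones are kept inside
  \<open>l1_bidual G\<close>, where \<open>arens_add_right\<close> applies.\<close>

lemma span_product:
  assumes A: "A \<subseteq> l1_bidual G" and B: "B \<subseteq> l1_bidual G"
    and C: "\<And>x y. x \<in> A \<Longrightarrow> y \<in> B \<Longrightarrow> arens G x y \<in> C"
    and a: "a \<in> module.span cscale A" and b: "b \<in> module.span cscale B"
  shows "arens G a b \<in> module.span cscale C" "b \<in> l1_bidual G"
proof -
  interpret m: Modules.module "cscale :: complex \<Rightarrow> 'a bidual_elt \<Rightarrow> _" by (rule cscale_module)
  have sub: "m.subspace (l1_bidual G)"
    by (auto intro!: m.subspaceI l1_bidual_add l1_bidual_cscale l1_bidual_zero)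
  have bl: "m.span B \<subseteq> l1_bidual G" "m.span A \<subseteq> l1_bidual G" using m.span_minimal[OF _ sub] A B by auto
  then show "b \<in> l1_bidual G" using b by blast
  have 1: "arens G x b \<in> m.span C" if x: "x \<in> A" for x
  proof -
    have xl: "x \<in> l1_bidual G" using A x by blast
    have "m.subspace {b \<in> l1_bidual G. arens G x b \<in> m.span C}"
      by (rule m.subspaceI) (use xl in \<open>auto simp: arens_add_right arens_cscale_right arens_zero_right m.span_zero
        m.span_add m.span_scale l1_bidual_add l1_bidual_cscale l1_bidual_zero\<close>)
    then have "m.span B \<subseteq> {b \<in> l1_bidual G. arens G x b \<in> m.span C}"
      by (rule m.span_minimal[rotated]) (use x B C in \<open>auto intro: m.span_base\<close>)
    then show ?thesis using b by blast
  qed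
  have "m.subspace {a. arens G a b \<in> m.span C}"
    by (rule m.subspaceI) (auto simp: arens_add_left arens_cscale_left arens_zero_left m.span_zero m.span_add m.span_scale)
  then have "m.span A \<subseteq> {a. arens G a b \<in> m.span C}" by (rule m.span_minimal[rotated]) (use 1 in auto)
  then show "arens G a b \<in> m.span C" using a by blast
qed

text \<open>Elements of \<open>A_sn G\<close> are combinations of nonempty words in differences, so
  an n-fold product is a combination of words of length at least n. Such words end in n letters
  whose product is 0.\<close>

lemma products_vanish_A_snI:
  assumes van: "\<And>xs. length xs = n \<Longrightarrow> set xs \<subseteq> sn_differences \<Longrightarrow> list_product (arens G) xs = 0" and n: "n \<ge> 1"
  shows "products_vanish (arens G) (A_sn G) n"
  unfolding products_vanish_def
proof (intro allI impI, elim conjE)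
  interpret m: Modules.module "cscale :: complex \<Rightarrow> 'a bidual_elt \<Rightarrow> _" by (rule cscale_module)
  let ?Q = "\<lambda>k. {list_product (arens G) xs |xs. xs \<noteq> [] \<and> length xs \<ge> k \<and> set xs \<subseteq> sn_differences}"
  have sl: "sn_differences \<subseteq> l1_bidual G" using sn_differences_closed by blast
  have Ql: "?Q k \<subseteq> l1_bidual G" for k using list_product_closed sl by blast
  have A: "A_sn G = m.span (?Q 1)" unfolding A_sn_eq
    by (rule arg_cong[where f = m.span]) (auto simp: Suc_le_eq)
  have claim: "ys \<noteq> [] \<Longrightarrow> set ys \<subseteq> A_sn G \<Longrightarrow> list_product (arens G) ys \<in> m.span (?Q (length ys))" for ys
  proof (induction ys rule: list_nonempty_induct)
    case (single x)
    then show ?case by (simp add: A)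
  next
    case (cons x xs)
    have "arens G x (list_product (arens G) xs) \<in> m.span (?Q (Suc (length xs)))"
    proof (rule span_product(1)[OF Ql Ql])
      show "x \<in> m.span (?Q 1)" "list_product (arens G) xs \<in> m.span (?Q (length xs))" using cons A by auto
      fix p q assume "p \<in> ?Q 1" "q \<in> ?Q (length xs)"
      then obtain ps qs where "p = list_product (arens G) ps" "q = list_product (arens G) qs" "ps \<noteq> []" "qs \<noteq> []"
        "length qs \<ge> length xs" "set ps \<subseteq> sn_differences" "set qs \<subseteq> sn_differences" by auto
      moreover have "length ps \<ge> 1" using \<open>ps \<noteq> []\<close> by (cases ps) auto
      moreover have "set ps \<subseteq> l1_bidual G" "set qs \<subseteq> l1_bidual G" using calculation sl by blast+
      ultimately have "arens G p q = list_product (arens G) (ps @ qs)" "length (ps @ qs) \<ge> Suc (length xs)"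
        "ps @ qs \<noteq> []" "set (ps @ qs) \<subseteq> sn_differences" by (simp_all add: list_product_append)
      then show "arens G p q \<in> ?Q (Suc (length xs))" by blast
    qed
    then show ?case using cons by (simp add: list_product_Cons)
  qed
  fix ys assume ys: "length ys = n" "set ys \<subseteq> A_sn G"
  then have "ys \<noteq> []" using n by auto
  then have "list_product (arens G) ys \<in> m.span (?Q n)" using claim ys by blast
  moreover have "?Q n \<subseteq> {0}" using list_product_vanish_longer[OF van n sl] by auto
  moreover from this have "m.span (?Q n) \<subseteq> {0}" by (rule m.span_minimal) (rule m.subspace_single_0)
  ultimately show "list_product (arens G) ys = 0" by blast
qed

text \<open>One-letter words show that the differences themselves belong to
  \<open>A_sn G\<close>.\<close>

lemma products_vanish_A_snD:
  assumes "products_vanish (arens G) (A_sn G) n" "length xs = n" "set xs \<subseteq> sn_differences"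
  shows "list_product (arens G) xs = 0"
proof -
  interpret m: Modules.module "cscale :: complex \<Rightarrow> 'a bidual_elt \<Rightarrow> _" by (rule cscale_module)
  have "sn_differences \<subseteq> A_sn G"
    unfolding A_sn_eq by (intro subsetI m.span_base) (auto intro!: exI[of _ "[_]"])
  then have "set xs \<subseteq> A_sn G" using assms(3) by simp
  with assms(1,2) show ?thesis unfolding products_vanish_def by simp
qed

end

section \<open>Vanishing and nonvanishing products\<close>

context group begin

lemma subgroup_inv_mult: "subgroup H G \<Longrightarrow> a \<in> H \<Longrightarrow> b \<in> H \<Longrightarrow> inv a \<otimes> b \<in> H"
  by (simp add: subgroup.m_closed subgroup.m_inv_closed)

lemma inv_mult_cancel:
  "a \<in> carrier G \<Longrightarrow> b \<in> carrier G \<Longrightarrow> inv a \<otimes> (a \<otimes> b) = b"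
  "a \<in> carrier G \<Longrightarrow> b \<in> carrier G \<Longrightarrow> a \<otimes> (inv a \<otimes> b) = b"
  by (simp_all add: m_assoc[symmetric])

text \<open>The representative is chosen by a predicate that depends only on the coset, so elements
  of one coset receive the same one.\<close>

lemma vle_transversal:
  assumes "H \<lessapprox> S" "subgroup H G" "subgroup S G" "S \<subseteq> H"
  obtains R where "finite R" "R \<subseteq> H" "\<forall>x\<in>H. \<exists>!t. t \<in> R \<and> inv t \<otimes> x \<in> S"
proof -
  obtain T where T: "finite T" "T \<subseteq> H" "\<And>a. a \<in> H \<Longrightarrow> \<exists>t\<in>T. inv t \<otimes> a \<in> S"
    using vle_reps[OF assms(1-3)] assms(4) by (metis Int_absorb1)
  define r where "r x = (SOME t. t \<in> T \<and> inv t \<otimes> x \<in> S)" for x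
  have r: "r x \<in> T \<and> inv (r x) \<otimes> x \<in> S" if "x \<in> H" for x
    unfolding r_def by (rule someI_ex) (use T(3)[OF that] in blast)
  have Hc: "H \<subseteq> carrier G" by (rule subgroup.subset[OF assms(2)])
  have eq: "r x = r y" if xy: "x \<in> H" "y \<in> H" "inv x \<otimes> y \<in> S" for x y
  proof -
    have "inv t \<otimes> x \<in> S \<longleftrightarrow> inv t \<otimes> y \<in> S" if t: "t \<in> T" for t
    proof -
      have c: "t \<in> carrier G" "x \<in> carrier G" "y \<in> carrier G" using t T xy Hc by auto
      have "inv t \<otimes> y = (inv t \<otimes> x) \<otimes> (inv x \<otimes> y)" "inv t \<otimes> x = (inv t \<otimes> y) \<otimes> inv (inv x \<otimes> y)"
        using c by (simp_all add: m_assoc inv_mult_group inv_mult_cancel)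
      then show ?thesis using xy(3) assms(3) by (metis subgroup.m_closed subgroup.m_inv_closed)
    qed
    then have "(\<lambda>t. t \<in> T \<and> inv t \<otimes> x \<in> S) = (\<lambda>t. t \<in> T \<and> inv t \<otimes> y \<in> S)" by blast
    then show ?thesis by (simp add: r_def)
  qed
  show ?thesis
  proof (rule that[of "r ` H"])
    show "finite (r ` H)" by (rule finite_subset[OF _ T(1)]) (use r in auto)
    show "r ` H \<subseteq> H" using r T by auto
    show "\<forall>x\<in>H. \<exists>!t. t \<in> r ` H \<and> inv t \<otimes> x \<in> S"
    proof
    fix x assume x: "x \<in> H"
    show "\<exists>!t. t \<in> r ` H \<and> inv t \<otimes> x \<in> S"
    proof (rule ex1I[of _ "r x"])
      show "r x \<in> r ` H \<and> inv (r x) \<otimes> x \<in> S" using r x by auto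
      fix t assume t: "t \<in> r ` H \<and> inv t \<otimes> x \<in> S"
      then obtain y where y: "y \<in> H" "t = r y" by blast
      have "t \<in> H" using t r T by auto
      have "r t = r x" using t x \<open>t \<in> H\<close> by (intro eq) auto
      moreover have "r t = r y" using r[OF y(1)] y \<open>t \<in> H\<close> by (intro eq) auto
      ultimately show "t = r x" using y by simp
    qed
    qed
  qed
qed

lemma sum_transversal:
  assumes "finite R" "\<exists>!t. t \<in> R \<and> P t"
  shows "(\<Sum>t\<in>R. if P t then f t else (0::complex)) = f (THE t. t \<in> R \<and> P t)"
proof -
  obtain t where t: "t \<in> R" "P t" "\<And>s. s \<in> R \<Longrightarrow> P s \<Longrightarrow> s = t" using assms(2) by blast
  have "(THE t. t \<in> R \<and> P t) = t" by (rule the_equality) (use t in blast)+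
  moreover have "(\<Sum>s\<in>R. if P s then f s else 0) = (\<Sum>s\<in>R. if s = t then f s else 0)"
    by (rule sum.cong[OF refl]) (use t(2) in \<open>auto dest: t(3)\<close>)
  ultimately show ?thesis using assms(1) t(1) by simp
qed

text \<open>On \<open>H\<close> the function is a finite combination of indicators of cosets of
  \<open>S\<close>. Invariance gives all these indicators a common value c, and evaluation at the
  constant 1 gives \<open>card R\<close> times c = 0.\<close>

lemma ev_difference_coset_function:
  assumes \<Gamma>: "\<Gamma> \<in> differences_on G H" and H: "subgroup H G" and S: "subgroup S G" "S \<subseteq> H" "H \<lessapprox> S"
    and w: "bdd_fun G w" "\<And>s m. s \<in> H \<Longrightarrow> m \<in> S \<Longrightarrow> w (s \<otimes> m) = w s"
  shows "ev G \<Gamma> w = 0"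
proof -
  obtain R where R': "finite R" "R \<subseteq> H" "\<forall>x\<in>H. \<exists>!t. t \<in> R \<and> inv t \<otimes> x \<in> S"
    using vle_transversal[OF S(3) H S(1,2)] .
  note R = R'(1,2) R'(3)[rule_format]
  note D = differences_onD[OF \<Gamma>]
  have Hc: "H \<subseteq> carrier G" by (rule subgroup.subset[OF H])
  let ?i = "\<lambda>t x. if inv t \<otimes> x \<in> S then 1 else (0::complex)"
  have key: "ev G \<Gamma> w = (\<Sum>t\<in>R. w t) * ev G \<Gamma> (?i \<one>)"
    if w: "bdd_fun G w" "\<And>s m. s \<in> H \<Longrightarrow> m \<in> S \<Longrightarrow> w (s \<otimes> m) = w s" for w
  proof -
    have "w x = (\<Sum>t\<in>R. w t * ?i t x)" if x: "x \<in> H" for x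
    proof -
      have "(\<Sum>t\<in>R. w t * ?i t x) = (\<Sum>t\<in>R. if inv t \<otimes> x \<in> S then w t else 0)"
        by (rule sum.cong) auto
      also have "\<dots> = w (THE t. t \<in> R \<and> inv t \<otimes> x \<in> S)" by (rule sum_transversal[OF R(1) R(3)[OF x]])
      also have "\<dots> = w x"
      proof -
        let ?t = "THE t. t \<in> R \<and> inv t \<otimes> x \<in> S"
        have t: "?t \<in> R \<and> inv ?t \<otimes> x \<in> S" by (rule theI'[OF R(3)[OF x]])
        then have "w (?t \<otimes> (inv ?t \<otimes> x)) = w ?t" using R by (intro w(2)) auto
        moreover have "?t \<otimes> (inv ?t \<otimes> x) = x" using t R Hc x by (intro inv_mult_cancel) auto
        ultimately show ?thesis by simp
      qed
      finally show ?thesis by simp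
    qed
    then have "ev G \<Gamma> w = ev G \<Gamma> (\<lambda>x. \<Sum>t\<in>R. w t * ?i t x)"
      by (intro D(2)) (use w in \<open>auto intro!: bdd_fun_sum bdd_fun_mult\<close>)
    also have "\<dots> = (\<Sum>t\<in>R. w t * ev G \<Gamma> (?i t))"
      using R(1) D(1) by (subst ev_sum) (auto intro!: bdd_fun_mult simp: ev_scale)
    also have "\<dots> = (\<Sum>t\<in>R. w t * ev G \<Gamma> (?i \<one>))"
    proof (rule sum.cong)
      fix t assume t: "t \<in> R"
      then have "ev G \<Gamma> (?i \<one>) = ev G \<Gamma> (\<lambda>x. ?i \<one> (inv t \<otimes> x))"
        using R H by (intro D(3)[symmetric]) (auto simp: subgroup.m_inv_closed)
      also have "\<dots> = ev G \<Gamma> (?i t)"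
        by (rule ev_cong) (use t R Hc in \<open>auto simp: subset_iff\<close>)
      finally show "w t * ev G \<Gamma> (?i t) = w t * ev G \<Gamma> (?i \<one>)" by simp
    qed simp
    finally show ?thesis by (simp add: sum_distrib_right)
  qed
  have "R \<noteq> {}" using R(3)[OF subgroup.one_closed[OF H]] by blast
  then have "of_nat (card R) \<noteq> (0::complex)" using R(1) by simp
  \<comment> \<open>The constant function is the combination in which all coefficients are
    1.\<close>
  moreover have "of_nat (card R) * ev G \<Gamma> (?i \<one>) = 0" using key[of "\<lambda>_. 1"] D(4) by simp
  ultimately have "ev G \<Gamma> (?i \<one>) = 0" by simp
  then show ?thesis using key[OF w] by simp
qed

text \<open>The function that \<Gamma> evaluates is constant on left cosets of H \<inter> S:
  multiplying s on the right by an element of \<open>S\<close> becomes a left translation, which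
  \<Phi> absorbs.\<close>

lemma arens_difference_vanish:
  assumes \<Gamma>: "\<Gamma> \<in> differences_on G H" and H: "subgroup H G" and \<Phi>: "\<Phi> \<in> l1_bidual G"
    and S: "subgroup S G" "H \<lessapprox> S" "invariant_under G S \<Phi>"
  shows "arens G \<Gamma> \<Phi> = 0"
proof (rule l1_bidual_ext)
  show "arens G \<Gamma> \<Phi> \<in> l1_bidual G" using \<Gamma> \<Phi> differences_onD(1) by (blast intro: arens_closed)
  fix u assume u: "bdd_fun G u"
  have Hc: "H \<subseteq> carrier G" "S \<subseteq> carrier G" using subgroup.subset H S by blast+
  have "ev G \<Gamma> (\<lambda>s. ev G \<Phi> (\<lambda>x. u (s \<otimes> x))) = 0"
  proof (rule ev_difference_coset_function[OF \<Gamma> H subgroups_Inter_pair[OF H S(1)]])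
    show "H \<lessapprox> H \<inter> S" using vle_Int[OF vle_subset[of H H] S(2) H H S(1)] Hc by simp
    fix s m assume sm: "s \<in> H" "m \<in> H \<inter> S"
    have "ev G \<Phi> (\<lambda>x. u (s \<otimes> m \<otimes> x)) = ev G \<Phi> (\<lambda>x. u (s \<otimes> (m \<otimes> x)))"
      by (rule ev_cong) (use sm Hc in \<open>auto simp: m_assoc subset_iff\<close>)
    also have "\<dots> = ev G \<Phi> (\<lambda>x. u (s \<otimes> x))"
      using S(3) sm bdd_fun_left[OF u, of s] Hc unfolding invariant_under_def by blast
    finally show "ev G \<Phi> (\<lambda>x. u (s \<otimes> m \<otimes> x)) = ev G \<Phi> (\<lambda>x. u (s \<otimes> x))" .
  qed (use u \<Phi> bdd_fun_ev in auto)
  then show "ev G (arens G \<Gamma> \<Phi>) u = ev G 0 u" using ev_arens[OF \<Phi> u] by (simp add: ev_def)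
qed (rule l1_bidual_zero)

lemma ev_plus: "ev G (\<Phi> + \<Psi>) u = ev G \<Phi> u + ev G \<Psi> u" "ev G 0 u = 0" "ev G (\<lambda>x. 0) u = 0"
  by (simp_all add: ev_def)

abbreviation pt :: "'a \<Rightarrow> 'a bidual_elt" where "pt t \<equiv> to_bidual G (point_mass t)"

lemma pt_mult: "s \<in> carrier G \<Longrightarrow> t \<in> carrier G \<Longrightarrow> arens G (pt s) (pt t) = pt (s \<otimes> t)"
  by (rule l1_bidual_ext[of _ G]) (auto simp: arens_closed to_bidual_point_mass ev_translate bdd_fun_left)

lemma pt_one: "\<Phi> \<in> l1_bidual G \<Longrightarrow> arens G (pt \<one>) \<Phi> = \<Phi>"
  by (rule l1_bidual_ext[of _ G]) (auto simp: arens_closed to_bidual_point_mass ev_translate intro!: ev_cong)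

text \<open>In the form \<Gamma> \<box> \<delta>_t = \<delta>_t \<box> \<Gamma>' this lets a point
  mass pass from the right of a difference to its left.\<close>

lemma differences_on_conjugate:
  assumes \<Gamma>: "\<Gamma> \<in> differences_on G M" and M: "M \<subseteq> carrier G" and t: "t \<in> carrier G"
  shows "arens G (pt (inv t)) (arens G \<Gamma> (pt t)) \<in> differences_on G (cj (inv t) M)"
proof -
  note D = differences_onD[OF \<Gamma>]
  let ?\<Theta> = "arens G (pt (inv t)) (arens G \<Gamma> (pt t))"
  have cl: "?\<Theta> \<in> l1_bidual G" "arens G \<Gamma> (pt t) \<in> l1_bidual G" "pt t \<in> l1_bidual G"
    using D(1) t by (simp_all add: arens_closed to_bidual_point_mass)
  have e: "ev G ?\<Theta> u = ev G \<Gamma> (\<lambda>s. u (inv t \<otimes> (s \<otimes> t)))" if u: "bdd_fun G u" for u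
  proof -
    have "ev G ?\<Theta> u = ev G \<Gamma> (\<lambda>s. ev G (pt t) (\<lambda>x. u (inv t \<otimes> (s \<otimes> x))))"
      unfolding ev_translate[OF inv_closed[OF t] cl(2) u]
      using bdd_fun_left[OF u inv_closed[OF t]] by (rule ev_arens[OF cl(3)])
    also have "\<dots> = ev G \<Gamma> (\<lambda>s. u (inv t \<otimes> (s \<otimes> t)))"
      using t bdd_fun_left[OF bdd_fun_left[OF u, of "inv t"]] by (intro ev_cong) (simp add: to_bidual_point_mass)
    finally show ?thesis .
  qed
  have b: "bdd_fun G (\<lambda>s. u (inv t \<otimes> (s \<otimes> t)))" if "bdd_fun G u" for u
    using bdd_fun_right[OF bdd_fun_left[OF that, of "inv t"], of t] t by simp
  have mem: "inv t \<otimes> (s \<otimes> t) \<in> cj (inv t) M" if "s \<in> M" for s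
    using that M t by (auto simp: conjugate_set_image m_assoc subset_iff)
  have "ev G ?\<Theta> u = ev G ?\<Theta> v" if "bdd_fun G u" "bdd_fun G v" "\<forall>s\<in>cj (inv t) M. u s = v s" for u v
    unfolding e[OF that(1)] e[OF that(2)] by (rule D(2)) (use that b mem in auto)
  moreover have "ev G ?\<Theta> (\<lambda>x. u (k \<otimes> x)) = ev G ?\<Theta> u" if k: "k \<in> cj (inv t) M" and u: "bdd_fun G u" for k u
  proof -
    obtain m where m: "m \<in> M" "k = inv t \<otimes> m \<otimes> t" using k M t by (auto simp: conjugate_set_image)
    have kc: "k \<in> carrier G" "m \<in> carrier G" using m M t by auto
    have "ev G ?\<Theta> (\<lambda>x. u (k \<otimes> x)) = ev G \<Gamma> (\<lambda>s. u (inv t \<otimes> ((m \<otimes> s) \<otimes> t)))"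
      unfolding e[OF bdd_fun_left[OF u kc(1)]]
      by (rule ev_cong) (use kc m t in \<open>simp add: m_assoc inv_mult_cancel\<close>)
    also have "\<dots> = ev G ?\<Theta> u" using D(3)[OF m(1) b[OF u]] e[OF u] by simp
    finally show ?thesis .
  qed
  moreover have "ev G ?\<Theta> (\<lambda>t. 1) = 0" using e[of "\<lambda>t. 1"] D(4) by simp
  ultimately show ?thesis unfolding differences_on_def supported_on_def invariant_under_def using cl(1) by blast
qed

text \<open>\<Gamma>' is \<Gamma> multiplied by the indicator of \<open>S\<close>; its translates by
  a transversal are the pieces of \<Gamma> on the cosets t S. That \<Gamma>' kills 1 is
  \<open>ev_difference_coset_function\<close> for this indicator.\<close>

lemma differences_on_finite_index:
  assumes \<Gamma>: "\<Gamma> \<in> differences_on G H" and H: "subgroup H G" and S: "subgroup S G" "S \<subseteq> H" "H \<lessapprox> S"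
  obtains R \<Gamma>' where "finite R" "R \<subseteq> H" "\<Gamma>' \<in> differences_on G S" "\<Gamma> = (\<Sum>t\<in>R. arens G (pt t) \<Gamma>')"
proof -
  obtain R where R': "finite R" "R \<subseteq> H" "\<forall>x\<in>H. \<exists>!t. t \<in> R \<and> inv t \<otimes> x \<in> S"
    using vle_transversal[OF S(3) H S(1,2)] .
  note R = R'(1,2) R'(3)[rule_format]
  note D = differences_onD[OF \<Gamma>]
  have Hc: "H \<subseteq> carrier G" by (rule subgroup.subset[OF H])
  let ?f = "\<lambda>u. ev G \<Gamma> (\<lambda>t. if t \<in> S then u t else 0)"
  have b: "bdd_fun G (\<lambda>t. if P t then u t else 0)" if "bdd_fun G u" for u P
    using that bdd_fun_mult[of G u "\<lambda>t. if P t then 1 else 0"] by (simp add: if_distrib cong: if_cong)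
  obtain K where K: "K \<ge> 0" "\<And>u C. (\<And>t. t \<in> carrier G \<Longrightarrow> cmod (u t) \<le> C) \<Longrightarrow> C \<ge> 0 \<Longrightarrow> cmod (ev G \<Gamma> u) \<le> K * C"
    using ev_bound[OF D(1)] by metis
  have 1: "?f (\<lambda>t. u t + v t) = ?f u + ?f v" if "bdd_fun G u" "bdd_fun G v" for u v
    unfolding ev_add[OF D(1) b[OF that(1)] b[OF that(2)], symmetric] by (rule ev_cong) auto
  have 2: "?f (\<lambda>t. c * u t) = c * ?f u" if "bdd_fun G u" for c u
    unfolding ev_scale[OF D(1) b[OF that], symmetric] by (rule ev_cong) auto
  have 3: "cmod (?f u) \<le> K * C" if "\<And>t. t \<in> carrier G \<Longrightarrow> cmod (u t) \<le> C" "C \<ge> 0" for u C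
    using that by (intro K(2)) auto
  let ?\<Gamma> = "bidual_of G ?f"
  have cl: "?\<Gamma> \<in> l1_bidual G" by (rule bidual_of(1)[OF carrier_nonempty 1 2 3])
  have e: "ev G ?\<Gamma> u = ?f u" if "bdd_fun G u" for u by (rule bidual_of(2)[OF carrier_nonempty 1 2 3 that])
  have "ev G ?\<Gamma> u = ev G ?\<Gamma> v" if "bdd_fun G u" "bdd_fun G v" "\<forall>s\<in>S. u s = v s" for u v
    unfolding e[OF that(1)] e[OF that(2)] by (rule ev_cong) (use that in auto)
  moreover have "ev G ?\<Gamma> (\<lambda>x. u (k \<otimes> x)) = ev G ?\<Gamma> u" if k: "k \<in> S" and u: "bdd_fun G u" for k u
  proof -
    have kc: "k \<in> carrier G" using k S Hc by auto
    have "inv k \<otimes> (k \<otimes> x) \<in> S" if "k \<otimes> x \<in> S" for x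
      using k that S(1) by (meson subgroup.m_closed subgroup.m_inv_closed)
    then have iff: "k \<otimes> x \<in> S \<longleftrightarrow> x \<in> S" if "x \<in> carrier G" for x
      using inv_mult_cancel(1)[OF kc that] subgroup.m_closed[OF S(1) k, of x] by metis
    have "ev G ?\<Gamma> (\<lambda>x. u (k \<otimes> x)) = ev G \<Gamma> (\<lambda>x. if k \<otimes> x \<in> S then u (k \<otimes> x) else 0)"
      unfolding e[OF bdd_fun_left[OF u kc]] by (rule ev_cong) (simp add: iff)
    also have "\<dots> = ?f u" using D(3)[of k, OF _ b[OF u, of "\<lambda>x. x \<in> S"]] k S by auto
    finally show ?thesis using e[OF u] by simp
  qed
  moreover have "ev G ?\<Gamma> (\<lambda>t. 1) = 0"
    unfolding e[OF bdd_fun_const]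
  proof (rule ev_difference_coset_function[OF \<Gamma> H S])
    fix s m assume sm: "s \<in> H" "m \<in> S"
    have "s = (s \<otimes> m) \<otimes> inv m" using sm S(2) Hc by (auto simp: m_assoc subset_iff)
    then have "s \<in> S" if "s \<otimes> m \<in> S" using that sm S(1) by (metis subgroup.m_closed subgroup.m_inv_closed)
    then show "(if s \<otimes> m \<in> S then 1 else 0) = (if s \<in> S then 1 else (0::complex))"
      using sm S(1) by (auto simp: subgroup.m_closed)
  qed auto
  ultimately have "?\<Gamma> \<in> differences_on G S"
    unfolding differences_on_def supported_on_def invariant_under_def using cl by blast
  moreover have "\<Gamma> = (\<Sum>t\<in>R. arens G (pt t) ?\<Gamma>)"
  proof (rule l1_bidual_ext[OF D(1)])
    have ac: "arens G (pt t) ?\<Gamma> \<in> l1_bidual G" if "t \<in> R" for t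
      using that R Hc cl by (auto intro!: arens_closed to_bidual_point_mass)
    have sc: "finite F \<Longrightarrow> F \<subseteq> R \<Longrightarrow> (\<Sum>t\<in>F. arens G (pt t) ?\<Gamma>) \<in> l1_bidual G
       \<and> (\<forall>u. ev G (\<Sum>t\<in>F. arens G (pt t) ?\<Gamma>) u = (\<Sum>t\<in>F. ev G (arens G (pt t) ?\<Gamma>) u))" for F
      by (induction F rule: finite_induct) (auto simp: ac l1_bidual_add l1_bidual_zero ev_plus)
    show "(\<Sum>t\<in>R. arens G (pt t) ?\<Gamma>) \<in> l1_bidual G" using sc[OF R(1)] by simp
    fix u assume u: "bdd_fun G u"
    have "ev G (\<Sum>t\<in>R. arens G (pt t) ?\<Gamma>) u = (\<Sum>t\<in>R. ev G (arens G (pt t) ?\<Gamma>) u)" using sc[OF R(1)] by simp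
    also have "\<dots> = (\<Sum>t\<in>R. ev G \<Gamma> (\<lambda>x. if inv t \<otimes> x \<in> S then u x else 0))"
    proof (rule sum.cong)
      fix t assume t: "t \<in> R"
      have tc: "t \<in> carrier G" "inv t \<in> H" using t R Hc H by (auto simp: subgroup.m_inv_closed)
      have "ev G (arens G (pt t) ?\<Gamma>) u = ?f (\<lambda>x. u (t \<otimes> x))"
        using tc cl u by (simp add: ev_translate e bdd_fun_left)
      also have "\<dots> = ev G \<Gamma> (\<lambda>x. if inv t \<otimes> x \<in> S then u (t \<otimes> (inv t \<otimes> x)) else 0)"
        using D(3)[OF tc(2) b[OF bdd_fun_left[OF u tc(1)], of "\<lambda>x. x \<in> S"]] by simp
      also have "\<dots> = ev G \<Gamma> (\<lambda>x. if inv t \<otimes> x \<in> S then u x else 0)"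
        by (rule ev_cong) (use tc in \<open>simp add: inv_mult_cancel\<close>)
      finally show "ev G (arens G (pt t) ?\<Gamma>) u = ev G \<Gamma> (\<lambda>x. if inv t \<otimes> x \<in> S then u x else 0)" .
    qed simp
    also have "\<dots> = ev G \<Gamma> (\<lambda>x. \<Sum>t\<in>R. if inv t \<otimes> x \<in> S then u x else 0)"
      using R(1) D(1) u b by (subst ev_sum) auto
    also have "\<dots> = ev G \<Gamma> u"
      by (rule D(2)) (use u b R in \<open>auto intro!: bdd_fun_sum simp: sum_transversal\<close>)
    finally show "ev G \<Gamma> u = ev G (\<Sum>t\<in>R. arens G (pt t) ?\<Gamma>) u" by simp
  qed
  ultimately show ?thesis using that R by blast
qed

text \<open>Point masses are moved to the left by conjugation.\<close>

lemma sn_products_vanish_reduce: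
  assumes E: "E \<lhd> G" "carrier G \<lessapprox> E" and n: "n \<ge> 1"
    and van: "\<And>ys. length ys = n \<Longrightarrow> set ys \<subseteq> (\<Union>M\<in>{M. subnormal M G \<and> M \<subseteq> E}. differences_on G M) \<Longrightarrow>
      list_product (arens G) ys = 0"
    and xs: "length xs = n" "set xs \<subseteq> sn_differences"
  shows "list_product (arens G) xs = 0"
proof -
  interpret m: Modules.module "cscale :: complex \<Rightarrow> 'a bidual_elt \<Rightarrow> _" by (rule cscale_module)
  define D where "D = (\<Union>M\<in>{M. subnormal M G \<and> M \<subseteq> E}. differences_on G M)"
  \<comment> \<open>Words of k differences on subnormal subgroups inside \<open>E\<close>, preceded
    by a single point mass. Left multiplication by \<open>V 1\<close> leads from \<open>V k\<close>
    to \<open>V (Suc k)\<close>, because \<open>E\<close> is normal and \<open>D\<close> is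
    therefore stable under conjugation.\<close>
  define V where "V k = {arens G (pt t) (list_product (arens G) ys) |t ys. t \<in> carrier G \<and> length ys = k \<and> set ys \<subseteq> D}" for k
  have Eg: "subgroup E G" "E \<subseteq> carrier G" using E by (auto simp: normal_imp_subgroup subgroup.subset)
  have Dl: "D \<subseteq> l1_bidual G" unfolding D_def using differences_onD(1) by blast
  have Vl: "V k \<subseteq> l1_bidual G" if "k \<ge> 1" for k
  proof
    fix v assume "v \<in> V k"
    then obtain t ys where v: "v = arens G (pt t) (list_product (arens G) ys)" "t \<in> carrier G" "length ys = k" "set ys \<subseteq> D"
      unfolding V_def by blast
    have "ys \<noteq> []" using v that by auto
    then show "v \<in> l1_bidual G" using v Dl by (auto intro!: arens_closed to_bidual_point_mass list_product_closed)
  qed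
  have base: "x \<in> m.span (V 1)" if x: "x \<in> sn_differences" for x
  proof -
    obtain H where H: "subnormal H G" "x \<in> differences_on G H" using x unfolding sn_differences_def by blast
    have Hg: "subgroup H G" "H \<subseteq> carrier G" using H subnormal_subgroup subgroup.subset by blast+
    have "H \<lessapprox> H \<inter> E" using vle_Int[OF vle_subset[of H H] vle_mono[OF E(2), of H E] Hg(1) Hg(1) Eg(1)] Hg by simp
    then obtain R x' where R: "finite R" "R \<subseteq> H" "x' \<in> differences_on G (H \<inter> E)" "x = (\<Sum>t\<in>R. arens G (pt t) x')"
      using differences_on_finite_index[OF H(2) Hg(1) subgroups_Inter_pair[OF Hg(1) Eg(1)]] by blast
    have "x' \<in> D" unfolding D_def using R(3) subnormal_Int[OF H(1) normal_subnormal[OF E(1)]] by blast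
    then have "arens G (pt t) x' \<in> V 1" if "t \<in> R" for t
      unfolding V_def using that R Hg by (auto intro!: exI[of _ t] exI[of _ "[x']"])
    then show ?thesis unfolding R(4) by (intro m.span_sum m.span_base) auto
  qed
  have conj: "arens G (pt (inv t)) (arens G x (pt t)) \<in> D" if x: "x \<in> D" and t: "t \<in> carrier G" for x t
  proof -
    obtain M where M: "subnormal M G" "M \<subseteq> E" "x \<in> differences_on G M" using x unfolding D_def by blast
    have "subnormal (cj (inv t) M) G" using M t by (intro subnormal_conjugate) auto
    moreover have "cj (inv t) M \<subseteq> E" using conjugate_mono[OF M(2), of "inv t"] normal_conjugate[OF E(1), of "inv t"] t by simp
    moreover have "M \<subseteq> carrier G" using M Eg by blast
    ultimately show ?thesis unfolding D_def using differences_on_conjugate[OF M(3) _ t] by blast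
  qed
  have step: "arens G p q \<in> V (Suc k)" if p: "p \<in> V 1" and q: "q \<in> V k" and k: "k \<ge> 1" for p q k
  proof -
    obtain s ps where s: "p = arens G (pt s) (list_product (arens G) ps)" "s \<in> carrier G" "length ps = 1" "set ps \<subseteq> D"
      using p unfolding V_def by blast
    then obtain x where x: "p = arens G (pt s) x" "x \<in> D" by (auto simp: length_Suc_conv)
    obtain t ys where t: "q = arens G (pt t) (list_product (arens G) ys)" "t \<in> carrier G" "length ys = k" "set ys \<subseteq> D"
      using q unfolding V_def by blast
    have ne: "ys \<noteq> []" using t k by auto
    define y where "y = list_product (arens G) ys"
    define x' where "x' = arens G (pt (inv t)) (arens G x (pt t))"
    have x'D: "x' \<in> D" unfolding x'_def by (rule conj[OF x(2) t(2)])
    have cl: "y \<in> l1_bidual G" "x \<in> l1_bidual G" "x' \<in> l1_bidual G" "pt t \<in> l1_bidual G" "pt s \<in> l1_bidual G"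
        "pt (inv t) \<in> l1_bidual G"
      using ne t Dl x x'D s by (auto simp: y_def to_bidual_point_mass intro!: list_product_closed)
    have "arens G (pt t) x' = arens G x (pt t)"
      unfolding x'_def using cl t by (simp add: arens_assoc[symmetric] arens_closed pt_mult)
        (simp add: arens_assoc pt_one arens_closed)
    then have "arens G (arens G x (pt t)) y = arens G (arens G (pt t) x') y" by simp
    then have "arens G p q = arens G (pt s) (arens G (pt t) (arens G x' y))"
      unfolding x t(1) y_def[symmetric] using cl by (simp add: arens_assoc arens_closed)
    also have "\<dots> = arens G (pt (s \<otimes> t)) (arens G x' y)"
      unfolding pt_mult[OF s(2) t(2), symmetric] using cl by (intro arens_assoc[symmetric] arens_closed)
    also have "arens G x' y = list_product (arens G) (x' # ys)" using ne by (simp add: y_def list_product_Cons)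
    finally show ?thesis unfolding V_def using s t x'D by (auto intro!: exI[of _ "s \<otimes> t"] exI[of _ "x' # ys"])
  qed
  have "zs \<noteq> [] \<Longrightarrow> set zs \<subseteq> sn_differences \<Longrightarrow> list_product (arens G) zs \<in> m.span (V (length zs))" for zs
  proof (induction zs rule: list_nonempty_induct)
    case (cons z zs)
    then have "length zs \<ge> 1" by (cases zs) auto
    then have "arens G z (list_product (arens G) zs) \<in> m.span (V (Suc (length zs)))"
      using cons Vl base step by (intro span_product(1)[of "V 1" "V (length zs)"]) auto
    then show ?case using cons by (simp add: list_product_Cons)
  qed (use base in auto)
  then have "list_product (arens G) xs \<in> m.span (V n)" using xs n by (metis One_nat_def Suc_n_not_le_n list.size(3) not_one_le_zero)
  moreover have "V n \<subseteq> {0}"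
  proof
    fix v assume "v \<in> V n"
    then obtain t ys where "v = arens G (pt t) (list_product (arens G) ys)" "t \<in> carrier G" "length ys = n" "set ys \<subseteq> D"
      unfolding V_def by blast
    then show "v \<in> {0}" using van[of ys] arens_zero_right[OF to_bidual_point_mass(1), of t] by (simp add: D_def)
  qed
  then have "m.span (V n) \<subseteq> {0}" by (rule m.span_minimal) (rule m.subspace_single_0)
  ultimately show ?thesis by blast
qed

section \<open>Nonzero products along independent subgroups\<close>

primrec direct_list :: "'a set list \<Rightarrow> bool" where
  "direct_list [] \<longleftrightarrow> True"
| "direct_list (K # Ks) \<longleftrightarrow> K \<inter> generate G (\<Union>(set Ks)) = {\<one>} \<and> direct_list Ks"

lemma nonzero_ev:
  assumes "\<Phi> \<in> l1_bidual G" "\<Phi> \<noteq> 0" obtains u where "bdd_fun G u" "ev G \<Phi> u \<noteq> 0"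
  using l1_bidual_ext[OF assms(1) l1_bidual_zero] assms(2) by (auto simp: ev_def)

text \<open>Trivial intersection makes the factorization s x, with s in \<open>K\<close> and x in
  the group generated by the rest, unique. So u(s x) = f(s) v(x) is a well-defined test function,
  and the product takes on it the product of two nonzero values. The support is carried along
  because the inner functional must see u only at such x.\<close>

lemma direct_list_product_nonzero:
  assumes "Ks \<noteq> []" "direct_list Ks" "\<And>K. K \<in> set Ks \<Longrightarrow> subgroup K G \<and> (\<exists>\<Gamma>\<in>differences_on G K. \<Gamma> \<noteq> 0)"
  shows "\<exists>xs. length xs = length Ks \<and> set xs \<subseteq> (\<Union>K\<in>set Ks. differences_on G K) \<and>
     list_product (arens G) xs \<noteq> 0 \<and> supported_on G (generate G (\<Union>(set Ks))) (list_product (arens G) xs)"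
  using assms
proof (induction Ks rule: list_nonempty_induct)
  case (single K)
  then obtain \<Gamma> where \<Gamma>: "\<Gamma> \<in> differences_on G K" "\<Gamma> \<noteq> 0" "subgroup K G" by (metis list.set_intros(1))
  have "K \<subseteq> generate G K" by (rule generate.incl[THEN subsetI])
  then have "supported_on G (generate G K) \<Gamma>" using \<Gamma>(1) unfolding differences_on_def supported_on_def by blast
  then show ?case using \<Gamma> by (intro exI[of _ "[\<Gamma>]"]) auto
next
  case (cons K Ks)
  let ?S = "generate G (\<Union>(set Ks))" and ?T = "generate G (\<Union>(set (K # Ks)))"
  obtain xs where xs: "length xs = length Ks" "set xs \<subseteq> (\<Union>K\<in>set Ks. differences_on G K)"
     "list_product (arens G) xs \<noteq> 0" "supported_on G ?S (list_product (arens G) xs)"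
    using cons.IH cons.prems by (metis direct_list.simps(2) list.set_intros(2))
  obtain \<Gamma> where \<Gamma>: "\<Gamma> \<in> differences_on G K" "\<Gamma> \<noteq> 0" using cons.prems by (metis list.set_intros(1))
  note D = differences_onD[OF \<Gamma>(1)]
  have sg: "subgroup L G" if "L \<in> set (K # Ks)" for L using cons.prems(2)[OF that] by simp
  then have Kg: "subgroup K G" by simp
  have uc: "\<Union>(set Ks) \<subseteq> carrier G" "\<Union>(set (K # Ks)) \<subseteq> carrier G" using subgroup.subset[OF sg] by auto
  have Sg: "subgroup ?S G" "subgroup ?T G" using uc by (auto intro: generate_is_subgroup)
  have c: "K \<subseteq> carrier G" "?S \<subseteq> carrier G" using Kg Sg subgroup.subset by blast+
  have KS: "K \<inter> ?S = {\<one>}" using cons by simp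
  have ne: "xs \<noteq> []" using xs cons by auto
  define \<Phi> where "\<Phi> = list_product (arens G) xs"
  have \<Phi>l: "\<Phi> \<in> l1_bidual G" unfolding \<Phi>_def using ne xs(2) differences_onD(1) by (intro list_product_closed) auto
  have \<Phi>s: "ev G \<Phi> u = ev G \<Phi> v" if "bdd_fun G u" "bdd_fun G v" "\<And>t. t \<in> ?S \<Longrightarrow> u t = v t" for u v
    using xs(4) that unfolding supported_on_def \<Phi>_def by blast
  obtain f where f: "bdd_fun G f" "ev G \<Gamma> f \<noteq> 0" using nonzero_ev[OF D(1) \<Gamma>(2)] .
  obtain v where v: "bdd_fun G v" "ev G \<Phi> v \<noteq> 0" using nonzero_ev[OF \<Phi>l] xs(3) unfolding \<Phi>_def by blast
  define p where "p y = (SOME q. fst q \<in> K \<and> snd q \<in> ?S \<and> y = fst q \<otimes> snd q)" for y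
  have p: "p (s \<otimes> x) = (s, x)" if sx: "s \<in> K" "x \<in> ?S" for s x
  proof -
    have "\<exists>q. fst q \<in> K \<and> snd q \<in> ?S \<and> s \<otimes> x = fst q \<otimes> snd q" using sx by (intro exI[of _ "(s, x)"]) simp
    then have q: "fst (p (s \<otimes> x)) \<in> K" "snd (p (s \<otimes> x)) \<in> ?S" "s \<otimes> x = fst (p (s \<otimes> x)) \<otimes> snd (p (s \<otimes> x))"
      unfolding p_def by (metis (mono_tags, lifting) someI_ex)+
    define a b where "a = fst (p (s \<otimes> x))" "b = snd (p (s \<otimes> x))"
    note q = q[folded a_b_def]
    have ac: "a \<in> carrier G" "b \<in> carrier G" "s \<in> carrier G" "x \<in> carrier G" using q sx c by auto
    have "inv a \<otimes> s \<otimes> x = b" using q(3) ac by (simp add: m_assoc inv_mult_cancel)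
    then have "inv a \<otimes> s = b \<otimes> inv x" using ac by (auto simp: m_assoc)
    moreover have "inv a \<otimes> s \<in> K" "b \<otimes> inv x \<in> ?S"
      using q(1,2) sx Kg Sg(1) by (meson subgroup.m_closed subgroup.m_inv_closed)+
    ultimately have "inv a \<otimes> s \<in> K \<inter> ?S" "b \<otimes> inv x \<in> K \<inter> ?S" by simp_all
    then have "inv a \<otimes> s = \<one>" "b \<otimes> inv x = \<one>" unfolding KS by simp_all
    then have "a = s" "b = x" using ac inv_mult_cancel(2)[of a s] inv_solve_right[of \<one> b x] by auto
    then show ?thesis by (metis a_b_def prod.collapse)
  qed
  \<comment> \<open>The value 0 elsewhere keeps \<open>u\<close> bounded; both evaluations see only
    products of an element of \<open>K\<close> with one of \<open>?S\<close>.\<close>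
  define u where "u y = (if \<exists>s\<in>K. \<exists>x\<in>?S. y = s \<otimes> x then f (fst (p y)) * v (snd (p y)) else 0)" for y
  obtain C C' where C: "C \<ge> 0" "C' \<ge> 0" "\<And>t. t \<in> carrier G \<Longrightarrow> cmod (f t) \<le> C" "\<And>t. t \<in> carrier G \<Longrightarrow> cmod (v t) \<le> C'"
    using bdd_fun_bound[OF f(1)] bdd_fun_bound[OF v(1)] by metis
  have u1: "u (s \<otimes> x) = f s * v x" if "s \<in> K" "x \<in> ?S" for s x
    using that p[OF that] by (auto simp: u_def)
  have ub: "bdd_fun G u"
  proof (rule bdd_funI)
    fix y
    show "cmod (u y) \<le> C * C'"
    proof (cases "\<exists>s\<in>K. \<exists>x\<in>?S. y = s \<otimes> x")
      case True
      then obtain s x where "s \<in> K" "x \<in> ?S" "y = s \<otimes> x" by blast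
      then show ?thesis using u1 c C by (auto simp: norm_mult intro!: mult_mono)
    qed (use C in \<open>simp add: u_def\<close>)
  qed
  have ne2: "ev G (arens G \<Gamma> \<Phi>) u \<noteq> 0"
  proof -
    have "ev G (arens G \<Gamma> \<Phi>) u = ev G \<Gamma> (\<lambda>s. ev G \<Phi> (\<lambda>x. u (s \<otimes> x)))" by (rule ev_arens[OF \<Phi>l ub])
    also have "\<dots> = ev G \<Gamma> (\<lambda>s. ev G \<Phi> v * f s)"
    proof (rule D(2))
      fix s assume s: "s \<in> K"
      have "ev G \<Phi> (\<lambda>x. u (s \<otimes> x)) = ev G \<Phi> (\<lambda>x. f s * v x)"
      proof (rule \<Phi>s)
        show "bdd_fun G (\<lambda>x. u (s \<otimes> x))" using s c ub by (blast intro: bdd_fun_left)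
        show "bdd_fun G (\<lambda>x. f s * v x)" using v(1) by (rule bdd_fun_mult[OF bdd_fun_const])
      qed (rule u1[OF s])
      then show "ev G \<Phi> (\<lambda>x. u (s \<otimes> x)) = ev G \<Phi> v * f s" using ev_scale[OF \<Phi>l v(1)] by simp
    next
      show "bdd_fun G (\<lambda>s. ev G \<Phi> (\<lambda>x. u (s \<otimes> x)))" by (rule bdd_fun_ev[OF \<Phi>l ub])
      show "bdd_fun G (\<lambda>s. ev G \<Phi> v * f s)" by (rule bdd_fun_mult[OF bdd_fun_const f(1)])
    qed
    also have "\<dots> = ev G \<Phi> v * ev G \<Gamma> f" using ev_scale[OF D(1) f(1)] by simp
    finally show ?thesis using f v by simp
  qed
  have "supported_on G ?T (arens G \<Gamma> \<Phi>)"
    unfolding supported_on_def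
  proof (intro allI impI)
    fix g h assume gh: "bdd_fun G g" "bdd_fun G h" "\<forall>t\<in>?T. g t = h t"
    have sub: "K \<subseteq> ?T" "?S \<subseteq> ?T" using mono_generate[of "\<Union>(set Ks)" "\<Union>(set (K # Ks))"]
      by (auto intro: generate.incl)
    show "ev G (arens G \<Gamma> \<Phi>) g = ev G (arens G \<Gamma> \<Phi>) h"
      unfolding ev_arens[OF \<Phi>l gh(1)] ev_arens[OF \<Phi>l gh(2)]
    proof (rule D(2))
      fix s assume s: "s \<in> K"
      show "ev G \<Phi> (\<lambda>x. g (s \<otimes> x)) = ev G \<Phi> (\<lambda>x. h (s \<otimes> x))"
      proof (rule \<Phi>s)
        fix x assume "x \<in> ?S"
        then have "s \<otimes> x \<in> ?T" using s sub subgroup.m_closed[OF Sg(2)] by blast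
        then show "g (s \<otimes> x) = h (s \<otimes> x)" using gh(3) by blast
      qed (use s c gh in \<open>blast intro: bdd_fun_left\<close>)+
    qed (rule bdd_fun_ev[OF \<Phi>l gh(1)] bdd_fun_ev[OF \<Phi>l gh(2)])+
  qed
  moreover have "arens G \<Gamma> \<Phi> \<noteq> 0" using ne2 by (auto simp: ev_def)
  ultimately show ?case using xs \<Gamma> ne
    by (intro exI[of _ "\<Gamma> # xs"]) (auto simp: list_product_Cons \<Phi>_def)
qed

end

section \<open>Existence of invariant differences\<close>

context includes cardinal_syntax begin

text \<open>Allows the finite subsets of an infinite \<open>H\<close> to be well-ordered with every
  initial segment smaller than \<open>H\<close>, which leaves room for new choices at each stage of
  a recursion over them.\<close>

lemma card_of_Fpow_le:
  assumes "infinite H" shows "|Fpow H| \<le>o |H|"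
proof -
  let ?C = "\<lambda>n. {Z. Z \<subseteq> H \<and> finite Z \<and> card Z = n}"
  have one: "|?C n| \<le>o |H|" for n
  proof (induction n)
    case 0
    have "?C 0 = {{}}" by auto
    moreover have "finite {{}}" by simp
    ultimately show ?case using assms by (metis card_of_ordLeq_infinite card_of_Well_order not_ordLess_iff_ordLeq
      ordLess_imp_ordLeq ordLeq_total finite.emptyI finite.insertI)
  next
    case (Suc n)
    have "?C (Suc n) \<subseteq> (\<lambda>(x, Z). insert x Z) ` (H \<times> ?C n)"
    proof
      fix Z assume "Z \<in> ?C (Suc n)"
      then obtain x Y where "Z = insert x Y" "x \<notin> Y" "card Y = n" "finite Y" "Z \<subseteq> H"
        by (auto simp: card_Suc_eq_finite)
      then show "Z \<in> (\<lambda>(x, Z). insert x Z) ` (H \<times> ?C n)" by (auto intro!: image_eqI[of _ _ "(x, Y)"])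
    qed
    then have "|?C (Suc n)| \<le>o |(\<lambda>(x, Z). insert x Z) ` (H \<times> ?C n)|" by (rule card_of_mono1)
    also have "|(\<lambda>(x, Z). insert x Z) ` (H \<times> ?C n)| \<le>o |H \<times> ?C n|" by (rule card_of_image)
    also have "|H \<times> ?C n| \<le>o |H|"
      using card_of_Times_ordLeq_infinite_Field[of "|H|" H "?C n"] assms Suc
      by (simp add: card_of_Field_ordIso card_of_Card_order Field_card_of ordLeq_refl)
    finally show ?case .
  qed
  have "Fpow H = (\<Union>n\<in>UNIV. ?C n)" by (auto simp: Fpow_def)
  moreover have "|\<Union>n\<in>UNIV. ?C n| \<le>o |H|"
    by (rule card_of_UNION_ordLeq_infinite[OF assms]) (use one assms in \<open>auto simp: infinite_iff_card_of_nat\<close>)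
  ultimately show ?thesis by simp
qed

text \<open>An infinite index set absorbs finite pieces; a finite one yields a finite union, which
  is smaller than the infinite \<open>H\<close>.\<close>

lemma card_of_UNION_finite_ordLess:
  assumes "infinite H" "|J| <o |H|" "\<And>j. j \<in> J \<Longrightarrow> finite (A j)"
  shows "|\<Union>j\<in>J. A j| <o |H|"
proof (cases "finite J")
  case True
  then have "finite (\<Union>j\<in>J. A j)" using assms by auto
  then show ?thesis using assms(1) by (metis card_of_Well_order card_of_ordLeq_infinite not_ordLeq_iff_ordLess)
next
  case False
  have "|\<Union>j\<in>J. A j| \<le>o |J|"
  proof (rule card_of_UNION_ordLeq_infinite[OF False ordLeq_refl[OF card_of_Card_order]], rule ballI)
    fix j assume "j \<in> J"
    then have "finite (A j)" by (rule assms)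
    then show "|A j| \<le>o |J|" using False
      by (metis card_of_Well_order card_of_ordLeq_infinite not_ordLeq_iff_ordLess ordLess_imp_ordLeq)
  qed
  then show ?thesis using assms(2) by (rule ordLeq_ordLess_trans)
qed

end

context group begin

text \<open>Both \<open>A\<close> and its complement are left thick in the sense of Mitchell; they are built by transfinite
  recursion over the finite subsets of \<open>H\<close>.\<close>

lemma thick_set_with_thick_complement:
  assumes H: "subgroup H G" "infinite H"
  obtains A where "\<And>F. finite F \<Longrightarrow> F \<subseteq> H \<Longrightarrow> \<exists>g\<in>H. \<forall>s\<in>F. s \<otimes> g \<in> A"
    "\<And>F. finite F \<Longrightarrow> F \<subseteq> H \<Longrightarrow> \<exists>g\<in>H. \<forall>s\<in>F. s \<otimes> g \<notin> A"
proof -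
  include cardinal_syntax
  \<comment> \<open>A well-order of the finite subsets in which every initial segment has
    cardinality below that of \<open>H\<close>.\<close>
  define r where "r = |Fpow H|"
  have r: "Well_order r" "Card_order r" "Field r = Fpow H"
    by (simp_all add: r_def card_of_Well_order card_of_Card_order Field_card_of)
  have Hc: "H \<subseteq> carrier G" by (rule subgroup.subset[OF H(1)])
  define R where "R = r - Id"
  have wfR: "wf R" using r(1) unfolding R_def well_order_on_def by simp
  \<comment> \<open>The forbidden k at stage F: those for which some s k with s in F would coincide
    with an element s' k' used at an earlier stage F'.\<close>
  define W where "W f F = (\<Union>F'\<in>{F'. (F', F) \<in> R}. (\<lambda>(s,s',k). inv s \<otimes> (s' \<otimes> k)) ` (F \<times> F' \<times> {fst (f F'), snd (f F')}))"
    for f :: "'a set \<Rightarrow> 'a \<times> 'a" and F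
  \<comment> \<open>Clashes inside one stage: the second choice h must keep the set F h disjoint
    from F g.\<close>
  define Y where "Y F g = (\<lambda>(s,s'). inv s \<otimes> (s' \<otimes> g)) ` (F \<times> F)" for F and g :: 'a
  define P where "P f F p \<longleftrightarrow> (F \<in> Fpow H \<longrightarrow> fst p \<in> H \<and> snd p \<in> H \<and> fst p \<notin> W f F \<and> snd p \<notin> W f F \<union> Y F (fst p))"
    for f F p
  have ex: "\<exists>g\<in>H. g \<notin> W f F \<union> Z" if F: "F \<in> Fpow H" and Z: "finite Z" for f F Z
  proof -
    have und: "{F'. (F', F) \<in> R} = underS r F" by (auto simp: R_def underS_def)
    have "|underS r F| <o r" by (rule card_of_underS[OF r(2)]) (use r(3) F in simp)
    also have "r \<le>o |H|" unfolding r_def by (rule card_of_Fpow_le[OF H(2)])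
    finally have l: "|{F'. (F', F) \<in> R}| <o |H|" unfolding und .
    have "finite F'" if "(F', F) \<in> R" for F'
    proof -
      have "F' \<in> Field r" using that unfolding R_def Field_def by blast
      then show ?thesis using r(3) by (simp add: Fpow_def)
    qed
    then have "|W f F| <o |H|" unfolding W_def
      by (intro card_of_UNION_finite_ordLess[OF H(2) l]) (use F in \<open>auto simp: Fpow_def\<close>)
    moreover have "|Z| <o |H|" using Z H(2) by (metis card_of_Well_order card_of_ordLeq_infinite not_ordLeq_iff_ordLess)
    ultimately have "|W f F \<union> Z| <o |H|" by (rule card_of_Un_ordLess_infinite[OF H(2)])
    then have "\<not> H \<subseteq> W f F \<union> Z" using card_of_mono1 not_ordLess_ordLeq by blast
    then show ?thesis by blast
  qed
  have "\<exists>f. \<forall>F. P f F (f F)"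
  proof (rule dependent_wf_choice[OF wfR])
    fix f g :: "'a set \<Rightarrow> 'a \<times> 'a" and F p assume "\<And>z. (z, F) \<in> R \<Longrightarrow> f z = g z"
    then have "W f F = W g F" unfolding W_def by auto
    then show "P f F p = P g F p" by (simp add: P_def)
  next
    fix F and f :: "'a set \<Rightarrow> 'a \<times> 'a"
    show "\<exists>p. P f F p"
    proof (cases "F \<in> Fpow H")
      case True
      then have fY: "finite (Y F g)" for g by (auto simp: Y_def Fpow_def)
      obtain g where g: "g \<in> H" "g \<notin> W f F" using ex[OF True, of "{}"] by auto
      obtain h where "h \<in> H" "h \<notin> W f F \<union> Y F g" using ex[OF True fY] by blast
      then show ?thesis using g by (intro exI[of _ "(g, h)"]) (simp add: P_def)
    qed (simp add: P_def)
  qed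
  then obtain f where f: "\<And>F. P f F (f F)" by blast
  \<comment> \<open>With (g, h) = \<open>f F\<close>, stage F puts F g into the set and keeps F h
    outside it.\<close>
  define A where "A = (\<Union>F\<in>Fpow H. (\<lambda>s. s \<otimes> fst (f F)) ` F)"
  have fH: "fst (f F) \<in> H" "snd (f F) \<in> H" "fst (f F) \<notin> W f F" "snd (f F) \<notin> W f F" "snd (f F) \<notin> Y F (fst (f F))"
    if "F \<in> Fpow H" for F
    using f[of F] that unfolding P_def by auto
  have cross: "s \<otimes> k \<noteq> s' \<otimes> k'" if "(F', F) \<in> R" "F' \<in> Fpow H" "F \<in> Fpow H" "s \<in> F" "s' \<in> F'" "k \<notin> W f F" "k' \<in> {fst (f F'), snd (f F')}" "k \<in> H"
    for F F' s s' k k'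
  proof
    assume "s \<otimes> k = s' \<otimes> k'"
    moreover have "s \<in> carrier G" "k \<in> carrier G" using that Hc by (auto simp: Fpow_def)
    ultimately have "k = inv s \<otimes> (s' \<otimes> k')" by (metis inv_mult_cancel(1))
    then have "k \<in> W f F" unfolding W_def using that by (auto intro!: bexI[of _ F'] image_eqI[of _ _ "(s, s', k')"])
    then show False using that by blast
  qed
  have notA: "s \<otimes> snd (f F) \<notin> A" if F: "F \<in> Fpow H" and s: "s \<in> F" for F s
  proof
    assume "s \<otimes> snd (f F) \<in> A"
    then obtain F' s' where F': "F' \<in> Fpow H" "s' \<in> F'" "s \<otimes> snd (f F) = s' \<otimes> fst (f F')" unfolding A_def by auto
    have "total_on (Fpow H) r" using r unfolding well_order_on_def linear_order_on_def by simp
    then have "F = F' \<or> (F', F) \<in> R \<or> (F, F') \<in> R"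
      using F F'(1) unfolding R_def total_on_def by blast
    then consider "F = F'" | "(F', F) \<in> R" | "(F, F') \<in> R" by blast
    then show False
    proof cases
      case 1
      have "s \<in> carrier G" "snd (f F) \<in> carrier G" using fH[OF F] F s Hc by (auto simp: Fpow_def)
      then have "snd (f F) = inv s \<otimes> (s' \<otimes> fst (f F))" using F'(3) 1 by (metis inv_mult_cancel(1))
      then have "snd (f F) \<in> Y F (fst (f F))" unfolding Y_def using s F'(2) 1 by (auto intro!: image_eqI[of _ _ "(s, s')"])
      then show False using fH[OF F] by blast
    next
      case 2
      show False using cross[OF 2 F'(1) F s F'(2) fH(4)[OF F], of "fst (f F')"] fH(2)[OF F] F'(3) by simp
    next
      case 3
      show False using cross[OF 3 F F'(1) F'(2) s fH(3)[OF F'(1)], of "snd (f F)"] fH(1)[OF F'(1)] F'(3) by simp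
    qed
  qed
  show ?thesis
  proof (rule that[of A])
    fix F assume "finite F" "F \<subseteq> H"
    then have F: "F \<in> Fpow H" by (simp add: Fpow_def)
    show "\<exists>g\<in>H. \<forall>s\<in>F. s \<otimes> g \<in> A" using fH(1)[OF F] F unfolding A_def by blast
    show "\<exists>g\<in>H. \<forall>s\<in>F. s \<otimes> g \<notin> A" using fH(2)[OF F] notA[OF F] by blast
  qed
qed

text \<open>A weak-star cluster point of point evaluations at elements of \<open>H\<close>.\<close>

lemma cluster_evaluation:
  fixes u0 :: "'a \<Rightarrow> complex"
  assumes H: "H \<subseteq> carrier G"
    and thick: "\<And>F. finite F \<Longrightarrow> F \<subseteq> H \<Longrightarrow> \<exists>g\<in>H. \<forall>s\<in>F. u0 (s \<otimes> g) = c" and u0: "bdd_fun G u0"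
  obtains \<phi> :: "('a \<Rightarrow> complex) \<Rightarrow> complex" where
    "\<And>u v. bdd_fun G u \<Longrightarrow> bdd_fun G v \<Longrightarrow> \<phi> (\<lambda>t. u t + v t) = \<phi> u + \<phi> v"
    "\<And>k u. bdd_fun G u \<Longrightarrow> \<phi> (\<lambda>t. k * u t) = k * \<phi> u"
    "\<And>u C. bdd_fun G u \<Longrightarrow> (\<And>t. t \<in> H \<Longrightarrow> cmod (u t) \<le> C) \<Longrightarrow> cmod (\<phi> u) \<le> C"
    "\<phi> (\<lambda>t. 1) = 1"
    "\<And>s. s \<in> H \<Longrightarrow> \<phi> (\<lambda>x. u0 (s \<otimes> x)) = c"
proof -
  define B where "B u = (SOME C. \<forall>t\<in>carrier G. cmod (u t) \<le> C)" for u :: "'a \<Rightarrow> complex"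
  have B: "cmod (u t) \<le> B u" if "bdd_fun G u" "t \<in> carrier G" for u t
    using someI_ex[of "\<lambda>C. \<forall>t\<in>carrier G. cmod (u t) \<le> C"] that unfolding B_def bdd_fun_def by blast
  define e where "e g u = (if bdd_fun G u then u g else 0)" for g and u :: "'a \<Rightarrow> complex"
  \<comment> \<open>A product of closed discs, compact by the theorem of Tychonoff. Unbounded
    functions receive the factor \<open>{0}\<close>, so that the index set can be the whole function
    type.\<close>
  let ?K = "{\<phi> :: ('a \<Rightarrow> complex) \<Rightarrow> complex. \<forall>u. \<phi> u \<in> (if bdd_fun G u then cball 0 (B u) else {0})}"
  have "?K = PiE UNIV (\<lambda>u. if bdd_fun G u then cball 0 (B u) else {0})"
    by (auto simp: PiE_def Pi_def)
  then have "compactin (product_topology (\<lambda>_. euclidean) UNIV) ?K" by (simp add: compactin_PiE)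
  then have K: "compact ?K" by (simp add: euclidean_product_topology)
  let ?L1 = "{\<phi> :: ('a \<Rightarrow> complex) \<Rightarrow> complex. \<forall>u v. bdd_fun G u \<and> bdd_fun G v \<longrightarrow> \<phi> (\<lambda>t. u t + v t) = \<phi> u + \<phi> v}"
  let ?L2 = "{\<phi> :: ('a \<Rightarrow> complex) \<Rightarrow> complex. \<forall>k u. bdd_fun G u \<longrightarrow> \<phi> (\<lambda>t. k * u t) = k * \<phi> u}"
  \<comment> \<open>The bound by the values on \<open>H\<close> alone is what later makes the
    functional supported on \<open>H\<close>.\<close>
  let ?L3 = "{\<phi> :: ('a \<Rightarrow> complex) \<Rightarrow> complex. \<forall>u C. bdd_fun G u \<and> (\<forall>t\<in>H. cmod (u t) \<le> C) \<longrightarrow> cmod (\<phi> u) \<le> C}"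
  let ?L4 = "{\<phi> :: ('a \<Rightarrow> complex) \<Rightarrow> complex. \<phi> (\<lambda>t. 1) = 1}"
  let ?M = "\<lambda>s. {\<phi> :: ('a \<Rightarrow> complex) \<Rightarrow> complex. \<phi> (\<lambda>x. u0 (s \<otimes> x)) = c}"
  have cl: "closed ?L1" "closed ?L2" "closed ?L3" "closed ?L4" "closed (?M s)" for s
    by (intro closed_Collect_all closed_Collect_imp closed_Collect_eq closed_Collect_le open_Collect_const
       continuous_intros continuous_on_product_coordinates)+
  have ne: "S \<noteq> {}" if "x \<in> S" for x and S :: "(('a \<Rightarrow> complex) \<Rightarrow> complex) set" using that by blast
  have ne': thesis' if "S \<noteq> {}" "\<And>x. x \<in> S \<Longrightarrow> thesis'" for thesis' and S :: "(('a \<Rightarrow> complex) \<Rightarrow> complex) set"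
    using that by blast
  have "(?K \<inter> ?L1 \<inter> ?L2 \<inter> ?L3 \<inter> ?L4) \<inter> (\<Inter>s\<in>H. ?M s) \<noteq> {}"
  proof (rule compact_imp_fip_image)
    show "compact (?K \<inter> ?L1 \<inter> ?L2 \<inter> ?L3 \<inter> ?L4)" using K cl by (intro compact_Int_closed)
    show "closed (?M s)" for s by (rule cl)
    fix F assume F: "finite F" "F \<subseteq> H"
    \<comment> \<open>Thickness provides a single point of \<open>H\<close> whose evaluation meets
      finitely many of the conditions at once.\<close>
    then obtain g where g: "g \<in> H" "\<forall>s\<in>F. u0 (s \<otimes> g) = c" using thick by blast
    have gc: "g \<in> carrier G" using g H by blast
    have eb: "e g u = u g" if "bdd_fun G u" for u using that by (simp add: e_def)
    have f1: "e g u \<in> (if bdd_fun G u then cball 0 (B u) else {0})" for u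
      using B[of u g] gc by (auto simp: e_def)
    have f2: "e g (\<lambda>t. u t + v t) = e g u + e g v" if "bdd_fun G u" "bdd_fun G v" for u v
      using that bdd_fun_add[OF that] by (simp add: eb)
    have f3: "e g (\<lambda>t. k * u t) = k * e g u" if "bdd_fun G u" for k u
      using that bdd_fun_mult[OF bdd_fun_const that, of k] by (simp add: eb)
    have f4: "cmod (e g u) \<le> C" if "bdd_fun G u" "\<forall>t\<in>H. cmod (u t) \<le> C" for u C
      using that g by (simp add: eb)
    have f5: "e g (\<lambda>t. 1) = 1" by (simp add: eb)
    have f6: "e g (\<lambda>x. u0 (s \<otimes> x)) = c" if "s \<in> F" for s
    proof -
      have "s \<in> carrier G" using that F H by blast
      then show ?thesis using that g bdd_fun_left[OF u0] by (simp add: eb)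
    qed
    have "e g \<in> ?K" by (rule CollectI, rule allI, rule f1)
    moreover have "e g \<in> ?L1" by (rule CollectI, rule allI, rule allI, rule impI, erule conjE, rule f2)
    moreover have "e g \<in> ?L2" by (rule CollectI, rule allI, rule allI, rule impI, rule f3)
    moreover have "e g \<in> ?L3" by (rule CollectI, rule allI, rule allI, rule impI, erule conjE, rule f4)
    moreover have "e g \<in> ?L4" by (rule CollectI, rule f5)
    moreover have "e g \<in> (\<Inter>s\<in>F. ?M s)" by (rule INT_I, rule CollectI, rule f6)
    ultimately have "e g \<in> (?K \<inter> ?L1 \<inter> ?L2 \<inter> ?L3 \<inter> ?L4) \<inter> (\<Inter>s\<in>F. ?M s)"
      by (intro IntI)
    then show "(?K \<inter> ?L1 \<inter> ?L2 \<inter> ?L3 \<inter> ?L4) \<inter> (\<Inter>s\<in>F. ?M s) \<noteq> {}" by (rule ne)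
  qed
  then obtain \<phi> where \<phi>: "\<phi> \<in> (?K \<inter> ?L1 \<inter> ?L2 \<inter> ?L3 \<inter> ?L4) \<inter> (\<Inter>s\<in>H. ?M s)" by (rule ne')
  have L: "\<phi> \<in> ?L1" "\<phi> \<in> ?L2" "\<phi> \<in> ?L3" "\<phi> \<in> ?L4" "\<phi> \<in> (\<Inter>s\<in>H. ?M s)"
    using \<phi> by (simp_all only: Int_iff)
  show ?thesis
  proof (rule that[of \<phi>])
    show "\<phi> (\<lambda>t. u t + v t) = \<phi> u + \<phi> v" if "bdd_fun G u" "bdd_fun G v" for u v
      using L(1)[unfolded mem_Collect_eq, rule_format, OF conjI[OF that]] .
    show "\<phi> (\<lambda>t. k * u t) = k * \<phi> u" if "bdd_fun G u" for k u
      using L(2)[unfolded mem_Collect_eq, rule_format, OF that] .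
    show "cmod (\<phi> u) \<le> C" if u: "bdd_fun G u" and C: "\<And>t. t \<in> H \<Longrightarrow> cmod (u t) \<le> C" for u C
      using L(3)[unfolded mem_Collect_eq, THEN spec, THEN spec, THEN mp, OF conjI[OF u ballI]] C .
    show "\<phi> (\<lambda>t. 1) = 1" using L(4)[unfolded mem_Collect_eq] .
    show "\<phi> (\<lambda>x. u0 (s \<otimes> x)) = c" if "s \<in> H" for s
      using L(5)[THEN INT_D, OF that, unfolded mem_Collect_eq] .
  qed
qed

text \<open>\<open>H\<close> acts freely on \<open>G\<close> by left multiplication. With a
  representative \<rho>(x) of each coset H x, the map sending x to x times the inverse of \<rho>(x)
  commutes with this action. It transfers the invariance of a mean on \<open>G\<close> to
  functionals on \<open>H\<close>.\<close>

lemma left_equivariant_retraction: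
  assumes H: "subgroup H G"
  obtains \<pi> where "\<And>x. x \<in> carrier G \<Longrightarrow> \<pi> x \<in> H" "\<And>h x. h \<in> H \<Longrightarrow> x \<in> carrier G \<Longrightarrow> \<pi> (h \<otimes> x) = h \<otimes> \<pi> x"
proof -
  have Hc: "H \<subseteq> carrier G" by (rule subgroup.subset[OF H])
  define \<rho> where "\<rho> x = (SOME y. y \<in> H #> x)" for x
  have \<rho>: "\<rho> x \<in> H #> x" if "x \<in> carrier G" for x
    unfolding \<rho>_def by (rule someI[of _ x]) (use rcos_self[OF that H] in simp)
  have \<rho>c: "\<rho> x \<in> carrier G" if "x \<in> carrier G" for x using \<rho>[OF that] r_coset_subset_G[OF Hc that] by blast
  have eq: "\<rho> (h \<otimes> x) = \<rho> x" if "h \<in> H" "x \<in> carrier G" for h x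
  proof -
    have "h \<otimes> x \<in> H #> x" using that by (auto simp: r_coset_def)
    then have "H #> (h \<otimes> x) = H #> x" using repr_independence[OF _ that(2) H] by simp
    then show ?thesis by (simp add: \<rho>_def)
  qed
  show ?thesis
  proof (rule that[of "\<lambda>x. x \<otimes> inv (\<rho> x)"])
    fix x assume x: "x \<in> carrier G"
    obtain h where h: "h \<in> H" "\<rho> x = h \<otimes> x" using \<rho>[OF x] by (auto simp: r_coset_def)
    have hc: "h \<in> carrier G" using h Hc by blast
    have "x \<otimes> inv (\<rho> x) = inv h" using h x hc by (simp add: inv_mult_group m_assoc[symmetric])
    then show "x \<otimes> inv (\<rho> x) \<in> H" using h H by (simp add: subgroup.m_inv_closed)
    fix k assume k: "k \<in> H"
    show "k \<otimes> x \<otimes> inv (\<rho> (k \<otimes> x)) = k \<otimes> (x \<otimes> inv (\<rho> x))"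
      using k x Hc \<rho>c[OF x] by (simp add: eq m_assoc subset_iff)
  qed
qed

text \<open>The difference \<delta> of two limits kills 1 and equals 1 on every translate by
  \<open>H\<close> of the indicator of \<open>A\<close>, but carries no invariance. Averaging the
  translates of \<delta> by \<pi>(x), with x distributed according to the mean of \<open>G\<close>,
  yields invariance under \<open>H\<close> and keeps the value 1 at the indicator.\<close>

lemma nonzero_difference_exists:
  assumes am: "amenable G" and H: "subgroup H G" "infinite H"
  shows "\<exists>\<Gamma>\<in>differences_on G H. \<Gamma> \<noteq> 0"
proof -
  have Hc: "H \<subseteq> carrier G" by (rule subgroup.subset[OF H(1)])
  obtain M where M: "M \<in> l1_bidual G" "M (one_functional G) = 1"
    "\<And>s. s \<in> carrier G \<Longrightarrow> arens G (pt s) M = M" using am unfolding amenable_def by blast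
  have M1: "ev G M (\<lambda>t. 1) = 1" using M(2) by (simp add: ev_def one_functional_def)
  have Minv: "ev G M (\<lambda>x. u (s \<otimes> x)) = ev G M u" if "s \<in> carrier G" "bdd_fun G u" for s u
    using ev_translate[OF that(1) M(1) that(2)] M(3)[OF that(1)] by simp
  obtain A where A: "\<And>F. finite F \<Longrightarrow> F \<subseteq> H \<Longrightarrow> \<exists>g\<in>H. \<forall>s\<in>F. s \<otimes> g \<in> A"
    "\<And>F. finite F \<Longrightarrow> F \<subseteq> H \<Longrightarrow> \<exists>g\<in>H. \<forall>s\<in>F. s \<otimes> g \<notin> A" by (rule thick_set_with_thick_complement[OF H]) (rule that)
  define a where "a x = (if x \<in> A then 1 else (0::complex))" for x
  have ab: "bdd_fun G a" by (simp add: a_def[abs_def])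
  have thick: "\<exists>g\<in>H. \<forall>s\<in>F. a (s \<otimes> g) = 1" "\<exists>g\<in>H. \<forall>s\<in>F. a (s \<otimes> g) = 0" if "finite F" "F \<subseteq> H" for F
    using A(1)[OF that] A(2)[OF that] by (auto simp: a_def intro!: bexI)
  obtain \<phi> where \<phi>: "\<And>u v. bdd_fun G u \<Longrightarrow> bdd_fun G v \<Longrightarrow> \<phi> (\<lambda>t. u t + v t) = \<phi> u + \<phi> v"
    "\<And>k u. bdd_fun G u \<Longrightarrow> \<phi> (\<lambda>t. k * u t) = k * \<phi> u"
    "\<And>u C. bdd_fun G u \<Longrightarrow> (\<And>t. t \<in> H \<Longrightarrow> cmod (u t) \<le> C) \<Longrightarrow> cmod (\<phi> u) \<le> C"
    "\<phi> (\<lambda>t. 1) = 1" "\<And>s. s \<in> H \<Longrightarrow> \<phi> (\<lambda>x. a (s \<otimes> x)) = 1"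
    by (rule cluster_evaluation[OF Hc thick(1) ab]) (assumption | rule that | blast)+
  obtain \<psi> where \<psi>: "\<And>u v. bdd_fun G u \<Longrightarrow> bdd_fun G v \<Longrightarrow> \<psi> (\<lambda>t. u t + v t) = \<psi> u + \<psi> v"
    "\<And>k u. bdd_fun G u \<Longrightarrow> \<psi> (\<lambda>t. k * u t) = k * \<psi> u"
    "\<And>u C. bdd_fun G u \<Longrightarrow> (\<And>t. t \<in> H \<Longrightarrow> cmod (u t) \<le> C) \<Longrightarrow> cmod (\<psi> u) \<le> C"
    "\<psi> (\<lambda>t. 1) = 1" "\<And>s. s \<in> H \<Longrightarrow> \<psi> (\<lambda>x. a (s \<otimes> x)) = 0"
    by (rule cluster_evaluation[OF Hc thick(2) ab]) (assumption | rule that | blast)+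
  define \<delta> where "\<delta> u = \<phi> u - \<psi> u" for u
  have \<delta>: "\<And>u v. bdd_fun G u \<Longrightarrow> bdd_fun G v \<Longrightarrow> \<delta> (\<lambda>t. u t + v t) = \<delta> u + \<delta> v"
    "\<And>k u. bdd_fun G u \<Longrightarrow> \<delta> (\<lambda>t. k * u t) = k * \<delta> u"
    "\<delta> (\<lambda>t. 1) = 0" "\<And>s. s \<in> H \<Longrightarrow> \<delta> (\<lambda>x. a (s \<otimes> x)) = 1"
    using \<phi>(1,2,4,5) \<psi>(1,2,4,5) by (simp_all add: \<delta>_def algebra_simps)
  have \<delta>b: "cmod (\<delta> u) \<le> 2 * C" if "bdd_fun G u" "\<And>t. t \<in> H \<Longrightarrow> cmod (u t) \<le> C" for u C
    using \<phi>(3)[OF that] \<psi>(3)[OF that] norm_triangle_ineq4[of "\<phi> u" "\<psi> u"] by (simp add: \<delta>_def)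
  have \<delta>e: "\<delta> u = \<delta> v" if "bdd_fun G u" "bdd_fun G v" "\<And>t. t \<in> H \<Longrightarrow> u t = v t" for u v
  proof -
    have m: "bdd_fun G (\<lambda>t. (-1) * v t)" by (rule bdd_fun_mult[OF bdd_fun_const that(2)])
    have "cmod (\<delta> (\<lambda>t. u t + (-1) * v t)) \<le> 2 * 0"
      by (rule \<delta>b) (use that bdd_fun_add[OF that(1) m] in auto)
    then show ?thesis unfolding \<delta>(1)[OF that(1) m] \<delta>(2)[OF that(2)] by simp
  qed
  obtain \<pi> where \<pi>: "\<And>x. x \<in> carrier G \<Longrightarrow> \<pi> x \<in> H" "\<And>h x. h \<in> H \<Longrightarrow> x \<in> carrier G \<Longrightarrow> \<pi> (h \<otimes> x) = h \<otimes> \<pi> x"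
    by (rule left_equivariant_retraction[OF H(1)]) (rule that)
  \<comment> \<open>Since \<pi> commutes with left multiplication by \<open>H\<close>, translating u
    by k in \<open>H\<close> translates \<open>w u\<close> by k on the carrier, and the mean absorbs
    this.\<close>
  define w where "w u x = \<delta> (\<lambda>y. u (\<pi> x \<otimes> y))" for u x
  have ub: "bdd_fun G (\<lambda>y. u (\<pi> x \<otimes> y))" if "bdd_fun G u" "x \<in> carrier G" for u x
    using bdd_fun_left[OF that(1)] \<pi>(1)[OF that(2)] Hc by blast
  have wC: "cmod (w u x) \<le> 2 * C" if "bdd_fun G u" "\<And>t. t \<in> H \<Longrightarrow> cmod (u t) \<le> C" "x \<in> carrier G" for u C x
    unfolding w_def using \<pi>(1)[OF that(3)] subgroup.m_closed[OF H(1)]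
    by (intro \<delta>b ub that(1,3) that(2)) blast
  have wb: "bdd_fun G (w u)" if u: "bdd_fun G u" for u
  proof -
    obtain C where C: "\<And>t. t \<in> carrier G \<Longrightarrow> cmod (u t) \<le> C" using bdd_fun_bound[OF u] by blast
    show ?thesis by (rule bdd_funI[of _ _ "2 * C"], rule wC[OF u]) (use C Hc in auto)
  qed
  obtain K where K: "K \<ge> 0" "\<And>u C. (\<And>t. t \<in> carrier G \<Longrightarrow> cmod (u t) \<le> C) \<Longrightarrow> C \<ge> 0 \<Longrightarrow> cmod (ev G M u) \<le> K * C"
    using ev_bound[OF M(1)] by metis
  let ?f = "\<lambda>u. ev G M (w u)"
  have 1: "?f (\<lambda>t. u t + v t) = ?f u + ?f v" if "bdd_fun G u" "bdd_fun G v" for u v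
    unfolding ev_add[OF M(1) wb[OF that(1)] wb[OF that(2)], symmetric]
    by (rule ev_cong) (use that in \<open>simp add: w_def \<delta>(1)[OF ub ub]\<close>)
  have 2: "?f (\<lambda>t. k * u t) = k * ?f u" if "bdd_fun G u" for k u
    unfolding ev_scale[OF M(1) wb[OF that], symmetric]
    by (rule ev_cong) (use that in \<open>simp add: w_def \<delta>(2)[OF ub]\<close>)
  have 3: "cmod (?f u) \<le> (K * 2) * C" if "\<And>t. t \<in> carrier G \<Longrightarrow> cmod (u t) \<le> C" "C \<ge> 0" for u C
  proof -
    have "cmod (?f u) \<le> K * (2 * C)"
      by (rule K(2), rule wC) (use that Hc in \<open>auto intro: bdd_funI\<close>)
    then show ?thesis by simp
  qed
  let ?\<Gamma> = "bidual_of G ?f"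
  have cl: "?\<Gamma> \<in> l1_bidual G" by (rule bidual_of(1)[OF carrier_nonempty 1 2 3])
  have e: "ev G ?\<Gamma> u = ?f u" if "bdd_fun G u" for u by (rule bidual_of(2)[OF carrier_nonempty 1 2 3 that])
  have "ev G ?\<Gamma> u = ev G ?\<Gamma> v" if uv: "bdd_fun G u" "bdd_fun G v" "\<forall>s\<in>H. u s = v s" for u v
    unfolding e[OF uv(1)] e[OF uv(2)]
  proof (rule ev_cong)
    fix x assume x: "x \<in> carrier G"
    show "w u x = w v x" unfolding w_def
      by (rule \<delta>e) (use ub uv x subgroup.m_closed[OF H(1) \<pi>(1)[OF x]] in auto)
  qed
  moreover have "ev G ?\<Gamma> (\<lambda>x. u (k \<otimes> x)) = ev G ?\<Gamma> u" if k: "k \<in> H" and u: "bdd_fun G u" for k u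
  proof -
    have kc: "k \<in> carrier G" using k Hc by blast
    have "ev G M (w (\<lambda>x. u (k \<otimes> x))) = ev G M (\<lambda>x. w u (k \<otimes> x))"
    proof (rule ev_cong)
      fix x assume x: "x \<in> carrier G"
      have px: "\<pi> x \<in> H" "\<pi> (k \<otimes> x) = k \<otimes> \<pi> x" using \<pi> x k by auto
      show "w (\<lambda>x. u (k \<otimes> x)) x = w u (k \<otimes> x)" unfolding w_def px(2)
      proof (rule \<delta>e)
        show "bdd_fun G (\<lambda>y. u (k \<otimes> (\<pi> x \<otimes> y)))" using ub[OF bdd_fun_left[OF u kc] x] .
        show "bdd_fun G (\<lambda>y. u (k \<otimes> \<pi> x \<otimes> y))" using ub[OF u, of "k \<otimes> x"] px kc x by simp
        fix y assume "y \<in> H"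
        then show "u (k \<otimes> (\<pi> x \<otimes> y)) = u (k \<otimes> \<pi> x \<otimes> y)" using px Hc kc by (simp add: m_assoc subset_iff)
      qed
    qed
    then show ?thesis unfolding e[OF bdd_fun_left[OF u kc]] e[OF u] using Minv[OF kc wb[OF u]] by simp
  qed
  moreover have "ev G ?\<Gamma> (\<lambda>t. 1) = 0"
    using e[of "\<lambda>t. 1"] ev_zero[OF M(1)] by (simp add: w_def[abs_def] \<delta>(3))
  ultimately have "?\<Gamma> \<in> differences_on G H"
    unfolding differences_on_def supported_on_def invariant_under_def using cl by blast
  moreover have "ev G ?\<Gamma> a = ev G M (\<lambda>t. 1)"
    unfolding e[OF ab] by (rule ev_cong) (simp add: w_def \<delta>(4) \<pi>(1))
  then have "?\<Gamma> \<noteq> 0" using M1 ev_plus(2)[of a] by (metis zero_neq_one)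
  ultimately show ?thesis by blast
qed

lemma direct_list_not_vanish:
  assumes am: "amenable G" and Ks: "Ks \<noteq> []" "direct_list Ks" "\<And>K. K \<in> set Ks \<Longrightarrow> subnormal K G \<and> infinite K"
  shows "\<not> products_vanish (arens G) (A_sn G) (length Ks)"
proof
  assume v: "products_vanish (arens G) (A_sn G) (length Ks)"
  have "subgroup K G \<and> (\<exists>\<Gamma>\<in>differences_on G K. \<Gamma> \<noteq> 0)" if "K \<in> set Ks" for K
    using Ks(3)[OF that] subnormal_subgroup nonzero_difference_exists[OF am] by blast
  then obtain xs where xs: "length xs = length Ks" "set xs \<subseteq> (\<Union>K\<in>set Ks. differences_on G K)" "list_product (arens G) xs \<noteq> 0"
    using direct_list_product_nonzero[OF Ks(1,2)] by blast
  have "set xs \<subseteq> sn_differences" using xs(2) Ks(3) unfolding sn_differences_def by blast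
  then show False using products_vanish_A_snD[OF v xs(1)] xs(3) by blast
qed

end

section \<open>Subnormal subgroups of just infinite groups\<close>

context group begin

definition cz :: "'a set \<Rightarrow> 'a set" where
  "cz A = {g \<in> carrier G. \<forall>a\<in>A. g \<otimes> a = a \<otimes> g}"

abbreviation nrm :: "'a set \<Rightarrow> 'a set \<Rightarrow> bool" where
  "nrm N A \<equiv> \<forall>n\<in>N. cj n A = A"

lemma cz_subset: "cz A \<subseteq> carrier G" by (auto simp: cz_def)

lemma cz_anti: "A \<subseteq> B \<Longrightarrow> cz B \<subseteq> cz A" by (auto simp: cz_def)

lemma cz_iff: "A \<subseteq> carrier G \<Longrightarrow> B \<subseteq> carrier G \<Longrightarrow> A \<subseteq> cz B \<longleftrightarrow> B \<subseteq> cz A"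
  by (auto simp: cz_def)

lemma czD: "g \<in> cz A \<Longrightarrow> a \<in> A \<Longrightarrow> g \<otimes> a = a \<otimes> g" by (auto simp: cz_def)

lemma cz_subgroup:
  assumes "A \<subseteq> carrier G" shows "subgroup (cz A) G"
proof (rule subgroupI)
  show "cz A \<subseteq> carrier G" by (rule cz_subset)
  have "\<one> \<in> cz A" using assms by (auto simp: cz_def subset_iff)
  then show "cz A \<noteq> {}" by blast
  fix g assume g: "g \<in> cz A"
  have gc: "g \<in> carrier G" using g cz_subset by blast
  have "inv g \<otimes> a = a \<otimes> inv g" if a: "a \<in> A" for a
  proof -
    have ac: "a \<in> carrier G" using a assms by blast
    have "inv g \<otimes> a = inv g \<otimes> (a \<otimes> g) \<otimes> inv g" using ac gc by (simp add: m_assoc)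
    also have "\<dots> = a \<otimes> inv g" unfolding czD[OF g a, symmetric] using ac gc by (simp add: inv_mult_cancel)
    finally show ?thesis .
  qed
  then show "inv g \<in> cz A" using gc by (simp add: cz_def)
  fix h assume h: "h \<in> cz A"
  have hc: "h \<in> carrier G" using h cz_subset by blast
  have "g \<otimes> h \<otimes> a = a \<otimes> (g \<otimes> h)" if a: "a \<in> A" for a
  proof -
    have ac: "a \<in> carrier G" using a assms by blast
    have "g \<otimes> h \<otimes> a = g \<otimes> (a \<otimes> h)" using ac gc hc czD[OF h a] by (simp add: m_assoc)
    also have "\<dots> = a \<otimes> (g \<otimes> h)" using ac gc hc czD[OF g a] by (simp add: m_assoc[symmetric])
    finally show ?thesis .
  qed
  then show "g \<otimes> h \<in> cz A" using gc hc by (simp add: cz_def)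
qed

lemma conjugate_mult:
  "g \<in> carrier G \<Longrightarrow> a \<in> carrier G \<Longrightarrow> b \<in> carrier G \<Longrightarrow>
   g \<otimes> (a \<otimes> b) \<otimes> inv g = (g \<otimes> a \<otimes> inv g) \<otimes> (g \<otimes> b \<otimes> inv g)"
  by (simp add: m_assoc inv_mult_cancel)

lemma conjugate_cz_subset:
  assumes A: "A \<subseteq> carrier G" and g: "g \<in> carrier G" shows "cj g (cz A) \<subseteq> cz (cj g A)"
proof
  fix x assume "x \<in> cj g (cz A)"
  then obtain c where c: "c \<in> cz A" "x = g \<otimes> c \<otimes> inv g" using conjugate_set_image[OF cz_subset g] by auto
  have cc: "c \<in> carrier G" using c cz_subset by blast
  have "x \<otimes> y = y \<otimes> x" if y: "y \<in> cj g A" for y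
  proof -
    obtain a where a: "a \<in> A" "y = g \<otimes> a \<otimes> inv g" using y conjugate_set_image[OF A g] by auto
    have ac: "a \<in> carrier G" using a A by blast
    show ?thesis unfolding c(2) a(2) conjugate_mult[OF g cc ac, symmetric] conjugate_mult[OF g ac cc, symmetric]
      using czD[OF c(1) a(1)] by simp
  qed
  then show "x \<in> cz (cj g A)" using c cc g by (auto simp: cz_def)
qed

lemma conjugate_cz:
  assumes A: "A \<subseteq> carrier G" and g: "g \<in> carrier G" shows "cj g (cz A) = cz (cj g A)"
proof
  have "cj (inv g) (cz (cj g A)) \<subseteq> cz (cj (inv g) (cj g A))"
    by (rule conjugate_cz_subset) (use A g conjugate_subset_carrier in auto)
  then have "cj (inv g) (cz (cj g A)) \<subseteq> cz A" using conjugate_inv_conjugate(1)[OF A g] by simp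
  then have "cj g (cj (inv g) (cz (cj g A))) \<subseteq> cj g (cz A)" by (rule conjugate_mono)
  then show "cz (cj g A) \<subseteq> cj g (cz A)" using conjugate_inv_conjugate(2)[OF cz_subset g] by simp
qed (rule conjugate_cz_subset[OF A g])

lemma nrmI:
  assumes "subgroup N G" "A \<subseteq> carrier G" "\<And>n. n \<in> N \<Longrightarrow> cj n A \<subseteq> A" shows "nrm N A"
proof
  fix n assume n: "n \<in> N"
  have nc: "n \<in> carrier G" using n subgroup.subset[OF assms(1)] by blast
  have "A = cj n (cj (inv n) A)" using conjugate_inv_conjugate(2)[OF assms(2) nc] by simp
  also have "\<dots> \<subseteq> cj n A" using n assms by (intro conjugate_mono assms(3)) (simp add: subgroup.m_inv_closed)
  finally show "cj n A = A" using assms(3)[OF n] by blast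
qed

lemma nrm_conj_mem: "nrm N A \<Longrightarrow> A \<subseteq> carrier G \<Longrightarrow> n \<in> N \<Longrightarrow> n \<in> carrier G \<Longrightarrow> a \<in> A \<Longrightarrow> n \<otimes> a \<otimes> inv n \<in> A"
  using conjugate_set_image by blast

lemma nrm_Int: "nrm N A \<Longrightarrow> nrm N B \<Longrightarrow> A \<subseteq> carrier G \<Longrightarrow> B \<subseteq> carrier G \<Longrightarrow> N \<subseteq> carrier G \<Longrightarrow> nrm N (A \<inter> B)"
  by (auto simp: conjugate_Int subset_iff)

lemma nrm_cz: "nrm N A \<Longrightarrow> A \<subseteq> carrier G \<Longrightarrow> N \<subseteq> carrier G \<Longrightarrow> nrm N (cz A)"
  using conjugate_cz by (metis subsetD)

lemma nrm_subset: "nrm N A \<Longrightarrow> M \<subseteq> N \<Longrightarrow> nrm M A" by blast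

lemma nrm_normal: "N \<lhd> G \<Longrightarrow> nrm (carrier G) N" using normal_conjugate by blast

lemma nrm_self: "subgroup A G \<Longrightarrow> nrm A A"
  using normal_restrict_conjugate[of A A] by (auto simp: normal_restrict_iff subgroup.m_closed subgroup.m_inv_closed)

lemma nrm_conjugate:
  assumes "N \<lhd> G" "nrm N A" "A \<subseteq> carrier G" "g \<in> carrier G" shows "nrm N (cj g A)"
proof
  fix n assume n: "n \<in> N"
  have Nc: "N \<subseteq> carrier G" using assms(1) by (simp add: normal_imp_subgroup subgroup.subset)
  have nc: "n \<in> carrier G" using n Nc by blast
  have "inv g \<otimes> n \<otimes> g \<in> N" using n assms(1,4) by (simp add: normal.inv_op_closed1)
  then have "cj g (cj (inv g \<otimes> n \<otimes> g) A) = cj g A" using assms(2) by simp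
  moreover have "cj g (cj (inv g \<otimes> n \<otimes> g) A) = cj n (cj g A)"
    using assms(3,4) nc by (simp add: conjugate_conjugate m_assoc inv_mult_cancel)
  ultimately show "cj n (cj g A) = cj g A" by simp
qed

text \<open>The commutator of a and b lies in both subgroups, because each normalizes the
  other.\<close>

lemma commute_if_trivial_Int:
  assumes "subgroup A G" "subgroup B G" "nrm B A" "nrm A B" "A \<inter> B \<subseteq> {\<one>}"
  shows "B \<subseteq> cz A"
proof
  fix b assume b: "b \<in> B"
  have c: "A \<subseteq> carrier G" "B \<subseteq> carrier G" using assms subgroup.subset by blast+
  have bc: "b \<in> carrier G" using b c by blast
  have "b \<otimes> a = a \<otimes> b" if a: "a \<in> A" for a
  proof -
    have ac: "a \<in> carrier G" using a c by blast
    have 1: "b \<otimes> a \<otimes> inv b \<in> A" "a \<otimes> inv b \<otimes> inv a \<in> B"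
      using nrm_conj_mem[OF assms(3) c(1) b bc a] nrm_conj_mem[OF assms(4) c(2) a ac subgroup.m_inv_closed[OF assms(2) b]] by auto
    have "(b \<otimes> a \<otimes> inv b) \<otimes> inv a \<in> A" using 1 a assms(1) by (simp add: subgroup.m_closed subgroup.m_inv_closed)
    moreover have "b \<otimes> (a \<otimes> inv b \<otimes> inv a) \<in> B" using 1 b assms(2) by (simp add: subgroup.m_closed)
    ultimately have "(b \<otimes> a \<otimes> inv b) \<otimes> inv a = \<one>" using assms(5) ac bc by (auto simp: m_assoc)
    then have "b \<otimes> a \<otimes> inv b = a" using ac bc by (metis inv_closed inv_equality inv_inv m_closed)
    then show ?thesis using ac bc by (metis inv_closed inv_solve_right' m_closed)
  qed
  then show "b \<in> cz A" using bc by (simp add: cz_def)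
qed

lemma set_mult_commuting_subgroup:
  assumes "subgroup A G" "subgroup B G" "B \<subseteq> cz A"
  shows "subgroup (A <#> B) G" "A \<subseteq> A <#> B" "B \<subseteq> A <#> B"
proof -
  have c: "A \<subseteq> carrier G" "B \<subseteq> carrier G" using assms subgroup.subset by blast+
  show sub: "A \<subseteq> A <#> B" "B \<subseteq> A <#> B"
    using c subgroup.one_closed[OF assms(1)] subgroup.one_closed[OF assms(2)]
    by (force simp: set_mult_def subset_iff)+
  have com: "b \<otimes> a = a \<otimes> b" if "a \<in> A" "b \<in> B" for a b using that assms(3) czD by blast
  show "subgroup (A <#> B) G"
  proof (rule subgroupI)
    show "A <#> B \<subseteq> carrier G" using c by (auto simp: set_mult_def)
    show "A <#> B \<noteq> {}" using sub subgroup.one_closed[OF assms(1)] by blast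
    fix x assume "x \<in> A <#> B"
    then obtain a b where x: "a \<in> A" "b \<in> B" "x = a \<otimes> b" by (auto simp: set_mult_def)
    have xc: "a \<in> carrier G" "b \<in> carrier G" using x c by auto
    have "inv x = inv a \<otimes> inv b" using x xc com[OF x(1,2)] by (metis inv_mult_group)
    then show "inv x \<in> A <#> B" using x assms by (auto simp: set_mult_def intro!: bexI subgroup.m_inv_closed)
    fix y assume "y \<in> A <#> B"
    then obtain a' b' where y: "a' \<in> A" "b' \<in> B" "y = a' \<otimes> b'" by (auto simp: set_mult_def)
    have yc: "a' \<in> carrier G" "b' \<in> carrier G" using y c by auto
    have "x \<otimes> y = a \<otimes> (b \<otimes> a') \<otimes> b'" using x y xc yc by (simp add: m_assoc)
    also have "\<dots> = (a \<otimes> a') \<otimes> (b \<otimes> b')" using com[OF y(1) x(2)] xc yc by (simp add: m_assoc)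
    finally show "x \<otimes> y \<in> A <#> B" using x y assms by (auto simp: set_mult_def intro!: bexI subgroup.m_closed)
  qed
qed

lemma conjugate_set_mult:
  assumes "A \<subseteq> carrier G" "B \<subseteq> carrier G" "g \<in> carrier G" shows "cj g (A <#> B) = cj g A <#> cj g B"
proof -
  have "A <#> B \<subseteq> carrier G" using assms by (auto simp: set_mult_def)
  moreover have "g \<otimes> (a \<otimes> b) \<otimes> inv g = (g \<otimes> a \<otimes> inv g) \<otimes> (g \<otimes> b \<otimes> inv g)" if "a \<in> A" "b \<in> B" for a b
    using that assms by (intro conjugate_mult) auto
  ultimately show ?thesis using assms by (simp add: conjugate_set_image) (force simp: set_mult_def)
qed

lemma conjugate_INT:
  assumes "\<T> \<noteq> {}" "\<And>A. A \<in> \<T> \<Longrightarrow> A \<subseteq> carrier G" "g \<in> carrier G"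
  shows "cj g (\<Inter>\<T>) = \<Inter>(cj g ` \<T>)"
proof -
  have c: "\<Inter>\<T> \<subseteq> carrier G" using assms by blast
  have "x \<in> cj g (\<Inter>\<T>) \<longleftrightarrow> x \<in> \<Inter>(cj g ` \<T>)" if x: "x \<in> carrier G" for x
    using conjugate_mem_iff[OF c assms(3) x] conjugate_mem_iff[OF assms(2) assms(3) x] by auto
  moreover have "cj g (\<Inter>\<T>) \<subseteq> carrier G" by (rule conjugate_subset_carrier[OF c assms(3)])
  moreover have "\<Inter>(cj g ` \<T>) \<subseteq> carrier G"
  proof -
    obtain A where A: "A \<in> \<T>" using assms(1) by blast
    then have "\<Inter>(cj g ` \<T>) \<subseteq> cj g A" by blast
    also have "\<dots> \<subseteq> carrier G" by (rule conjugate_subset_carrier[OF assms(2)[OF A] assms(3)])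
    finally show ?thesis .
  qed
  ultimately show ?thesis by blast
qed

text \<open>As \<open>N\<close> normalizes \<open>A\<close>, the conjugate by g depends only on the
  coset g N.\<close>

lemma conjugates_finite:
  assumes "carrier G \<lessapprox> N" "nrm N A" "A \<subseteq> carrier G" "N \<subseteq> carrier G"
  shows "finite ((\<lambda>g. cj g A) ` carrier G)"
proof -
  obtain T where T: "finite T" "T \<subseteq> carrier G" "\<And>a. a \<in> carrier G \<Longrightarrow> \<exists>t\<in>T. inv t \<otimes> a \<in> N"
    using assms unfolding virtually_le_def by metis
  have "(\<lambda>g. cj g A) ` carrier G \<subseteq> (\<lambda>g. cj g A) ` T"
  proof
    fix B assume "B \<in> (\<lambda>g. cj g A) ` carrier G"
    then obtain g where g: "g \<in> carrier G" "B = cj g A" by blast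
    then obtain t where t: "t \<in> T" "inv t \<otimes> g \<in> N" using T by blast
    then have "cj t (cj (inv t \<otimes> g) A) = cj t A" using assms by simp
    moreover have tc: "t \<in> carrier G" using t T by blast
    ultimately have "cj g A = cj t A" using g assms(3) by (simp add: conjugate_conjugate inv_mult_cancel)
    then show "B \<in> (\<lambda>g. cj g A) ` T" using t g by blast
  qed
  then show ?thesis using finite_imageI[OF T(1)] finite_subset by blast
qed

lemma conjugate_permutes:
  assumes "A \<subseteq> carrier G" "g \<in> carrier G"
  shows "cj g ` ((\<lambda>h. cj h A) ` carrier G) = (\<lambda>h. cj h A) ` carrier G"
proof -
  have 1: "cj g (cj h A) = cj (g \<otimes> h) A" if "h \<in> carrier G" for h using assms that by (simp add: conjugate_conjugate)
  have 2: "cj h A = cj g (cj (inv g \<otimes> h) A)" if "h \<in> carrier G" for h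
    using assms that by (simp add: conjugate_conjugate inv_mult_cancel)
  show ?thesis unfolding image_image
  proof (intro equalityI image_subsetI)
    fix h assume h: "h \<in> carrier G"
    show "cj g (cj h A) \<in> (\<lambda>h. cj h A) ` carrier G" unfolding 1[OF h] using assms(2) h by simp
    have "inv g \<otimes> h \<in> carrier G" using assms(2) h by simp
    then show "cj h A \<in> (\<lambda>h. cj g (cj h A)) ` carrier G" using 2[OF h] by (rule rev_image_eqI)
  qed
qed

lemma conjugate_inj: "g \<in> carrier G \<Longrightarrow> A \<subseteq> carrier G \<Longrightarrow> B \<subseteq> carrier G \<Longrightarrow> cj g A = cj g B \<Longrightarrow> A = B"
  by (metis conjugate_inv_conjugate(1))

text \<open>An intersection of as many conjugates as possible, subject to being nontrivial.\<close>

lemma minimal_intersection_of_conjugates: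
  assumes A: "subgroup A G" "A \<noteq> {\<one>}" and fin: "finite ((\<lambda>g. cj g A) ` carrier G)"
  obtains B where "subgroup B G" "B \<noteq> {\<one>}" "B \<subseteq> A"
    "\<And>g. g \<in> carrier G \<Longrightarrow> cj g B = B \<or> B \<inter> cj g B = {\<one>}"
    "\<exists>\<T>. \<T> \<noteq> {} \<and> \<T> \<subseteq> (\<lambda>g. cj g A) ` carrier G \<and> B = \<Inter>\<T>"
proof -
  let ?C = "(\<lambda>g. cj g A) ` carrier G"
  let ?P = "\<lambda>\<T>. \<T> \<subseteq> ?C \<and> A \<in> \<T> \<and> \<Inter>\<T> \<noteq> {\<one>}"
  have Ac: "A \<subseteq> carrier G" by (rule subgroup.subset[OF A(1)])
  have "A \<in> ?C" using conjugate_one[OF Ac] by (metis image_eqI one_closed)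
  then have "?P {A}" using A by simp
  moreover have "\<forall>\<S>. ?P \<S> \<longrightarrow> card \<S> < Suc (card ?C)" unfolding less_Suc_eq_le by (intro allI impI card_mono[OF fin]) (elim conjE)
  ultimately have "\<exists>\<T>. ?P \<T> \<and> (\<forall>\<S>. ?P \<S> \<longrightarrow> card \<S> \<le> card \<T>)"
    by (rule ex_has_greatest_nat[of ?P "{A}" card "Suc (card ?C)"])
  then obtain \<T> where T: "?P \<T>" "\<forall>\<S>. ?P \<S> \<longrightarrow> card \<S> \<le> card \<T>"
    by (elim exE) (rule that, erule conjunct1, erule conjunct2)
  have Cs: "subgroup C G" if "C \<in> ?C" for C using that conjugate_subgroup[OF A(1)] by blast
  have Tfin: "finite \<T>" using T(1) fin finite_subset by blast
  have Tne: "\<T> \<noteq> {}" using T(1) by blast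
  have Ts: "C \<subseteq> carrier G" if "C \<in> \<T>" for C using Cs[THEN subgroup.subset] T(1) that by blast
  have sub: "subgroup (\<Inter>\<S>) G" if "\<S> \<noteq> {}" "\<S> \<subseteq> ?C" for \<S> using that Cs by (intro subgroups_Inter) blast+
  show ?thesis
  proof (rule that[of "\<Inter>\<T>"])
    show "subgroup (\<Inter>\<T>) G" using sub T(1) by blast
    show "\<Inter>\<T> \<noteq> {\<one>}" "\<Inter>\<T> \<subseteq> A" "\<exists>\<T>'. \<T>' \<noteq> {} \<and> \<T>' \<subseteq> ?C \<and> \<Inter>\<T> = \<Inter>\<T>'" using T(1) by blast+
    fix g assume g: "g \<in> carrier G"
    have eq: "cj g (\<Inter>\<T>) = \<Inter>(cj g ` \<T>)" by (rule conjugate_INT[OF Tne Ts g])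
    have gT: "cj g ` \<T> \<subseteq> ?C" using conjugate_permutes[OF Ac g] T(1) by blast
    show "cj g (\<Inter>\<T>) = \<Inter>\<T> \<or> \<Inter>\<T> \<inter> cj g (\<Inter>\<T>) = {\<one>}"
    proof (cases "\<Inter>\<T> \<inter> cj g (\<Inter>\<T>) = {\<one>}")
      case False
      have "\<Inter>(\<T> \<union> cj g ` \<T>) = \<Inter>\<T> \<inter> cj g (\<Inter>\<T>)" unfolding eq by (rule Inter_Un_distrib)
      then have "\<Inter>(\<T> \<union> cj g ` \<T>) \<noteq> {\<one>}" using False by simp
      then have "?P (\<T> \<union> cj g ` \<T>)" using T(1) gT by simp
      \<comment> \<open>By maximality the union is no larger than the family, so conjugation by g
        permutes the family and fixes its intersection.\<close>
      then have "card (\<T> \<union> cj g ` \<T>) \<le> card \<T>" by (rule T(2)[rule_format])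
      then have "\<T> = \<T> \<union> cj g ` \<T>" using Tfin by (intro card_seteq finite_UnI finite_imageI Un_upper1)
      moreover have "card (cj g ` \<T>) = card \<T>"
        by (rule card_image, rule inj_onI) (rule conjugate_inj[OF g Ts Ts])
      ultimately have "cj g ` \<T> = \<T>" using Tfin by (intro card_subset_eq) (simp_all add: sup.absorb_iff1)
      then show ?thesis using eq by simp
    qed simp
  qed
qed

lemma conjugate_generate_subset:
  assumes "S \<subseteq> carrier G" "g \<in> carrier G" "cj g S \<subseteq> generate G S" shows "cj g (generate G S) \<subseteq> generate G S"
proof -
  have sg: "subgroup (generate G S) G" by (rule generate_is_subgroup[OF assms(1)])
  have "cj (inv g) (cj g S) \<subseteq> cj (inv g) (generate G S)" using assms(3) by (rule conjugate_mono)
  then have "S \<subseteq> cj (inv g) (generate G S)" using conjugate_inv_conjugate(1) assms by simp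
  then have "generate G S \<subseteq> cj (inv g) (generate G S)"
    by (rule generate_subgroup_incl) (use conjugate_subgroup[OF sg] assms in simp)
  then have "cj g (generate G S) \<subseteq> cj g (cj (inv g) (generate G S))" by (rule conjugate_mono)
  then show ?thesis using conjugate_inv_conjugate(2)[OF subgroup.subset[OF sg] assms(2)] by simp
qed

text \<open>The normal closure. In a just infinite group it has finite index once \<open>A\<close>
  contains a nontrivial element.\<close>

definition ncl :: "'a set \<Rightarrow> 'a set" where "ncl A = generate G (\<Union>g\<in>carrier G. cj g A)"

lemma ncl:
  assumes "A \<subseteq> carrier G" shows "ncl A \<lhd> G" "A \<subseteq> ncl A"
proof -
  let ?S = "\<Union>g\<in>carrier G. cj g A"
  have c: "?S \<subseteq> carrier G" using conjugate_subset_carrier[OF assms] by blast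
  have "cj g ?S \<subseteq> generate G ?S" if g: "g \<in> carrier G" for g
  proof -
    have "cj g ?S = (\<Union>C\<in>(\<lambda>h. cj h A) ` carrier G. cj g C)"
      using c g conjugate_subset_carrier[OF assms] by (auto simp: conjugate_set_image)
    also have "\<dots> = ?S" unfolding conjugate_permutes[OF assms g] ..
    finally show ?thesis by (auto intro: generate.incl)
  qed
  then show "ncl A \<lhd> G" unfolding ncl_def
    by (intro normal_conjugateI generate_is_subgroup c conjugate_generate_subset)
  have "A \<subseteq> ?S" using conjugate_one[OF assms] by (metis UN_upper one_closed)
  then show "A \<subseteq> ncl A" unfolding ncl_def by (auto intro: generate.incl)
qed

lemma generate_commute:
  assumes "S \<subseteq> carrier G" "T \<subseteq> carrier G" "S \<subseteq> cz T" shows "generate G S \<subseteq> cz (generate G T)"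
proof -
  have "generate G S \<subseteq> cz T" by (rule generate_subgroup_incl[OF assms(3) cz_subgroup[OF assms(2)]])
  then have "T \<subseteq> cz (generate G S)" using cz_iff generate_incl assms by blast
  then have "generate G T \<subseteq> cz (generate G S)"
    by (rule generate_subgroup_incl) (use cz_subgroup generate_incl assms in blast)
  then show ?thesis using cz_iff generate_incl assms by blast
qed

lemma abelian_cz:
  assumes "subgroup A G" "A \<subseteq> cz A" shows "comm_group (G\<lparr>carrier := A\<rparr>)"
proof -
  interpret K: group "G\<lparr>carrier := A\<rparr>" by (rule subgroup.subgroup_is_group[OF assms(1) group_axioms])
  show ?thesis by (rule K.group_comm_groupI) (use assms(2) czD in auto)
qed

end

section \<open>Centralizers in just infinite groups that are not virtually abelian\<close>

locale just_infinite_group = group G for G :: "('a, 'b) monoid_scheme" (structure) +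
  assumes just_inf: "just_infinite G"
begin

lemma infinite_carrier: "infinite (carrier G)"
  using just_inf by (simp add: just_infinite_def)

lemma normal_nontrivial_finite_index: "N \<lhd> G \<Longrightarrow> N \<noteq> {\<one>} \<Longrightarrow> carrier G \<lessapprox> N"
  using just_inf finite_index_iff_vle'[OF normal_imp_subgroup, of N] by (auto simp: just_infinite_def)

lemma finite_index_infinite: "carrier G \<lessapprox> N \<Longrightarrow> infinite N"
  using vle_trivial_finite infinite_carrier by blast

end

text \<open>Just infinite groups that are virtually abelian turn out to be finitely generated, so
  this condition describes case (ii) of the theorem.\<close>

locale just_infinite_nva = just_infinite_group +
  assumes nva: "\<not> virtually_abelian G"
begin

lemma no_abelian_finite_index: "subgroup A G \<Longrightarrow> carrier G \<lessapprox> A \<Longrightarrow> A \<subseteq> cz A \<Longrightarrow> False"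
  using nva abelian_cz[of A] finite_index_iff_vle'[of A] unfolding virtually_abelian_def finite_index_abelian_def by blast

text \<open>The centre of \<open>M\<close> is abelian and normal; if nontrivial, it would be an
  abelian subgroup of finite index. A nontrivial centralizer would have finite index like
  \<open>M\<close> and would meet \<open>M\<close> in an infinite group, against the first
  claim.\<close>

lemma normal_center_centralizer:
  assumes M: "M \<lhd> G" "M \<noteq> {\<one>}" shows "M \<inter> cz M = {\<one>}" "cz M = {\<one>}"
proof -
  have Ms: "subgroup M G" "M \<subseteq> carrier G" using M by (auto simp: normal_imp_subgroup subgroup.subset)
  have C: "subgroup (cz M) G" by (rule cz_subgroup[OF Ms(2)])
  have Cn: "cz M \<lhd> G" by (rule normal_conjugateI[OF C]) (use conjugate_cz[OF Ms(2)] normal_conjugate[OF M(1)] in simp)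
  have Zn: "M \<inter> cz M \<lhd> G"
    by (rule normal_conjugateI[OF subgroups_Inter_pair[OF Ms(1) C]])
       (use conjugate_Int[OF Ms(2) cz_subset] normal_conjugate[OF M(1)] normal_conjugate[OF Cn] in simp)
  have ab: "M \<inter> cz M \<subseteq> cz (M \<inter> cz M)" using cz_anti[of "M \<inter> cz M" M] by blast
  show Z: "M \<inter> cz M = {\<one>}"
    using no_abelian_finite_index[OF normal_imp_subgroup[OF Zn] normal_nontrivial_finite_index[OF Zn] ab] by blast
  show "cz M = {\<one>}"
  proof (rule ccontr)
    assume ne: "cz M \<noteq> {\<one>}"
    have "carrier G \<lessapprox> M \<inter> cz M"
      by (rule vle_Int[OF normal_nontrivial_finite_index[OF M] normal_nontrivial_finite_index[OF Cn ne] subgroup_self Ms(1) C])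
    then show False using finite_index_infinite[of "M \<inter> cz M"] Z by simp
  qed
qed

text \<open>A minimal nontrivial intersection \<open>B\<close> of conjugates of \<open>A\<close>
  commutes with all its conjugates: different ones meet trivially and normalize each other, and
  \<open>B\<close> itself is abelian. So the normal closure of \<open>B\<close> is abelian and has
  finite index.\<close>

lemma no_abelian_normal_in_finite_index:
  assumes N: "N \<lhd> G" "carrier G \<lessapprox> N" and A: "subgroup A G" "A \<subseteq> N" "nrm N A" "A \<subseteq> cz A"
  shows "A = {\<one>}"
proof (rule ccontr)
  assume ne: "A \<noteq> {\<one>}"
  have Ns: "subgroup N G" "N \<subseteq> carrier G" using N by (auto simp: normal_imp_subgroup subgroup.subset)
  have Ac: "A \<subseteq> carrier G" using A Ns by blast
  obtain B \<T> where B: "subgroup B G" "B \<noteq> {\<one>}" "B \<subseteq> A"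
    "\<And>g. g \<in> carrier G \<Longrightarrow> cj g B = B \<or> B \<inter> cj g B = {\<one>}"
    and T: "\<T> \<noteq> {}" "\<T> \<subseteq> (\<lambda>g. cj g A) ` carrier G" "B = \<Inter>\<T>"
    using minimal_intersection_of_conjugates[OF A(1) ne conjugates_finite[OF N(2) A(3) Ac Ns(2)]] by metis
  have Bc: "B \<subseteq> carrier G" using B Ac by blast
  have nB: "nrm N B"
  proof
    fix n assume n: "n \<in> N"
    have "cj n C = C" if "C \<in> \<T>" for C using that T(2) nrm_conjugate[OF N(1) A(3) Ac] n by blast
    then have "cj n ` \<T> = \<T>" by simp
    moreover have "cj n B = \<Inter>(cj n ` \<T>)" unfolding T(3)
      by (rule conjugate_INT[OF T(1)]) (use T(2) conjugate_subset_carrier[OF Ac] n Ns in blast)+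
    ultimately show "cj n B = B" using T(3) by simp
  qed
  have BN: "cj g B \<subseteq> N" if "g \<in> carrier G" for g
    using conjugate_mono[of B N g] B(3) A(2) normal_conjugate[OF N(1) that] by blast
  have BB: "cj g B \<subseteq> cz B" if g: "g \<in> carrier G" for g
  proof (cases "cj g B = B")
    case True
    then show ?thesis using B(3) A(4) cz_anti[OF B(3)] by blast
  next
    case False
    show ?thesis
    proof (rule commute_if_trivial_Int[OF B(1) conjugate_subgroup[OF B(1) g]])
      show "nrm (cj g B) B" using nB BN[OF g] by blast
      show "nrm B (cj g B)" using nrm_conjugate[OF N(1) nB Bc g] B(3) A(2) by blast
      show "B \<inter> cj g B \<subseteq> {\<one>}" using B(4)[OF g] False by simp
    qed
  qed
  let ?S = "\<Union>g\<in>carrier G. cj g B"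
  have Sc: "?S \<subseteq> carrier G" using conjugate_subset_carrier[OF Bc] by blast
  have "?S \<subseteq> cz ?S"
  proof
    fix x assume "x \<in> ?S"
    then obtain g where g: "g \<in> carrier G" "x \<in> cj g B" by blast
    have "x \<otimes> y = y \<otimes> x" if y: "y \<in> ?S" for y
    proof -
      obtain h where h: "h \<in> carrier G" "y \<in> cj h B" using y by blast
      have "cj h (cj (inv h \<otimes> g) B) \<subseteq> cj h (cz B)" using BB[of "inv h \<otimes> g"] g h by (intro conjugate_mono) simp
      then have "cj g B \<subseteq> cz (cj h B)"
        using conjugate_cz[OF Bc h(1)] g h Bc by (simp add: conjugate_conjugate inv_mult_cancel)
      then show ?thesis using g h czD by blast
    qed
    then show "x \<in> cz ?S" using g conjugate_subset_carrier[OF Bc] by (auto simp: cz_def)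
  qed
  then have ab: "ncl B \<subseteq> cz (ncl B)" unfolding ncl_def by (rule generate_commute[OF Sc Sc])
  have "ncl B \<noteq> {\<one>}" using ncl(2)[OF Bc] B(2) subgroup.one_closed[OF B(1)] by blast
  then show False using no_abelian_finite_index[OF normal_imp_subgroup normal_nontrivial_finite_index ab] ncl(1)[OF Bc] by blast
qed

text \<open>Call a subgroup full if it lies in \<open>N\<close>, is normalized by \<open>N\<close>
  and has trivial centralizer in \<open>N\<close>. Fullness passes to conjugates and finite
  intersections, and A C_N(A) is full because its centralizer in \<open>N\<close> lies in the centre
  of C_N(A). So the intersection of its finitely many conjugates is full, hence a nontrivial normal
  subgroup of \<open>G\<close>, hence of finite index.\<close>

lemma depth_two_product_finite_index:
  assumes N: "N \<lhd> G" "carrier G \<lessapprox> N" and A: "subgroup A G" "A \<subseteq> N" "nrm N A"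
  shows "A \<inter> cz A = {\<one>}" "carrier G \<lessapprox> A <#> (N \<inter> cz A)"
proof -
  have Ns: "subgroup N G" "N \<subseteq> carrier G" using N by (auto simp: normal_imp_subgroup subgroup.subset)
  have center: "B \<inter> cz B = {\<one>}" if B: "subgroup B G" "B \<subseteq> N" "nrm N B" for B
  proof -
    have Bc: "B \<subseteq> carrier G" using B Ns by blast
    show ?thesis
    proof (rule no_abelian_normal_in_finite_index[OF N])
      show "subgroup (B \<inter> cz B) G" by (rule subgroups_Inter_pair[OF B(1) cz_subgroup[OF Bc]])
      show "nrm N (B \<inter> cz B)" by (rule nrm_Int[OF B(3) nrm_cz[OF B(3) Bc Ns(2)] Bc cz_subset Ns(2)])
      show "B \<inter> cz B \<subseteq> cz (B \<inter> cz B)" using cz_anti[of "B \<inter> cz B" B] by blast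
    qed (use B in blast)
  qed
  show "A \<inter> cz A = {\<one>}" by (rule center[OF A])
  have Ac: "A \<subseteq> carrier G" using A Ns by blast
  define full where "full B \<longleftrightarrow> subgroup B G \<and> B \<subseteq> N \<and> nrm N B \<and> N \<inter> cz B = {\<one>}" for B
  have triv: "N \<inter> cz B \<noteq> {} \<and> \<one> \<in> N \<inter> cz B" if "B \<subseteq> carrier G" for B
    using subgroup.one_closed[OF Ns(1)] subgroup.one_closed[OF cz_subgroup[OF that]] by blast
  \<comment> \<open>The centralizer Z of B \<inter> D in \<open>N\<close> meets B \<inter> D
    trivially. Therefore Z \<inter> B commutes with D and is trivial, and then Z commutes with B and
    is trivial.\<close>
  have fullInt: "full (B \<inter> D)" if "full B" "full D" for B D
  proof -
    have B: "subgroup B G" "B \<subseteq> N" "nrm N B" "N \<inter> cz B = {\<one>}" and D: "subgroup D G" "D \<subseteq> N" "nrm N D" "N \<inter> cz D = {\<one>}"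
      using that by (simp_all add: full_def)
    have c: "B \<subseteq> carrier G" "D \<subseteq> carrier G" "B \<inter> D \<subseteq> carrier G" using B D Ns by auto
    have BD: "subgroup (B \<inter> D) G" "B \<inter> D \<subseteq> N" "nrm N (B \<inter> D)"
      using B D c Ns by (auto intro!: subgroups_Inter_pair nrm_Int simp: conjugate_Int subset_iff)
    define Z where "Z = N \<inter> cz (B \<inter> D)"
    have Z: "subgroup Z G" "nrm N Z" "Z \<subseteq> N" "Z \<subseteq> carrier G"
      unfolding Z_def using nrm_Int[OF nrm_subset[OF nrm_normal[OF N(1)] Ns(2)] nrm_cz[OF BD(3) c(3) Ns(2)] Ns(2) cz_subset Ns(2)]
      by (auto intro!: subgroups_Inter_pair Ns cz_subgroup c(3) simp: subsetD[OF Ns(2)])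
    have one: "B \<inter> D \<inter> Z = {\<one>}" using center[OF BD] triv[OF c(3)] subgroup.one_closed[OF BD(1)] unfolding Z_def by blast
    have ZB: "subgroup (Z \<inter> B) G" "nrm N (Z \<inter> B)"
      using nrm_Int[OF Z(2) B(3) Z(4) c(1) Ns(2)] subgroups_Inter_pair[OF Z(1) B(1)] by blast+
    have "Z \<inter> B \<subseteq> cz D"
      by (rule commute_if_trivial_Int[OF D(1) ZB(1) nrm_subset[OF D(3)] nrm_subset[OF ZB(2)]]) (use Z D one in auto)
    then have "B \<inter> Z \<subseteq> {\<one>}" using D(4) Z(3) by blast
    then have "Z \<subseteq> cz B"
      by (intro commute_if_trivial_Int[OF B(1) Z(1) nrm_subset[OF B(3)] nrm_subset[OF Z(2)]]) (use Z B in auto)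
    then have "Z = {\<one>}" using B(4) Z(3) subgroup.one_closed[OF Z(1)] by blast
    then show ?thesis using BD by (simp add: full_def Z_def)
  qed
  let ?C = "N \<inter> cz A"
  define E where "E = A <#> ?C"
  have C: "subgroup ?C G" "nrm N ?C" "?C \<subseteq> carrier G"
    using nrm_Int[OF nrm_subset[OF nrm_normal[OF N(1)] Ns(2)] nrm_cz[OF A(3) Ac Ns(2)] Ns(2) cz_subset Ns(2)]
    by (auto intro!: subgroups_Inter_pair Ns cz_subgroup Ac simp: subsetD[OF Ns(2)])
  have E: "subgroup E G" "A \<subseteq> E" "?C \<subseteq> E"
    unfolding E_def using set_mult_commuting_subgroup[OF A(1) C(1)] by blast+
  have EN: "E \<subseteq> N" unfolding E_def set_mult_def using A(2) subgroup.m_closed[OF Ns(1)] by auto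
  have Ec: "E \<subseteq> carrier G" using EN Ns by blast
  have nE: "nrm N E" unfolding E_def using conjugate_set_mult[OF Ac C(3)] A(3) C(2) Ns(2) by (simp add: subset_iff)
  have "N \<inter> cz E \<subseteq> ?C \<inter> cz ?C" using cz_anti[OF E(2)] cz_anti[OF E(3)] by blast
  then have "N \<inter> cz E = {\<one>}" using center[OF C(1) _ C(2)] triv[OF Ec] by blast
  then have fE: "full E" using E EN nE by (simp add: full_def)
  let ?T = "(\<lambda>g. cj g E) ` carrier G"
  have fT: "finite ?T" by (rule conjugates_finite[OF N(2) nE Ec Ns(2)])
  have fulls: "full D" if "D \<in> ?T" for D
  proof -
    obtain g where g: "g \<in> carrier G" "D = cj g E" using \<open>D \<in> ?T\<close> by blast
    have "N \<inter> cz D = cj g (N \<inter> cz E)"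
      unfolding g(2) conjugate_Int[OF Ns(2) cz_subset g(1)] conjugate_cz[OF Ec g(1)] normal_conjugate[OF N(1) g(1)] ..
    also have "\<dots> = {\<one>}" unfolding \<open>N \<inter> cz E = {\<one>}\<close> using g(1) by (subst conjugate_set_image) auto
    finally have "N \<inter> cz D = {\<one>}" .
    moreover have "D \<subseteq> N" unfolding g(2) using conjugate_mono[OF EN, of g] normal_conjugate[OF N(1) g(1)] by blast
    ultimately show ?thesis unfolding full_def g(2)
      using conjugate_subgroup[OF E(1) g(1)] nrm_conjugate[OF N(1) nE Ec g(1)] by blast
  qed
  have "finite \<S> \<Longrightarrow> \<S> \<noteq> {} \<Longrightarrow> \<S> \<subseteq> ?T \<Longrightarrow> full (\<Inter>\<S>)" for \<S>
  proof (induction \<S> rule: finite_ne_induct)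
    case (singleton D)
    then show ?case using fulls by simp
  next
    case (insert D \<S>)
    then show ?case using fullInt[OF fulls] by simp
  qed
  then have core: "full (\<Inter>?T)" using fT carrier_nonempty by blast
  then have cs: "subgroup (\<Inter>?T) G" "N \<inter> cz (\<Inter>?T) = {\<one>}" by (simp_all add: full_def)
  have Tne: "?T \<noteq> {}" using carrier_nonempty by blast
  have "cj g (\<Inter>?T) = \<Inter>?T" if g: "g \<in> carrier G" for g
  proof -
    have "cj g (\<Inter>?T) = \<Inter>(cj g ` ?T)"
      by (rule conjugate_INT[OF Tne _ g]) (use conjugate_subset_carrier[OF Ec] in blast)
    then show ?thesis unfolding conjugate_permutes[OF Ec g] .
  qed
  then have nc: "\<Inter>?T \<lhd> G" by (intro normal_conjugateI[OF cs(1)]) blast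
  \<comment> \<open>A trivial core would be centralized by all of \<open>N\<close>, against
    fullness.\<close>
  have "\<Inter>?T \<noteq> {\<one>}"
  proof
    assume "\<Inter>?T = {\<one>}"
    then have "cz (\<Inter>?T) = carrier G" by (auto simp: cz_def)
    then have "N = {\<one>}" using cs(2) Ns(2) by blast
    then show False using finite_index_infinite[OF N(2)] by simp
  qed
  then have "carrier G \<lessapprox> \<Inter>?T" by (rule normal_nontrivial_finite_index[OF nc])
  moreover have "\<Inter>?T \<subseteq> E" using conjugate_one[OF Ec] by (metis INT_lower one_closed)
  ultimately show "carrier G \<lessapprox> A <#> (N \<inter> cz A)" using vle_mono[of "carrier G" "\<Inter>?T" "carrier G" E] by (simp add: E_def)
qed

text \<open>Induction on the depth. If \<open>H\<close> is normal in \<open>K\<close>, then K C(K),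
  which has finite index by induction, normalizes \<open>H\<close>. Passing to its normal core
  \<open>N\<close> leaves the subgroup H \<inter> N, which is normal in \<open>N\<close>, and the
  case of depth two applies.\<close>

lemma subnormal_product_finite_index:
  assumes "subnormal H G"
  shows "carrier G \<lessapprox> H <#> cz H \<and> H \<inter> cz H = {\<one>} \<and>
    (\<exists>N. N \<lhd> G \<and> carrier G \<lessapprox> N \<and> nrm N H \<and> carrier G \<lessapprox> (H \<inter> N) <#> (N \<inter> cz H))"
  using assms
proof (induction rule: subnormal_induct)
  case carrier
  have n: "carrier G \<lhd> G" by (rule normal_conjugateI[OF subgroup_self]) (simp add: conjugate_carrier)
  have ne: "carrier G \<noteq> {\<one>}" using infinite_carrier by (metis finite.emptyI finite.insertI)
  have cc: "carrier G \<subseteq> carrier G <#> {\<one>}" "carrier G \<subseteq> carrier G" by (auto simp: set_mult_def)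
  then have "carrier G \<lessapprox> carrier G <#> {\<one>}" using vle_mono[OF vle_subset[OF order_refl order_refl] order_refl] by blast
  then show ?case using n normal_center_centralizer[OF n ne] vle_subset[of "carrier G" "carrier G"]
    by (auto simp: conjugate_carrier intro!: exI[of _ "carrier G"])
next
  case (step K H)
  have Kc: "K \<subseteq> carrier G" using step by (simp add: subgroup.subset)
  have H: "subgroup H G" "H \<subseteq> K" "\<forall>k\<in>K. \<forall>h\<in>H. k \<otimes> h \<otimes> inv k \<in> H"
    using step normal_restrict_iff by auto
  have Hc: "H \<subseteq> carrier G" using H Kc by blast
  have Bs: "subgroup (K <#> cz K) G" using set_mult_commuting_subgroup[OF step(2) cz_subgroup[OF Kc]] by blast
  have nB: "nrm (K <#> cz K) H"
  proof
    fix b assume "b \<in> K <#> cz K"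
    then obtain k c where b: "k \<in> K" "c \<in> cz K" "b = k \<otimes> c" by (auto simp: set_mult_def)
    have cc: "k \<in> carrier G" "c \<in> carrier G" using b Kc cz_subset by auto
    have "cj c H = H"
    proof -
      have "c \<otimes> h \<otimes> inv c = h" if "h \<in> H" for h
      proof -
        have "h \<in> carrier G" "c \<otimes> h = h \<otimes> c" using that Hc H(2) czD[OF b(2), of h] by auto
        then show ?thesis using cc by (simp add: m_assoc)
      qed
      then show ?thesis using conjugate_set_image[OF Hc cc(2)] by simp
    qed
    moreover have "cj k H = H" using normal_restrict_conjugate[OF step(2) \<open>H \<lhd> G\<lparr>carrier := K\<rparr>\<close> b(1)] .
    ultimately show "cj b H = H" unfolding b(3) conjugate_conjugate[OF Hc cc, symmetric] by simp
  qed
  obtain N where N: "N \<lhd> G" "N \<subseteq> K <#> cz K" "carrier G \<lessapprox> N"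
    by (rule finite_index_core[OF Bs conjunct1[OF step.IH]])
  have Ns: "subgroup N G" "N \<subseteq> carrier G" using N by (auto simp: normal_imp_subgroup subgroup.subset)
  have nN: "nrm N H" using nB N(2) by blast
  let ?H = "H \<inter> N"
  have H': "subgroup ?H G" "?H \<subseteq> N" "nrm N ?H" "?H \<subseteq> carrier G"
    using subgroups_Inter_pair[OF H(1) Ns(1)] nrm_Int[OF nN nrm_self[OF Ns(1)] Hc Ns(2) Ns(2)] Hc by auto
  note d = depth_two_product_finite_index[OF N(1,3) H'(1-3)]
  let ?C = "N \<inter> cz ?H"
  have Cs: "subgroup ?C G" using subgroups_Inter_pair[OF Ns(1) cz_subgroup[OF H'(4)]] .
  \<comment> \<open>Commutators of \<open>H\<close> with \<open>?C\<close> lie in the intersection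
    of both, which is the centre of H \<inter> N and hence trivial.\<close>
  have "?C \<subseteq> cz H"
  proof (rule commute_if_trivial_Int[OF H(1) Cs])
    show "nrm ?C H" using nN by blast
    have "nrm H ?H" using nrm_Int[OF nrm_self[OF H(1)] nrm_subset[OF nrm_normal[OF N(1)] Hc] Hc Ns(2) Hc] .
    then show "nrm H ?C" using nrm_Int[OF nrm_subset[OF nrm_normal[OF N(1)] Hc] nrm_cz[OF _ H'(4) Hc] Ns(2) cz_subset Hc] by blast
    show "H \<inter> ?C \<subseteq> {\<one>}" using d(1) by blast
  qed
  then have Ceq: "?C = N \<inter> cz H" using cz_anti[of ?H H] by blast
  have f: "carrier G \<lessapprox> ?H <#> (N \<inter> cz H)" using d(2) Ceq by simp
  then have f2: "carrier G \<lessapprox> H <#> cz H" by (rule vle_mono) (auto simp: set_mult_def)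
  \<comment> \<open>The centre of \<open>H\<close> meets \<open>N\<close> trivially, so it commutes
    with \<open>N\<close>, whose centralizer is trivial.\<close>
  have "H \<inter> cz H = {\<one>}"
  proof -
    let ?Z = "H \<inter> cz H"
    have Z: "subgroup ?Z G" "?Z \<subseteq> carrier G" using subgroups_Inter_pair[OF H(1) cz_subgroup[OF Hc]] Hc by blast+
    have nZ: "nrm N ?Z" using nrm_Int[OF nN nrm_cz[OF nN Hc Ns(2)] Hc cz_subset Ns(2)] .
    have Ntriv: "N \<noteq> {\<one>}" using finite_index_infinite[OF N(3)] by auto
    have "?Z \<subseteq> cz N"
      by (rule commute_if_trivial_Int[OF Ns(1) Z(1) nrm_subset[OF nrm_normal[OF N(1)] Z(2)] nZ])
         (use d(1) cz_anti[of ?H H] in blast)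
    then show ?thesis using normal_center_centralizer(2)[OF N(1) Ntriv] subgroup.one_closed[OF Z(1)] by blast
  qed
  then show ?case using f f2 N nN by blast
qed

lemma subnormal_centre: "subnormal H G \<Longrightarrow> H \<inter> cz H = {\<one>}"
  using subnormal_product_finite_index by blast

lemma subnormal_normalizer:
  assumes "subnormal H G"
  obtains N where "N \<lhd> G" "carrier G \<lessapprox> N" "nrm N H"
    "carrier G \<lessapprox> (H \<inter> N) <#> (N \<inter> cz H)" "subnormal (N \<inter> cz H) G"
proof -
  obtain N where N: "N \<lhd> G" "carrier G \<lessapprox> N" "nrm N H" "carrier G \<lessapprox> (H \<inter> N) <#> (N \<inter> cz H)"
    using subnormal_product_finite_index[OF assms] by blast
  have Ns: "subgroup N G" "N \<subseteq> carrier G" using N by (auto simp: normal_imp_subgroup subgroup.subset)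
  have Hc: "H \<subseteq> carrier G" using subnormal_subgroup[OF assms] subgroup.subset by blast
  have n: "nrm N (N \<inter> cz H)" by (rule nrm_Int[OF nrm_self[OF Ns(1)] nrm_cz[OF N(3) Hc Ns(2)] Ns(2) cz_subset Ns(2)])
  have "N \<inter> cz H \<lhd> G\<lparr>carrier := N\<rparr>"
    unfolding normal_restrict_iff[OF Ns(1)]
    using subgroups_Inter_pair[OF Ns(1) cz_subgroup[OF Hc]] nrm_conj_mem[OF n] Ns(2) by blast
  then have "subnormal (N \<inter> cz H) G" by (rule subnormal_step[OF normal_subnormal[OF N(1)]])
  then show ?thesis using that N by blast
qed

text \<open>If \<open>H\<close> were finite, its centralizer would contain a subgroup of finite
  index. The normal core of that is centralized by \<open>H\<close>, although nontrivial normal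
  subgroups have trivial centralizer.\<close>

lemma subnormal_infinite:
  assumes "subnormal H G" "H \<noteq> {\<one>}" shows "infinite H"
proof
  assume fin: "finite H"
  obtain N where N: "N \<lhd> G" "carrier G \<lessapprox> (H \<inter> N) <#> (N \<inter> cz H)" "subnormal (N \<inter> cz H) G"
    using subnormal_normalizer[OF assms(1)] by metis
  have Hs: "subgroup H G" "H \<subseteq> carrier G" using subnormal_subgroup[OF assms(1)] subgroup.subset by blast+
  have Cs: "subgroup (N \<inter> cz H) G" using N(3) by (rule subnormal_subgroup)
  have "(H \<inter> N) <#> (N \<inter> cz H) \<lessapprox> N \<inter> cz H"
    unfolding virtually_le_def
  proof (intro exI[of _ H] conjI fin Hs ballI)
    fix a assume "a \<in> (H \<inter> N) <#> (N \<inter> cz H)"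
    then obtain h c where h: "h \<in> H" "c \<in> N \<inter> cz H" "a = h \<otimes> c" by (auto simp: set_mult_def)
    then have "inv h \<otimes> a = c" using Hs cz_subset by (auto simp: inv_mult_cancel subset_iff)
    then show "\<exists>t\<in>H. inv t \<otimes> a \<in> N \<inter> cz H" using h by (intro bexI[of _ h]) simp_all
  qed
  then have "carrier G \<lessapprox> N \<inter> cz H" by (rule vle_trans[OF N(2)]) simp
  then obtain M where M: "M \<lhd> G" "M \<subseteq> N \<inter> cz H" "carrier G \<lessapprox> M" using finite_index_core[OF Cs] by metis
  have "M \<noteq> {\<one>}" using finite_index_infinite[OF M(3)] by auto
  then have "cz M = {\<one>}" by (rule normal_center_centralizer(2)[OF M(1)])
  moreover have "M \<subseteq> carrier G" using M(1) by (simp add: normal_imp_subgroup subgroup.subset)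
  then have "H \<subseteq> cz M" using M(2) cz_iff[of M H] Hs(2) by blast
  ultimately show False using assms(2) subgroup.one_closed[OF Hs(1)] by blast
qed

end

section \<open>Independent families of subnormal subgroups\<close>

context group begin

section \<open>Left stabilizers of bidual elements\<close>

definition stab :: "'a bidual_elt \<Rightarrow> 'a set" where
  "stab \<Phi> = {g \<in> carrier G. \<forall>u. bdd_fun G u \<longrightarrow> ev G \<Phi> (\<lambda>x. u (g \<otimes> x)) = ev G \<Phi> u}"

lemma stab_subgroup: "subgroup (stab \<Phi>) G"
proof (rule subgroupI)
  have "\<one> \<in> stab \<Phi>" by (auto simp: stab_def intro!: ev_cong)
  then show "stab \<Phi> \<noteq> {}" by blast
  fix a assume "a \<in> stab \<Phi>"
  then have a: "a \<in> carrier G" "\<And>u. bdd_fun G u \<Longrightarrow> ev G \<Phi> (\<lambda>x. u (a \<otimes> x)) = ev G \<Phi> u" by (auto simp: stab_def)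
  have "ev G \<Phi> (\<lambda>x. u (inv a \<otimes> x)) = ev G \<Phi> u" if u: "bdd_fun G u" for u
  proof -
    have "ev G \<Phi> (\<lambda>x. u (inv a \<otimes> x)) = ev G \<Phi> (\<lambda>x. u (inv a \<otimes> (a \<otimes> x)))"
      using a(2)[OF bdd_fun_left[OF u inv_closed[OF a(1)]]] by simp
    also have "\<dots> = ev G \<Phi> u" by (rule ev_cong) (simp add: a inv_mult_cancel)
    finally show ?thesis .
  qed
  then show "inv a \<in> stab \<Phi>" using a by (simp add: stab_def)
  fix b assume "b \<in> stab \<Phi>"
  then have b: "b \<in> carrier G" "\<And>u. bdd_fun G u \<Longrightarrow> ev G \<Phi> (\<lambda>x. u (b \<otimes> x)) = ev G \<Phi> u" by (auto simp: stab_def)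
  have "ev G \<Phi> (\<lambda>x. u (a \<otimes> b \<otimes> x)) = ev G \<Phi> u" if u: "bdd_fun G u" for u
  proof -
    have "ev G \<Phi> (\<lambda>x. u (a \<otimes> b \<otimes> x)) = ev G \<Phi> (\<lambda>x. u (a \<otimes> (b \<otimes> x)))"
      by (rule ev_cong) (simp add: a b m_assoc)
    also have "\<dots> = ev G \<Phi> u" using b(2)[OF bdd_fun_left[OF u a(1)]] a(2)[OF u] by simp
    finally show ?thesis .
  qed
  then show "a \<otimes> b \<in> stab \<Phi>" using a b by (simp add: stab_def)
qed (auto simp: stab_def)

lemma stab_invariant: "invariant_under G (stab \<Phi>) \<Phi>"
  by (auto simp: invariant_under_def stab_def)

lemma differences_stab: "\<Gamma> \<in> differences_on G M \<Longrightarrow> M \<subseteq> carrier G \<Longrightarrow> \<Phi> \<in> l1_bidual G \<Longrightarrow> M \<subseteq> stab (arens G \<Gamma> \<Phi>)"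
proof
  fix s assume \<Gamma>: "\<Gamma> \<in> differences_on G M" and M: "M \<subseteq> carrier G" and \<Phi>: "\<Phi> \<in> l1_bidual G" and s: "s \<in> M"
  have sc: "s \<in> carrier G" using s M by blast
  have "ev G (arens G \<Gamma> \<Phi>) (\<lambda>x. u (s \<otimes> x)) = ev G (arens G \<Gamma> \<Phi>) u" if u: "bdd_fun G u" for u
  proof -
    have "ev G (arens G \<Gamma> \<Phi>) (\<lambda>x. u (s \<otimes> x)) = ev G \<Gamma> (\<lambda>t. ev G \<Phi> (\<lambda>x. u (s \<otimes> (t \<otimes> x))))"
      by (rule ev_arens[OF \<Phi> bdd_fun_left[OF u sc]])
    also have "\<dots> = ev G \<Gamma> (\<lambda>t. ev G \<Phi> (\<lambda>x. u (s \<otimes> t \<otimes> x)))"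
      by (rule ev_cong, rule ev_cong) (simp add: sc m_assoc)
    also have "\<dots> = ev G \<Gamma> (\<lambda>t. ev G \<Phi> (\<lambda>x. u (t \<otimes> x)))"
      using differences_onD(3)[OF \<Gamma> s bdd_fun_ev[OF \<Phi> u]] .
    finally show ?thesis using ev_arens[OF \<Phi> u] by simp
  qed
  then show "s \<in> stab (arens G \<Gamma> \<Phi>)" using sc by (simp add: stab_def)
qed

text \<open>An element commuting with \<open>M\<close> can be moved past the variable of \<Gamma>,
  which runs over \<open>M\<close>, and is then absorbed by \<Phi>. This is the part of the old
  stabilizer known to survive a multiplication.\<close>

lemma centralizer_stab:
  assumes \<Gamma>: "\<Gamma> \<in> differences_on G M" and M: "M \<subseteq> carrier G" and \<Phi>: "\<Phi> \<in> l1_bidual G"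
  shows "stab \<Phi> \<inter> cz M \<subseteq> stab (arens G \<Gamma> \<Phi>)"
proof
  fix s assume s: "s \<in> stab \<Phi> \<inter> cz M"
  have sc: "s \<in> carrier G" using s cz_subset by blast
  have "ev G (arens G \<Gamma> \<Phi>) (\<lambda>x. u (s \<otimes> x)) = ev G (arens G \<Gamma> \<Phi>) u" if u: "bdd_fun G u" for u
  proof -
    have "ev G (arens G \<Gamma> \<Phi>) (\<lambda>x. u (s \<otimes> x)) = ev G \<Gamma> (\<lambda>t. ev G \<Phi> (\<lambda>x. u (s \<otimes> (t \<otimes> x))))"
      by (rule ev_arens[OF \<Phi> bdd_fun_left[OF u sc]])
    also have "\<dots> = ev G \<Gamma> (\<lambda>t. ev G \<Phi> (\<lambda>x. u (t \<otimes> x)))"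
    proof (rule differences_onD(2)[OF \<Gamma>])
      fix t assume t: "t \<in> M"
      have tc: "t \<in> carrier G" using t M by blast
      have st: "s \<otimes> t = t \<otimes> s" using s t czD by blast
      have "ev G \<Phi> (\<lambda>x. u (s \<otimes> (t \<otimes> x))) = ev G \<Phi> (\<lambda>x. u (t \<otimes> (s \<otimes> x)))"
        by (rule ev_cong) (simp add: sc tc m_assoc[symmetric] st)
      also have "\<dots> = ev G \<Phi> (\<lambda>x. u (t \<otimes> x))"
        using s bdd_fun_left[OF u tc] unfolding stab_def by blast
      finally show "ev G \<Phi> (\<lambda>x. u (s \<otimes> (t \<otimes> x))) = ev G \<Phi> (\<lambda>x. u (t \<otimes> x))" .
    qed (rule bdd_fun_ev[OF \<Phi> bdd_fun_left[OF u sc]] bdd_fun_ev[OF \<Phi> u])+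
    finally show ?thesis using ev_arens[OF \<Phi> u] by simp
  qed
  then show "s \<in> stab (arens G \<Gamma> \<Phi>)" using sc by (simp add: stab_def)
qed

lemma vle_Int_self: "A \<lessapprox> B \<Longrightarrow> subgroup A G \<Longrightarrow> subgroup B G \<Longrightarrow> A \<lessapprox> A \<inter> B"
  using vle_Int[of A A B] vle_subset[of A A] subgroup.subset[of A G] by blast

lemma finite_index_Int: "carrier G \<lessapprox> B \<Longrightarrow> subgroup A G \<Longrightarrow> subgroup B G \<Longrightarrow> A \<lessapprox> A \<inter> B"
  using vle_Int_self[of A B] vle_mono[of "carrier G" B A B] subgroup.subset[of A G] by blast

abbreviation gen :: "'a set set \<Rightarrow> 'a set" where "gen I \<equiv> generate G (\<Union>I)"

lemma gen_insert_commuting: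
  assumes "L \<subseteq> cz (\<Union>I)" "subgroup L G" "\<Union>I \<subseteq> carrier G"
  shows "gen (insert L I) = L <#> gen I" "L \<subseteq> cz (gen I)" "gen I \<subseteq> cz L"
proof -
  have Lc: "L \<subseteq> carrier G" by (rule subgroup.subset[OF assms(2)])
  have gI: "subgroup (gen I) G" by (rule generate_is_subgroup[OF assms(3)])
  have gL: "generate G L = L" by (rule generateI[OF assms(2), symmetric]) auto
  then show L: "L \<subseteq> cz (gen I)" using generate_commute[OF Lc assms(3,1)] by simp
  then show gz: "gen I \<subseteq> cz L" using cz_iff[OF Lc subgroup.subset[OF gI]] by simp
  note p = set_mult_commuting_subgroup[OF assms(2) gI gz]
  have U: "\<Union>(insert L I) \<subseteq> carrier G" using Lc assms(3) by simp
  show "gen (insert L I) = L <#> gen I"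
  proof
    show "gen (insert L I) \<subseteq> L <#> gen I"
      by (rule generate_subgroup_incl[OF _ p(1)]) (use p(2,3) in \<open>auto intro: generate.incl\<close>)
    have "L \<subseteq> gen (insert L I)" "gen I \<subseteq> gen (insert L I)"
      by (auto intro: generate.incl mono_generate[THEN subsetD])
    then show "L <#> gen I \<subseteq> gen (insert L I)"
      using subgroup.m_closed[OF generate_is_subgroup[OF U]] by (auto simp: set_mult_def)
  qed
qed

lemma vle_set_mult_commuting:
  assumes "A \<lessapprox> H" "B \<lessapprox> H" "subgroup A G" "subgroup B G" "subgroup H G" "B \<subseteq> cz A"
  shows "A <#> B \<lessapprox> H"
proof -
  obtain T where T: "finite T" "T \<subseteq> A" "\<And>a. a \<in> A \<Longrightarrow> \<exists>t\<in>T. inv t \<otimes> a \<in> A \<inter> H"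
    using vle_reps[OF assms(1,3,5)] by metis
  obtain S where S: "finite S" "S \<subseteq> B" "\<And>a. a \<in> B \<Longrightarrow> \<exists>t\<in>S. inv t \<otimes> a \<in> B \<inter> H"
    using vle_reps[OF assms(2,4,5)] by metis
  have c: "A \<subseteq> carrier G" "B \<subseteq> carrier G" using assms subgroup.subset by blast+
  show ?thesis unfolding virtually_le_def
  proof (intro exI[of _ "(\<lambda>(t,s). t \<otimes> s) ` (T \<times> S)"] conjI ballI)
    show "finite ((\<lambda>(t,s). t \<otimes> s) ` (T \<times> S))" using T S by simp
    show "(\<lambda>(t,s). t \<otimes> s) ` (T \<times> S) \<subseteq> carrier G" using T(2) S(2) c by (auto simp: subset_iff)
    fix x assume "x \<in> A <#> B"
    then obtain a b where x: "a \<in> A" "b \<in> B" "x = a \<otimes> b" by (auto simp: set_mult_def)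
    obtain t where t: "t \<in> T" "inv t \<otimes> a \<in> A \<inter> H" using T(3)[OF x(1)] by blast
    obtain s where s: "s \<in> S" "inv s \<otimes> b \<in> B \<inter> H" using S(3)[OF x(2)] by blast
    have cc: "t \<in> carrier G" "a \<in> carrier G" "s \<in> carrier G" "b \<in> carrier G" using t s T(2) S(2) x c by auto
    have "inv s \<in> cz A" using s S(2) assms(4,6) by (meson subgroup.m_inv_closed subsetD)
    then have com: "inv s \<otimes> (inv t \<otimes> a) = (inv t \<otimes> a) \<otimes> inv s" using t czD by blast
    have "inv (t \<otimes> s) \<otimes> x = (inv s \<otimes> (inv t \<otimes> a)) \<otimes> b" using cc x by (simp add: inv_mult_group m_assoc)
    also have "\<dots> = (inv t \<otimes> a) \<otimes> (inv s \<otimes> b)" unfolding com using cc by (simp add: m_assoc)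
    also have "\<dots> \<in> H" using t s assms(5) by (simp add: subgroup.m_closed)
    finally show "\<exists>p\<in>(\<lambda>(t,s). t \<otimes> s) ` (T \<times> S). inv p \<otimes> x \<in> H" using t(1) s(1) by force
  qed
qed

lemma commensurability_iff:
  "(H, K) \<in> commensurability G \<longleftrightarrow> subnormal H G \<and> subnormal K G \<and> H \<lessapprox> K \<and> K \<lessapprox> H"
proof -
  have "finite_index (G\<lparr>carrier := A\<rparr>) (A \<inter> B) \<longleftrightarrow> A \<lessapprox> B" if "subnormal A G" "subnormal B G" for A B
  proof -
    have s: "subgroup A G" "subgroup B G" using that subnormal_subgroup by blast+
    have "A \<lessapprox> A \<inter> B \<longleftrightarrow> A \<lessapprox> B"
      using vle_Int[OF vle_subset[of A A] _ s(1) s(1) s(2)] vle_mono[of A "A \<inter> B" A B] subgroup.subset[OF s(1)] by blast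
    then show ?thesis using finite_index_iff_vle[OF s(1) subgroups_Inter_pair[OF s], of] by simp
  qed
  from this[of H K] this[of K H] show ?thesis unfolding commensurability_def by (auto simp: Int_commute[of K H])
qed

lemma commensurability_equiv: "equiv {H. subnormal H G} (commensurability G)"
proof (rule equivI)
  show "commensurability G \<subseteq> {H. subnormal H G} \<times> {H. subnormal H G}" by (auto simp: commensurability_iff)
  show "refl_on {H. subnormal H G} (commensurability G)"
    by (auto simp: refl_on_def commensurability_iff intro!: vle_subset subgroup.subset subnormal_subgroup)
  show "sym (commensurability G)" by (auto simp: sym_def commensurability_iff)
  show "trans (commensurability G)"
    unfolding trans_def commensurability_iff by (meson vle_trans subgroup.subset subnormal_subgroup)
qed

end

section \<open>Commuting families of subnormal subgroups\<close>

context just_infinite_nva begin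

text \<open>Subnormal subgroups have trivial centre here, so commuting members already generate
  their direct product; being nontrivial they are also infinite.\<close>

definition indep :: "'a set set \<Rightarrow> bool" where
  "indep \<L> \<longleftrightarrow> finite \<L> \<and> (\<forall>L\<in>\<L>. subnormal L G \<and> L \<noteq> {\<one>}) \<and> (\<forall>L\<in>\<L>. \<forall>L'\<in>\<L>. L \<noteq> L' \<longrightarrow> L \<subseteq> cz L')"

lemma indepD:
  assumes "indep \<L>" "L \<in> \<L>"
  shows "subnormal L G" "L \<noteq> {\<one>}" "subgroup L G" "L \<subseteq> carrier G" "infinite L" "L \<inter> cz L = {\<one>}" "\<one> \<in> L"
  using assms subnormal_subgroup[of L] subgroup.subset[of L G] subnormal_infinite[of L] subnormal_centre[of L]
    subgroup.one_closed[of L G]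
  unfolding indep_def by blast+

lemma indep_commute: "indep \<L> \<Longrightarrow> L \<in> \<L> \<Longrightarrow> L' \<in> \<L> \<Longrightarrow> L \<noteq> L' \<Longrightarrow> L \<subseteq> cz L'"
  by (simp add: indep_def)

lemma indep_gen:
  assumes "indep \<L>" "I \<subseteq> \<L>" "L \<in> \<L>" "L \<notin> I"
  shows "L \<subseteq> cz (\<Union>I)" "\<Union>I \<subseteq> carrier G" "L \<inter> gen I = {\<one>}"
proof -
  show U: "\<Union>I \<subseteq> carrier G" using indepD(4)[OF assms(1)] assms(2) by blast
  have "x \<otimes> y = y \<otimes> x" if "x \<in> L" "K \<in> I" "y \<in> K" for x y K
    using indep_commute[OF assms(1,3), of K] assms(2,4) that czD by blast
  then show L: "L \<subseteq> cz (\<Union>I)" using indepD(4)[OF assms(1,3)] by (auto simp: cz_def)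
  have "gen I \<subseteq> cz L" by (rule gen_insert_commuting(3)[OF L indepD(3)[OF assms(1,3)] U])
  moreover have "\<one> \<in> gen I" by (rule generate.one)
  ultimately show "L \<inter> gen I = {\<one>}" using indepD(6,7)[OF assms(1,3)] by blast
qed

lemma indep_direct_list:
  assumes "indep \<L>"
  shows "distinct Ls \<Longrightarrow> set Ls \<subseteq> \<L> \<Longrightarrow> direct_list Ls"
  by (induction Ls) (use indep_gen(3)[OF assms] in auto)

lemma indep_not_vanish:
  assumes "amenable G" "indep \<L>" "card \<L> \<ge> n" "n \<ge> 1"
  shows "\<not> products_vanish (arens G) (A_sn G) n"
proof -
  have "finite \<L>" using assms(2) by (simp add: indep_def)
  then obtain \<M> where M: "\<M> \<subseteq> \<L>" "card \<M> = n" "finite \<M>" using assms(3) by (metis obtain_subset_with_card_n)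
  then obtain Ls where Ls: "distinct Ls" "set Ls = \<M>" by (metis finite_distinct_list)
  then have "length Ls = n" using M by (metis distinct_card)
  moreover have "direct_list Ls" using indep_direct_list[OF assms(2)] Ls M by blast
  ultimately show ?thesis
    using direct_list_not_vanish[OF assms(1), of Ls] Ls M indepD(1,5)[OF assms(2)] assms(4) by fastforce
qed

text \<open>Different members of a family are infinite and meet trivially, so their commensurability
  classes differ.\<close>

lemma structure_lattice_infinite:
  assumes "\<And>n. \<exists>\<L>. indep \<L> \<and> card \<L> \<ge> n" shows "infinite (structure_lattice G)"
proof
  assume fin: "finite (structure_lattice G)"
  obtain \<L> where L: "indep \<L>" "card \<L> \<ge> Suc (card (structure_lattice G))" using assms by blast
  let ?c = "\<lambda>L. commensurability G `` {L}"
  have "?c ` \<L> \<subseteq> structure_lattice G" unfolding structure_lattice_def using indepD(1)[OF L(1)] by (auto intro: quotientI)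
  moreover have "inj_on ?c \<L>"
  proof (rule inj_onI, rule ccontr)
    fix L L' assume LL: "L \<in> \<L>" "L' \<in> \<L>" "?c L = ?c L'" "L \<noteq> L'"
    have "(L, L') \<in> commensurability G"
      using LL indepD(1)[OF L(1)] eq_equiv_class[OF LL(3) commensurability_equiv] by simp
    then have "L \<lessapprox> L'" by (simp add: commensurability_iff)
    then have "L \<lessapprox> L \<inter> L'"
      by (rule vle_Int_self[OF _ indepD(3)[OF L(1) LL(1)] indepD(3)[OF L(1) LL(2)]])
    moreover have "L \<inter> L' = {\<one>}" using indep_commute[OF L(1) LL(1,2,4)] indepD(6,7)[OF L(1)] LL by blast
    ultimately show False using vle_trivial_finite[of L "{\<one>}"] indepD(4,5)[OF L(1) LL(1)] by simp
  qed
  ultimately have "card \<L> \<le> card (structure_lattice G)" using fin by (metis card_image card_mono)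
  then show False using L(2) by simp
qed

text \<open>Let M' be the intersection of \<open>M\<close> with a normal subgroup of finite index
  normalizing \<open>Q\<close>. It normalizes the subgroup in question and meets it inside the
  centre of Q \<inter> M, which is trivial. So the two commute, and M' has trivial
  centralizer.\<close>

lemma centralizer_of_finite_index_part:
  assumes Q: "subnormal Q G" and M: "M \<lhd> G" "carrier G \<lessapprox> M"
  shows "Q \<inter> cz (Q \<inter> M) = {\<one>}"
proof -
  obtain N where N: "N \<lhd> G" "carrier G \<lessapprox> N" "nrm N Q" using subnormal_normalizer[OF Q] by metis
  let ?M = "M \<inter> N" and ?Z = "Q \<inter> cz (Q \<inter> M)"
  have s: "subgroup Q G" "subgroup M G" "subgroup N G" using subnormal_subgroup[OF Q] M N normal_imp_subgroup by blast+
  then have c: "Q \<subseteq> carrier G" "M \<subseteq> carrier G" "N \<subseteq> carrier G" "Q \<inter> M \<subseteq> carrier G" using subgroup.subset by blast+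
  have Ms: "subgroup ?M G" "?M \<subseteq> carrier G" using subgroups_Inter_pair[OF s(2,3)] c by auto
  have Mn: "?M \<lhd> G" by (rule normal_conjugateI[OF Ms(1)]) (use c normal_conjugate[OF M(1)] normal_conjugate[OF N(1)] in \<open>simp add: conjugate_Int\<close>)
  have Mf: "carrier G \<lessapprox> ?M" by (rule vle_Int[OF M(2) N(2) subgroup_self s(2,3)])
  have Zs: "subgroup ?Z G" using subgroups_Inter_pair[OF s(1) cz_subgroup[OF c(4)]] .
  have nQ: "nrm ?M Q" using N(3) by blast
  have nM: "nrm ?M M" using nrm_subset[OF nrm_normal[OF M(1)] Ms(2)] .
  have nQM: "nrm ?M (Q \<inter> M)" by (rule nrm_Int[OF nQ nM c(1,2) Ms(2)])
  have nZ: "nrm ?M ?Z" by (rule nrm_Int[OF nQ nrm_cz[OF nQM c(4) Ms(2)] c(1) cz_subset Ms(2)])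
  have "?M \<inter> ?Z \<subseteq> (Q \<inter> M) \<inter> cz (Q \<inter> M)" by blast
  also have "\<dots> = {\<one>}" by (rule subnormal_centre[OF subnormal_Int[OF Q normal_subnormal[OF M(1)]]])
  finally have "?Z \<subseteq> cz ?M"
    by (intro commute_if_trivial_Int[OF Ms(1) Zs nrm_subset[OF nrm_normal[OF Mn]] nZ]) (use c in auto)
  moreover have "?M \<noteq> {\<one>}" using finite_index_infinite[OF Mf] by auto
  ultimately show ?thesis using normal_center_centralizer(2)[OF Mn] subgroup.one_closed[OF Zs] by blast
qed

text \<open>All members are cut down to a common normal subgroup of finite index that normalizes
  them. Being infinite they stay nontrivial, and commuting keeps them apart, so the size of the
  family is unchanged.\<close>

lemma indep_normalize:
  assumes "indep \<L>"
  obtains N \<M> where "indep \<M>" "card \<M> = card \<L>" "N \<lhd> G" "carrier G \<lessapprox> N" "\<And>L. L \<in> \<M> \<Longrightarrow> L \<subseteq> N \<and> nrm N L"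
proof -
  have fin: "finite \<L>" using assms by (simp add: indep_def)
  have "\<forall>L\<in>\<L>. \<exists>N. N \<lhd> G \<and> carrier G \<lessapprox> N \<and> nrm N L" using subnormal_normalizer indepD(1)[OF assms] by metis
  then obtain f where "\<forall>L\<in>\<L>. f L \<lhd> G \<and> carrier G \<lessapprox> f L \<and> nrm (f L) L" by (rule bchoice[THEN exE])
  then have f: "f L \<lhd> G \<and> carrier G \<lessapprox> f L \<and> nrm (f L) L" if "L \<in> \<L>" for L using that by (rule bspec)
  define N where "N = carrier G \<inter> (\<Inter>L\<in>\<L>. f L)"
  have N: "carrier G \<lessapprox> N" "subgroup N G" unfolding N_def
    using vle_Inter_finite[OF fin subgroup_self, of f] f normal_imp_subgroup by blast+
  have Nc: "N \<subseteq> carrier G" by (simp add: N_def)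
  have "cj g N \<subseteq> N" if g: "g \<in> carrier G" for g
  proof -
    have "cj g N \<subseteq> f L" if "L \<in> \<L>" for L
      using conjugate_mono[of N "f L" g] normal_conjugate[of "f L" g] f[OF that] g that unfolding N_def by blast
    then show ?thesis using conjugate_subset_carrier[OF Nc g] unfolding N_def by blast
  qed
  then have Nn: "N \<lhd> G" by (rule normal_conjugateI[OF N(2)])
  let ?M = "(\<lambda>L. L \<inter> N) ` \<L>"
  have ne: "L \<inter> N \<noteq> {\<one>}" if L: "L \<in> \<L>" for L
  proof
    assume "L \<inter> N = {\<one>}"
    moreover have "L \<lessapprox> L \<inter> N"
      using indepD(3,4)[OF assms L] N by (intro vle_Int vle_subset vle_mono[OF N(1)]) auto
    ultimately show False using vle_trivial_finite[of L "{\<one>}"] indepD(4,5)[OF assms L] by simp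
  qed
  have one: "\<one> \<in> L \<inter> N" if "L \<in> \<L>" for L using indepD(7)[OF assms that] subgroup.one_closed[OF N(2)] by blast
  have com: "L \<inter> N \<subseteq> cz (L' \<inter> N)" if "L \<in> \<L>" "L' \<in> \<L>" "L \<noteq> L'" for L L'
    using indep_commute[OF assms that] cz_anti[of "L' \<inter> N" L'] by blast
  have inj: "inj_on (\<lambda>L. L \<inter> N) \<L>"
  proof (rule inj_onI, rule ccontr)
    fix L L' assume a: "L \<in> \<L>" "L' \<in> \<L>" "L \<inter> N = L' \<inter> N" "L \<noteq> L'"
    have "L \<inter> N \<subseteq> (L \<inter> N) \<inter> cz (L \<inter> N)" using com[OF a(1,2,4)] a(3) by simp
    moreover have "(L \<inter> N) \<inter> cz (L \<inter> N) = {\<one>}"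
      by (rule subnormal_centre[OF subnormal_Int[OF indepD(1)[OF assms a(1)] normal_subnormal[OF Nn]]])
    ultimately show False using ne[OF a(1)] one[OF a(1)] by blast
  qed
  have "indep ?M" unfolding indep_def
    using fin ne com subnormal_Int[OF indepD(1)[OF assms] normal_subnormal[OF Nn]] by auto
  moreover have "card ?M = card \<L>" by (rule card_image[OF inj])
  moreover have "L \<subseteq> N \<and> nrm N L" if LM: "L \<in> ?M" for L
  proof -
    obtain K where K: "K \<in> \<L>" "L = K \<inter> N" using LM by blast
    have "nrm N K" using f[OF K(1)] K(1) by (auto simp: N_def)
    then show ?thesis unfolding K(2) using nrm_Int[OF _ nrm_self[OF N(2)] indepD(4)[OF assms K(1)] Nc Nc] by blast
  qed
  ultimately show ?thesis using Nn N(1) by (intro that[of ?M N])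
qed

end

section \<open>Families of maximal size and the structure lattice\<close>

locale max_family = just_infinite_nva +
  fixes N \<L>
  assumes N: "N \<lhd> G" "carrier G \<lessapprox> N" and indep: "indep \<L>" and in_N: "\<And>L. L \<in> \<L> \<Longrightarrow> L \<subseteq> N" "\<And>L. L \<in> \<L> \<Longrightarrow> nrm N L"
    and maximal: "\<And>\<M>. indep \<M> \<Longrightarrow> card \<M> \<le> card \<L>"
begin

lemma N_subgroup: "subgroup N G" and N_carrier: "N \<subseteq> carrier G"
  using N(1) by (auto simp: normal_imp_subgroup subgroup.subset)

lemma fin: "finite \<L>" using indep by (simp add: indep_def)

text \<open>If the part of \<open>L\<close> centralizing \<open>H\<close> were nontrivial, replacing
  \<open>L\<close> by \<open>H\<close> and that part would enlarge the family. So it is trivial, and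
  the product of \<open>H\<close> with its centralizer, which has finite index, meets
  \<open>L\<close> inside \<open>H\<close>.\<close>

lemma atomic:
  assumes L: "L \<in> \<L>" and H: "subnormal H G" "H \<subseteq> L" "H \<noteq> {\<one>}"
  shows "L \<lessapprox> H"
proof -
  note LD = indepD[OF indep L]
  have Hs: "subgroup H G" "H \<subseteq> carrier G" using H subnormal_subgroup LD by blast+
  obtain M where M: "M \<lhd> G" "carrier G \<lessapprox> (H \<inter> M) <#> (M \<inter> cz H)" "subnormal (M \<inter> cz H) G"
    using subnormal_normalizer[OF H(1)] by metis
  let ?D = "M \<inter> cz H \<inter> L"
  have Dsub: "subnormal ?D G" by (rule subnormal_Int[OF M(3) LD(1)])
  have D: "?D = {\<one>}"
  proof (rule ccontr)
    assume ne: "?D \<noteq> {\<one>}"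
    let ?M = "insert H (insert ?D (\<L> - {L}))"
    have HD: "H \<inter> ?D = {\<one>}" using subnormal_centre[OF H(1)] subgroup.one_closed[OF subnormal_subgroup[OF Dsub]] subgroup.one_closed[OF Hs(1)] by blast
    have notin: "A \<notin> \<L> - {L}" if A: "A \<subseteq> L" "A \<noteq> {\<one>}" for A
    proof
      assume a: "A \<in> \<L> - {L}"
      then have "A \<subseteq> cz L" using indep_commute[OF indep _ L] by blast
      then have "A \<subseteq> {\<one>}" using A LD(6) by blast
      then show False using A indepD(7)[OF indep, of A] a by blast
    qed
    have "indep ?M" unfolding indep_def
    proof (intro conjI ballI impI)
      show "finite ?M" using fin by simp
      fix A assume A: "A \<in> ?M"
      show "subnormal A G" "A \<noteq> {\<one>}" using A H Dsub ne indepD(1,2)[OF indep] by blast+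
      fix B assume B: "B \<in> ?M" "A \<noteq> B"
      have c1: "P \<subseteq> cz K" "K \<subseteq> cz P" if "P \<subseteq> L" "K \<in> \<L> - {L}" for P K
        using that indep_commute[OF indep L, of K] indep_commute[OF indep _ L, of K] cz_anti[of P L] by blast+
      have c2: "?D \<subseteq> cz H" "H \<subseteq> cz ?D" using cz_iff[of ?D H] Hs LD(4) by blast+
      have c3: "K \<subseteq> cz K'" if "K \<in> \<L> - {L}" "K' \<in> \<L> - {L}" "K \<noteq> K'" for K K'
        using that indep_commute[OF indep] by blast
      consider "A = H" "B = ?D" | "A = ?D" "B = H" | "A = H" "B \<in> \<L> - {L}" | "A = ?D" "B \<in> \<L> - {L}"
        | "A \<in> \<L> - {L}" "B = H" | "A \<in> \<L> - {L}" "B = ?D" | "A \<in> \<L> - {L}" "B \<in> \<L> - {L}"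
        using A B by (elim insertE) simp_all
      then show "A \<subseteq> cz B"
      proof cases
        case 1 show ?thesis unfolding 1 by (rule c2(2))
      next
        case 2 show ?thesis unfolding 2 by blast
      next
        case 3 show ?thesis unfolding 3(1) by (rule c1(1)[OF H(2) 3(2)])
      next
        case 4 show ?thesis unfolding 4(1) by (rule c1(1)[OF _ 4(2)]) blast
      next
        case 5 show ?thesis unfolding 5(2) by (rule c1(2)[OF H(2) 5(1)])
      next
        case 6 show ?thesis unfolding 6(2) by (rule c1(2)[OF _ 6(1)]) blast
      next
        case 7 show ?thesis by (rule c3[OF 7 B(2)])
      qed
    qed
    moreover have "card ?M = Suc (card \<L>)"
    proof -
      have D: "?D \<notin> \<L> - {L}" by (rule notin[OF _ ne]) blast
      have "H \<noteq> ?D"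
      proof
        assume "H = ?D"
        then have "H \<inter> ?D = H" by simp
        then show False using HD H(3) by simp
      qed
      then have Hn: "H \<notin> insert ?D (\<L> - {L})" using notin[OF H(2,3)] by blast
      have f: "finite (\<L> - {L})" using fin by simp
      have "card ?M = Suc (card (insert ?D (\<L> - {L})))"
        using f by (intro card_insert_disjoint Hn finite.insertI)
      also have "card (insert ?D (\<L> - {L})) = Suc (card (\<L> - {L}))" by (rule card_insert_disjoint[OF f D])
      also have "\<dots> = card \<L>" by (rule card.remove[OF fin L, symmetric])
      finally show ?thesis .
    qed
    ultimately show False using maximal[of ?M] by simp
  qed
  have HC: "subgroup ((H \<inter> M) <#> (M \<inter> cz H)) G"
    by (rule set_mult_commuting_subgroup[OF subgroups_Inter_pair[OF Hs(1) normal_imp_subgroup[OF M(1)]] subnormal_subgroup[OF M(3)]])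
       (use cz_anti[of "H \<inter> M" H] in blast)
  have "L \<lessapprox> L \<inter> ((H \<inter> M) <#> (M \<inter> cz H))"
    by (rule vle_Int[OF vle_subset vle_mono[OF M(2)] LD(3) LD(3) HC]) (use LD in auto)
  moreover have "L \<inter> ((H \<inter> M) <#> (M \<inter> cz H)) \<subseteq> H"
  proof
    fix x assume "x \<in> L \<inter> ((H \<inter> M) <#> (M \<inter> cz H))"
    then obtain h c where x: "x \<in> L" "h \<in> H" "c \<in> M \<inter> cz H" "x = h \<otimes> c" by (auto simp: set_mult_def)
    have cc: "h \<in> carrier G" "c \<in> carrier G" using x Hs cz_subset by auto
    have "inv h \<otimes> x \<in> L" using x(1,2) H(2) LD(3) by (intro subgroup_inv_mult) auto
    then have "c \<in> ?D" using x cc by (simp add: inv_mult_cancel)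
    then show "x \<in> H" using D x cc by simp
  qed
  ultimately show ?thesis by (rule vle_mono[OF _ order_refl])
qed

lemma gen_facts:
  assumes "I \<subseteq> \<L>"
  shows "\<Union>I \<subseteq> carrier G" "subgroup (gen I) G" "gen I \<subseteq> N" "nrm N (gen I)" "subnormal (gen I) G"
proof -
  show U: "\<Union>I \<subseteq> carrier G" using indepD(4)[OF indep] assms by blast
  show s: "subgroup (gen I) G" by (rule generate_is_subgroup[OF U])
  show i: "gen I \<subseteq> N" by (rule generate_subgroup_incl[OF _ N_subgroup]) (use in_N assms in blast)
  have "cj n (gen I) \<subseteq> gen I" if n: "n \<in> N" for n
  proof (rule conjugate_generate_subset[OF U])
    show nc: "n \<in> carrier G" using n N_carrier by blast
    have "n \<otimes> x \<otimes> inv n \<in> \<Union>I" if "x \<in> L" "L \<in> I" for x L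
      using nrm_conj_mem[OF in_N(2)[of L] indepD(4)[OF indep, of L] n nc] that assms by blast
    then show "cj n (\<Union>I) \<subseteq> gen I" using conjugate_set_image[OF U nc] by (auto intro: generate.incl)
  qed
  then show nn: "nrm N (gen I)" by (intro nrmI[OF N_subgroup]) (use s subgroup.subset in blast)+
  have "gen I \<lhd> G\<lparr>carrier := N\<rparr>" unfolding normal_restrict_iff[OF N_subgroup]
    using s i nrm_conj_mem[OF nn subgroup.subset[OF s]] N_carrier by blast
  then show "subnormal (gen I) G" by (rule subnormal_step[OF normal_subnormal[OF N(1)]])
qed

text \<open>A nontrivial centralizer of \<open>gen \<L>\<close> in \<open>N\<close> could be added
  to the family. So it is trivial, and \<open>gen \<L>\<close> multiplied by it has finite
  index.\<close>

lemma gen_full: "carrier G \<lessapprox> gen \<L>"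
proof -
  note g = gen_facts[OF order_refl]
  have gc: "gen \<L> \<subseteq> carrier G" using g(2) subgroup.subset by blast
  let ?C = "N \<inter> cz (gen \<L>)"
  have Csn: "subnormal ?C G"
  proof (rule subnormal_step[OF normal_subnormal[OF N(1)]])
    have n: "nrm N ?C" by (rule nrm_Int[OF nrm_self[OF N_subgroup] nrm_cz[OF g(4) gc N_carrier] N_carrier cz_subset N_carrier])
    have "?C \<subseteq> carrier G" using N_carrier by blast
    then show "?C \<lhd> G\<lparr>carrier := N\<rparr>" unfolding normal_restrict_iff[OF N_subgroup]
      using subgroups_Inter_pair[OF N_subgroup cz_subgroup[OF gc]] nrm_conj_mem[OF n] N_carrier by blast
  qed
  have "?C = {\<one>}"
  proof (rule ccontr)
    assume ne: "?C \<noteq> {\<one>}"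
    have Cz: "?C \<subseteq> cz L" "L \<subseteq> cz ?C" if "L \<in> \<L>" for L
    proof -
      have "L \<subseteq> gen \<L>" using that by (auto intro: generate.incl)
      then show 1: "?C \<subseteq> cz L" using cz_anti by blast
      have "?C \<subseteq> carrier G" using N_carrier by blast
      then show "L \<subseteq> cz ?C" using cz_iff[OF _ indepD(4)[OF indep that]] 1 by blast
    qed
    have "indep (insert ?C \<L>)" unfolding indep_def
    proof (intro conjI ballI impI)
      show "finite (insert ?C \<L>)" using fin by simp
      fix A assume A: "A \<in> insert ?C \<L>"
      show "subnormal A G" "A \<noteq> {\<one>}" using A Csn ne indepD(1,2)[OF indep] by blast+
      fix B assume B: "B \<in> insert ?C \<L>" "A \<noteq> B"
      show "A \<subseteq> cz B" using A B Cz indep_commute[OF indep] by blast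
    qed
    moreover have "?C \<notin> \<L>"
    proof
      assume "?C \<in> \<L>"
      then show False using Cz(1)[of ?C] indepD(6)[OF indep, of ?C] ne by blast
    qed
    ultimately show False using maximal[of "insert ?C \<L>"] fin by simp
  qed
  then have "carrier G \<lessapprox> gen \<L> <#> {\<one>}" using depth_two_product_finite_index(2)[OF N g(2-4)] by simp
  moreover have "gen \<L> <#> {\<one>} = gen \<L>" using gc by (force simp: set_mult_def)
  ultimately show ?thesis by simp
qed

lemma gen_split:
  assumes "J \<subseteq> \<L>" "I \<subseteq> J" "e \<in> gen J"
  shows "\<exists>a\<in>gen I. \<exists>b\<in>gen (J - I). e = a \<otimes> b"
proof -
  have "finite I" by (rule finite_subset[OF subset_trans[OF assms(2,1)] fin])
  then have "e \<in> gen J \<Longrightarrow> I \<subseteq> J \<Longrightarrow> \<exists>a\<in>gen I. \<exists>b\<in>gen (J - I). e = a \<otimes> b" for e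
  proof (induction I arbitrary: e rule: finite_induct)
    case empty
    have "e \<in> carrier G" using empty gen_facts(2)[OF assms(1)] subgroup.subset by blast
    then show ?case using empty generate.one by (intro bexI[of _ \<one>] bexI[of _ e]) auto
  next
    case (insert L I)
    obtain a b where ab: "a \<in> gen I" "b \<in> gen (J - I)" "e = a \<otimes> b" using insert by blast
    have L: "L \<in> \<L>" "L \<notin> J - insert L I" "J - I = insert L (J - insert L I)" using insert assms by auto
    have sub: "J - insert L I \<subseteq> \<L>" "I \<subseteq> \<L>" using assms insert by blast+
    have "gen (J - I) = L <#> gen (J - insert L I)"
      using gen_insert_commuting(1)[OF indep_gen(1)[OF indep sub(1) L(1,2)] indepD(3)[OF indep L(1)] gen_facts(1)[OF sub(1)]] L(3) by simp
    then obtain x y where xy: "x \<in> L" "y \<in> gen (J - insert L I)" "b = x \<otimes> y" using ab(2) by (auto simp: set_mult_def)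
    have c: "a \<in> carrier G" "x \<in> carrier G" "y \<in> carrier G"
      using ab(1) xy indepD(4)[OF indep L(1)] gen_facts(2)[OF sub(1)] gen_facts(2)[OF sub(2)] subgroup.subset by blast+
    have U: "\<Union>(insert L I) \<subseteq> carrier G" using gen_facts(1)[of "insert L I"] L sub by blast
    have "a \<in> gen (insert L I)" "x \<in> gen (insert L I)"
      using ab(1) xy(1) mono_generate[of "\<Union>I" "\<Union>(insert L I)"] by (auto intro: generate.incl)
    then have "a \<otimes> x \<in> gen (insert L I)" using subgroup.m_closed[OF generate_is_subgroup[OF U]] by blast
    moreover have "e = (a \<otimes> x) \<otimes> y" using ab xy c by (simp add: m_assoc)
    ultimately show ?case using xy(2) by blast
  qed
  then show ?thesis using assms by blast
qed

lemma gen_disjoint_commute: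
  assumes "I \<subseteq> \<L>" "J \<subseteq> \<L>" "I \<inter> J = {}" shows "gen I \<subseteq> cz (gen J)"
proof (rule generate_commute[OF gen_facts(1)[OF assms(1)] gen_facts(1)[OF assms(2)]])
  show "\<Union>I \<subseteq> cz (\<Union>J)" using indep_gen(1)[OF indep assms(2)] assms by blast
qed

text \<open>Coordinate by coordinate: the other coordinates commute with \<open>L\<close>, so the
  coordinate of b in \<open>L\<close> centralizes L \<inter> M and is trivial by
  \<open>centralizer_of_finite_index_part\<close>.\<close>

lemma gen_centralizing_trivial:
  assumes M: "M \<lhd> G" "carrier G \<lessapprox> M" and J: "J \<subseteq> \<L>" "b \<in> gen J" "\<And>L. L \<in> J \<Longrightarrow> b \<in> cz (L \<inter> M)"
  shows "b = \<one>"
proof -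
  have "finite J" by (rule finite_subset[OF J(1) fin])
  then show ?thesis using J
  proof (induction J rule: finite_induct)
    case empty
    then show ?case by (simp add: generate_empty)
  next
    case (insert L J)
    have L: "L \<in> \<L>" "J \<subseteq> \<L>" using insert by auto
    note g = gen_insert_commuting[OF indep_gen(1)[OF indep L(2,1) insert.hyps(2)] indepD(3)[OF indep L(1)] gen_facts(1)[OF L(2)]]
    obtain x y where xy: "x \<in> L" "y \<in> gen J" "b = x \<otimes> y" using insert.prems(2) unfolding g(1) by (auto simp: set_mult_def)
    have c: "x \<in> carrier G" "y \<in> carrier G"
      using xy indepD(4)[OF indep L(1)] gen_facts(2)[OF L(2)] subgroup.subset by blast+
    have Lc: "L \<inter> M \<subseteq> carrier G" using indepD(4)[OF indep L(1)] by blast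
    have "y \<in> cz (L \<inter> M)" using g(3) xy(2) cz_anti[of "L \<inter> M" L] by blast
    then have "inv y \<in> cz (L \<inter> M)" using subgroup.m_inv_closed[OF cz_subgroup[OF Lc]] by blast
    then have "b \<otimes> inv y \<in> cz (L \<inter> M)" using insert.prems(3)[of L] subgroup.m_closed[OF cz_subgroup[OF Lc]] by blast
    moreover have "b \<otimes> inv y = x" using xy c by (simp add: m_assoc)
    ultimately have "x = \<one>" using centralizer_of_finite_index_part[OF indepD(1)[OF indep L(1)] M] xy(1) by blast
    then have "b \<in> gen J" using xy c by simp
    then show ?case using insert by blast
  qed
qed

text \<open>By atomicity these members lie virtually in \<open>H\<close>, so they serve as the
  coordinates of its commensurability class.\<close>

definition support :: "'a set \<Rightarrow> 'a set set" where "support H = {L \<in> \<L>. H \<inter> L \<noteq> {\<one>}}"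

lemma support_subset: "support H \<subseteq> \<L>" by (auto simp: support_def)

lemma disjoint_member_commute:
  assumes H: "subgroup H G" "H \<subseteq> N" "H \<inter> L = {\<one>}" and L: "L \<in> \<L>" and M: "M \<lhd> G" "nrm M H"
  shows "L \<inter> M \<subseteq> cz H"
proof (rule commute_if_trivial_Int[OF H(1) subgroups_Inter_pair[OF indepD(3)[OF indep L] normal_imp_subgroup[OF M(1)]]])
  have c: "H \<subseteq> carrier G" "L \<subseteq> carrier G" "M \<subseteq> carrier G"
    using H(1) indepD(4)[OF indep L] M(1) by (auto simp: subgroup.subset normal_imp_subgroup)
  show "nrm (L \<inter> M) H" using M(2) by blast
  show "nrm H (L \<inter> M)" by (rule nrm_Int[OF nrm_subset[OF in_N(2)[OF L] H(2)] nrm_subset[OF nrm_normal[OF M(1)] c(1)] c(2,3,1)])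
qed (use H(3) in blast)

text \<open>An element of H \<inter> N in \<open>gen \<L>\<close> is a product of a part over the
  support and a rest. Where \<open>H\<close> meets a member trivially, H \<inter> N commutes with a
  finite-index part of that member. So the rest centralizes finite-index parts of all members it
  involves, and is trivial.\<close>

lemma vle_gen_support:
  assumes H: "subnormal H G" shows "H \<lessapprox> gen (support H)"
proof -
  have Hs: "subgroup H G" "H \<subseteq> carrier G" using H subnormal_subgroup subgroup.subset by blast+
  obtain M where M: "M \<lhd> G" "carrier G \<lessapprox> M" "nrm M H" using subnormal_normalizer[OF H] by metis
  let ?H = "H \<inter> N" and ?I = "support H" and ?J = "\<L> - support H"
  have H's: "subgroup ?H G" by (rule subgroups_Inter_pair[OF Hs(1) N_subgroup])
  have Mc: "M \<subseteq> carrier G" using M(1) by (simp add: normal_imp_subgroup subgroup.subset)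
  have nH': "nrm M ?H" by (rule nrm_Int[OF M(3) nrm_subset[OF nrm_normal[OF N(1)] Mc] Hs(2) N_carrier Mc])
  note gs = gen_facts[OF order_refl]
  have J: "?J \<subseteq> \<L>" "?I \<subseteq> \<L>" "?I \<inter> ?J = {}" using support_subset by auto
  have "?H \<inter> gen \<L> \<subseteq> gen ?I"
  proof
    fix e assume e: "e \<in> ?H \<inter> gen \<L>"
    then obtain a b where ab: "a \<in> gen ?I" "b \<in> gen ?J" "e = a \<otimes> b" using gen_split[OF order_refl J(2)] by blast
    have ac: "a \<in> carrier G" "b \<in> carrier G" using ab gen_facts(2)[OF J(1)] gen_facts(2)[OF J(2)] subgroup.subset by blast+
    have "b \<in> cz (L \<inter> M)" if L: "L \<in> ?J" for L
    proof -
      have LL: "L \<in> \<L>" "H \<inter> L = {\<one>}" using L by (auto simp: support_def)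
      have "?H \<inter> L = {\<one>}" using LL(2) indepD(7)[OF indep LL(1)] subgroup.one_closed[OF H's] by blast
      then have "L \<inter> M \<subseteq> cz ?H" by (intro disjoint_member_commute[OF H's _ _ LL(1) M(1) nH']) auto
      moreover have Lc: "L \<inter> M \<subseteq> carrier G" "?H \<subseteq> carrier G" using Mc Hs by auto
      ultimately have "e \<in> cz (L \<inter> M)" using cz_iff[OF Lc] e by blast
      moreover have "L \<subseteq> gen ?J" using L by (auto intro: generate.incl)
      then have "cz (gen ?J) \<subseteq> cz (L \<inter> M)" by (intro cz_anti) blast
      then have "a \<in> cz (L \<inter> M)" using gen_disjoint_commute[OF J(2,1,3)] ab(1) by blast
      ultimately have "inv a \<otimes> e \<in> cz (L \<inter> M)" by (intro subgroup_inv_mult cz_subgroup Lc)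
      then show ?thesis using ab ac by (simp add: inv_mult_cancel)
    qed
    then have "b = \<one>" by (rule gen_centralizing_trivial[OF M(1,2) J(1) ab(2)])
    then show "e \<in> gen ?I" using ab ac by simp
  qed
  moreover have "H \<lessapprox> ?H \<inter> gen \<L>"
    using Hs gs(2) H's N_subgroup by (intro vle_Int vle_subset vle_mono[OF N(2)] vle_mono[OF gen_full]) auto
  ultimately show ?thesis using vle_mono by blast
qed

lemma gen_vle:
  assumes "I \<subseteq> \<L>" "subgroup S G" "\<And>L. L \<in> I \<Longrightarrow> L \<lessapprox> S" shows "gen I \<lessapprox> S"
proof -
  have "finite I" by (rule finite_subset[OF assms(1) fin])
  then show ?thesis using assms(1,3)
  proof (induction I rule: finite_induct)
    case empty
    then show ?case using subgroup.one_closed[OF assms(2)] subgroup.subset[OF assms(2)] by (intro vle_subset) (auto simp: generate_empty)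
  next
    case (insert L I)
    have L: "L \<in> \<L>" "I \<subseteq> \<L>" using insert by auto
    note g = gen_insert_commuting[OF indep_gen(1)[OF indep L(2,1) insert.hyps(2)] indepD(3)[OF indep L(1)] gen_facts(1)[OF L(2)]]
    show ?case unfolding g(1)
      by (rule vle_set_mult_commuting) (use insert indepD(3)[OF indep L(1)] gen_facts(2)[OF L(2)] assms(2) g in auto)
  qed
qed

lemma support_vle: "subnormal H G \<Longrightarrow> L \<in> support H \<Longrightarrow> L \<lessapprox> H"
  using atomic[of L "H \<inter> L"] subnormal_Int[of H L] indepD(1)[OF indep, of L] vle_mono[of L "H \<inter> L" L H]
  by (auto simp: support_def)

lemma gen_vle_iff:
  assumes "I \<subseteq> \<L>" "J \<subseteq> \<L>" shows "gen I \<lessapprox> gen J \<longleftrightarrow> I \<subseteq> J"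
proof
  assume v: "gen I \<lessapprox> gen J"
  show "I \<subseteq> J"
  proof (rule ccontr)
    assume "\<not> I \<subseteq> J"
    then obtain L where L: "L \<in> I" "L \<notin> J" "L \<in> \<L>" using assms by blast
    have "L \<subseteq> gen I" using L by (auto intro: generate.incl)
    then have "L \<lessapprox> gen J" using vle_mono[OF v] by blast
    then have "L \<lessapprox> L \<inter> gen J"
      by (rule vle_Int_self[OF _ indepD(3)[OF indep L(3)] gen_facts(2)[OF assms(2)]])
    then have "finite L" using indep_gen(3)[OF indep assms(2) L(3,2)] vle_trivial_finite[of L "{\<one>}"] indepD(4)[OF indep L(3)] by simp
    then show False using indepD(5)[OF indep L(3)] by simp
  qed
next
  assume "I \<subseteq> J"
  then show "gen I \<lessapprox> gen J"
    using gen_facts(2)[OF assms(2)] by (intro vle_subset mono_generate) (auto dest: subgroup.subset)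
qed

text \<open>Subsets I of \<open>\<L>\<close> correspond bijectively to the classes of
  \<open>gen I\<close>; the preimage of the class of \<open>H\<close> is its support.\<close>

lemma card_structure_lattice: "finite (structure_lattice G)" "card (structure_lattice G) = 2 ^ card \<L>"
proof -
  let ?c = "\<lambda>I. commensurability G `` {gen I}"
  have "bij_betw ?c (Pow \<L>) (structure_lattice G)"
    unfolding bij_betw_def
  proof
    show "inj_on ?c (Pow \<L>)"
    proof (rule inj_onI)
      fix I J assume a: "I \<in> Pow \<L>" "J \<in> Pow \<L>" "?c I = ?c J"
      have "(gen I, gen J) \<in> commensurability G"
        using a gen_facts(5) eq_equiv_class[OF a(3) commensurability_equiv] by simp
      then show "I = J" using a gen_vle_iff by (auto simp: commensurability_iff)
    qed
    show "?c ` Pow \<L> = structure_lattice G"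
    proof
      show "?c ` Pow \<L> \<subseteq> structure_lattice G" unfolding structure_lattice_def using gen_facts(5) by (auto intro: quotientI)
      show "structure_lattice G \<subseteq> ?c ` Pow \<L>"
      proof
        fix c assume "c \<in> structure_lattice G"
        then obtain H where H: "subnormal H G" "c = commensurability G `` {H}"
          unfolding structure_lattice_def by (auto elim: quotientE)
        have "gen (support H) \<lessapprox> H"
          by (rule gen_vle[OF support_subset subnormal_subgroup[OF H(1)]]) (rule support_vle[OF H(1)])
        then have "(H, gen (support H)) \<in> commensurability G"
          using vle_gen_support[OF H(1)] gen_facts(5)[OF support_subset] H(1) by (simp add: commensurability_iff)
        then have "c = ?c (support H)" unfolding H(2) by (rule equiv_class_eq[OF commensurability_equiv])
        then show "c \<in> ?c ` Pow \<L>" using support_subset by blast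
      qed
    qed
  qed
  then show "finite (structure_lattice G)" "card (structure_lattice G) = 2 ^ card \<L>"
    using bij_betw_finite[of ?c] bij_betw_same_card[of ?c] fin by (force simp: card_Pow)+
qed

text \<open>The measure that every factor of a nonzero product raises; it is at most
  \<open>card \<L>\<close>.\<close>

definition rk :: "'a bidual_elt \<Rightarrow> nat" where "rk \<Phi> = card {L \<in> \<L>. L \<lessapprox> stab \<Phi>}"

text \<open>Atoms in the support of \<open>M\<close> enter the stabilizer with \<open>M\<close>; the
  others commute with \<open>M\<close> up to finite index and survive from \<Phi>. If no atom were
  new, \<open>M\<close> would lie virtually in \<open>stab \<Phi>\<close> and the product would
  vanish.\<close>

lemma rk_increases:
  assumes M: "subnormal M G" "M \<subseteq> N" and \<Gamma>: "\<Gamma> \<in> differences_on G M" and \<Phi>: "\<Phi> \<in> l1_bidual G"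
    and nz: "arens G \<Gamma> \<Phi> \<noteq> 0"
  shows "rk \<Phi> < rk (arens G \<Gamma> \<Phi>)"
proof -
  have Ms: "subgroup M G" "M \<subseteq> carrier G" using M subnormal_subgroup subgroup.subset by blast+
  obtain N' where N': "N' \<lhd> G" "carrier G \<lessapprox> N'" "nrm N' M" using subnormal_normalizer[OF M(1)] by metis
  let ?A = "{L \<in> \<L>. L \<lessapprox> stab \<Phi>}" and ?B = "{L \<in> \<L>. L \<lessapprox> stab (arens G \<Gamma> \<Phi>)}"
  have MB: "M \<subseteq> stab (arens G \<Gamma> \<Phi>)" by (rule differences_stab[OF \<Gamma> Ms(2) \<Phi>])
  have I: "support M \<subseteq> ?B"
    using support_vle[OF M(1)] support_subset vle_mono[OF _ order_refl MB] by blast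
  have "?A \<subseteq> ?B"
  proof
    fix L assume L: "L \<in> ?A"
    show "L \<in> ?B"
    proof (cases "L \<in> support M")
      case False
      then have "M \<inter> L = {\<one>}" using L by (auto simp: support_def)
      then have "L \<inter> N' \<subseteq> cz M" using L by (intro disjoint_member_commute[OF Ms(1) M(2) _ _ N'(1,3)]) auto
      moreover have LL: "L \<in> \<L>" "L \<lessapprox> stab \<Phi>" using L by blast+
      then have "L \<lessapprox> (L \<inter> N') \<inter> stab \<Phi>"
        using indepD(3)[OF indep LL(1)] normal_imp_subgroup[OF N'(1)] stab_subgroup
        by (intro vle_Int[OF _ LL(2)] finite_index_Int[OF N'(2)] subgroups_Inter_pair)
      ultimately have "L \<lessapprox> stab (arens G \<Gamma> \<Phi>)"
        using centralizer_stab[OF \<Gamma> Ms(2) \<Phi>] by (elim vle_mono) auto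
      then show ?thesis using L by simp
    qed (use I in blast)
  qed
  moreover have "\<not> support M \<subseteq> ?A"
  proof
    assume "support M \<subseteq> ?A"
    then have "gen (support M) \<lessapprox> stab \<Phi>" by (intro gen_vle[OF support_subset stab_subgroup]) blast
    then have "M \<lessapprox> stab \<Phi>" by (rule vle_trans[OF vle_gen_support[OF M(1)] _ Ms(2)])
    then show False using arens_difference_vanish[OF \<Gamma> Ms(1) \<Phi> stab_subgroup _ stab_invariant] nz by blast
  qed
  then have "?A \<noteq> ?B" using I by blast
  ultimately show ?thesis unfolding rk_def using fin by (intro psubset_card_mono) auto
qed

lemma products_vanish_max: "products_vanish (arens G) (A_sn G) (Suc (card \<L>))"
proof (rule products_vanish_A_snI)
  let ?D = "\<Union>M\<in>{M. subnormal M G \<and> M \<subseteq> N}. differences_on G M"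
  have Dl: "?D \<subseteq> l1_bidual G" using differences_onD(1) by blast
  have claim: "ys \<noteq> [] \<Longrightarrow> set ys \<subseteq> ?D \<Longrightarrow> list_product (arens G) ys \<noteq> 0 \<Longrightarrow> rk (list_product (arens G) ys) \<ge> length ys" for ys
  proof (induction ys rule: list_nonempty_induct)
    case (single y)
    then obtain M where M: "subnormal M G" "M \<subseteq> N" "y \<in> differences_on G M" by auto
    have yl: "y \<in> l1_bidual G" using M differences_onD(1) by blast
    \<comment> \<open>Written as y \<box> \<delta>_1, the rightmost factor also raises the rank,
      namely above that of the point mass.\<close>
    have p: "arens G y (pt \<one>) = y"
      by (rule l1_bidual_ext[of _ G]) (auto simp: yl arens_closed to_bidual_point_mass ev_arens bdd_fun_left intro!: ev_cong)
    have "rk (pt \<one>) < rk (arens G y (pt \<one>))"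
      by (rule rk_increases[OF M to_bidual_point_mass(1)]) (use p single in auto)
    then show ?case using p by simp
  next
    case (cons y ys)
    then obtain M where M: "subnormal M G" "M \<subseteq> N" "y \<in> differences_on G M" by auto
    have yl: "y \<in> l1_bidual G" using M differences_onD(1) by blast
    let ?P = "list_product (arens G) ys"
    have eq: "list_product (arens G) (y # ys) = arens G y ?P" using cons by (simp add: list_product_Cons)
    have Pl: "?P \<in> l1_bidual G" using cons Dl by (intro list_product_closed) auto
    have ne: "arens G y ?P \<noteq> 0" using cons.prems(2) unfolding eq .
    then have P0: "?P \<noteq> 0" using arens_zero_right[OF yl] by auto
    have "set ys \<subseteq> ?D" using cons.prems(1) by simp
    then have "length ys \<le> rk ?P" using P0 by (rule cons.IH)
    then show ?case using rk_increases[OF M Pl ne] eq by simp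
  qed
  fix xs assume xs: "length xs = Suc (card \<L>)" "set xs \<subseteq> sn_differences"
  show "list_product (arens G) xs = 0"
  proof (rule sn_products_vanish_reduce[OF N _ _ xs])
    fix ys assume ys: "length ys = Suc (card \<L>)" "set ys \<subseteq> ?D"
    have le: "rk (list_product (arens G) ys) \<le> card \<L>" unfolding rk_def by (rule card_mono[OF fin]) blast
    show "list_product (arens G) ys = 0"
    proof (rule ccontr)
      assume "list_product (arens G) ys \<noteq> 0"
      moreover have "ys \<noteq> []" using ys(1) by (metis Zero_not_Suc list.size(3))
      ultimately have "length ys \<le> rk (list_product (arens G) ys)" by (intro claim ys(2))
      then show False using le ys(1) by linarith
    qed
  qed simp
qed simp

end

section \<open>Branch groups\<close>

context group begin

abbreviation CC :: "'a set \<Rightarrow> 'a set set" where "CC A \<equiv> (\<lambda>g. cj g A) ` carrier G"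

lemma self_conjugate: "A \<subseteq> carrier G \<Longrightarrow> A \<in> CC A"
proof -
  assume "A \<subseteq> carrier G"
  then have "A = cj \<one> A" by (simp add: conjugate_one)
  then show "A \<in> CC A" by (rule rev_image_eqI[OF one_closed])
qed

lemma card_conjugates_le:
  assumes "finite T" "T \<subseteq> carrier G" "\<forall>a\<in>carrier G. \<exists>t\<in>T. inv t \<otimes> a \<in> N" "nrm N A" "A \<subseteq> carrier G"
  shows "card (CC A) \<le> card T"
proof -
  have "CC A \<subseteq> (\<lambda>g. cj g A) ` T"
  proof
    fix B assume "B \<in> CC A"
    then obtain g where g: "g \<in> carrier G" "B = cj g A" by blast
    then obtain t where t: "t \<in> T" "inv t \<otimes> g \<in> N" using assms(3) by blast
    then have "cj t (cj (inv t \<otimes> g) A) = cj t A" using assms by simp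
    moreover have tc: "t \<in> carrier G" using t assms by blast
    ultimately have "cj g A = cj t A" using g assms(5) by (simp add: conjugate_conjugate inv_mult_cancel)
    then show "B \<in> (\<lambda>g. cj g A) ` T" using t g by blast
  qed
  then show ?thesis using assms(1) by (meson card_image_le card_mono finite_imageI le_trans)
qed

lemma conjugate_iso:
  assumes "A \<subseteq> carrier G" "g \<in> carrier G"
  shows "G\<lparr>carrier := A\<rparr> \<cong> G\<lparr>carrier := cj g A\<rparr>"
proof -
  let ?f = "\<lambda>x. g \<otimes> x \<otimes> inv g"
  have "?f \<in> hom (G\<lparr>carrier := A\<rparr>) (G\<lparr>carrier := cj g A\<rparr>)"
    using assms by (intro homI) (auto simp: conjugate_set_image subset_iff conjugate_mult)
  moreover have "inj_on ?f A"
  proof (rule inj_onI)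
    fix x y assume xy: "x \<in> A" "y \<in> A" "?f x = ?f y"
    then have "x \<in> carrier G" "y \<in> carrier G" using assms by auto
    then show "x = y" using xy(3) assms(2) by simp
  qed
  ultimately have "?f \<in> iso (G\<lparr>carrier := A\<rparr>) (G\<lparr>carrier := cj g A\<rparr>)"
    unfolding iso_def bij_betw_def using conjugate_set_image[OF assms] by simp
  then show ?thesis by (auto simp: is_iso_def)
qed

lemma normalizer_subgroup:
  assumes "A \<subseteq> carrier G" shows "subgroup {x \<in> carrier G. cj x A = A} G"
proof (rule subgroupI)
  show "{x \<in> carrier G. cj x A = A} \<noteq> {}" using conjugate_one[OF assms] by blast
  fix a assume a: "a \<in> {x \<in> carrier G. cj x A = A}"
  then have "cj (inv a) A = A" using conjugate_inv_conjugate(1)[OF assms, of a] by simp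
  then show "inv a \<in> {x \<in> carrier G. cj x A = A}" using a by simp
  fix b assume "b \<in> {x \<in> carrier G. cj x A = A}"
  then show "a \<otimes> b \<in> {x \<in> carrier G. cj x A = A}" using a assms by (simp add: conjugate_conjugate[symmetric])
qed auto

lemma cz_normalizes: "A \<subseteq> carrier G \<Longrightarrow> x \<in> cz A \<Longrightarrow> cj x A = A"
proof -
  assume A: "A \<subseteq> carrier G" and x: "x \<in> cz A"
  have xc: "x \<in> carrier G" using x cz_subset by blast
  have "x \<otimes> a \<otimes> inv x = a" if "a \<in> A" for a
    using czD[OF x that] A xc that by (simp add: m_assoc subset_iff)
  then show ?thesis using conjugate_set_image[OF A xc] by simp
qed

end

section \<open>Subgroups that commute with their other conjugates\<close>

context just_infinite_nva begin

text \<open>The normal closure of such a subgroup is the direct product of its finitely many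
  conjugates, which is the shape of one level of a branch structure.\<close>

definition basal :: "'a set \<Rightarrow> bool" where
  "basal B \<longleftrightarrow> subnormal B G \<and> B \<noteq> {\<one>} \<and> (\<forall>g\<in>carrier G. cj g B = B \<or> cj g B \<subseteq> cz B)"

lemma basalD:
  assumes "basal B"
  shows "subnormal B G" "B \<noteq> {\<one>}" "subgroup B G" "B \<subseteq> carrier G" "\<one> \<in> B" "finite (CC B)" "card (CC B) \<ge> 1"
proof -
  show s: "subnormal B G" "B \<noteq> {\<one>}" using assms by (auto simp: basal_def)
  show g: "subgroup B G" "B \<subseteq> carrier G" "\<one> \<in> B"
    using subnormal_subgroup[OF s(1)] subgroup.subset subgroup.one_closed by blast+
  obtain N where N: "N \<lhd> G" "carrier G \<lessapprox> N" "nrm N B" using subnormal_normalizer[OF s(1)] by metis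
  show f: "finite (CC B)"
    by (rule conjugates_finite[OF N(2,3) g(2)]) (use N(1) in \<open>simp add: normal_imp_subgroup subgroup.subset\<close>)
  then show "card (CC B) \<ge> 1" using carrier_nonempty by (simp add: Suc_le_eq card_gt_0_iff)
qed

lemma basal_carrier: "basal (carrier G)"
  using infinite_carrier subnormal_carrier by (auto simp: basal_def conjugate_carrier)

lemma basal_conjugates:
  assumes "basal B" "C \<in> CC B"
  shows "subnormal C G" "C \<noteq> {\<one>}" "subgroup C G" "C \<subseteq> carrier G" "\<one> \<in> C" "C \<inter> cz C = {\<one>}" "CC C = CC B"
    "\<And>C'. C' \<in> CC B \<Longrightarrow> C \<noteq> C' \<Longrightarrow> C \<subseteq> cz C'"
    "\<And>C'. C' \<in> CC B \<Longrightarrow> C \<noteq> C' \<Longrightarrow> C \<inter> C' = {\<one>}"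
proof -
  note B = basalD[OF assms(1)]
  obtain g where g: "g \<in> carrier G" "C = cj g B" using assms by blast
  show s: "subnormal C G" unfolding g(2) by (rule subnormal_conjugate[OF g(1) B(1)])
  show Cs: "subgroup C G" "C \<subseteq> carrier G" "\<one> \<in> C" using subnormal_subgroup[OF s] subgroup.subset subgroup.one_closed by blast+
  show "C \<noteq> {\<one>}"
  proof
    assume "C = {\<one>}"
    then have "cj (inv g) (cj g B) = {\<one>}" using g by (simp add: conjugate_set_image)
    then show False using B g by (simp add: conjugate_inv_conjugate)
  qed
  show z: "C \<inter> cz C = {\<one>}" by (rule subnormal_centre[OF s])
  show "CC C = CC B"
  proof (intro equalityI subsetI)
    fix D assume "D \<in> CC C"
    then obtain h where "h \<in> carrier G" "D = cj h (cj g B)" using g by blast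
    then show "D \<in> CC B" using g B by (simp add: conjugate_conjugate)
  next
    fix D assume "D \<in> CC B"
    then obtain h where h: "h \<in> carrier G" "D = cj h B" by blast
    then have "D = cj (h \<otimes> inv g) C" using g B by (simp add: conjugate_conjugate m_assoc)
    then show "D \<in> CC C" using h g by blast
  qed
  fix C' assume C': "C' \<in> CC B" "C \<noteq> C'"
  then obtain h where h: "h \<in> carrier G" "C' = cj h B" by blast
  have "cj (inv h \<otimes> g) B \<noteq> B"
  proof
    assume "cj (inv h \<otimes> g) B = B"
    then have "cj h (cj (inv h \<otimes> g) B) = cj h B" by simp
    then show False using C' g h B by (simp add: conjugate_conjugate inv_mult_cancel)
  qed
  then have "cj (inv h \<otimes> g) B \<subseteq> cz B" using assms(1) g h by (auto simp: basal_def)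
  then have "cj h (cj (inv h \<otimes> g) B) \<subseteq> cj h (cz B)" by (rule conjugate_mono)
  then show c: "C \<subseteq> cz C'" unfolding g(2) h(2) conjugate_cz[OF B(4) h(1), symmetric]
    using g h B by (simp add: conjugate_conjugate inv_mult_cancel)
  have "\<one> \<in> C'" using subgroup.one_closed[OF conjugate_subgroup[OF B(3) h(1)]] h by simp
  moreover have "C' \<subseteq> carrier G" using h conjugate_subset_carrier[OF B(4)] by blast
  then have "C' \<subseteq> cz C" using c cz_iff Cs(2) by blast
  then have "C \<inter> C' \<subseteq> C \<inter> cz C" by blast
  ultimately show "C \<inter> C' = {\<one>}" using z Cs(3) by blast
qed

lemma ncl_CC: "ncl A = gen (CC A)" by (simp add: ncl_def)

lemma ncl_nontrivial: "A \<subseteq> carrier G \<Longrightarrow> \<one> \<in> A \<Longrightarrow> A \<noteq> {\<one>} \<Longrightarrow> ncl A \<noteq> {\<one>}"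
  using ncl(2) by blast

text \<open>\<open>D\<close> commutes with the normal closure of \<open>A\<close>, a nontrivial
  normal subgroup, and those have trivial centralizer.\<close>

lemma ncl_centralizer:
  assumes "A \<subseteq> carrier G" "\<one> \<in> A" "A \<noteq> {\<one>}" "D \<subseteq> carrier G" "\<And>C. C \<in> CC A \<Longrightarrow> D \<subseteq> cz C" shows "D \<subseteq> {\<one>}"
proof -
  have c: "\<Union>(CC A) \<subseteq> carrier G" using conjugate_subset_carrier[OF assms(1)] by blast
  have "D \<subseteq> cz (\<Union>(CC A))"
  proof
    fix d assume d: "d \<in> D"
    have "d \<otimes> x = x \<otimes> d" if "x \<in> C" "C \<in> CC A" for x C using assms(5)[OF that(2)] that(1) d czD by blast
    then show "d \<in> cz (\<Union>(CC A))" using d assms(4) by (auto simp: cz_def)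
  qed
  then have "\<Union>(CC A) \<subseteq> cz D" using cz_iff[OF assms(4) c] by simp
  then have "ncl A \<subseteq> cz D" unfolding ncl_CC by (rule generate_subgroup_incl[OF _ cz_subgroup[OF assms(4)]])
  moreover have "ncl A \<subseteq> carrier G" using ncl(1)[OF assms(1)] by (simp add: normal_imp_subgroup subgroup.subset)
  ultimately have "D \<subseteq> cz (ncl A)" using cz_iff[OF assms(4)] by simp
  then show ?thesis using normal_center_centralizer(2)[OF ncl(1)[OF assms(1)] ncl_nontrivial[OF assms(1-3)]] by simp
qed

text \<open>Each conjugate normalizes itself and is centralized by all the others.\<close>

lemma basal_ncl_normalizes:
  assumes "basal B" "C \<in> CC B" shows "nrm (ncl B) C"
proof -
  note C = basal_conjugates[OF assms]
  have "\<Union>(CC B) \<subseteq> {x \<in> carrier G. cj x C = C}"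
  proof
    fix x assume "x \<in> \<Union>(CC B)"
    then obtain C' where C': "C' \<in> CC B" "x \<in> C'" by blast
    have xc: "x \<in> carrier G" using C' basal_conjugates(4)[OF assms(1)] by blast
    have "cj x C = C"
    proof (cases "C' = C")
      case True
      then show ?thesis using nrm_self[OF C(3)] C'(2) by blast
    next
      case False
      then have "x \<in> cz C" using basal_conjugates(8)[OF assms(1) C'(1) assms(2)] C'(2) by blast
      then show ?thesis by (rule cz_normalizes[OF C(4)])
    qed
    then show "x \<in> {x \<in> carrier G. cj x C = C}" using xc by simp
  qed
  then have "ncl B \<subseteq> {x \<in> carrier G. cj x C = C}"
    unfolding ncl_CC by (rule generate_subgroup_incl[OF _ normalizer_subgroup[OF C(4)]])
  then show ?thesis by blast
qed

text \<open>Every member of the family meets some conjugate of \<open>B\<close>: otherwise a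
  finite-index part of it would centralize all conjugates of a finite-index part of
  \<open>B\<close>. Two members cannot meet the same conjugate, since conjugating back would give
  commuting nontrivial subnormal subgroups of \<open>B\<close>.\<close>

lemma indep_le_conjugates:
  assumes B: "basal B" and atom: "\<And>H D. subnormal H G \<Longrightarrow> subnormal D G \<Longrightarrow> H \<subseteq> B \<Longrightarrow> D \<subseteq> B \<Longrightarrow> D \<subseteq> cz H \<Longrightarrow> H = {\<one>} \<or> D = {\<one>}"
    and M: "indep \<M>"
  shows "card \<M> \<le> card (CC B)"
proof -
  note BD = basalD[OF B]
  have meet: "\<exists>C\<in>CC B. K \<inter> C \<noteq> {\<one>}" if K: "K \<in> \<M>" for K
  proof (rule ccontr)
    assume no: "\<not> (\<exists>C\<in>CC B. K \<inter> C \<noteq> {\<one>})"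
    note KD = indepD[OF M K]
    obtain N1 where N1: "N1 \<lhd> G" "carrier G \<lessapprox> N1" "nrm N1 B" using subnormal_normalizer[OF BD(1)] by metis
    obtain N2 where N2: "N2 \<lhd> G" "carrier G \<lessapprox> N2" "nrm N2 K" using subnormal_normalizer[OF KD(1)] by metis
    let ?N = "N1 \<inter> N2"
    have s: "subgroup N1 G" "subgroup N2 G" "N1 \<subseteq> carrier G" "N2 \<subseteq> carrier G" using N1 N2 by (auto simp: normal_imp_subgroup subgroup.subset)
    have Ns: "subgroup ?N G" "?N \<subseteq> carrier G" using subgroups_Inter_pair[OF s(1,2)] s by auto
    have Nf: "carrier G \<lessapprox> ?N" by (rule vle_Int[OF N1(2) N2(2) subgroup_self s(1,2)])
    have Nn: "?N \<lhd> G" by (rule normal_conjugateI[OF Ns(1)])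
      (use s normal_conjugate[OF N1(1)] normal_conjugate[OF N2(1)] in \<open>simp add: conjugate_Int\<close>)
    let ?K = "K \<inter> ?N" and ?B = "B \<inter> ?N"
    have Ks: "subgroup ?K G" "?K \<subseteq> carrier G" using subgroups_Inter_pair[OF KD(3) Ns(1)] KD by auto
    have Bs: "subgroup ?B G" "?B \<subseteq> carrier G" using subgroups_Inter_pair[OF BD(3) Ns(1)] BD by auto
    have nn: "nrm ?N ?N" by (rule nrm_self[OF Ns(1)])
    have nK: "nrm ?N ?K" by (rule nrm_Int[OF _ nn KD(4) Ns(2) Ns(2)]) (use N2(3) in blast)
    have nB: "nrm ?N ?B" by (rule nrm_Int[OF _ nn BD(4) Ns(2) Ns(2)]) (use N1(3) in blast)
    have inf: "A \<inter> ?N \<noteq> {\<one>}" if A: "subgroup A G" "infinite A" for A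
    proof
      assume "A \<inter> ?N = {\<one>}"
      then have "A \<lessapprox> {\<one>}" using finite_index_Int[OF Nf A(1) Ns(1)] by simp
      then show False using vle_trivial_finite[of A "{\<one>}"] subgroup.subset[OF A(1)] A(2) by simp
    qed
    have "?K \<subseteq> cz C" if C: "C \<in> CC ?B" for C
    proof -
      obtain g where g: "g \<in> carrier G" "C = cj g ?B" using C by blast
      have CN: "C \<subseteq> ?N" unfolding g(2) using conjugate_mono[of ?B ?N g] normal_conjugate[OF Nn g(1)] by blast
      have Cs: "subgroup C G" unfolding g(2) by (rule conjugate_subgroup[OF Bs(1) g(1)])
      have nC: "nrm ?N C" unfolding g(2) by (rule nrm_conjugate[OF Nn nB Bs(2) g(1)])
      have "C \<subseteq> cj g B" unfolding g(2) by (rule conjugate_mono) blast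
      then have "C \<inter> ?K \<subseteq> {\<one>}" using no g(1) by blast
      then show ?thesis by (intro commute_if_trivial_Int[OF Cs Ks(1)] nrm_subset[OF nC] nrm_subset[OF nK CN]) blast+
    qed
    then have "?K \<subseteq> {\<one>}"
      using inf[OF BD(3) subnormal_infinite[OF BD(1,2)]] subgroup.one_closed[OF Bs(1)] by (intro ncl_centralizer[OF Bs(2) _ _ Ks(2)])
    then show False using inf[OF KD(3,5)] subgroup.one_closed[OF Ks(1)] by blast
  qed
  then have "\<forall>K\<in>\<M>. \<exists>C. C \<in> CC B \<and> K \<inter> C \<noteq> {\<one>}" by blast
  then obtain f where "\<forall>K\<in>\<M>. f K \<in> CC B \<and> K \<inter> f K \<noteq> {\<one>}" by (rule bchoice[THEN exE])
  then have f: "f K \<in> CC B" "K \<inter> f K \<noteq> {\<one>}" if "K \<in> \<M>" for K using that by blast+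
  have "inj_on f \<M>"
  proof (rule inj_onI, rule ccontr)
    fix K K' assume a: "K \<in> \<M>" "K' \<in> \<M>" "f K = f K'" "K \<noteq> K'"
    obtain g where g: "g \<in> carrier G" "f K = cj g B" using f(1)[OF a(1)] by blast
    let ?H = "cj (inv g) (K \<inter> f K)" and ?D = "cj (inv g) (K' \<inter> f K)"
    have sn: "subnormal (f K) G" by (rule basal_conjugates(1)[OF B f(1)[OF a(1)]])
    have sn2: "subnormal (K \<inter> f K) G" "subnormal (K' \<inter> f K) G"
      using subnormal_Int[OF indepD(1)[OF M] sn] a by blast+
    have c: "K \<inter> f K \<subseteq> carrier G" "K' \<inter> f K \<subseteq> carrier G" using indepD(4)[OF M] a by blast+
    have sn3: "subnormal ?H G" "subnormal ?D G" using sn2 g(1) by (auto intro: subnormal_conjugate)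
    have "cj (inv g) (f K) = B" using g BD(4) by (simp add: conjugate_inv_conjugate)
    then have inB: "?H \<subseteq> B" "?D \<subseteq> B" using conjugate_mono[of _ "f K" "inv g"] by blast+
    have "K' \<inter> f K \<subseteq> cz (K \<inter> f K)" using indep_commute[OF M a(2,1)] a(4) cz_anti[of "K \<inter> f K" K] by blast
    then have "?D \<subseteq> cj (inv g) (cz (K \<inter> f K))" by (rule conjugate_mono)
    then have "?D \<subseteq> cz ?H" using conjugate_cz[OF c(1), of "inv g"] g(1) by simp
    then have "?H = {\<one>} \<or> ?D = {\<one>}" by (rule atom[OF sn3 inB])
    moreover have "cj g {\<one>} = {\<one>}" using g(1) by (subst conjugate_set_image) auto
    ultimately have "cj g ?H = {\<one>} \<or> cj g ?D = {\<one>}" by (elim disjE) simp_all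
    then show False using f(2)[OF a(1)] f(2)[OF a(2)] a(3) c g(1) by (simp add: conjugate_inv_conjugate)
  qed
  then show ?thesis using f(1) BD(6) by (intro card_inj_on_le[of f]) auto
qed

lemma basal_contained:
  assumes "basal B" "basal B'" "B' \<subseteq> B" "D \<in> CC B'"
  shows "\<exists>C\<in>CC B. D \<subseteq> C" "\<And>C C'. C \<in> CC B \<Longrightarrow> C' \<in> CC B \<Longrightarrow> D \<subseteq> C \<Longrightarrow> D \<subseteq> C' \<Longrightarrow> C = C'"
proof -
  show "\<exists>C\<in>CC B. D \<subseteq> C" using assms(3,4) conjugate_mono by blast
  fix C C' assume "C \<in> CC B" "C' \<in> CC B" "D \<subseteq> C" "D \<subseteq> C'"
  then show "C = C'" using basal_conjugates(9)[OF assms(1), of C C'] basal_conjugates(2,5)[OF assms(2,4)] by blast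
qed

text \<open>As families are unbounded, \<open>B\<close> contains commuting nontrivial subnormal
  subgroups \<open>H\<close> and \<open>D\<close>. A minimal intersection of conjugates of a
  finite-index part of \<open>H\<close> gives \<open>B'\<close>. Without more conjugates than
  before, each conjugate of \<open>B\<close> would contain just one of \<open>B'\<close>, and
  \<open>D\<close> would commute with all of these.\<close>

lemma basal_refine:
  assumes unb: "\<And>n. \<exists>\<L>. indep \<L> \<and> card \<L> \<ge> n" and B: "basal B"
  shows "\<exists>B'. basal B' \<and> B' \<subseteq> B \<and> card (CC B) < card (CC B')"
proof -
  note BD = basalD[OF B]
  obtain \<M> where M: "indep \<M>" "card \<M> \<ge> Suc (card (CC B))" using unb by blast
  obtain H D where HD: "subnormal H G" "subnormal D G" "H \<subseteq> B" "D \<subseteq> B" "D \<subseteq> cz H" "H \<noteq> {\<one>}" "D \<noteq> {\<one>}"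
    using indep_le_conjugates[OF B _ M(1)] M(2) by (metis not_less_eq_eq)
  have Hs: "subgroup H G" "H \<subseteq> carrier G" "D \<subseteq> carrier G" "\<one> \<in> D"
    using subnormal_subgroup[OF HD(1)] subnormal_subgroup[OF HD(2)] subgroup.subset subgroup.one_closed by blast+
  obtain N where N: "N \<lhd> G" "carrier G \<lessapprox> N" "nrm N H" using subnormal_normalizer[OF HD(1)] by metis
  have Ns: "subgroup N G" "N \<subseteq> carrier G" using N by (auto simp: normal_imp_subgroup subgroup.subset)
  let ?H = "H \<inter> N"
  have H': "subgroup ?H G" "?H \<subseteq> carrier G" "nrm N ?H"
    using subgroups_Inter_pair[OF Hs(1) Ns(1)] Hs(2) nrm_Int[OF N(3) nrm_self[OF Ns(1)] Hs(2) Ns(2) Ns(2)] by blast+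
  have "?H \<noteq> {\<one>}"
  proof
    assume "?H = {\<one>}"
    then have "H \<lessapprox> {\<one>}" using finite_index_Int[OF N(2) Hs(1) Ns(1)] by simp
    then show False using vle_trivial_finite[of H "{\<one>}"] Hs(2) subnormal_infinite[OF HD(1,6)] by simp
  qed
  then obtain B' \<T> where B': "subgroup B' G" "B' \<noteq> {\<one>}" "B' \<subseteq> ?H"
    "\<And>g. g \<in> carrier G \<Longrightarrow> cj g B' = B' \<or> B' \<inter> cj g B' = {\<one>}"
    and T: "\<T> \<noteq> {}" "\<T> \<subseteq> CC ?H" "B' = \<Inter>\<T>"
    using minimal_intersection_of_conjugates[OF H'(1) _ conjugates_finite[OF N(2) H'(3,2) Ns(2)]] by metis
  have B'c: "B' \<subseteq> carrier G" "B' \<subseteq> N" "B' \<subseteq> B" "B' \<subseteq> H" using B'(3) Ns(2) HD(3) by blast+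
  have nB: "nrm N B'"
  proof
    fix n assume n: "n \<in> N"
    have "cj n C = C" if "C \<in> \<T>" for C using that T(2) nrm_conjugate[OF N(1) H'(3,2)] n by blast
    then have "cj n ` \<T> = \<T>" by simp
    moreover have "cj n B' = \<Inter>(cj n ` \<T>)" unfolding T(3)
      by (rule conjugate_INT[OF T(1)]) (use T(2) conjugate_subset_carrier[OF H'(2)] n Ns in blast)+
    ultimately show "cj n B' = B'" using T(3) by simp
  qed
  have "B' \<lhd> G\<lparr>carrier := N\<rparr>" unfolding normal_restrict_iff[OF Ns(1)]
    using B'(1) B'c(2) nrm_conj_mem[OF nB B'c(1)] Ns(2) by blast
  then have sn: "subnormal B' G" by (rule subnormal_step[OF normal_subnormal[OF N(1)]])
  have bas: "basal B'" unfolding basal_def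
  proof (intro conjI ballI sn B'(2))
    fix g assume g: "g \<in> carrier G"
    show "cj g B' = B' \<or> cj g B' \<subseteq> cz B'"
    proof (cases "cj g B' = B'")
      case False
      have "cj g B' \<subseteq> N" using conjugate_mono[OF B'c(2), of g] normal_conjugate[OF N(1) g] by blast
      then have "cj g B' \<subseteq> cz B'"
        using B'(4)[OF g] False
        by (intro commute_if_trivial_Int[OF B'(1) conjugate_subgroup[OF B'(1) g] nrm_subset[OF nB]
            nrm_subset[OF nrm_conjugate[OF N(1) nB B'c(1) g] B'c(2)]]) auto
      then show ?thesis by blast
    qed simp
  qed
  note B'D = basalD[OF bas]
  have "card (CC B) < card (CC B')"
  proof (rule ccontr)
    assume "\<not> card (CC B) < card (CC B')"
    then have le: "card (CC B') \<le> card (CC B)" by simp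
    \<comment> \<open>Sends a conjugate of \<open>B'\<close> to the unique conjugate of
      \<open>B\<close> that contains it.\<close>
    let ?\<phi> = "\<lambda>E. THE C. C \<in> CC B \<and> E \<subseteq> C"
    have \<phi>: "?\<phi> E = C" if "E \<in> CC B'" "C \<in> CC B" "E \<subseteq> C" for E C
      using that basal_contained(2)[OF B bas B'c(3) that(1)] by (intro the_equality) blast+
    have conj: "?\<phi> (cj g B') = cj g B" if "g \<in> carrier G" for g
      using that conjugate_mono[OF B'c(3)] by (intro \<phi>) blast+
    then have im: "?\<phi> ` CC B' = CC B" by (simp add: image_image)
    then have "card (CC B) = card (CC B')" using le card_image_le[OF B'D(6), of ?\<phi>] by simp
    then have inj: "inj_on ?\<phi> (CC B')" using im B'D(6) by (intro eq_card_imp_inj_on) auto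
    \<comment> \<open>The conjugate inside \<open>B\<close> is \<open>B'\<close> itself, which lies
      in \<open>H\<close>; every other one lies in a conjugate that commutes with
      \<open>B\<close>.\<close>
    have "D \<subseteq> cz E" if E: "E \<in> CC B'" for E
    proof -
      obtain g where g: "g \<in> carrier G" "E = cj g B'" using E by blast
      show ?thesis
      proof (cases "cj g B = B")
        case True
        then have "?\<phi> E = ?\<phi> (cj \<one> B')" using conj[OF g(1)] conj[OF one_closed] conjugate_one[OF BD(4)] g(2) by simp
        then have "E = cj \<one> B'" using inj E by (auto dest: inj_onD)
        then have "E \<subseteq> H" using conjugate_one[OF B'c(1)] B'c(4) by simp
        then show ?thesis using HD(5) cz_anti by blast
      next
        case False
        have "B \<in> CC B" by (rule self_conjugate[OF BD(4)])
        then have "B \<subseteq> cz (cj g B)" using basal_conjugates(8)[OF B, of B "cj g B"] g(1) False by blast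
        moreover have "E \<subseteq> cj g B" unfolding g(2) by (rule conjugate_mono[OF B'c(3)])
        ultimately show ?thesis using HD(4) cz_anti by blast
      qed
    qed
    then have "D \<subseteq> {\<one>}" by (rule ncl_centralizer[OF B'c(1) B'D(5,2) Hs(3)])
    then show False using HD(7) Hs(4) by blast
  qed
  then show ?thesis using bas B'c(3) by blast
qed

lemma basal_refine_many:
  assumes unb: "\<And>n. \<exists>\<L>. indep \<L> \<and> card \<L> \<ge> n" and B: "basal B"
  shows "\<exists>B'. basal B' \<and> B' \<subseteq> B \<and> c \<le> card (CC B')"
proof (induction c)
  case (Suc c)
  then obtain B' where B': "basal B'" "B' \<subseteq> B" "c \<le> card (CC B')" by blast
  then obtain B'' where "basal B''" "B'' \<subseteq> B'" "card (CC B') < card (CC B'')" using basal_refine[OF unb] by blast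
  then show ?case using B' by (intro exI[of _ B'']) auto
qed (use B in blast)

lemma ncl_mono: "A \<subseteq> B \<Longrightarrow> ncl A \<subseteq> ncl B"
  unfolding ncl_def by (rule mono_generate, rule UN_mono[OF order_refl conjugate_mono])

lemma basal_ncl_finite_index: "basal B \<Longrightarrow> carrier G \<lessapprox> ncl B"
  by (rule normal_nontrivial_finite_index[OF ncl(1)[OF basalD(4)] ncl_nontrivial[OF basalD(4,5,2)]])

text \<open>If the normal closures agreed, \<open>ncl B\<close> would normalize \<open>B'\<close>,
  and there would be at most \<open>card T\<close> conjugates of \<open>B'\<close>. Refining until
  there are more forces proper inclusion.\<close>

lemma basal_refine_strict:
  assumes unb: "\<And>n. \<exists>\<L>. indep \<L> \<and> card \<L> \<ge> n" and B: "basal B"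
  shows "\<exists>B'. basal B' \<and> B' \<subseteq> B \<and> card (CC B) < card (CC B') \<and> ncl B' \<subset> ncl B"
proof -
  obtain T where T: "finite T" "T \<subseteq> carrier G" "\<forall>a\<in>carrier G. \<exists>t\<in>T. inv t \<otimes> a \<in> ncl B"
    using basal_ncl_finite_index[OF B] unfolding virtually_le_def by blast
  obtain B' where B': "basal B'" "B' \<subseteq> B" "Suc (card (CC B) + card T) \<le> card (CC B')"
    using basal_refine_many[OF unb B] by blast
  have "ncl B' \<noteq> ncl B"
  proof
    assume e: "ncl B' = ncl B"
    have "B' \<in> CC B'" by (rule self_conjugate[OF basalD(4)[OF B'(1)]])
    then have "nrm (ncl B) B'" unfolding e[symmetric] by (rule basal_ncl_normalizes[OF B'(1)])
    then have "card (CC B') \<le> card T" by (rule card_conjugates_le[OF T _ basalD(4)[OF B'(1)]])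
    then show False using B'(3) by simp
  qed
  then show ?thesis using B' ncl_mono[OF B'(2)] by (intro exI[of _ B']) auto
qed

text \<open>Conjugation permutes the conjugates of \<open>B\<close> transitively and carries the
  conjugates of \<open>B'\<close> inside one to those inside another.\<close>

lemma basal_blocks:
  assumes B: "basal B" "basal B'" "B' \<subseteq> B"
  obtains m where "card (CC B') = m * card (CC B)" "\<And>C. C \<in> CC B \<Longrightarrow> card {D \<in> CC B'. D \<subseteq> C} = m"
proof -
  note BD = basalD[OF B(1)] and B'D = basalD[OF B(2)]
  let ?P = "\<lambda>C. {D \<in> CC B'. D \<subseteq> C}"
  define m where "m = card (?P B)"
  have m: "card (?P C) = m" if C: "C \<in> CC B" for C
  proof -
    obtain g where g: "g \<in> carrier G" "C = cj g B" using C by blast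
    have mem: "cj h D \<in> CC B'" "D \<subseteq> carrier G" if "D \<in> CC B'" "h \<in> carrier G" for D h
      using that conjugate_permutes[OF B'D(4) that(2)] conjugate_subset_carrier[OF B'D(4)] by blast+
    have "bij_betw (cj g) (?P B) (?P C)"
    proof (rule bij_betw_byWitness[where f' = "cj (inv g)"])
      show "\<forall>D\<in>?P B. cj (inv g) (cj g D) = D" "\<forall>D\<in>?P C. cj g (cj (inv g) D) = D"
        using mem(2)[OF _ one_closed] g(1) by (auto simp: conjugate_inv_conjugate)
      show "cj g ` ?P B \<subseteq> ?P C" using mem(1)[OF _ g(1)] g(2) conjugate_mono by blast
      have "cj (inv g) C = B" using g BD(4) by (simp add: conjugate_inv_conjugate)
      then show "cj (inv g) ` ?P C \<subseteq> ?P B" using mem(1)[OF _ inv_closed[OF g(1)]] conjugate_mono[of _ C "inv g"] by blast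
    qed
    then show ?thesis unfolding m_def by (rule bij_betw_same_card[symmetric])
  qed
  have "CC B' = (\<Union>C\<in>CC B. ?P C)" using basal_contained(1)[OF B] by blast
  then have "card (CC B') = card (\<Union>C\<in>CC B. ?P C)" by simp
  also have "\<dots> = (\<Sum>C\<in>CC B. card (?P C))"
  proof (rule card_UN_disjoint[OF BD(6)])
    show "\<forall>i\<in>CC B. finite (?P i)" using B'D(6) by simp
    show "\<forall>i\<in>CC B. \<forall>j\<in>CC B. i \<noteq> j \<longrightarrow> ?P i \<inter> ?P j = {}" using basal_contained(2)[OF B] by blast
  qed
  also have "\<dots> = m * card (CC B)" using m by simp
  finally show ?thesis using that m by blast
qed

text \<open>The blocks are listed one after the other: position l, counted from 1, falls into block
  (l - 1) div m + 1. The block size is at least 2 because the number of conjugates grows.\<close>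

lemma basal_enumerate_blocks:
  assumes B: "basal B" "basal B'" "B' \<subseteq> B" and F: "bij_betw F {1..card (CC B)} (CC B)"
    and less: "card (CC B) < card (CC B')"
  obtains F' m where "bij_betw F' {1..card (CC B')} (CC B')" "m \<ge> 2" "card (CC B') = m * card (CC B)"
    "\<And>j l. j \<in> {1..card (CC B)} \<Longrightarrow> l \<in> {(j - 1) * m + 1..j * m} \<Longrightarrow> F' l \<subseteq> F j"
proof -
  let ?k = "card (CC B)"
  let ?P = "\<lambda>C. {D \<in> CC B'. D \<subseteq> C}"
  obtain m where m: "card (CC B') = m * ?k" "\<And>C. C \<in> CC B \<Longrightarrow> card (?P C) = m"
    by (rule basal_blocks[OF B]) (rule that)
  have m2: "m \<ge> 2"
  proof (rule ccontr)
    assume "\<not> 2 \<le> m"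
    then have "m * ?k \<le> 1 * ?k" by (intro mult_right_mono) auto
    then show False using less m(1) by simp
  qed
  have FC: "F j \<in> CC B" if "j \<in> {1..?k}" for j using F that bij_betwE by blast
  have "\<exists>e. bij_betw e {1..m} (?P (F j))" if j: "j \<in> {1..?k}" for j
    using ex_bij_betw_nat_finite_1[of "?P (F j)"] m(2)[OF FC[OF j]] basalD(6)[OF B(2)] by simp
  then have "\<forall>j\<in>{1..?k}. \<exists>e. bij_betw e {1..m} (?P (F j))" by (rule ballI)
  then obtain e where "\<forall>j\<in>{1..?k}. bij_betw (e j) {1..m} (?P (F j))" by (rule bchoice[THEN exE])
  then have e: "bij_betw (e j) {1..m} (?P (F j))" if "j \<in> {1..?k}" for j using that by blast
  define F' where "F' l = e ((l - 1) div m + 1) ((l - 1) mod m + 1)" for l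
  have idx: "F' ((j - 1) * m + r) = e j r" if "1 \<le> j" "1 \<le> r" "r \<le> m" for j r
  proof -
    have eq: "(j - 1) * m + r - 1 = (j - 1) * m + (r - 1)" using that by simp
    have lt: "r - 1 < m" using that by simp
    have "((j - 1) * m + (r - 1)) div m = j - 1" "((j - 1) * m + (r - 1)) mod m = r - 1"
      using lt by simp_all
    then show ?thesis unfolding F'_def eq using that by simp
  qed
  have sub: "F' l \<subseteq> F j" "F' l \<in> CC B'" if j: "j \<in> {1..?k}" and l: "l \<in> {(j - 1) * m + 1..j * m}" for j l
  proof -
    define r where "r = l - (j - 1) * m"
    have "j * m = (j - 1) * m + m" using j by (cases j) auto
    then have r: "1 \<le> r" "r \<le> m" "l = (j - 1) * m + r" using l by (auto simp: r_def)
    have "F' l = e j r" using idx[of j r] r j by simp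
    moreover have "e j r \<in> ?P (F j)" using bij_betwE[OF e[OF j]] r by auto
    ultimately show "F' l \<subseteq> F j" "F' l \<in> CC B'" by auto
  qed
  have "F' ` {1..card (CC B')} = CC B'"
  proof
    show "F' ` {1..card (CC B')} \<subseteq> CC B'"
    proof
      fix D assume "D \<in> F' ` {1..card (CC B')}"
      then obtain l where l: "1 \<le> l" "l \<le> m * ?k" "D = F' l" using m(1) by auto
      define j where "j = (l - 1) div m + 1"
      have "l - 1 < ?k * m" using l by (cases l) (auto simp: mult.commute)
      then have "(l - 1) div m < ?k" by (simp add: less_mult_imp_div_less)
      then have j: "j \<in> {1..?k}" by (simp add: j_def)
      have "(l - 1) div m * m \<le> l - 1" "l - 1 < (l - 1) div m * m + m"
        using div_mult_mod_eq[of "l - 1" m] mod_less_divisor[of m "l - 1"] m2 by linarith+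
      moreover obtain q where q: "q = (l - 1) div m" by blast
      ultimately have "q * m \<le> l - 1" "l - 1 < q * m + m" by simp_all
      moreover have "j = q + 1" by (simp add: j_def q)
      ultimately have "l \<in> {(j - 1) * m + 1..j * m}" using l(1) by auto
      then show "D \<in> CC B'" using sub(2)[OF j] l(3) by simp
    qed
    show "CC B' \<subseteq> F' ` {1..card (CC B')}"
    proof
      fix D assume D: "D \<in> CC B'"
      then obtain C where C: "C \<in> CC B" "D \<subseteq> C" using basal_contained(1)[OF B] by blast
      then obtain j where j: "j \<in> {1..?k}" "C = F j" using F by (metis bij_betw_imp_surj_on imageE)
      have "D \<in> e j ` {1..m}" using bij_betw_imp_surj_on[OF e[OF j(1)]] D C j by simp
      then obtain r where r: "1 \<le> r" "r \<le> m" "D = e j r" by auto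
      have "(j - 1) * m + r \<le> (j - 1) * m + m" using r by simp
      also have "\<dots> = j * m" using j by (cases j) auto
      also have "\<dots> \<le> ?k * m" using j by (intro mult_right_mono) auto
      finally have "(j - 1) * m + r \<in> {1..card (CC B')}" using r m(1) by (simp add: mult.commute)
      moreover have "D = F' ((j - 1) * m + r)" using idx[of j r] r j by simp
      ultimately show "D \<in> F' ` {1..card (CC B')}" by blast
    qed
  qed
  then have "bij_betw F' {1..card (CC B')} (CC B')"
    unfolding bij_betw_def by (intro conjI eq_card_imp_inj_on) auto
  then show ?thesis using that m2 m(1) sub(1) by blast
qed

lemma basal_internal_direct_product:
  assumes B: "basal B" and F: "bij_betw F {1..card (CC B)} (CC B)"
  shows "internal_direct_product G (ncl B) {1..card (CC B)} F"
  unfolding internal_direct_product_def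
proof (intro conjI ballI)
  let ?I = "{1..card (CC B)}"
  have FC: "F i \<in> CC B" if "i \<in> ?I" for i using F that bij_betwE by blast
  have im: "F ` ?I = CC B" using F by (rule bij_betw_imp_surj_on)
  show g: "generate G (\<Union>i\<in>?I. F i) = ncl B" unfolding ncl_CC im ..
  have Ns: "subgroup (ncl B) G" using ncl(1)[OF basalD(4)[OF B]] by (rule normal_imp_subgroup)
  fix i assume i: "i \<in> ?I"
  note C = basal_conjugates[OF B FC[OF i]]
  have "F i \<subseteq> ncl B" unfolding g[symmetric] using i generate.incl[of _ "\<Union>i\<in>?I. F i" G] by blast
  then show "F i \<lhd> G\<lparr>carrier := ncl B\<rparr>" unfolding normal_restrict_iff[OF Ns]
    by (intro conjI ballI C(3) nrm_conj_mem[OF basal_ncl_normalizes[OF B FC[OF i]] C(4)])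
      (use subgroup.subset[OF Ns] in blast)+
  have "F j \<subseteq> cz (F i)" if "j \<in> ?I - {i}" for j
  proof -
    have "F j \<noteq> F i" using bij_betw_imp_inj_on[OF F] that i by (auto dest: inj_onD)
    then show ?thesis using basal_conjugates(8)[OF B FC FC[OF i]] that by blast
  qed
  then have "generate G (\<Union>j\<in>?I - {i}. F j) \<subseteq> cz (F i)" by (intro generate_subgroup_incl[OF _ cz_subgroup[OF C(4)]]) blast
  moreover have "\<one> \<in> generate G (\<Union>j\<in>?I - {i}. F j)" by (rule generate.one)
  ultimately show "F i \<inter> generate G (\<Union>j\<in>?I - {i}. F j) = {\<one>}" using C(5,6) by blast
qed

text \<open>Dependent choice gives a sequence of ever smaller such subgroups with enumerated
  conjugates. The levels are their normal closures. If these had a nontrivial intersection, it would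
  be normal of finite index and would normalize every \<open>B n\<close> with n \<ge> 1, which
  bounds the number of conjugates, although that number keeps growing.\<close>

lemma unbounded_imp_branch:
  assumes unb: "\<And>n. \<exists>\<L>. indep \<L> \<and> card \<L> \<ge> n"
  shows "branch_group G"
proof -
  define P where "P p \<longleftrightarrow> basal (fst p) \<and> bij_betw (snd p) {1..card (CC (fst p))} (CC (fst p))" for p :: "'a set \<times> (nat \<Rightarrow> 'a set)"
  define Q where "Q p q \<longleftrightarrow> card (CC (fst p)) < card (CC (fst q)) \<and> ncl (fst q) \<subset> ncl (fst p) \<and>
     (\<exists>m\<ge>2. card (CC (fst q)) = m * card (CC (fst p)) \<and>
       (\<forall>j\<in>{1..card (CC (fst p))}. \<forall>l\<in>{(j - 1) * m + 1..j * m}. snd q l \<subseteq> snd p j))" for p q :: "'a set \<times> (nat \<Rightarrow> 'a set)"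
  have "\<exists>f. \<forall>n. P (f n) \<and> Q (f n) (f (Suc n))"
  proof (rule dependent_nat_choice)
    obtain F where "bij_betw F {1..card (CC (carrier G))} (CC (carrier G))"
      using ex_bij_betw_nat_finite_1[OF basalD(6)[OF basal_carrier]] by blast
    then show "\<exists>p. P p" using basal_carrier by (intro exI[of _ "(carrier G, F)"]) (simp add: P_def)
    fix p and n :: nat assume "P p"
    then have p: "basal (fst p)" "bij_betw (snd p) {1..card (CC (fst p))} (CC (fst p))" by (simp_all add: P_def)
    obtain B' where B': "basal B'" "B' \<subseteq> fst p" "card (CC (fst p)) < card (CC B')" "ncl B' \<subset> ncl (fst p)"
      using basal_refine_strict[OF unb p(1)] by blast
    obtain F' m where F': "bij_betw F' {1..card (CC B')} (CC B')" "m \<ge> 2" "card (CC B') = m * card (CC (fst p))"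
      "\<And>j l. j \<in> {1..card (CC (fst p))} \<Longrightarrow> l \<in> {(j - 1) * m + 1..j * m} \<Longrightarrow> F' l \<subseteq> snd p j"
      by (rule basal_enumerate_blocks[OF p(1) B'(1,2) p(2) B'(3)]) (rule that)
    show "\<exists>q. P q \<and> Q p q"
      by (rule exI[of _ "(B', F')"]) (use B' F' in \<open>auto simp: P_def Q_def\<close>)
  qed
  then obtain f where f: "\<And>n. P (f n)" "\<And>n. Q (f n) (f (Suc n))" by blast
  define B where "B n = fst (f n)" for n
  define F where "F n = snd (f n)" for n
  define k where "k n = card (CC (B n))" for n
  have bas: "basal (B n)" and bij: "bij_betw (F n) {1..k n} (CC (B n))" for n
    using f(1)[of n] by (simp_all add: P_def B_def F_def k_def)
  have klt: "k n < k (Suc n)" and nclt: "ncl (B (Suc n)) \<subset> ncl (B n)"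
    and blk: "\<exists>m\<ge>2. k (Suc n) = m * k n \<and> (\<forall>j\<in>{1..k n}. \<forall>l\<in>{(j - 1) * m + 1..j * m}. F (Suc n) l \<subseteq> F n j)" for n
    using f(2)[of n] by (simp_all add: Q_def B_def F_def k_def)
  have k1: "k n \<ge> 1" for n unfolding k_def by (rule basalD(7)[OF bas])
  have FC: "F n j \<in> CC (B n)" if "j \<in> {1..k n}" for n j using bij that bij_betwE by blast
  have one: "1 \<in> {1..k n}" for n using k1[of n] by simp
  note C = basal_conjugates[OF bas FC]
  have ns: "ncl (B n) \<lhd> G" "subgroup (ncl (B n)) G" for n
    using ncl(1)[OF basalD(4)[OF bas]] normal_imp_subgroup by blast+
  \<comment> \<open>The first block contains two different factors, and these meet trivially, so the
    first of them is a proper subgroup of \<open>F n 1\<close>.\<close>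
  have Lsub: "F (Suc n) 1 \<subset> F n 1" for n
  proof -
    obtain m where m: "m \<ge> 2" "k (Suc n) = m * k n" "\<forall>j\<in>{1..k n}. \<forall>l\<in>{(j - 1) * m + 1..j * m}. F (Suc n) l \<subseteq> F n j"
      using blk by blast
    have l: "1 \<in> {(1 - 1) * m + 1..1 * m}" "2 \<in> {(1 - 1) * m + 1..1 * m}" using m(1) by auto
    have s: "F (Suc n) 1 \<subseteq> F n 1" "F (Suc n) 2 \<subseteq> F n 1"
      using m(3)[rule_format, OF one l(1)] m(3)[rule_format, OF one l(2)] .
    have two: "2 \<in> {1..k (Suc n)}" using klt[of n] k1[of n] by simp
    have "F (Suc n) 2 \<noteq> F (Suc n) 1" using bij_betw_imp_inj_on[OF bij, of "Suc n"] two one by (auto dest: inj_onD)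
    then have "F (Suc n) 2 \<inter> F (Suc n) 1 = {\<one>}" by (rule C(9)[OF two FC[OF one]])
    then have "F (Suc n) 1 \<noteq> F n 1" using s(2) C(2)[OF two] by blast
    then show ?thesis using s(1) by blast
  qed
  have inter: "(\<Inter>i\<in>{1..}. ncl (B i)) = {\<one>}"
  proof (rule ccontr)
    let ?W = "\<Inter>i\<in>{1::nat..}. ncl (B i)"
    assume ne: "?W \<noteq> {\<one>}"
    have Ws: "subgroup ?W G" by (rule subgroups_Inter) (use ns in auto)
    have "cj g ?W \<subseteq> ?W" if g: "g \<in> carrier G" for g
    proof -
      have "cj g ?W \<subseteq> ncl (B i)" if "i \<in> {1..}" for i
        using conjugate_mono[of ?W "ncl (B i)" g] normal_conjugate[OF ns(1) g, of i] that by blast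
      then show ?thesis by blast
    qed
    then have "carrier G \<lessapprox> ?W" by (intro normal_nontrivial_finite_index[OF normal_conjugateI[OF Ws] ne])
    then obtain T where T: "finite T" "T \<subseteq> carrier G" "\<forall>a\<in>carrier G. \<exists>t\<in>T. inv t \<otimes> a \<in> ?W"
      unfolding virtually_le_def by blast
    have "k n \<ge> n" for n using klt by (induction n) (auto simp: Suc_le_eq intro: le_less_trans)
    then have "k (Suc (card T)) > card T" by (meson Suc_le_eq)
    moreover have "k (Suc (card T)) \<le> card T" unfolding k_def
    proof (rule card_conjugates_le[OF T _ basalD(4)[OF bas]])
      have "B n \<in> CC (B n)" for n by (rule self_conjugate[OF basalD(4)[OF bas]])
      then have "nrm (ncl (B (Suc (card T)))) (B (Suc (card T)))" by (rule basal_ncl_normalizes[OF bas])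
      then show "nrm ?W (B (Suc (card T)))" by auto
    qed
    ultimately show False by simp
  qed
  have iso: "G\<lparr>carrier := F i j\<rparr> \<cong> G\<lparr>carrier := F i 1\<rparr>" and trans: "\<exists>g\<in>carrier G. cj g (F i j) = F i l"
    if j: "j \<in> {1..k i}" and l: "l \<in> {1..k i}" for i j l
  proof -
    have ex: "\<exists>g\<in>carrier G. cj g (F i j) = F i l" if l: "l \<in> {1..k i}" for l
    proof -
      have "F i l \<in> CC (F i j)" using FC[OF l] C(7)[OF j] by simp
      then show ?thesis by auto
    qed
    show "\<exists>g\<in>carrier G. cj g (F i j) = F i l" by (rule ex[OF l])
    obtain g where "g \<in> carrier G" "cj g (F i j) = F i 1" using ex[OF one] by blast
    then show "G\<lparr>carrier := F i j\<rparr> \<cong> G\<lparr>carrier := F i 1\<rparr>" using conjugate_iso[OF C(4)[OF j]] by metis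
  qed
  have perm: "\<exists>l\<in>{1..k i}. cj g (F i j) = F i l" if j: "j \<in> {1..k i}" and g: "g \<in> carrier G" for i j g
  proof -
    have "cj g (F i j) \<in> CC (B i)" using C(7)[OF j] g by blast
    then show ?thesis using bij_betw_imp_surj_on[OF bij, of i] by (metis imageE)
  qed
  have fi: "finite_index G (ncl (B i))" for i
    using finite_index_iff_vle'[OF ns(2)] basal_ncl_finite_index[OF bas] by simp
  have dp: "internal_direct_product G (ncl (B i)) {1..k i} (F i)" for i
    using basal_internal_direct_product[OF bas bij[unfolded k_def]] by (simp add: k_def)
  show ?thesis unfolding branch_group_def
    \<comment> \<open>The abstract group L_i is realized by the first factor of level i, to which
      the others are conjugate.\<close>
    by (rule exI[of _ "\<lambda>i. ncl (B i)"], rule exI[of _ "\<lambda>i. F i 1"], rule exI[of _ k], rule exI[of _ F])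
      (use ns nclt Lsub C(3)[OF one] k1 inter fi dp iso[OF _ one] blk perm trans in \<open>simp add: Suc_eq_plus1[symmetric] del: One_nat_def\<close>)
qed

end

section \<open>Nonzero products in branch groups\<close>

context group begin

text \<open>The group generated so far normalizes the next subgroup, so their product set is a
  subgroup, and it is finite. This excludes finite factors in a branch structure.\<close>

lemma generate_finite_normalized:
  assumes "finite I" "\<And>i. i \<in> I \<Longrightarrow> subgroup (K i) G \<and> finite (K i)" "\<And>i j. i \<in> I \<Longrightarrow> j \<in> I \<Longrightarrow> nrm (K i) (K j)"
  shows "finite (generate G (\<Union>i\<in>I. K i))"
  using assms
proof (induction I rule: finite_induct)
  case empty
  then show ?case by (simp add: generate_empty)
next
  case (insert i I)
  let ?S = "generate G (\<Union>j\<in>I. K j)"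
  have Kc: "K j \<subseteq> carrier G" "subgroup (K j) G" if "j \<in> insert i I" for j using insert.prems(1)[OF that] subgroup.subset by blast+
  have U: "(\<Union>j\<in>I. K j) \<subseteq> carrier G" using Kc by blast
  have Ss: "subgroup ?S G" by (rule generate_is_subgroup[OF U])
  have Sc: "?S \<subseteq> carrier G" by (rule subgroup.subset[OF Ss])
  have fS: "finite ?S" using insert by blast
  have "?S \<subseteq> {x \<in> carrier G. cj x (K i) = K i}"
    by (rule generate_subgroup_incl[OF _ normalizer_subgroup]) (use Kc insert.prems(2) in blast)+
  then have nS: "cj x (K i) = K i" if "x \<in> ?S" for x using that by blast
  have ps: "subgroup (K i <#> ?S) G"
  proof (rule subgroupI)
    show "K i <#> ?S \<subseteq> carrier G" using Kc(1)[of i] Sc by (auto simp: set_mult_def subset_iff)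
    show "K i <#> ?S \<noteq> {}" using subgroup.one_closed[OF Kc(2)[of i]] subgroup.one_closed[OF Ss] by (auto simp: set_mult_def)
    fix x assume "x \<in> K i <#> ?S"
    then obtain a s where x: "a \<in> K i" "s \<in> ?S" "x = a \<otimes> s" by (auto simp: set_mult_def)
    have c: "a \<in> carrier G" "s \<in> carrier G" using x Kc(1)[of i] Sc by auto
    have si: "inv s \<in> ?S" "inv a \<in> K i" using x Ss Kc(2)[of i] by (auto simp: subgroup.m_inv_closed)
    have "inv s \<otimes> inv a \<otimes> inv (inv s) \<in> K i"
      using nrm_conj_mem[of ?S "K i" "inv s" "inv a"] nS Kc(1)[of i] si c by simp
    moreover have "inv x = (inv s \<otimes> inv a \<otimes> inv (inv s)) \<otimes> inv s" using x c by (simp add: inv_mult_group m_assoc)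
    ultimately show "inv x \<in> K i <#> ?S" using si by (auto simp: set_mult_def)
    fix y assume "y \<in> K i <#> ?S"
    then obtain b t where y: "b \<in> K i" "t \<in> ?S" "y = b \<otimes> t" by (auto simp: set_mult_def)
    have d: "b \<in> carrier G" "t \<in> carrier G" using y Kc(1)[of i] Sc by auto
    have "s \<otimes> b \<otimes> inv s \<in> K i" using nrm_conj_mem[of ?S "K i" s b] nS Kc(1)[of i] x y c by simp
    then have "a \<otimes> (s \<otimes> b \<otimes> inv s) \<in> K i" "s \<otimes> t \<in> ?S" using x y Kc(2)[of i] Ss by (auto simp: subgroup.m_closed)
    moreover have "x \<otimes> y = (a \<otimes> (s \<otimes> b \<otimes> inv s)) \<otimes> (s \<otimes> t)" using x y c d by (simp add: m_assoc inv_mult_cancel)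
    ultimately show "x \<otimes> y \<in> K i <#> ?S" by (auto simp: set_mult_def)
  qed
  have "K i \<subseteq> K i <#> ?S" "?S \<subseteq> K i <#> ?S"
    using Kc(1)[of i] Sc subgroup.one_closed[OF Kc(2)[of i]] subgroup.one_closed[OF Ss] by (force simp: set_mult_def)+
  then have "(\<Union>j\<in>insert i I. K j) \<subseteq> K i <#> ?S" by (auto intro: generate.incl)
  then have "generate G (\<Union>j\<in>insert i I. K j) \<subseteq> K i <#> ?S" by (rule generate_subgroup_incl[OF _ ps])
  moreover have "finite (K i <#> ?S)"
  proof -
    have "K i <#> ?S = (\<lambda>(a,s). a \<otimes> s) ` (K i \<times> ?S)" by (auto simp: set_mult_def)
    then show ?thesis using fS insert.prems(1)[of i] by simp
  qed
  ultimately show ?case using finite_subset by blast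
qed

lemma direct_list_drop: "direct_list Ks \<Longrightarrow> direct_list (drop n Ks)"
  by (induction Ks arbitrary: n) (auto simp: drop_Cons split: nat.split)

lemma direct_list_not_vanish_le:
  assumes "amenable G" "direct_list Ks" "\<And>K. K \<in> set Ks \<Longrightarrow> subnormal K G \<and> infinite K" "n \<le> length Ks" "n \<ge> 1"
  shows "\<not> products_vanish (arens G) (A_sn G) n"
proof -
  let ?L = "drop (length Ks - n) Ks"
  have l: "length ?L = n" using assms by simp
  then have "?L \<noteq> []" using assms by auto
  then show ?thesis using direct_list_not_vanish[OF assms(1) _ direct_list_drop[OF assms(2)]] assms(3) l
    by (metis in_set_dropD)
qed

end

context just_infinite_group begin

text \<open>The factors of a level are isomorphic; if one were finite, all would be, and so would
  the level, which has finite index. Level n has at least n factors and thus supplies n independent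
  infinite subgroups. The lemma covers all just infinite groups because it also rules out branch
  structures in the virtually abelian case.\<close>

lemma branch_not_vanish:
  assumes am: "amenable G" and br: "branch_group G" and n: "n \<ge> 1"
  shows "\<not> products_vanish (arens G) (A_sn G) n"
proof -
  obtain H L :: "nat \<Rightarrow> 'a set" and k :: "nat \<Rightarrow> nat" and F where b: "\<forall>i\<ge>1. k i \<ge> 1" "\<forall>i\<ge>1. H i \<lhd> G \<and> finite_index G (H i)"
    "\<forall>i\<ge>1. internal_direct_product G (H i) {1..k i} (F i) \<and>
         (\<forall>j\<in>{1..k i}. G\<lparr>carrier := F i j\<rparr> \<cong> G\<lparr>carrier := L i\<rparr>)"
    "\<forall>i\<ge>1. \<exists>m\<ge>2. k (i + 1) = m * k i \<and>
         (\<forall>j\<in>{1..k i}. \<forall>l\<in>{(j - 1) * m + 1..j * m}. F (i + 1) l \<subseteq> F i j)"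
    using br unfolding branch_group_def by (elim exE conjE) (rule that)
  \<comment> \<open>The sequences start at index 1, where the value is at least 1; from there each
    step at least doubles it.\<close>
  have kge: "k (Suc i) \<ge> Suc i" for i
  proof (induction i)
    case 0
    then show ?case using b(1) by auto
  next
    case (Suc i)
    obtain m where "m \<ge> 2" "k (Suc i + 1) = m * k (Suc i)" using b(4) by (metis One_nat_def Suc_le_mono le0)
    then have "k (Suc (Suc i)) \<ge> 2 * k (Suc i)" by (simp add: mult_right_mono)
    then show ?case using Suc by simp
  qed
  have n1: "n \<ge> 1" "k n \<ge> n" using n kge[of "n - 1"] by simp_all
  have Hn: "H n \<lhd> G" "finite_index G (H n)" using b(2) n1 by auto
  have Hs: "subgroup (H n) G" "H n \<subseteq> carrier G" using Hn by (auto simp: normal_imp_subgroup subgroup.subset)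
  have dp: "\<And>j. j \<in> {1..k n} \<Longrightarrow> F n j \<lhd> G\<lparr>carrier := H n\<rparr>" "generate G (\<Union>j\<in>{1..k n}. F n j) = H n"
    "\<And>j. j \<in> {1..k n} \<Longrightarrow> F n j \<inter> generate G (\<Union>i\<in>{1..k n} - {j}. F n i) = {\<one>}"
    using b(3) n1 unfolding internal_direct_product_def by auto
  have iso: "\<And>j. j \<in> {1..k n} \<Longrightarrow> G\<lparr>carrier := F n j\<rparr> \<cong> G\<lparr>carrier := L n\<rparr>" using b(3) n1 by blast
  have Fs: "subgroup (F n j) G" "F n j \<subseteq> H n" "nrm (H n) (F n j)" "subnormal (F n j) G" if "j \<in> {1..k n}" for j
  proof -
    note nj = dp(1)[OF that]
    show "subgroup (F n j) G" "F n j \<subseteq> H n" using nj unfolding normal_restrict_iff[OF Hs(1)] by blast+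
    show "nrm (H n) (F n j)" by (intro ballI normal_restrict_conjugate[OF Hs(1) nj])
    show "subnormal (F n j) G" by (rule subnormal_step[OF normal_subnormal[OF Hn(1)] nj])
  qed
  have card: "finite (F n j) \<longleftrightarrow> finite (L n)" if "j \<in> {1..k n}" for j
    using iso[OF that] by (auto simp: is_iso_def iso_def dest: bij_betw_finite)
  have inf: "infinite (F n j)" if j: "j \<in> {1..k n}" for j
  proof
    assume "finite (F n j)"
    then have "finite (F n i)" if "i \<in> {1..k n}" for i using card j that by blast
    then have "finite (generate G (\<Union>j\<in>{1..k n}. F n j))"
      using Fs by (intro generate_finite_normalized) blast+
    then show False using dp(2) finite_index_infinite[of "H n"] finite_index_iff_vle'[OF Hs(1)] Hn(2) by simp
  qed
  have dl: "direct_list (map (F n) js)" if "distinct js" "set js \<subseteq> {1..k n}" for js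
    using that
  proof (induction js)
    case (Cons j js)
    have "generate G (\<Union>(F n ` set js)) \<subseteq> generate G (\<Union>i\<in>{1..k n} - {j}. F n i)"
      by (rule mono_generate) (use Cons in auto)
    then have "F n j \<inter> generate G (\<Union>(F n ` set js)) \<subseteq> {\<one>}" using dp(3)[of j] Cons by auto
    moreover have "\<one> \<in> F n j" using Fs(1)[of j] Cons by (auto simp: subgroup.one_closed)
    moreover have "\<one> \<in> generate G (\<Union>(F n ` set js))" by (rule generate.one)
    ultimately show ?case using Cons by auto
  qed simp
  show ?thesis
    by (rule direct_list_not_vanish_le[OF am dl[of "[1..<Suc (k n)]"]]) (use Fs(4) inf n1 in auto)
qed

end

section \<open>Abelian groups\<close>

context comm_group begin

lemma cz_all: "A \<subseteq> carrier G \<Longrightarrow> cz A = carrier G"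
  by (auto simp: cz_def m_comm subset_iff)

lemma generate_insert:
  assumes "a \<in> carrier G" "S \<subseteq> carrier G"
  shows "generate G (insert a S) = {a [^] e \<otimes> y |(e::int) y. y \<in> generate G S}"
proof -
  have s: "subgroup (generate G {a}) G" "subgroup (generate G S) G" using assms by (auto intro: generate_is_subgroup)
  have c: "generate G {a} \<subseteq> carrier G" "generate G S \<subseteq> carrier G" using s subgroup.subset by blast+
  note p = set_mult_commuting_subgroup[OF s, unfolded cz_all[OF c(1)], OF c(2)]
  have "generate G (insert a S) = generate G {a} <#> generate G S"
  proof
    show "generate G (insert a S) \<subseteq> generate G {a} <#> generate G S"
    proof (rule generate_subgroup_incl[OF _ p(1)])
      show "insert a S \<subseteq> generate G {a} <#> generate G S"
        using p(2,3) generate.incl[of a "{a}" G] generate.incl[of _ S G] by blast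
    qed
    have m: "generate G {a} \<subseteq> generate G (insert a S)" "generate G S \<subseteq> generate G (insert a S)"
      by (rule mono_generate, blast)+
    have "subgroup (generate G (insert a S)) G" using assms by (intro generate_is_subgroup) auto
    then show "generate G {a} <#> generate G S \<subseteq> generate G (insert a S)"
      using m subgroup.m_closed by (fastforce simp: set_mult_def)
  qed
  then show ?thesis unfolding generate_pow[OF assms(1)] by (auto simp: set_mult_def)
qed

text \<open>For subgroups P \<subseteq> Q this says that Q/P is not a torsion group.\<close>

definition big_step :: "'a set \<Rightarrow> 'a set \<Rightarrow> bool" where
  "big_step P Q \<longleftrightarrow> (\<exists>m\<in>Q. \<forall>k::int. k \<noteq> 0 \<longrightarrow> m [^] k \<notin> P)"

text \<open>Passing to a subgroup with cyclic quotient loses at most one big step: the one at which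
  the chain first leaves that subgroup modulo torsion.\<close>

lemma big_steps_le_generators:
  assumes "finite S" "S \<subseteq> carrier G"
  shows "(\<And>j. subgroup (T j) G) \<Longrightarrow> (\<And>j. T j \<subseteq> generate G S) \<Longrightarrow> (\<And>j. T j \<subseteq> T (Suc j)) \<Longrightarrow>
    card {j. j < n \<and> big_step (T j) (T (Suc j))} \<le> card S"
  using assms
proof (induction S arbitrary: T rule: finite_induct)
  case empty
  have "\<not> big_step (T j) (T (Suc j))" for j
  proof
    assume "big_step (T j) (T (Suc j))"
    then obtain m where m: "m \<in> T (Suc j)" "\<And>k::int. k \<noteq> 0 \<Longrightarrow> m [^] k \<notin> T j" unfolding big_step_def by blast
    have "m = \<one>" using m(1) empty.prems(2)[of "Suc j"] by (auto simp: generate_empty)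
    then have "m [^] (1::int) \<in> T j" using empty.prems(1)[of j] by (simp add: subgroup.one_closed)
    then show False using m(2)[of 1] by simp
  qed
  then show ?case by simp
next
  case (insert a S)
  let ?A = "generate G S"
  have ac: "a \<in> carrier G" "S \<subseteq> carrier G" using insert.prems by auto
  have As: "subgroup ?A G" by (rule generate_is_subgroup[OF ac(2)])
  have Ac: "?A \<subseteq> carrier G" by (rule subgroup.subset[OF As])
  have Tc: "T j \<subseteq> carrier G" for j using subgroup.subset[OF insert.prems(1)] .
  \<comment> \<open>Some element of \<open>T j\<close> has a nonzero exponent at the new generator.
    Once true, this stays true along the chain.\<close>
  define has where "has j \<longleftrightarrow> (\<exists>e::int. e \<noteq> 0 \<and> (\<exists>y\<in>?A. a [^] e \<otimes> y \<in> T j))" for j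
  define T' where "T' j = T j \<inter> ?A" for j
  have Tmono: "i \<le> j \<Longrightarrow> T i \<subseteq> T j" for i j using lift_Suc_mono_le[of T, OF insert.prems(3)] by blast
  have hmono: "has i \<Longrightarrow> i \<le> j \<Longrightarrow> has j" for i j using Tmono[of i j] unfolding has_def by blast
  have step: "big_step (T' j) (T' (Suc j))" if b: "big_step (T j) (T (Suc j))" and h: "\<not> (\<not> has j \<and> has (Suc j))" for j
  proof -
    obtain m where m: "m \<in> T (Suc j)" "\<And>k::int. k \<noteq> 0 \<Longrightarrow> m [^] k \<notin> T j" using b unfolding big_step_def by blast
    have "m \<in> generate G (insert a S)" using m(1) insert.prems(2) by blast
    then obtain f :: int and z where mz: "m = a [^] f \<otimes> z" "z \<in> ?A" unfolding generate_insert[OF ac] by blast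
    have zc: "z \<in> carrier G" using mz Ac by blast
    have mc: "m \<in> carrier G" using m(1) Tc by blast
    show ?thesis
    proof (cases "has (Suc j)")
      case False
      then have "f = 0" using m(1) mz unfolding has_def by blast
      then have "m \<in> T' (Suc j)" using m(1) mz zc by (simp add: T'_def)
      then show ?thesis using m(2) unfolding big_step_def T'_def by blast
    next
      case True
      then obtain e :: int and y where ey: "e \<noteq> 0" "y \<in> ?A" "a [^] e \<otimes> y \<in> T j" using h unfolding has_def by blast
      have yc: "y \<in> carrier G" using ey Ac by blast
      define c where "c = a [^] e \<otimes> y"
      have cc: "c \<in> carrier G" "c \<in> T j" "c \<in> T (Suc j)" using ey(3) Tc insert.prems(3) unfolding c_def by blast+
      \<comment> \<open>Both powers have exponent f e at the new generator, which cancels. So m'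
        lies in the smaller group, while still no nonzero power of it lies in
        \<open>T j\<close>.\<close>
      define m' where "m' = m [^] e \<otimes> inv (c [^] f)"
      have m'c: "m' \<in> carrier G" using mc cc by (simp add: m'_def)
      have pe: "m [^] e = a [^] (f * e) \<otimes> z [^] e" unfolding mz(1) using ac zc by (simp add: int_pow_distrib int_pow_pow)
      have pf: "c [^] f = a [^] (f * e) \<otimes> y [^] f" unfolding c_def using ac yc by (simp add: int_pow_distrib int_pow_pow mult.commute)
      have "m' = z [^] e \<otimes> inv (y [^] f)"
      proof -
        let ?w = "a [^] (f * e)"
        have w: "?w \<in> carrier G" "z [^] e \<in> carrier G" "y [^] f \<in> carrier G" using ac zc yc by auto
        have "m' = z [^] e \<otimes> ?w \<otimes> (inv ?w \<otimes> inv (y [^] f))"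
          unfolding m'_def pe pf using w by (simp add: inv_mult m_comm)
        also have "\<dots> = z [^] e \<otimes> inv (y [^] f)" using w by (simp add: m_assoc inv_mult_cancel)
        finally show ?thesis .
      qed
      then have "m' \<in> ?A" using mz ey As by (simp add: subgroup.m_closed subgroup.m_inv_closed subgroup_int_pow_closed)
      moreover have "m' \<in> T (Suc j)" unfolding m'_def using m(1) cc insert.prems(1)[of "Suc j"]
        by (simp add: subgroup.m_closed subgroup.m_inv_closed subgroup_int_pow_closed)
      moreover have "m' [^] k \<notin> T j" if k: "k \<noteq> 0" for k :: int
      proof
        assume a1: "m' [^] k \<in> T j"
        have "m' [^] k = m [^] (e * k) \<otimes> inv (c [^] (f * k))"
          unfolding m'_def using mc cc by (simp add: int_pow_distrib int_pow_pow int_pow_inv)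
        then have "m [^] (e * k) = m' [^] k \<otimes> c [^] (f * k)" using mc cc by (simp add: m_assoc)
        moreover have "\<dots> \<in> T j" using a1 cc insert.prems(1)[of j] by (simp add: subgroup.m_closed subgroup_int_pow_closed)
        ultimately show False using m(2)[of "e * k"] ey(1) k by simp
      qed
      ultimately show ?thesis unfolding big_step_def T'_def by blast
    qed
  qed
  let ?B = "{j. j < n \<and> big_step (T j) (T (Suc j))}" and ?B' = "{j. j < n \<and> big_step (T' j) (T' (Suc j))}"
  \<comment> \<open>At most one index qualifies, as \<open>has\<close> persists along the chain;
    this is the big step that may be lost.\<close>
  let ?C = "{j. \<not> has j \<and> has (Suc j)}"
  have "card ?B' \<le> card S"
  proof (rule insert.IH)
    show "subgroup (T' j) G" "T' j \<subseteq> ?A" "T' j \<subseteq> T' (Suc j)" for j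
      unfolding T'_def using subgroups_Inter_pair[OF insert.prems(1) As] insert.prems(3) by blast+
  qed (rule ac)
  moreover have C1: "i = j" if "i \<in> ?C" "j \<in> ?C" for i j
    using that hmono[of "Suc i" j] hmono[of "Suc j" i] by (metis (mono_tags, lifting) mem_Collect_eq not_less_eq_eq le_antisym)
  then have "finite ?C \<and> card ?C \<le> 1"
  proof (cases "?C = {}")
    case False
    then obtain i where "i \<in> ?C" by blast
    then have "?C \<subseteq> {i}" using C1 by blast
    then show ?thesis using card_mono[of "{i}" ?C] finite_subset[of ?C "{i}"] by simp
  next
    case True
    show ?thesis unfolding True by simp
  qed
  moreover have "?B \<subseteq> ?B' \<union> ?C" using step by blast
  then have "card ?B \<le> card (?B' \<union> ?C)" using calculation by (intro card_mono) auto
  moreover have "card (?B' \<union> ?C) \<le> card ?B' + card ?C" by (rule card_Un_le)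
  ultimately show ?case using insert.hyps by simp
qed

text \<open>As for subgroups of the integers: if \<open>M\<close> leaves the smaller group, an
  element of \<open>M\<close> with least positive exponent at the new generator, together with
  generators of the part of \<open>M\<close> in the smaller group, generates
  \<open>M\<close>.\<close>

lemma subgroup_of_finitely_generated:
  assumes "finite S" "S \<subseteq> carrier G"
  shows "subgroup M G \<Longrightarrow> M \<subseteq> generate G S \<Longrightarrow> \<exists>S'. finite S' \<and> S' \<subseteq> M \<and> M = generate G S'"
  using assms
proof (induction S arbitrary: M rule: finite_induct)
  case empty
  then have "M = {\<one>}" using subgroup.one_closed[of M G] by (auto simp: generate_empty)
  then show ?case by (intro exI[of _ "{}"]) (simp add: generate_empty)
next
  case (insert a S)
  let ?A = "generate G S"
  have ac: "a \<in> carrier G" "S \<subseteq> carrier G" using insert.prems by auto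
  have As: "subgroup ?A G" by (rule generate_is_subgroup[OF ac(2)])
  have Mc: "M \<subseteq> carrier G" "?A \<subseteq> carrier G" using subgroup.subset[OF insert.prems(1)] subgroup.subset[OF As] .
  obtain S' where S': "finite S'" "S' \<subseteq> M \<inter> ?A" "M \<inter> ?A = generate G S'"
    using insert.IH[OF subgroups_Inter_pair[OF insert.prems(1) As] Int_lower2 ac(2)] by blast
  define E where "E = {e::nat. e > 0 \<and> (\<exists>y\<in>?A. a [^] (int e) \<otimes> y \<in> M)}"
  \<comment> \<open>The division step: removing the q-th power of one element of \<open>M\<close>
    from another leaves an element of \<open>M\<close> with exponent e - e' q.\<close>
  have red: "\<exists>y\<in>?A. a [^] (e - e' * q) \<otimes> y \<in> M \<and> a [^] e \<otimes> x = (a [^] e' \<otimes> x') [^] q \<otimes> (a [^] (e - e' * q) \<otimes> y)"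
    if "x \<in> ?A" "a [^] e \<otimes> x \<in> M" "x' \<in> ?A" "a [^] e' \<otimes> x' \<in> M" for e e' q :: int and x x'
  proof -
    let ?m = "a [^] e' \<otimes> x'"
    have c: "x \<in> carrier G" "x' \<in> carrier G" "?m \<in> carrier G" using that Mc by auto
    have y: "x \<otimes> inv (x' [^] q) \<in> ?A" using that As by (simp add: subgroup.m_closed subgroup.m_inv_closed subgroup_int_pow_closed)
    have mq: "?m [^] q = a [^] (e' * q) \<otimes> x' [^] q" using ac c by (simp add: int_pow_distrib int_pow_pow)
    have eq: "a [^] e \<otimes> x = ?m [^] q \<otimes> (a [^] (e - e' * q) \<otimes> (x \<otimes> inv (x' [^] q)))"
    proof -
      let ?w = "a [^] (e' * q)" and ?v = "x' [^] q"
      have w: "?w \<in> carrier G" "?v \<in> carrier G" "a [^] e \<in> carrier G" using ac c by auto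
      have "?m [^] q \<otimes> (a [^] (e - e' * q) \<otimes> (x \<otimes> inv ?v)) = (a [^] e \<otimes> inv ?w \<otimes> ?w) \<otimes> (x \<otimes> inv ?v \<otimes> ?v)"
        unfolding mq int_pow_diff[OF ac(1)] using w c by (simp add: m_ac)
      also have "\<dots> = a [^] e \<otimes> x" using w c by (simp add: m_assoc)
      finally show ?thesis by simp
    qed
    have "inv (?m [^] q) \<otimes> (a [^] e \<otimes> x) \<in> M"
      using that insert.prems(1) by (simp add: subgroup.m_closed subgroup.m_inv_closed subgroup_int_pow_closed)
    moreover have "inv (?m [^] q) \<otimes> (a [^] e \<otimes> x) = a [^] (e - e' * q) \<otimes> (x \<otimes> inv (x' [^] q))"
      unfolding eq using ac c y Mc by (intro inv_mult_cancel) auto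
    ultimately show ?thesis using y eq by auto
  qed
  show ?case
  proof (cases "E = {}")
    case True
    have "M \<subseteq> ?A"
    proof
      fix m assume m: "m \<in> M"
      then obtain f :: int and z where mz: "m = a [^] f \<otimes> z" "z \<in> ?A" using insert.prems(2) unfolding generate_insert[OF ac] by blast
      have zc: "z \<in> carrier G" using mz Mc by blast
      have "f = 0"
      proof (rule ccontr)
        assume f: "f \<noteq> 0"
        have "inv m = a [^] (- f) \<otimes> inv z" unfolding mz(1) using ac zc by (simp add: inv_mult int_pow_neg)
        moreover have "inv m \<in> M" "inv z \<in> ?A" using m mz insert.prems(1) As by (simp_all add: subgroup.m_inv_closed)
        ultimately have "f > 0 \<Longrightarrow> nat f \<in> E" "f < 0 \<Longrightarrow> nat (- f) \<in> E"
          using m mz unfolding E_def by auto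
        then show False using True f by (cases f "0::int" rule: linorder_cases) simp_all
      qed
      then show "m \<in> ?A" using mz zc by simp
    qed
    then have "M \<inter> ?A = M" by blast
    then show ?thesis using S' by auto
  next
    case False
    define e where "e = (LEAST e. e \<in> E)"
    have "e \<in> E" unfolding e_def using False by (metis LeastI ex_in_conv)
    then obtain y where e: "e > 0" "y \<in> ?A" "a [^] (int e) \<otimes> y \<in> M" by (auto simp: E_def)
    let ?m = "a [^] (int e) \<otimes> y"
    have "M = generate G (insert ?m S')"
    proof
      show "generate G (insert ?m S') \<subseteq> M" by (rule generate_subgroup_incl[OF _ insert.prems(1)]) (use e S' in auto)
      show "M \<subseteq> generate G (insert ?m S')"
      proof
        fix m assume m: "m \<in> M"
        then obtain f :: int and z where mz: "m = a [^] f \<otimes> z" "z \<in> ?A" using insert.prems(2) unfolding generate_insert[OF ac] by blast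
        let ?q = "f div int e"
        obtain w where w: "w \<in> ?A" "a [^] (f - int e * ?q) \<otimes> w \<in> M" "a [^] f \<otimes> z = ?m [^] ?q \<otimes> (a [^] (f - int e * ?q) \<otimes> w)"
          using red[of z f y "int e" ?q] mz m e by blast
        have r: "f - int e * ?q = f mod int e" by (simp add: minus_mult_div_eq_mod)
        have rr: "0 \<le> f mod int e" "f mod int e < int e" using e(1) by simp_all
        have "f mod int e = 0"
        proof (rule ccontr)
          assume "f mod int e \<noteq> 0"
          then have "nat (f mod int e) \<in> E" unfolding E_def using w rr r by auto
          then have "e \<le> nat (f mod int e)" unfolding e_def by (rule Least_le)
          then show False using rr by linarith
        qed
        then have r0: "f - int e * ?q = 0" using r by simp
        have wc: "w \<in> carrier G" using w(1) Mc by blast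
        have "w \<in> M \<inter> ?A" using w(1,2) wc unfolding r0 by simp
        then have wg: "w \<in> generate G S'" using S'(3) by simp
        have "?m \<in> carrier G" "S' \<subseteq> carrier G" using e(3) S'(2) Mc by blast+
        note gi = generate_insert[OF this]
        have "m = ?m [^] ?q \<otimes> w" using w(3) wc unfolding mz(1) r0 by simp
        then show "m \<in> generate G (insert ?m S')" unfolding gi using wg by blast
      qed
    qed
    moreover have "finite (insert ?m S')" "insert ?m S' \<subseteq> M" using S' e by auto
    ultimately show ?thesis by blast
  qed
qed

text \<open>If the k-th power of a lies in \<open>P\<close>, the powers of a are covered by |k|
  translates of \<open>P\<close>. Further generators are added as commuting products.\<close>

lemma torsion_vle:
  assumes P: "subgroup P G" and "finite S" "S \<subseteq> carrier G" "\<And>s. s \<in> S \<Longrightarrow> \<exists>k::int. k \<noteq> 0 \<and> s [^] k \<in> P"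
  shows "generate G S \<lessapprox> P"
  using assms(2-)
proof (induction S rule: finite_induct)
  case empty
  then show ?case using subgroup.one_closed[OF P] subgroup.subset[OF P] by (intro vle_subset) (auto simp: generate_empty)
next
  case (insert a S)
  have ac: "a \<in> carrier G" "S \<subseteq> carrier G" using insert.prems by auto
  obtain k :: int where k: "k \<noteq> 0" "a [^] k \<in> P" using insert.prems(2) by blast
  have IH: "generate G S \<lessapprox> P" using insert ac by blast
  have s: "subgroup (generate G {a}) G" "subgroup (generate G S) G" using ac by (auto intro: generate_is_subgroup)
  have c: "generate G {a} \<subseteq> carrier G" "generate G S \<subseteq> carrier G" using s subgroup.subset by blast+
  have "generate G {a} \<lessapprox> P"
    unfolding virtually_le_def
  proof (intro exI[of _ "(\<lambda>i. a [^] i) ` {0..<\<bar>k\<bar>}"] conjI ballI)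
    show "finite ((\<lambda>i. a [^] i) ` {0..<\<bar>k\<bar>})" by simp
    show "(\<lambda>i. a [^] i) ` {0..<\<bar>k\<bar>} \<subseteq> carrier G" using ac by auto
    fix x assume "x \<in> generate G {a}"
    then obtain j :: int where j: "x = a [^] j" unfolding generate_pow[OF ac(1)] by blast
    have "inv (a [^] (j mod \<bar>k\<bar>)) \<otimes> x = a [^] (j - j mod \<bar>k\<bar>)"
      unfolding j using ac by (simp add: int_pow_diff m_comm)
    \<comment> \<open>The sign of k turns a multiple of |k| into a multiple of k.\<close>
    also have "j - j mod \<bar>k\<bar> = k * (sgn k * (j div \<bar>k\<bar>))"
      by (simp add: minus_mod_eq_mult_div mult.assoc[symmetric] abs_sgn[symmetric] mult_sgn_abs mult.commute[of k "sgn k"])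
    also have "a [^] (k * (sgn k * (j div \<bar>k\<bar>))) = (a [^] k) [^] (sgn k * (j div \<bar>k\<bar>))" using ac by (simp add: int_pow_pow)
    also have "\<dots> \<in> P" by (rule subgroup_int_pow_closed[OF P k(2)])
    finally have "inv (a [^] (j mod \<bar>k\<bar>)) \<otimes> x \<in> P" .
    moreover have "j mod \<bar>k\<bar> \<in> {0..<\<bar>k\<bar>}" using k(1) by simp
    ultimately show "\<exists>t\<in>(\<lambda>i. a [^] i) ` {0..<\<bar>k\<bar>}. inv t \<otimes> x \<in> P" by blast
  qed
  then have "generate G {a} <#> generate G S \<lessapprox> P"
    by (rule vle_set_mult_commuting[OF _ IH s P]) (use cz_all[OF c(1)] c(2) in simp)
  moreover have "generate G (insert a S) = generate G {a} <#> generate G S"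
    unfolding generate_insert[OF ac] generate_pow[OF ac(1)] by (auto simp: set_mult_def)
  ultimately show ?case by simp
qed

section \<open>Integral independence\<close>

lemma finprod_in_subgroup:
  assumes "subgroup P G" "finite B" shows "f \<in> B \<rightarrow> P \<Longrightarrow> finprod G f B \<in> P"
  using assms(2)
proof (induction B rule: finite_induct)
  case (insert b B)
  have Pc: "P \<subseteq> carrier G" by (rule subgroup.subset[OF assms(1)])
  have "finprod G f (insert b B) = f b \<otimes> finprod G f B"
    using insert Pc by (intro finprod_insert) auto
  then show ?case using insert by (auto intro: subgroup.m_closed[OF assms(1)])
qed (simp add: subgroup.one_closed[OF assms(1)])

lemma int_independentD:
  assumes "int_independent G B"
  shows "finite B" "B \<subseteq> carrier G" "\<And>k b. finprod G (\<lambda>b. b [^] (k b :: int)) B = \<one> \<Longrightarrow> b \<in> B \<Longrightarrow> k b = 0"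
  using assms unfolding int_independent_def by blast+

text \<open>In a relation, the power of m equals an element of \<open>P\<close>, so its exponent is
  0 and a relation in \<open>B\<close> remains.\<close>

lemma int_independent_insert:
  assumes B: "int_independent G B" and P: "subgroup P G" "B \<subseteq> P" and m: "m \<in> carrier G" "\<And>k::int. k \<noteq> 0 \<Longrightarrow> m [^] k \<notin> P"
  shows "int_independent G (insert m B)" "m \<notin> B"
proof -
  note BD = int_independentD[OF B]
  show mB: "m \<notin> B"
  proof
    assume "m \<in> B"
    then have "m [^] (1::int) \<in> P" using P m by auto
    then show False using m(2)[of 1] by simp
  qed
  show "int_independent G (insert m B)" unfolding int_independent_def
  proof (intro conjI allI impI)
    show "finite (insert m B)" "insert m B \<subseteq> carrier G" using BD m by auto
    fix k :: "'a \<Rightarrow> int"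
    let ?f = "\<lambda>b. b [^] k b"
    assume e: "finprod G ?f (insert m B) = \<one>"
    have fi: "finprod G ?f (insert m B) = ?f m \<otimes> finprod G ?f B"
      using BD m mB by (intro finprod_insert) auto
    have inP: "finprod G ?f B \<in> P" using P subgroup_int_pow_closed[OF P(1)] by (intro finprod_in_subgroup[OF P(1) BD(1)]) blast
    have pc: "finprod G ?f B \<in> carrier G" using inP subgroup.subset[OF P(1)] by blast
    have "?f m = inv (finprod G ?f B)" using e fi pc m by (metis int_pow_closed inv_equality)
    then have "?f m \<in> P" using inP subgroup.m_inv_closed[OF P(1)] by simp
    then have km: "k m = 0" using m(2) by blast
    then have "finprod G ?f B = \<one>" using e fi pc by simp
    then show "\<forall>b\<in>insert m B. k b = 0" using BD(3) km by blast
  qed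
qed

lemma generate_finprod:
  assumes "finite B" "B \<subseteq> carrier G" "x \<in> generate G B"
  shows "\<exists>k::'a \<Rightarrow> int. x = finprod G (\<lambda>b. b [^] k b) B"
  using assms
proof (induction B arbitrary: x rule: finite_induct)
  case empty
  then show ?case by (simp add: generate_empty)
next
  case (insert a S)
  have ac: "a \<in> carrier G" "S \<subseteq> carrier G" using insert.prems by auto
  obtain e :: int and y where ey: "x = a [^] e \<otimes> y" "y \<in> generate G S" using insert.prems(2) unfolding generate_insert[OF ac] by blast
  obtain k :: "'a \<Rightarrow> int" where k: "y = finprod G (\<lambda>b. b [^] k b) S" using insert.IH ac(2) ey(2) by blast
  let ?k = "k(a := e)"
  have "finprod G (\<lambda>b. b [^] ?k b) (insert a S) = a [^] ?k a \<otimes> finprod G (\<lambda>b. b [^] ?k b) S"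
    using insert.hyps ac by (intro finprod_insert) auto
  also have "finprod G (\<lambda>b. b [^] ?k b) S = finprod G (\<lambda>b. b [^] k b) S"
    by (rule finprod_cong') (use insert.hyps ac in auto)
  finally have "x = finprod G (\<lambda>b. b [^] ?k b) (insert a S)" using ey k by simp
  then show ?case by blast
qed

lemma int_independent_mono:
  assumes "int_independent G B" "C \<subseteq> B" shows "int_independent G C"
proof -
  note BD = int_independentD[OF assms(1)]
  have fC: "finite C" "C \<subseteq> carrier G" using finite_subset[OF assms(2) BD(1)] subset_trans[OF assms(2) BD(2)] .
  show ?thesis unfolding int_independent_def
  proof (intro conjI allI impI ballI fC)
    fix k :: "'a \<Rightarrow> int" and b assume e: "finprod G (\<lambda>b. b [^] k b) C = \<one>" and b: "b \<in> C"
    let ?k = "\<lambda>b. if b \<in> C then k b else 0"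
    have "finprod G (\<lambda>b. b [^] ?k b) B = finprod G (\<lambda>b. b [^] k b) C"
      by (rule finprod_mono_neutral_cong_right) (use BD assms fC in auto)
    then have "?k b = 0" using e b assms by (intro BD(3)) auto
    then show "k b = 0" using b by simp
  qed
qed

lemma int_independent_disjoint:
  assumes "int_independent G (insert b C)" "b \<notin> C" "b [^] (i::int) \<in> generate G C" shows "i = 0"
proof -
  note BD = int_independentD[OF assms(1)]
  have c: "finite C" "C \<subseteq> carrier G" "b \<in> carrier G" using BD by auto
  obtain k :: "'a \<Rightarrow> int" where k: "b [^] i = finprod G (\<lambda>b. b [^] k b) C" using generate_finprod[OF c(1,2) assms(3)] by blast
  let ?k = "\<lambda>x. if x = b then - i else k x"
  have "finprod G (\<lambda>x. x [^] ?k x) (insert b C) = b [^] ?k b \<otimes> finprod G (\<lambda>x. x [^] ?k x) C"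
    using c assms(2) by (intro finprod_insert) auto
  also have "finprod G (\<lambda>x. x [^] ?k x) C = finprod G (\<lambda>b. b [^] k b) C"
    by (rule finprod_cong') (use c assms(2) in auto)
  also have "b [^] ?k b \<otimes> \<dots> = \<one>" unfolding k[symmetric] using c by (simp add: int_pow_neg)
  finally have "?k b = 0" by (rule BD(3)) simp
  then show ?thesis by simp
qed

text \<open>The groups generated by initial segments of a list of \<open>B\<close> form a chain in
  which every step is big; \<open>big_steps_le_generators\<close> bounds the number of such
  steps.\<close>

lemma int_independent_card_le:
  assumes S: "finite S" "generate G S = carrier G" "S \<subseteq> carrier G" and B: "int_independent G B"
  shows "card B \<le> card S"
proof -
  note BD = int_independentD[OF B]
  obtain bs where bs: "set bs = B" "distinct bs" using finite_distinct_list[OF BD(1)] by blast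
  define T where "T j = generate G (set (take j bs))" for j
  have c: "set (take j bs) \<subseteq> carrier G" for j using BD(2) bs set_take_subset[of j bs] by blast
  have "big_step (T j) (T (Suc j))" if j: "j < length bs" for j
  proof -
    have t: "set (take (Suc j) bs) = insert (bs ! j) (set (take j bs))" using j by (simp add: take_Suc_conv_app_nth)
    have nin: "bs ! j \<notin> set (take j bs)"
      using bs(2) j nth_eq_iff_index_eq[OF bs(2)] by (fastforce simp: in_set_conv_nth)
    have ind: "int_independent G (insert (bs ! j) (set (take j bs)))"
      using int_independent_mono[OF B, of "set (take (Suc j) bs)"] bs(1) set_take_subset[of "Suc j" bs] unfolding t by blast
    have "bs ! j \<in> T (Suc j)" unfolding T_def t by (rule generate.incl) simp
    moreover have "(bs ! j) [^] k \<notin> T j" if "k \<noteq> 0" for k :: int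
      using int_independent_disjoint[OF ind nin, of k] that unfolding T_def by blast
    ultimately show ?thesis unfolding big_step_def by blast
  qed
  then have "{j. j < length bs \<and> big_step (T j) (T (Suc j))} = {..<length bs}" by auto
  moreover have "card {j. j < length bs \<and> big_step (T j) (T (Suc j))} \<le> card S"
  proof (rule big_steps_le_generators[OF S(1,3)])
    show "subgroup (T j) G" for j unfolding T_def by (rule generate_is_subgroup[OF c])
    then show "T j \<subseteq> generate G S" for j using S(2) subgroup.subset by blast
    show "T j \<subseteq> T (Suc j)" for j unfolding T_def by (rule mono_generate) (rule set_take_subset_set_take, simp)
  qed
  ultimately show ?thesis using bs by (simp add: distinct_card[symmetric])
qed

end

section \<open>Virtually abelian just infinite groups\<close>

context group begin

text \<open>Two different powers of x lie in the same of finitely many cosets of \<open>A\<close>;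
  their quotient is the required power.\<close>

lemma finite_index_power:
  assumes A: "subgroup A G" "carrier G \<lessapprox> A" and x: "x \<in> carrier G"
  shows "\<exists>n::int. n \<noteq> 0 \<and> x [^] n \<in> A"
proof -
  obtain T where T: "finite T" "T \<subseteq> carrier G" "\<forall>a\<in>carrier G. \<exists>t\<in>T. inv t \<otimes> a \<in> A"
    using A(2) unfolding virtually_le_def by blast
  have "\<forall>n::int. \<exists>t. t \<in> T \<and> inv t \<otimes> x [^] n \<in> A" using T(3) x by blast
  then obtain t where t: "\<forall>n::int. t n \<in> T \<and> inv (t n) \<otimes> x [^] n \<in> A" by (rule choice[THEN exE])
  have "\<not> inj t"
  proof
    assume "inj t"
    moreover have "finite (range t)" by (rule finite_subset[OF _ T(1)]) (use t in blast)
    ultimately show False using finite_imageD[of t UNIV] infinite_UNIV_int by blast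
  qed
  then obtain i j where ij: "i \<noteq> j" "t i = t j" by (auto simp: inj_def)
  have c: "t i \<in> carrier G" "x [^] i \<in> carrier G" "x [^] j \<in> carrier G" using t T(2) x by auto
  have "inv (inv (t i) \<otimes> x [^] i) \<otimes> (inv (t j) \<otimes> x [^] j) \<in> A" by (rule subgroup_inv_mult[OF A(1)]) (use t in blast)+
  moreover have "inv (inv (t i) \<otimes> x [^] i) \<otimes> (inv (t j) \<otimes> x [^] j) = x [^] (- i + j)"
    using c ij(2) x unfolding int_pow_mult[OF x] int_pow_neg[OF x] by (simp add: inv_mult_group m_assoc inv_mult_cancel)
  ultimately show ?thesis using ij(1) by (intro exI[of _ "- i + j"]) simp
qed

lemma finprod_restrict_eq:
  assumes A: "comm_group (G\<lparr>carrier := A\<rparr>)" and B: "comm_group (G\<lparr>carrier := B\<rparr>)" and f: "finite F"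
  shows "f \<in> F \<rightarrow> A \<inter> B \<Longrightarrow> finprod (G\<lparr>carrier := A\<rparr>) f F = finprod (G\<lparr>carrier := B\<rparr>) f F"
proof -
  interpret A: comm_group "G\<lparr>carrier := A\<rparr>" by fact
  interpret B: comm_group "G\<lparr>carrier := B\<rparr>" by fact
  show "f \<in> F \<rightarrow> A \<inter> B \<Longrightarrow> ?thesis"
    using f
  proof (induction F rule: finite_induct)
    case (insert x F)
    have "finprod (G\<lparr>carrier := A\<rparr>) f (insert x F) = f x \<otimes> finprod (G\<lparr>carrier := A\<rparr>) f F"
      using A.finprod_insert[of F x f] insert by (auto simp: Pi_def)
    moreover have "finprod (G\<lparr>carrier := B\<rparr>) f (insert x F) = f x \<otimes> finprod (G\<lparr>carrier := B\<rparr>) f F"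
      using B.finprod_insert[of F x f] insert by (auto simp: Pi_def)
    ultimately show ?case using insert by simp
  qed simp
qed

lemma finite_index_abelianD:
  assumes "finite_index_abelian G A"
  shows "subgroup A G" "carrier G \<lessapprox> A" "comm_group (G\<lparr>carrier := A\<rparr>)" "A \<subseteq> cz A" "A \<subseteq> carrier G"
proof -
  show s: "subgroup A G" "comm_group (G\<lparr>carrier := A\<rparr>)" using assms by (simp_all add: finite_index_abelian_def)
  show "carrier G \<lessapprox> A" using assms finite_index_iff_vle'[OF s(1)] by (simp add: finite_index_abelian_def)
  show c: "A \<subseteq> carrier G" by (rule subgroup.subset[OF s(1)])
  interpret A: comm_group "G\<lparr>carrier := A\<rparr>" by fact
  show "A \<subseteq> cz A" using A.m_comm c by (auto simp: cz_def)
qed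

text \<open>Each c in an independent set is replaced by a nonzero power lying in \<open>B\<close>.
  Exponents multiply, so a relation among the powers is a relation in \<open>A\<close>. The two
  structures carry their own finite products, which agree for factors in A \<inter> B.\<close>

lemma torsion_free_rank_le:
  assumes A: "finite_index_abelian G A" and B: "finite_index_abelian G B"
  shows "torsion_free_rank (G\<lparr>carrier := A\<rparr>) \<le> torsion_free_rank (G\<lparr>carrier := B\<rparr>)"
proof -
  note AD = finite_index_abelianD[OF A] and BD = finite_index_abelianD[OF B]
  interpret A: comm_group "G\<lparr>carrier := A\<rparr>" by (rule AD(3))
  interpret B: comm_group "G\<lparr>carrier := B\<rparr>" by (rule BD(3))
  have "\<exists>D. int_independent (G\<lparr>carrier := B\<rparr>) D \<and> card D = card C" if C: "int_independent (G\<lparr>carrier := A\<rparr>) C" for C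
  proof -
    note CD = A.int_independentD[OF C]
    have Cs: "C \<subseteq> A" "C \<subseteq> carrier G" using CD(2) AD(5) by auto
    have pA: "c [^]\<^bsub>G\<lparr>carrier := A\<rparr>\<^esub> n = c [^] n" if "c \<in> A" for c and n :: int
      using int_pow_consistent[OF AD(1) that] by simp
    have clA: "c [^]\<^bsub>G\<lparr>carrier := A\<rparr>\<^esub> n \<in> A" if "c \<in> A" for c and n :: int
      using A.int_pow_closed[of c n] that by simp
    have pB: "c [^]\<^bsub>G\<lparr>carrier := B\<rparr>\<^esub> n = c [^] n" if "c \<in> B" for c and n :: int
      using int_pow_consistent[OF BD(1) that] by simp
    have "\<forall>c\<in>C. \<exists>n::int. n \<noteq> 0 \<and> c [^] n \<in> B" using finite_index_power[OF BD(1,2)] Cs(2) by blast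
    then obtain n :: "'a \<Rightarrow> int" where n: "\<forall>c\<in>C. n c \<noteq> 0 \<and> c [^] n c \<in> B" by (rule bchoice[THEN exE])
    let ?h = "\<lambda>c. c [^] n c"
    have hAB: "?h c \<in> A \<inter> B" if "c \<in> C" for c
      using n that Cs subgroup_int_pow_closed[OF AD(1)] by blast
    have prod: "finprod (G\<lparr>carrier := B\<rparr>) (\<lambda>c. ?h c [^]\<^bsub>G\<lparr>carrier := B\<rparr>\<^esub> k c) F =
       finprod (G\<lparr>carrier := A\<rparr>) (\<lambda>c. c [^]\<^bsub>G\<lparr>carrier := A\<rparr>\<^esub> (n c * k c)) F" if F: "F \<subseteq> C" for F and k :: "'a \<Rightarrow> int"
    proof -
      have fF: "finite F" using F CD(1) finite_subset by blast
      have eq: "?h c [^]\<^bsub>G\<lparr>carrier := B\<rparr>\<^esub> k c = c [^]\<^bsub>G\<lparr>carrier := A\<rparr>\<^esub> (n c * k c)" if "c \<in> F" for c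
      proof -
        have "c \<in> A" "c \<in> carrier G" "?h c \<in> B" using that F Cs hAB by blast+
        then show ?thesis using pA pB int_pow_pow by metis
      qed
      have inAB: "c [^]\<^bsub>G\<lparr>carrier := A\<rparr>\<^esub> (n c * k c) \<in> A \<inter> B" if "c \<in> F" for c
      proof -
        have "?h c [^] k c \<in> A \<inter> B" using hAB[of c] F that subgroup_int_pow_closed[OF AD(1)] subgroup_int_pow_closed[OF BD(1)] by blast
        then show ?thesis using eq[OF that] pB[of "?h c"] hAB[of c] F that by auto
      qed
      have "finprod (G\<lparr>carrier := B\<rparr>) (\<lambda>c. ?h c [^]\<^bsub>G\<lparr>carrier := B\<rparr>\<^esub> k c) F =
         finprod (G\<lparr>carrier := B\<rparr>) (\<lambda>c. c [^]\<^bsub>G\<lparr>carrier := A\<rparr>\<^esub> (n c * k c)) F"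
        by (rule B.finprod_cong') (use eq inAB in auto)
      also have "\<dots> = finprod (G\<lparr>carrier := A\<rparr>) (\<lambda>c. c [^]\<^bsub>G\<lparr>carrier := A\<rparr>\<^esub> (n c * k c)) F"
        by (rule finprod_restrict_eq[OF AD(3) BD(3) fF, symmetric]) (use inAB in auto)
      finally show ?thesis .
    qed
    \<comment> \<open>Independence is a property of sets, so coinciding powers must be excluded:
      they would give the relation with exponents n b and - n c.\<close>
    have inj: "inj_on ?h C"
    proof (rule inj_onI, rule ccontr)
      fix b c assume bc: "b \<in> C" "c \<in> C" "?h b = ?h c" "b \<noteq> c"
      let ?k = "\<lambda>x. if x = b then 1 else if x = c then -1 else (0::int)"
      have "finprod (G\<lparr>carrier := A\<rparr>) (\<lambda>x. x [^]\<^bsub>G\<lparr>carrier := A\<rparr>\<^esub> (n x * ?k x)) C =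
            finprod (G\<lparr>carrier := A\<rparr>) (\<lambda>x. x [^]\<^bsub>G\<lparr>carrier := A\<rparr>\<^esub> (n x * ?k x)) {b, c}"
        using CD(1) by (rule A.finprod_mono_neutral_cong_right) (use bc(1,2) Cs(1) clA subgroup.one_closed[OF AD(1)] in auto)
      also have "\<dots> = ?h b \<otimes> inv ?h c"
      proof -
        have c: "b \<in> A" "c \<in> A" "b \<in> carrier G" "c \<in> carrier G" using bc Cs by auto
        have "finprod (G\<lparr>carrier := A\<rparr>) (\<lambda>x. x [^]\<^bsub>G\<lparr>carrier := A\<rparr>\<^esub> (n x * ?k x)) {b, c} =
           b [^]\<^bsub>G\<lparr>carrier := A\<rparr>\<^esub> (n b) \<otimes> c [^]\<^bsub>G\<lparr>carrier := A\<rparr>\<^esub> (- n c)"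
          using A.finprod_insert[of "{c}" b "\<lambda>x. x [^]\<^bsub>G\<lparr>carrier := A\<rparr>\<^esub> (n x * ?k x)"] c bc(4)
            A.finprod_insert[of "{}" c "\<lambda>x. x [^]\<^bsub>G\<lparr>carrier := A\<rparr>\<^esub> (n x * ?k x)"] A.int_pow_closed[of b] A.int_pow_closed[of c]
            A.r_one
          by (simp add: Pi_def)
        then show ?thesis using pA c by (simp add: int_pow_neg)
      qed
      also have "\<dots> = \<one>" using bc Cs by (simp add: subset_iff)
      finally have "n b * ?k b = 0" using bc(1) by (intro CD(3)[of "\<lambda>x. n x * ?k x"]) simp_all
      then show False using n bc(1) by simp
    qed
    let ?D = "?h ` C"
    have "int_independent (G\<lparr>carrier := B\<rparr>) ?D" unfolding int_independent_def
    proof (intro conjI allI impI ballI)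
      show "finite ?D" using CD(1) by simp
      show "?D \<subseteq> carrier (G\<lparr>carrier := B\<rparr>)" using hAB by auto
      fix k :: "'a \<Rightarrow> int" and d
      assume e: "finprod (G\<lparr>carrier := B\<rparr>) (\<lambda>b. b [^]\<^bsub>G\<lparr>carrier := B\<rparr>\<^esub> k b) ?D = \<one>\<^bsub>G\<lparr>carrier := B\<rparr>\<^esub>" and d: "d \<in> ?D"
      have "finprod (G\<lparr>carrier := B\<rparr>) (\<lambda>b. b [^]\<^bsub>G\<lparr>carrier := B\<rparr>\<^esub> k b) ?D =
         finprod (G\<lparr>carrier := B\<rparr>) (\<lambda>c. ?h c [^]\<^bsub>G\<lparr>carrier := B\<rparr>\<^esub> k (?h c)) C"
        by (rule B.finprod_reindex[OF _ inj]) (use hAB in \<open>auto intro!: B.int_pow_closed[simplified]\<close>)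
      also have "\<dots> = finprod (G\<lparr>carrier := A\<rparr>) (\<lambda>c. c [^]\<^bsub>G\<lparr>carrier := A\<rparr>\<^esub> (n c * k (?h c))) C"
        by (rule prod[OF order_refl])
      finally have "finprod (G\<lparr>carrier := A\<rparr>) (\<lambda>c. c [^]\<^bsub>G\<lparr>carrier := A\<rparr>\<^esub> (n c * k (?h c))) C = \<one>\<^bsub>G\<lparr>carrier := A\<rparr>\<^esub>" using e by simp
      moreover obtain c where c: "c \<in> C" "d = ?h c" using d by blast
      ultimately have "n c * k (?h c) = 0" using CD(3)[of "\<lambda>c. n c * k (?h c)"] by blast
      then show "k d = 0" using n c by simp
    qed
    moreover have "card ?D = card C" by (rule card_image[OF inj])
    ultimately show ?thesis by blast
  qed
  then show ?thesis unfolding torsion_free_rank_def by (intro SUP_least) (metis (no_types, lifting) SUP_upper mem_Collect_eq)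
qed

text \<open>\<open>torsion_free_rank_le\<close> in both directions makes the definite description in
  \<open>virtual_rank\<close> unique.\<close>

lemma virtual_rank_eq:
  assumes "finite_index_abelian G A" shows "virtual_rank G = torsion_free_rank (G\<lparr>carrier := A\<rparr>)"
  unfolding virtual_rank_def
proof (rule the_equality)
  show "\<exists>B. finite_index_abelian G B \<and> torsion_free_rank (G\<lparr>carrier := B\<rparr>) = torsion_free_rank (G\<lparr>carrier := A\<rparr>)"
    using assms by blast
  fix r assume "\<exists>B. finite_index_abelian G B \<and> torsion_free_rank (G\<lparr>carrier := B\<rparr>) = r"
  then show "r = torsion_free_rank (G\<lparr>carrier := A\<rparr>)"
    using torsion_free_rank_le assms by (metis order_antisym)
qed

end

context just_infinite_group begin

text \<open>A nontrivial element of an abelian normal subgroup \<open>N\<close> of finite index is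
  centralized by \<open>N\<close>, so it has finitely many conjugates. They generate a nontrivial
  normal subgroup inside \<open>N\<close>, which has finite index by just infinity; this is the
  source of finite generation.\<close>

lemma virtually_abelian_structure:
  assumes "virtually_abelian G"
  obtains E S where "E \<lhd> G" "carrier G \<lessapprox> E" "E \<subseteq> cz E" "finite S" "S \<subseteq> E" "generate G S = E"
proof -
  obtain A where A: "finite_index_abelian G A" using assms by (auto simp: virtually_abelian_def)
  note AD = finite_index_abelianD[OF A]
  obtain N where N: "N \<lhd> G" "N \<subseteq> A" "carrier G \<lessapprox> N" by (rule finite_index_core[OF AD(1,2)])
  have Nc: "N \<subseteq> carrier G" using N(2) AD(5) by blast
  have "N \<noteq> {\<one>}" using finite_index_infinite[OF N(3)] by auto
  moreover have "\<one> \<in> N" using N(1) by (simp add: normal_imp_subgroup subgroup.one_closed)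
  ultimately obtain a where a: "a \<in> N" "a \<noteq> \<one>" by blast
  have ac: "{a} \<subseteq> carrier G" using a Nc by blast
  have "nrm N {a}"
  proof
    fix n assume n: "n \<in> N"
    have "n \<in> cz {a}" using n N(2) AD(4) cz_anti[of "{a}" A] a by blast
    then show "cj n {a} = {a}"
      using czD[of n "{a}" a] ac n Nc conjugate_set_image[OF ac, of n] by (auto simp: m_assoc subset_iff)
  qed
  then have fin: "finite ((\<lambda>g. cj g {a}) ` carrier G)" by (rule conjugates_finite[OF N(3) _ ac Nc])
  let ?S = "\<Union>g\<in>carrier G. cj g {a}"
  have "finite ?S"
  proof (rule finite_Union[OF fin])
    fix M assume "M \<in> (\<lambda>g. cj g {a}) ` carrier G"
    then show "finite M" using conjugate_set_image[OF ac] by auto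
  qed
  have En: "ncl {a} \<lhd> G" "{a} \<subseteq> ncl {a}" using ncl[OF ac] .
  have SN: "?S \<subseteq> N"
  proof
    fix x assume "x \<in> ?S"
    then obtain g where g: "g \<in> carrier G" "x \<in> cj g {a}" by blast
    then show "x \<in> N" using conjugate_mono[of "{a}" N g] a normal_conjugate[OF N(1) g(1)] by blast
  qed
  have "ncl {a} \<subseteq> N" unfolding ncl_def by (rule generate_subgroup_incl[OF SN normal_imp_subgroup[OF N(1)]])
  then have "ncl {a} \<subseteq> cz (ncl {a})" using N(2) AD(4) cz_anti[of "ncl {a}" A] by blast
  moreover have "ncl {a} \<noteq> {\<one>}" using En(2) a by blast
  then have "carrier G \<lessapprox> ncl {a}" by (rule normal_nontrivial_finite_index[OF En(1)])
  moreover have "?S \<subseteq> ncl {a}" unfolding ncl_def by (auto intro: generate.incl)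
  ultimately show ?thesis using En(1) \<open>finite ?S\<close> ncl_def[symmetric] by (intro that[of "ncl {a}" ?S])
qed

text \<open>Generators of the abelian subgroup together with finitely many coset representatives
  generate \<open>G\<close>.\<close>

lemma virtually_abelian_finitely_generated:
  assumes "virtually_abelian G" shows "finitely_generated G"
proof -
  obtain E S where E: "E \<lhd> G" "carrier G \<lessapprox> E" "finite S" "S \<subseteq> E" "generate G S = E"
    by (rule virtually_abelian_structure[OF assms]) (rule that)
  have Ec: "E \<subseteq> carrier G" using E(1) by (simp add: normal_imp_subgroup subgroup.subset)
  obtain T where T: "finite T" "T \<subseteq> carrier G" "\<forall>a\<in>carrier G. \<exists>t\<in>T. inv t \<otimes> a \<in> E"
    using E(2) unfolding virtually_le_def by blast
  have c: "S \<union> T \<subseteq> carrier G" using E T Ec by blast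
  have g: "subgroup (generate G (S \<union> T)) G" by (rule generate_is_subgroup[OF c])
  have "carrier G \<subseteq> generate G (S \<union> T)"
  proof
    fix x assume x: "x \<in> carrier G"
    then obtain t where t: "t \<in> T" "inv t \<otimes> x \<in> E" using T(3) by blast
    have "E \<subseteq> generate G (S \<union> T)" unfolding E(5)[symmetric] by (rule mono_generate) blast
    moreover have "t \<in> generate G (S \<union> T)" using t by (intro generate.incl) blast
    ultimately have "t \<otimes> (inv t \<otimes> x) \<in> generate G (S \<union> T)" using t g by (blast intro: subgroup.m_closed)
    then show "x \<in> generate G (S \<union> T)" using t T x by (simp add: inv_mult_cancel subset_iff)
  qed
  then have "generate G (S \<union> T) = carrier G" using subgroup.subset[OF g] by blast
  then show ?thesis unfolding finitely_generated_def using c E(3) T(1) by (intro exI[of _ "S \<union> T"]) auto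
qed

end

section \<open>Counting factors by the rank of an abelian normal subgroup\<close>

locale abelian_normal_finite_index = just_infinite_group +
  fixes E S
  assumes E: "E \<lhd> G" "carrier G \<lessapprox> E" "E \<subseteq> cz E" and S: "finite S" "S \<subseteq> E" "generate G S = E"
begin

abbreviation K where "K \<equiv> G\<lparr>carrier := E\<rparr>"

lemma E_subgroup: "subgroup E G" and E_carrier: "E \<subseteq> carrier G"
  using E(1) by (auto simp: normal_imp_subgroup subgroup.subset)

lemma K_comm: "comm_group K" by (rule abelian_cz[OF E_subgroup E(3)])

interpretation K: comm_group K by (rule K_comm)

lemma K_subgroup: "subgroup P G \<Longrightarrow> P \<subseteq> E \<Longrightarrow> subgroup P K"
  using subgroup_incl[OF _ E_subgroup] by blast

lemma K_generate: "B \<subseteq> E \<Longrightarrow> generate K B = generate G B"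
  by (rule generate_consistent[OF _ E_subgroup])

lemma K_virtually_le: "virtually_le K A B \<Longrightarrow> A \<lessapprox> B"
proof -
  assume "virtually_le K A B"
  then obtain T where T: "finite T" "T \<subseteq> E" "\<forall>a\<in>A. \<exists>t\<in>T. inv\<^bsub>K\<^esub> t \<otimes> a \<in> B" unfolding virtually_le_def by auto
  have "inv\<^bsub>K\<^esub> t = inv t" if "t \<in> T" for t using m_inv_consistent[OF E_subgroup] that T(2) by blast
  then show "A \<lessapprox> B" unfolding virtually_le_def using T E_carrier by (intro exI[of _ T]) auto
qed

text \<open>Otherwise each of finitely many generators of \<open>M\<close> would have a nonzero
  power in \<open>P\<close>, and \<open>M\<close> would lie virtually in \<open>P\<close>.\<close>

lemma not_vle_element:
  assumes M: "subgroup M G" "M \<subseteq> E" and P: "subgroup P G" and n: "\<not> M \<lessapprox> P"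
  shows "\<exists>m\<in>M. \<forall>k::int. k \<noteq> 0 \<longrightarrow> m [^]\<^bsub>K\<^esub> k \<notin> P \<inter> E"
proof (rule ccontr)
  assume c: "\<not> (\<exists>m\<in>M. \<forall>k::int. k \<noteq> 0 \<longrightarrow> m [^]\<^bsub>K\<^esub> k \<notin> P \<inter> E)"
  have SK: "S \<subseteq> carrier K" "generate K S = E" using S K_generate[OF S(2)] by auto
  obtain S' where S': "finite S'" "S' \<subseteq> M" "M = generate K S'"
    using K.subgroup_of_finitely_generated[OF S(1) SK(1) K_subgroup[OF M]] SK(2) M(2) by auto
  have "virtually_le K (generate K S') (P \<inter> E)"
  proof (rule K.torsion_vle[OF K_subgroup S'(1)])
    show "subgroup (P \<inter> E) G" "P \<inter> E \<subseteq> E" "S' \<subseteq> carrier K"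
      using subgroups_Inter_pair[OF P E_subgroup] S' M by auto
    fix s assume "s \<in> S'"
    then show "\<exists>k::int. k \<noteq> 0 \<and> s [^]\<^bsub>K\<^esub> k \<in> P \<inter> E" using c S'(2) by blast
  qed
  then have "M \<lessapprox> P \<inter> E" unfolding S'(3)[symmetric] by (rule K_virtually_le)
  then show False using n vle_mono[of M "P \<inter> E" M P] by blast
qed

text \<open>\<open>E\<close> is abelian, so the part of the stabilizer inside \<open>E\<close>
  survives multiplication by a difference on \<open>M\<close>. As \<open>M\<close> is not virtually
  inside the old stabilizer, it contributes one more independent element.\<close>

lemma independent_in_stab_step:
  assumes M: "subgroup M G" "M \<subseteq> E" and \<Gamma>: "\<Gamma> \<in> differences_on G M" and \<Phi>: "\<Phi> \<in> l1_bidual G"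
    and B: "int_independent K B" "B \<subseteq> stab \<Phi>" and nz: "arens G \<Gamma> \<Phi> \<noteq> 0"
  shows "\<exists>B'. int_independent K B' \<and> B' \<subseteq> stab (arens G \<Gamma> \<Phi>) \<and> card B' = Suc (card B)"
proof -
  have Mc: "M \<subseteq> carrier G" using M E_carrier by blast
  have BE: "B \<subseteq> E" "finite B" using K.int_independentD[OF B(1)] by auto
  have "\<not> M \<lessapprox> stab \<Phi>" using arens_difference_vanish[OF \<Gamma> M(1) \<Phi> stab_subgroup _ stab_invariant] nz by blast
  from not_vle_element[OF M stab_subgroup this]
  obtain m where m: "m \<in> M" "\<And>k::int. k \<noteq> 0 \<Longrightarrow> m [^]\<^bsub>K\<^esub> k \<notin> stab \<Phi> \<inter> E" by (elim bexE) simp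
  have P: "subgroup (stab \<Phi> \<inter> E) K" by (rule K_subgroup[OF subgroups_Inter_pair[OF stab_subgroup E_subgroup]]) blast
  have mE: "m \<in> carrier K" using m M by auto
  have BP: "B \<subseteq> stab \<Phi> \<inter> E" using B(2) BE(1) by blast
  note i = K.int_independent_insert[OF B(1) P BP mE m(2)]
  have "E \<subseteq> cz M" using E(3) cz_anti[OF M(2)] by blast
  then have "B \<subseteq> stab (arens G \<Gamma> \<Phi>)" using centralizer_stab[OF \<Gamma> Mc \<Phi>] BP by blast
  moreover have "m \<in> stab (arens G \<Gamma> \<Phi>)" using differences_stab[OF \<Gamma> Mc \<Phi>] m(1) by blast
  ultimately show ?thesis using i BE(2) by (intro exI[of _ "insert m B"]) simp
qed

lemma independent_of_nonzero_product:
  assumes "ys \<noteq> []" "set ys \<subseteq> (\<Union>M\<in>{M. subnormal M G \<and> M \<subseteq> E}. differences_on G M)" "list_product (arens G) ys \<noteq> 0"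
  shows "\<exists>B. int_independent K B \<and> B \<subseteq> stab (list_product (arens G) ys) \<and> card B = length ys"
  using assms
proof (induction ys rule: list_nonempty_induct)
  case (single y)
  then obtain M where M: "subnormal M G" "M \<subseteq> E" "y \<in> differences_on G M" by auto
  have yl: "y \<in> l1_bidual G" by (rule differences_onD(1)[OF M(3)])
  \<comment> \<open>Starting from \<delta>_1 and the empty independent set, the rightmost factor
    contributes an element too.\<close>
  have p: "arens G y (pt \<one>) = y"
    by (rule l1_bidual_ext[of _ G]) (auto simp: yl arens_closed to_bidual_point_mass ev_arens bdd_fun_left intro!: ev_cong)
  have ei: "int_independent K {}" by (simp add: int_independent_def)
  have "y \<noteq> 0" using single.prems(2) unfolding list_product.simps .
  then have "arens G y (pt \<one>) \<noteq> 0" unfolding p .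
  from independent_in_stab_step[OF subnormal_subgroup[OF M(1)] M(2,3) to_bidual_point_mass(1)[OF one_closed] ei _ this]
  show ?case using p by simp
next
  case (cons y ys)
  let ?D = "\<Union>M\<in>{M. subnormal M G \<and> M \<subseteq> E}. differences_on G M"
  let ?P = "list_product (arens G) ys"
  obtain M where M: "subnormal M G" "M \<subseteq> E" "y \<in> differences_on G M" using cons.prems(1) by auto
  have yl: "y \<in> l1_bidual G" by (rule differences_onD(1)[OF M(3)])
  have eq: "list_product (arens G) (y # ys) = arens G y ?P" using cons.hyps by (simp add: list_product_Cons)
  have ys: "set ys \<subseteq> ?D" using cons.prems(1) by simp
  moreover have "?D \<subseteq> l1_bidual G" using differences_onD(1) by blast
  ultimately have Pl: "?P \<in> l1_bidual G" by (intro list_product_closed cons.hyps) blast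
  have ne: "arens G y ?P \<noteq> 0" using cons.prems(2) unfolding eq .
  then have P0: "?P \<noteq> 0" using arens_zero_right[OF yl] by auto
  obtain B where B: "int_independent K B" "B \<subseteq> stab ?P" "card B = length ys" using cons.IH[OF ys P0] by blast
  show ?case using independent_in_stab_step[OF subnormal_subgroup[OF M(1)] M(2,3) Pl B(1,2) ne] B(3) unfolding eq by simp
qed

text \<open>The finite generating set bounds the size of independent sets, so the supremum in the
  rank is a maximum.\<close>

lemma rank_attained:
  obtains r B where "int_independent K B" "card B = r" "\<And>B. int_independent K B \<Longrightarrow> card B \<le> r"
    "torsion_free_rank K = enat r"
proof -
  have bd: "card B \<le> card S" if "int_independent K B" for B
    by (rule K.int_independent_card_le[OF S(1) _ _ that]) (use S K_generate[OF S(2)] in auto)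
  have ei: "int_independent K {}" by (simp add: int_independent_def)
  have "\<exists>B. int_independent K B \<and> (\<forall>B'. int_independent K B' \<longrightarrow> card B' \<le> card B)"
    by (rule ex_has_greatest_nat[of "int_independent K" "{}" card "Suc (card S)"]) (use ei bd in \<open>auto simp: less_Suc_eq_le\<close>)
  then obtain B where B: "int_independent K B" "\<And>B'. int_independent K B' \<Longrightarrow> card B' \<le> card B" by blast
  have "torsion_free_rank K = enat (card B)" unfolding torsion_free_rank_def
    by (rule antisym[OF SUP_least SUP_upper]) (use B in auto)
  then show ?thesis using that B by blast
qed

text \<open>A power of b in the group generated by the other elements has exponent 0, which gives
  the trivial intersections demanded by \<open>direct_list\<close>.\<close>

lemma independent_direct_list:
  assumes B: "int_independent K B"
  shows "distinct bs \<Longrightarrow> set bs \<subseteq> B \<Longrightarrow> direct_list (map (\<lambda>b. generate G {b}) bs)"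
proof (induction bs)
  case (Cons b bs)
  have BE: "B \<subseteq> E" using K.int_independentD(2)[OF B] by simp
  have bE: "b \<in> E" "set bs \<subseteq> E" "b \<in> carrier G" using Cons.prems BE E_carrier by auto
  have gs: "generate G {b'} \<subseteq> generate G (set bs)" if "b' \<in> set bs" for b' by (rule mono_generate) (use that in auto)
  have sg: "subgroup (generate G (set bs)) G" by (rule generate_is_subgroup) (use bE E_carrier in blast)
  have ind: "int_independent K (insert b (set bs))" by (rule K.int_independent_mono[OF B]) (use Cons in auto)
  have "generate G {b} \<inter> generate G (\<Union>(set (map (\<lambda>b. generate G {b}) bs))) \<subseteq> {\<one>}"
  proof
    fix x assume x: "x \<in> generate G {b} \<inter> generate G (\<Union>(set (map (\<lambda>b. generate G {b}) bs)))"
    then obtain i :: int where i: "x = b [^] i" using generate_pow[OF bE(3)] by auto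
    have "generate G (\<Union>(set (map (\<lambda>b. generate G {b}) bs))) \<subseteq> generate G (set bs)"
      by (rule generate_subgroup_incl[OF _ sg]) (use gs in auto)
    then have "x \<in> generate K (set bs)" using x K_generate[OF bE(2)] by blast
    then have "b [^]\<^bsub>K\<^esub> i \<in> generate K (set bs)" using i int_pow_consistent[OF E_subgroup bE(1)] by simp
    then have "i = 0" by (rule K.int_independent_disjoint[OF ind, rotated]) (use Cons in auto)
    then show "x \<in> {\<one>}" using i by simp
  qed
  then show ?case using Cons generate.one by auto
qed simp

lemma cyclic_subnormal_infinite:
  assumes B: "int_independent K B" and b: "b \<in> B"
  shows "subnormal (generate G {b}) G" "infinite (generate G {b})"
proof -
  have bE: "b \<in> E" "b \<in> carrier G" using K.int_independentD(2)[OF B] b E_carrier by auto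
  have s: "subgroup (generate G {b}) G" by (rule generate_is_subgroup) (use bE in simp)
  have i: "generate G {b} \<subseteq> E" by (rule generate_subgroup_incl[OF _ E_subgroup]) (use bE in simp)
  have "k \<otimes> h \<otimes> inv k = h" if "k \<in> E" "h \<in> generate G {b}" for k h
  proof -
    have c: "k \<in> carrier G" "h \<in> carrier G" "h \<in> E" using that i E_carrier by auto
    have "k \<otimes> h = h \<otimes> k" using E(3) that(1) c(3) czD by blast
    then show ?thesis using c by (simp add: m_assoc)
  qed
  then have "generate G {b} \<lhd> K" unfolding normal_restrict_iff[OF E_subgroup] using s i by auto
  then show "subnormal (generate G {b}) G" by (rule subnormal_step[OF normal_subnormal[OF E(1)]])
  have inj: "inj (\<lambda>i::int. b [^] i)"
  proof (rule injI)
    fix i j :: int assume ij: "b [^] i = b [^] j"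
    have "b [^] (i - j) = \<one>" using ij bE by (simp add: int_pow_diff)
    then have "b [^]\<^bsub>K\<^esub> (i - j) \<in> generate K {}" using int_pow_consistent[OF E_subgroup bE(1)] K.generate_empty by simp
    moreover have "int_independent K (insert b {})" by (rule K.int_independent_mono[OF B]) (use b in auto)
    ultimately have "i - j = 0" using K.int_independent_disjoint[of b "{}" "i - j"] by blast
    then show "i = j" by simp
  qed
  have "generate G {b} = range (\<lambda>i::int. b [^] i)" unfolding generate_pow[OF bE(2)] by auto
  then show "infinite (generate G {b})" using inj finite_imageD[of "\<lambda>i::int. b [^] i" UNIV] infinite_UNIV_int by auto
qed

lemma vanish_above_rank:
  assumes "\<And>B. int_independent K B \<Longrightarrow> card B \<le> r"
  shows "products_vanish (arens G) (A_sn G) (Suc r)"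
proof (rule products_vanish_A_snI)
  fix xs assume xs: "length xs = Suc r" "set xs \<subseteq> sn_differences"
  show "list_product (arens G) xs = 0"
  proof (rule sn_products_vanish_reduce[OF E(1,2) _ _ xs])
    fix ys assume ys: "length ys = Suc r" "set ys \<subseteq> (\<Union>M\<in>{M. subnormal M G \<and> M \<subseteq> E}. differences_on G M)"
    show "list_product (arens G) ys = 0"
    proof (rule ccontr)
      assume nz: "list_product (arens G) ys \<noteq> 0"
      have "ys \<noteq> []" using ys(1) by (metis Zero_not_Suc list.size(3))
      then obtain B where "int_independent K B" "card B = Suc r" using independent_of_nonzero_product[OF _ ys(2) nz] ys(1) by metis
      then show False using assms[of B] by simp
    qed
  qed simp
qed simp

lemma not_vanish_below_rank:
  assumes am: "amenable G" and B: "int_independent K B" and n: "n \<le> card B" "n \<ge> 1"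
  shows "\<not> products_vanish (arens G) (A_sn G) n"
proof -
  obtain bs where bs: "set bs = B" "distinct bs" using finite_distinct_list K.int_independentD(1)[OF B] by metis
  have len: "length bs = card B" using bs by (metis distinct_card)
  show ?thesis
    by (rule direct_list_not_vanish_le[OF am independent_direct_list[OF B bs(2)]])
       (use bs cyclic_subnormal_infinite[OF B] len n in auto)
qed

end

section \<open>The index of nilpotence in the three cases\<close>

lemma nilpotence_index_eq:
  assumes "products_vanish mul A (Suc d)" "\<And>n. n \<le> d \<Longrightarrow> n \<ge> 1 \<Longrightarrow> \<not> products_vanish mul A n"
  shows "nilpotence_index mul A = enat (Suc d)"
  unfolding nilpotence_index_def
proof (rule antisym)
  show "Inf {enat n |n. n \<ge> 1 \<and> products_vanish mul A n} \<le> enat (Suc d)" by (rule Inf_lower) (use assms(1) in auto)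
  have "enat (Suc d) \<le> x" if x: "x \<in> {enat n |n. n \<ge> 1 \<and> products_vanish mul A n}" for x
  proof -
    obtain n where n: "x = enat n" "n \<ge> 1" "products_vanish mul A n" using x by blast
    then have "\<not> n \<le> d" using assms(2)[of n] by blast
    then show ?thesis using n(1) by simp
  qed
  then show "enat (Suc d) \<le> Inf {enat n |n. n \<ge> 1 \<and> products_vanish mul A n}" by (rule Inf_greatest)
qed

theorem theorem1p1:
  fixes G :: "('a, 'b) monoid_scheme"
  assumes "group G" and "amenable G" and "just_infinite G"
  shows "(nilpotent_algebra (arens G) (A_sn G) \<longleftrightarrow> \<not> branch_group G) \<and>
    (finitely_generated G \<and> virtually_abelian G \<longrightarrow>
       nilpotence_index (arens G) (A_sn G) = virtual_rank G + 1) \<and>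
    (\<not> (finitely_generated G \<and> virtually_abelian G) \<longrightarrow>
       ereal_of_enat (nilpotence_index (arens G) (A_sn G)) = log2_card (structure_lattice G) + 1 \<and>
       (branch_group G \<longrightarrow> log2_card (structure_lattice G) = \<infinity>))"
proof -
  interpret just_infinite_group G
    by (simp add: just_infinite_group_def just_infinite_group_axioms_def assms)
  show ?thesis
  \<comment> \<open>Finite generation follows in the first case, so this split separates (i) from
    (ii).\<close>
  proof (cases "virtually_abelian G")
    case True
    obtain E S where E: "E \<lhd> G" "carrier G \<lessapprox> E" "E \<subseteq> cz E" "finite S" "S \<subseteq> E" "generate G S = E"
      by (rule virtually_abelian_structure[OF True]) (rule that)
    interpret A: abelian_normal_finite_index G E S
      by (intro abelian_normal_finite_index.intro just_infinite_group_axioms abelian_normal_finite_index_axioms.intro E)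
    obtain r B where r: "int_independent A.K B" "card B = r" "\<And>B. int_independent A.K B \<Longrightarrow> card B \<le> r"
      "torsion_free_rank A.K = enat r" using A.rank_attained by metis
    have v: "products_vanish (arens G) (A_sn G) (Suc r)" by (rule A.vanish_above_rank[OF r(3)])
    have nv: "\<not> products_vanish (arens G) (A_sn G) n" if "n \<le> r" "n \<ge> 1" for n
      by (rule A.not_vanish_below_rank[OF assms(2) r(1)]) (use that r(2) in auto)
    \<comment> \<open>In a branch group no length makes all products vanish, so one vanishing length
      excludes a branch structure.\<close>
    have nb: "\<not> branch_group G" using branch_not_vanish[OF assms(2) _, of "Suc r"] v by auto
    have fa: "finite_index_abelian G E" unfolding finite_index_abelian_def
      using A.E_subgroup A.K_comm finite_index_iff_vle'[OF A.E_subgroup] E(2) by simp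
    have "nilpotence_index (arens G) (A_sn G) = virtual_rank G + 1"
      using nilpotence_index_eq[OF v nv] virtual_rank_eq[OF fa] r(4) by (simp add: one_enat_def)
    moreover have "nilpotent_algebra (arens G) (A_sn G)" unfolding nilpotent_algebra_def using v by (intro exI[of _ "Suc r"]) simp
    ultimately show ?thesis using nb True virtually_abelian_finitely_generated[OF True] by simp
  next
    case False
    interpret just_infinite_nva G by unfold_locales (rule False)
    show ?thesis
    \<comment> \<open>Unbounded commuting families produce a branch structure; if their sizes are
      bounded, a largest family determines both the index and the structure lattice.\<close>
    proof (cases "\<forall>n. \<exists>\<L>. indep \<L> \<and> card \<L> \<ge> n")
      case True
      then have unb: "\<And>n. \<exists>\<L>. indep \<L> \<and> card \<L> \<ge> n" by blast
      have nv: "\<not> products_vanish (arens G) (A_sn G) n" if "n \<ge> 1" for n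
        using unb[of n] indep_not_vanish[OF assms(2) _ _ that] by blast
      then have e: "{enat n |n. n \<ge> 1 \<and> products_vanish (arens G) (A_sn G) n} = {}" by blast
      have "nilpotence_index (arens G) (A_sn G) = \<infinity>" unfolding nilpotence_index_def e by (simp add: Inf_enat_def)
      moreover have "log2_card (structure_lattice G) = \<infinity>"
        using structure_lattice_infinite[OF unb] by (simp add: log2_card_def)
      moreover have "\<not> nilpotent_algebra (arens G) (A_sn G)" using nv by (auto simp: nilpotent_algebra_def)
      ultimately show ?thesis using unbounded_imp_branch[OF unb] False by simp
    next
      case bounded: False
      then obtain b where b: "\<And>\<L>. indep \<L> \<Longrightarrow> card \<L> < b" by (meson not_le)
      have "indep {}" by (simp add: indep_def)
      then have "\<exists>\<L>. indep \<L> \<and> (\<forall>\<M>. indep \<M> \<longrightarrow> card \<M> \<le> card \<L>)"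
        by (rule ex_has_greatest_nat[of indep "{}" card b]) (use b in blast)
      then obtain \<L>0 where L0: "indep \<L>0" "\<And>\<M>. indep \<M> \<Longrightarrow> card \<M> \<le> card \<L>0" by blast
      \<comment> \<open>The largest family is moved into a normal subgroup of finite index without
        loss of size, so it is still maximal.\<close>
      obtain N \<L> where L: "indep \<L>" "card \<L> = card \<L>0" "N \<lhd> G" "carrier G \<lessapprox> N" "\<And>L. L \<in> \<L> \<Longrightarrow> L \<subseteq> N \<and> nrm N L"
        by (rule indep_normalize[OF L0(1)]) (rule that)
      interpret max_family G N \<L>
        by (intro max_family.intro just_infinite_nva_axioms max_family_axioms.intro) (use L L0(2) in auto)
      let ?d = "card \<L>"
      have v: "products_vanish (arens G) (A_sn G) (Suc ?d)" by (rule products_vanish_max)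
      have nv: "\<not> products_vanish (arens G) (A_sn G) n" if "n \<le> ?d" "n \<ge> 1" for n
        by (rule indep_not_vanish[OF assms(2) L(1) that])
      have nb: "\<not> branch_group G" using branch_not_vanish[OF assms(2) _, of "Suc ?d"] v by auto
      have "log2_card (structure_lattice G) = ereal (real ?d)"
        using card_structure_lattice by (simp add: log2_card_def)
      moreover have "nilpotence_index (arens G) (A_sn G) = enat (Suc ?d)" by (rule nilpotence_index_eq[OF v nv])
      moreover have "nilpotent_algebra (arens G) (A_sn G)" unfolding nilpotent_algebra_def using v by (intro exI[of _ "Suc ?d"]) simp
      ultimately show ?thesis using nb False by (simp add: one_ereal_def)
    qed
  qed
qed

end
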